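(* Let $K=K(S_1,S_2)$ be an arbitrary oriented generic pair of immersions, and let $\overline{K}$ be the pair obtained from $K$ by reversing the orientation of one of the two immersions. Put $x=J^+(S_1)$, $y=J^+(S_2)$, $z=J^{2+}(K)$ and $\overline{z}=J^{2+}(\overline{K})$. Then $x,y,z,\overline{z}$ are even integers and $$z+\overline{z}\ \geq\ 2x+2y .$$
   Context: An immersion is a smooth map $S:S^1\to\mathbb{C}$ with nowhere vanishing derivative; $S$ also denotes its image, and it is oriented by its parametrization. It is generic if its only singularities are transverse double points. A pair of immersions $K=K(S_1,S_2)$ is a map $K:S^1\sqcup S^1\to\mathbb{C}$ given by two immersions $S_1,S_2$ on the two circles; $K$ also denotes the image $S_1\cup S_2$. The pair is generic if its only singularities are transverse double points (self-intersections of $S_1$ or of $S_2$, or intersections of $S_1$ with $S_2$). For $X=S$ a generic immersion or $X=K$ a generic pair and a connected component $C$ of $\mathbb{C}\setminus X$, $\omega_C(X)$ is the winding number of $X$ around any point of $C$ (for a pair, the sum of the winding numbers of $S_1$ and $S_2$). For a double point $p$ of $X$, $ind_p(X)$ is the arithmetic mean of the winding numbers of the four components (quadrants, counted with multiplicity) adjacent to $p$. $J^+(S)$ is Arnold's $J^+$-invariant of a generic immersion $S$ (independent of orientation); by Viro's formula, $J^+(S)=1+n-\sum_{C\subset\mathbb{C}\setminus S}\omega_C(S)^2+\sum_p ind_p(S)^2$, with $n$ the number of double points of $S$. The encircling index is $u(K)=0$ if $S_1\cap S_2\neq\emptyset$, and otherwise $u(K)=\omega_{C_1}(S_2)+\omega_{C_2}(S_1)$,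 where $C_1$ is the component of $\mathbb{C}\setminus S_2$ containing $S_1$ and $C_2$ is the component of $\mathbb{C}\setminus S_1$ containing $S_2$. With $n$ the number of double points of $K$, $$J^{2+}(K):=2+n-\sum_{C\subset\mathbb{C}\setminus K}\omega_C(K)^2+\sum_p ind_p(K)^2+u(K)^2 .$$ $J^{2+}$ is unchanged when the orientations of both immersions are reversed simultaneously, so $J^{2+}(\overline{K})$ does not depend on which of the two immersions is reversed. *)

theory Defs
  imports "HOL-Complex_Analysis.Complex_Analysis"
begin

text \<open>
  The circle is \<open>\<real>/\<int>\<close>: an immersion of the circle is a 1-periodic map on the reals, and its
  restriction to \<open>{0..1}\<close> is a closed path in the sense of the library.
\<close>

definition smooth :: "(real \<Rightarrow> complex) \<Rightarrow> bool" where
  "smooth \<gamma> \<longleftrightarrow>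
    (\<forall>n t. ((\<lambda>f s. vector_derivative f (at s)) ^^ n) \<gamma> differentiable (at t))"

definition immersion :: "(real \<Rightarrow> complex) \<Rightarrow> bool" where
  "immersion \<gamma> \<longleftrightarrow>
    (\<forall>t. \<gamma> (t + 1) = \<gamma> t) \<and> smooth \<gamma> \<and> (\<forall>t. vector_derivative \<gamma> (at t) \<noteq> 0)"

text \<open>
  A list \<open>\<Gamma>\<close> of closed curves stands for one map on the disjoint union of \<open>length \<Gamma>\<close> circles;
  the point \<open>(i, t)\<close> is the parameter \<open>t\<close> on the \<open>i\<close>-th circle. A single immersion is a list
  of length 1, a pair is a list of length 2.
\<close>

definition params :: "(real \<Rightarrow> complex) list \<Rightarrow> (nat \<times> real) set" where
  "params \<Gamma> = {..<length \<Gamma>} \<times> {0..<1}"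

definition point :: "(real \<Rightarrow> complex) list \<Rightarrow> nat \<times> real \<Rightarrow> complex" where
  "point \<Gamma> a = (\<Gamma> ! fst a) (snd a)"

definition velocity :: "(real \<Rightarrow> complex) list \<Rightarrow> nat \<times> real \<Rightarrow> complex" where
  "velocity \<Gamma> a = vector_derivative (\<Gamma> ! fst a) (at (snd a))"

definition fibre :: "(real \<Rightarrow> complex) list \<Rightarrow> complex \<Rightarrow> (nat \<times> real) set" where
  "fibre \<Gamma> p = {a \<in> params \<Gamma>. point \<Gamma> a = p}"

definition generic :: "(real \<Rightarrow> complex) list \<Rightarrow> bool" where
  "generic \<Gamma> \<longleftrightarrow>
    (\<forall>\<gamma> \<in> set \<Gamma>. immersion \<gamma>) \<and>
    (\<forall>p. finite (fibre \<Gamma> p) \<and> card (fibre \<Gamma> p) \<le> 2) \<and>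
    (\<forall>p. \<forall>a \<in> fibre \<Gamma> p. \<forall>b \<in> fibre \<Gamma> p. a \<noteq> b \<longrightarrow> span {velocity \<Gamma> a, velocity \<Gamma> b} = UNIV)"

definition double_points :: "(real \<Rightarrow> complex) list \<Rightarrow> complex set" where
  "double_points \<Gamma> = {p. card (fibre \<Gamma> p) = 2}"

definition curve_image :: "(real \<Rightarrow> complex) list \<Rightarrow> complex set" where
  "curve_image \<Gamma> = (\<Union>\<gamma> \<in> set \<Gamma>. path_image \<gamma>)"

definition omega :: "(real \<Rightarrow> complex) list \<Rightarrow> complex set \<Rightarrow> int" where
  "omega \<Gamma> C = (THE k. \<forall>z \<in> C. (\<Sum>\<gamma>\<leftarrow>\<Gamma>. winding_number \<gamma> z) = of_int k)"

text \<open>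
  If the two branches through a double point \<open>p\<close> have velocities \<open>v\<close> and \<open>w\<close>, then
  \<open>quadrant_dirs \<Gamma> p\<close> consists of the four distinct directions \<open>\<plusminus>v \<plusminus> w\<close>, one in each quadrant
  at \<open>p\<close>, and \<open>quadrant \<Gamma> p d\<close> is the complementary component containing the quadrant in
  direction \<open>d\<close>. Since the sum defining the index runs over directions, a component that
  occupies several quadrants is counted with multiplicity.
\<close>

definition quadrant_dirs :: "(real \<Rightarrow> complex) list \<Rightarrow> complex \<Rightarrow> complex set" where
  "quadrant_dirs \<Gamma> p =
    {\<Sum>a \<in> fibre \<Gamma> p. s a *\<^sub>R velocity \<Gamma> a | s. \<forall>a. s a \<in> {-1, 1 :: real}}"

definition quadrant :: "(real \<Rightarrow> complex) list \<Rightarrow> complex \<Rightarrow> complex \<Rightarrow> complex set" where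
  "quadrant \<Gamma> p d =
    (THE C. C \<in> components (- curve_image \<Gamma>) \<and> (\<forall>\<^sub>F r in at_right (0::real). p + r *\<^sub>R d \<in> C))"

definition ind :: "(real \<Rightarrow> complex) list \<Rightarrow> complex \<Rightarrow> real" where
  "ind \<Gamma> p = (\<Sum>d \<in> quadrant_dirs \<Gamma> p. of_int (omega \<Gamma> (quadrant \<Gamma> p d))) / 4"

definition encircling_index :: "(real \<Rightarrow> complex) \<Rightarrow> (real \<Rightarrow> complex) \<Rightarrow> int" where
  "encircling_index S1 S2 =
    (if path_image S1 \<inter> path_image S2 \<noteq> {} then 0
     else omega [S2] (THE C. C \<in> components (- path_image S2) \<and> path_image S1 \<subseteq> C)
        + omega [S1] (THE C. C \<in> components (- path_image S1) \<and> path_image S2 \<subseteq> C))"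

text \<open>
  Arnold's invariant of a generic immersion, given by Viro's formula. For a generic \<open>\<Gamma>\<close>
  there are finitely many double points and complementary components, so the sums below are
  genuine finite sums.
\<close>

definition J_plus :: "(real \<Rightarrow> complex) \<Rightarrow> real" where
  "J_plus S =
    1 + of_nat (card (double_points [S]))
      - (\<Sum>C \<in> components (- curve_image [S]). (of_int (omega [S] C))\<^sup>2)
      + (\<Sum>p \<in> double_points [S]. (ind [S] p)\<^sup>2)"

definition J_two_plus :: "(real \<Rightarrow> complex) \<Rightarrow> (real \<Rightarrow> complex) \<Rightarrow> real" where
  "J_two_plus S1 S2 =
    2 + of_nat (card (double_points [S1, S2]))
      - (\<Sum>C \<in> components (- curve_image [S1, S2]). (of_int (omega [S1, S2] C))\<^sup>2)
      + (\<Sum>p \<in> double_points [S1, S2]. (ind [S1, S2] p)\<^sup>2)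
      + (of_int (encircling_index S1 S2))\<^sup>2"

end

theory Submission
  imports Defs
begin

text \<open>
  Adding a closed curve \<open>T\<close> arc by arc to a connected set splits one complementary component each time
  \<open>T\<close> returns to what has been drawn (Jordan curve theorem and Janiszewski's theorem), and the new
  component has the value just before the return. For a function \<open>h\<close> of the winding number of \<open>S\<close> this
  expresses the sum over the components of the complement of \<open>S \<union> T\<close> by the sum over those of \<open>S\<close>, the
  nodes of \<open>T\<close> and the values \<open>h (\<mu> - \<sigma>/2)\<close> at the crossings \<open>Q = S \<inter> T\<close>, where \<open>\<mu>\<close> is the mean index
  and \<open>\<sigma>\<close> the crossing sign; running backwards gives \<open>h (\<mu> + \<sigma>/2)\<close> instead. With \<open>h x = x\<^sup>2\<close>,
  \<open>J\<^sup>2\<^sup>+(S, T) = J\<^sup>+(S) + J\<^sup>+(T) + |Q|/2 + 2 X\<close>, where \<open>X\<close> is bilinear in the winding numbers of \<open>S\<close> and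
  \<open>T\<close>. Reversing one curve replaces \<open>X\<close> by \<open>-X\<close>, so the two values for the pair add up to
  \<open>2 J\<^sup>+(S) + 2 J\<^sup>+(T) + |Q|\<close>. If \<open>Q\<close> is empty, the two square terms that the sums leave over are
  completed to a square by the encircling index.

  Evenness of \<open>J\<^sup>+\<close> amounts to the parity of (sum of winding numbers) - (sum of indices) + \<open>n\<close> + 1, which
  follows by induction on the number \<open>n\<close> of nodes, cutting the curve at a node into two closed curves that
  cross each other an even number of times. For pairs one uses the identities for \<open>h x = x\<close> and
  \<open>h x = x\<^sup>2\<close> once more.
\<close>

section \<open>Components of the complement of a planar set\<close>

text \<open>A function of the winding number of \<open>S\<close> does not see \<open>T\<close>, so
  both parts of a component cut by \<open>T\<close> inherit its value, and each return of
  \<open>T\<close> adds exactly one summand. On the curves themselves there is no winding number,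
  only a mean and a half-jump, and this is the origin of the constants:
  \<open>(\<mu> - \<sigma>/2)^2 = \<mu>^2 - \<mu> \<sigma> + 1/4\<close>, where the terms
  \<open>\<mu> \<sigma>\<close> sum to zero because both directions of travel give the same total.
  Each of the two curves thus takes \<open>|Q|/4\<close> away from the \<open>|Q|\<close> new double
  points, which leaves \<open>|Q|/2\<close>. The obstacle in the parity argument is that the two
  closed curves obtained by cutting at a node have corners. The induction therefore admits
  continuous closed curves with velocities at their double points only, and winding numbers near a
  point are recorded by direction, on truncated cones, so that smooth branches and corners are
  treated alike. At the node where the curve was cut, the two corners touch without crossing; that
  is why the remaining crossings are even in number.\<close>

lemma interior_arc_image:
  fixes e :: "real \<Rightarrow> complex"
  assumes "arc e" shows "interior (path_image e) = {}"
proof (rule ccontr)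
  assume "interior (path_image e) \<noteq> {}"
  then obtain a r where r: "r > 0" and B: "ball a r \<subseteq> path_image e"
    by (meson ex_in_conv mem_interior)
  define C where "C = ball a r"
  have inj: "inj_on e {0..1}" and cont: "continuous_on {0..1} e"
    using assms by (auto simp: arc_def path_def)
  define T where "T = {t\<in>{0..1}. e t \<in> C}"
  have eT: "e ` T = C" using B by (auto simp: T_def C_def path_image_def)
  have "infinite C" using r by (simp add: C_def) (metis centre_in_ball empty_iff finite_imp_not_open open_ball)
  then have "infinite T" using eT by (metis finite_imageI)
  then obtain K where K: "K \<subseteq> T" "card K = 3" "finite K" by (metis infinite_arbitrarily_large)
  \<comment> \<open>Three parameters that land in the disc: deleting the image of the middle one
    separates the images of the other two on the arc, whereas a punctured disc is connected.\<close>
  obtain t1 t2 t3 where t: "t1 \<in> T" "t2 \<in> T" "t3 \<in> T" "t1 < t2" "t2 < t3"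
  proof -
    define ts where "ts = sorted_list_of_set K"
    have "length ts = 3" "set ts = K" "sorted_wrt (<) ts" using K by (auto simp: ts_def)
    then obtain a b c where "ts = [a,b,c]"
      by (metis (no_types, lifting) length_0_conv length_Suc_conv numeral_3_eq_3)
    then show thesis using that[of a b c] \<open>set ts = K\<close> \<open>sorted_wrt (<) ts\<close> K by auto
  qed
  have conn: "connected (C - {e t2})"
    unfolding C_def by (rule connected_open_delete) auto
  have c1: "closed (e ` {0..t2})" "closed (e ` {t2..1})"
    using t by (auto simp: T_def intro!: compact_imp_closed compact_continuous_image continuous_on_subset[OF cont])
  have "C - {e t2} \<subseteq> e ` {0..t2} \<union> e ` {t2..1}"
  proof -
    have "C \<subseteq> e ` {0..1}" unfolding eT[symmetric] by (rule image_mono) (auto simp: T_def)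
    also have "{0..1} = {0..t2} \<union> {t2..1}" using t by (auto simp: T_def)
    finally show ?thesis by (auto simp: image_Un)
  qed
  moreover have "e ` {0..t2} \<inter> e ` {t2..1} \<inter> (C - {e t2}) = {}"
  proof -
    have "x = t2" if "x \<in> {0..t2}" "y \<in> {t2..1}" "e x = e y" for x y
    proof -
      have "x = y" using inj that t unfolding inj_on_def T_def by auto
      then show ?thesis using that by auto
    qed
    then show ?thesis by blast
  qed
  moreover have "e t1 \<in> e ` {0..t2}" "e t3 \<in> e ` {t2..1}" "e t1 \<in> C - {e t2}" "e t3 \<in> C - {e t2}"
  proof -
    have "e t1 \<noteq> e t2" "e t3 \<noteq> e t2" using t inj unfolding T_def inj_on_def by force+
    then show "e t1 \<in> e ` {0..t2}" "e t3 \<in> e ` {t2..1}" "e t1 \<in> C - {e t2}" "e t3 \<in> C - {e t2}"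
      using t by (auto simp: T_def)
  qed
  ultimately show False
    using connected_closedD[OF conn _ _ c1] by blast
qed

text \<open>The union of all other members is open as well, so a connected subset of
  \<open>U\<close> that meets one member cannot leave it.\<close>

lemma components_eq_partition:
  assumes "\<And>C. C \<in> \<D> \<Longrightarrow> open C \<and> connected C \<and> C \<noteq> {}" and "pairwise disjnt \<D>" and "\<Union>\<D> = U"
  shows "components U = \<D>"
proof -
  have D: "C \<in> components U" if "C \<in> \<D>" for C
  proof -
    obtain x where x: "x \<in> C" using assms(1)[OF \<open>C \<in> \<D>\<close>] by auto
    have "connected_component_set U x \<subseteq> C"
    proof (rule ccontr)
      define K where "K = connected_component_set U x"
      assume "\<not> connected_component_set U x \<subseteq> C"
      then obtain y where y: "y \<in> K" "y \<notin> C" unfolding K_def by blast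
      have "connected K" "K \<subseteq> U" by (auto simp: K_def connected_component_subset)
      have "x \<in> K" using x that assms(3) unfolding K_def by auto
      have "open C" "open (\<Union>(\<D> - {C}))" using assms(1) that by auto
      moreover have "K \<subseteq> C \<union> \<Union>(\<D> - {C})" using \<open>K \<subseteq> U\<close> assms(3) by auto
      moreover have "C \<inter> \<Union>(\<D> - {C}) \<inter> K = {}"
        using assms(2) that by (auto simp: pairwise_def disjnt_iff)
      ultimately have "C \<inter> K = {} \<or> \<Union>(\<D> - {C}) \<inter> K = {}"
        using \<open>connected K\<close> unfolding connected_def by blast
      then show False using x \<open>x \<in> K\<close> y \<open>K \<subseteq> U\<close> assms(3) by blast
    qed
    moreover have "C \<subseteq> connected_component_set U x"
      using assms(1)[OF that] x assms(3) that by (intro connected_component_maximal) auto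
    ultimately show ?thesis using x that assms(3) by (auto simp: components_def)
  qed
  have "C \<in> \<D>" if C: "C \<in> components U" for C
  proof -
    obtain x where "x \<in> C" using C in_components_nonempty by auto
    then obtain E where "E \<in> \<D>" "x \<in> E" using assms(3) C in_components_subset by blast
    then show ?thesis using D \<open>x \<in> C\<close> C components_eq[of C U E] by auto
  qed
  with D show ?thesis by auto
qed

text \<open>The chosen point is irrelevant for functions that are constant on components, such as winding
  numbers.\<close>

definition cval :: "(complex \<Rightarrow> real) \<Rightarrow> complex set \<Rightarrow> real" where
  "cval g C = g (SOME z. z \<in> C)"

definition csum :: "(complex \<Rightarrow> real) \<Rightarrow> complex set \<Rightarrow> real" where
  "csum g X = (\<Sum>C\<in>components (- X). cval g C)"

definition loc_const :: "(complex \<Rightarrow> real) \<Rightarrow> complex set \<Rightarrow> bool" where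
  "loc_const g X \<longleftrightarrow> (\<forall>a b. connected_component (- X) a b \<longrightarrow> g a = g b)"

lemma loc_const_mono: "loc_const g X \<Longrightarrow> X \<subseteq> Y \<Longrightarrow> loc_const g Y"
  unfolding loc_const_def connected_component_def by (meson Compl_anti_mono subset_trans)

lemma loc_constD:
  assumes "loc_const g X" "connected S" "S \<subseteq> - X" "a \<in> S" "b \<in> S" shows "g a = g b"
  using assms unfolding loc_const_def connected_component_def by blast

lemma cval_eq:
  assumes "loc_const g X" "connected C" "C \<subseteq> - X" "z \<in> C"
  shows "cval g C = g z"
  unfolding cval_def by (rule loc_constD[OF assms(1,2,3) _ assms(4)]) (metis assms(4) someI)

text \<open>By Janiszewski's theorem points that neither \<open>X\<close> nor the arc separates are
  not separated by their union, since the two sets have connected intersection; and an arc alone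
  separates nothing. A component, being open, cannot be swallowed by the arc, which has empty
  interior.\<close>

lemma components_Un_free_arc:
  fixes X :: "complex set"
  assumes "compact X" "arc e" "connected (X \<inter> path_image e)"
  shows "components (- (X \<union> path_image e)) = (\<lambda>C. C - path_image e) ` components (- X)"
    and "inj_on (\<lambda>C. C - path_image e) (components (- X))"
    and "C \<in> components (- X) \<Longrightarrow> C - path_image e \<noteq> {}"
proof -
  let ?e = "path_image e"
  have ce: "compact ?e" "closed ?e" using assms(2) compact_arc_image closed_arc_image by auto
  have op: "open C" if "C \<in> components (- X)" for C
    using that assms(1) by (metis compact_imp_closed open_Compl open_components)
  have ne: "C - ?e \<noteq> {}" if "C \<in> components (- X)" for C
    using op[OF that] in_components_nonempty[OF that] interior_arc_image[OF assms(2)]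
    by (metis Diff_eq_empty_iff interior_maximal subset_empty)
  have con: "connected (C - ?e)" if C: "C \<in> components (- X)" for C
  proof -
    have "connected_component (C - ?e) a b" if ab: "a \<in> C - ?e" "b \<in> C - ?e" for a b
    proof -
      have "connected_component (- X) a b"
        using C ab in_components_connected in_components_subset unfolding connected_component_def by blast
      moreover have "connected (- ?e)" by (rule connected_arc_complement[OF assms(2)]) simp
      then have "connected_component (- ?e) a b" using ab
        by (metis ComplI DiffD2 connected_iff_connected_component)
      ultimately have "connected_component (- (X \<union> ?e)) a b"
        by (rule Janiszewski[OF assms(1) ce(2) assms(3)])
      then obtain T where T: "connected T" "T \<subseteq> - (X \<union> ?e)" "a \<in> T" "b \<in> T"
        unfolding connected_component_def by auto
      then have "T \<subseteq> C" using C ab by (intro components_maximal[of C "-X"]) auto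
      then show ?thesis unfolding connected_component_def using T by blast
    qed
    then show ?thesis by (simp add: connected_iff_connected_component)
  qed
  show "components (- (X \<union> ?e)) = (\<lambda>C. C - ?e) ` components (- X)"
  proof (rule components_eq_partition)
    show "pairwise disjnt ((\<lambda>C. C - ?e) ` components (- X))"
      using pairwise_disjoint_components[of "-X"] by (auto simp: pairwise_def disjnt_def)
    show "\<Union> ((\<lambda>C. C - ?e) ` components (- X)) = - (X \<union> ?e)"
      using Union_components[of "-X"] by auto
  qed (use op ne con ce in auto)
  show "inj_on (\<lambda>C. C - ?e) (components (- X))"
  proof (rule inj_onI)
    fix C D assume CD: "C \<in> components (- X)" "D \<in> components (- X)" "C - ?e = D - ?e"
    then show "C = D" using ne[OF CD(1)] components_eq[OF CD(1,2)] by blast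
  qed
  show "C \<in> components (- X) \<Longrightarrow> C - path_image e \<noteq> {}" by (rule ne)
qed

lemma csum_Un_free_arc:
  fixes X :: "complex set"
  assumes "compact X" "arc e" "connected (X \<inter> path_image e)" "loc_const g X"
  shows "finite (components (- (X \<union> path_image e))) \<longleftrightarrow> finite (components (- X))"
    and "csum g (X \<union> path_image e) = csum g X"
proof -
  note c = components_Un_free_arc[OF assms(1-3)]
  show "finite (components (- (X \<union> path_image e))) \<longleftrightarrow> finite (components (- X))"
    unfolding c(1) by (rule finite_image_iff[OF c(2)])
  have "cval g (C - path_image e) = cval g C" if C: "C \<in> components (- X)" for C
  proof -
    obtain z where z: "z \<in> C - path_image e" using c(3)[OF C] by auto
    have "C - path_image e \<in> components (- (X \<union> path_image e))" using c(1) C by auto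
    then have "cval g (C - path_image e) = g z"
      using cval_eq[OF loc_const_mono[OF assms(4), of "X \<union> path_image e"]] z
        in_components_connected in_components_subset by blast
    moreover have "cval g C = g z"
      using cval_eq[OF assms(4), of C z] z C in_components_connected in_components_subset by blast
    ultimately show ?thesis by simp
  qed
  then show "csum g (X \<union> path_image e) = csum g X"
    unfolding csum_def c(1) sum.reindex[OF c(2)] comp_def by (rule sum.cong[OF refl])
qed

text \<open>The endpoints of \<open>e\<close> are joined by an arc \<open>f\<close> inside \<open>X\<close>, so that \<open>J = e \<union> f\<close> is a Jordan
  curve with \<open>X \<inter> J = f\<close> connected. By Janiszewski's theorem two points of \<open>C - e\<close> on the same side
  of \<open>J\<close> are not separated by \<open>X \<union> J = X \<union> e\<close>.\<close>

lemma components_Un_chord: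
  fixes X :: "complex set"
  assumes X: "compact X" "path_connected X" and e: "arc e"
    and int: "path_image e \<inter> X = {pathstart e, pathfinish e}"
    and C: "C \<in> components (- X)" "t \<in> {0<..<1}" "e t \<in> C"
  obtains D E where "components (- (X \<union> path_image e)) = insert D (insert E (components (- X) - {C}))"
    "D \<noteq> E" "D \<noteq> {}" "E \<noteq> {}" "D \<subseteq> C" "E \<subseteq> C" "open D" "open E" "connected D" "connected E"
    "D \<union> E = C - path_image e"
proof -
  let ?e = "path_image e"
  have ce: "compact ?e" "closed ?e" using e compact_arc_image closed_arc_image by auto
  have op: "open C" if "C \<in> components (- X)" for C
    using that X(1) by (metis compact_imp_closed open_Compl open_components)
  have inj: "inj_on e {0..1}" and cont: "continuous_on {0..1} e"
    using e by (auto simp: arc_def path_def)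
  have ends: "pathstart e \<noteq> pathfinish e" using arc_distinct_ends[OF e] by simp
  obtain f where f: "arc f" "path_image f \<subseteq> X" "pathstart f = pathfinish e" "pathfinish f = pathstart e"
  proof -
    have "pathstart e \<in> X" "pathfinish e \<in> X" using int by auto
    then show thesis using that X(2) ends unfolding path_connected_arcwise by metis
  qed
  define J where "J = ?e \<union> path_image f"
  have ef: "?e \<inter> path_image f = {pathstart e, pathfinish e}"
    using f int pathstart_in_path_image[of f] pathfinish_in_path_image[of f] by auto
  have sp: "simple_path (e +++ f)"
    using e f ef by (intro simple_path_join_loop) auto
  have Jim: "path_image (e +++ f) = J" unfolding J_def using f by (simp add: path_image_join)
  have jord: "inside J \<noteq> {}" "open (inside J)" "connected (inside J)" "outside J \<noteq> {}"
     "open (outside J)" "connected (outside J)" "inside J \<inter> outside J = {}" "inside J \<union> outside J = - J"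
     "frontier (inside J) = J" "frontier (outside J) = J"
  proof -
    have "pathfinish (e +++ f) = pathstart (e +++ f)" using f by simp
    note jj = Jordan_inside_outside[OF sp this, unfolded Jim]
    show "inside J \<noteq> {}" "open (inside J)" "connected (inside J)" "outside J \<noteq> {}"
     "open (outside J)" "connected (outside J)" "inside J \<inter> outside J = {}" "inside J \<union> outside J = - J"
     "frontier (inside J) = J" "frontier (outside J) = J" using jj by blast+
  qed
  have cJ: "closed J" using ce f(1) closed_arc_image unfolding J_def by auto
  have "X \<inter> J = path_image f" using int f(2) ef unfolding J_def by auto
  then have XJ: "connected (X \<inter> J)" using f(1) by (simp add: connected_arc_image)
  have XuJ: "X \<union> J = X \<union> ?e" using f(2) unfolding J_def by auto
  define interior_e where "interior_e = e ` {0<..<1}"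
  have int_e: "?e = insert (pathstart e) (insert (pathfinish e) interior_e)"
  proof -
    have "{0..1} = insert 0 (insert 1 {0<..<1::real})" by auto
    then show ?thesis unfolding path_image_def interior_e_def pathstart_def pathfinish_def by auto
  qed
  have int_e_X: "interior_e \<inter> X = {}"
  proof -
    have False if "s \<in> {0<..<1}" "e s \<in> X" for s
    proof -
      have "e s \<in> {e 0, e 1}" using that int unfolding path_image_def pathstart_def pathfinish_def by fastforce
      then show False using inj that unfolding inj_on_def by force
    qed
    then show ?thesis unfolding interior_e_def by blast
  qed
  have "connected interior_e" unfolding interior_e_def
    by (intro connected_continuous_image continuous_on_subset[OF cont]) auto
  then have eC: "interior_e \<subseteq> C" using int_e_X C
    by (intro components_maximal[OF C(1)]) (auto simp: interior_e_def)
  have Ce: "C \<inter> ?e = interior_e" using int_e eC in_components_subset[OF C(1)] int by auto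
  define D where "D = C \<inter> inside J"
  define E where "E = C \<inter> outside J"
  have CX: "C \<inter> X = {}" using in_components_subset[OF C(1)] by auto
  have DE: "D \<union> E = C - ?e"
  proof -
    have "C - ?e = C \<inter> - J" using CX f(2) unfolding J_def by blast
    then show ?thesis using jord(8) unfolding D_def E_def by blast
  qed
  have "e t \<in> J" using C(2) unfolding J_def path_image_def by auto
  \<comment> \<open>Every point of a Jordan curve is a boundary point of both sides, and
    \<open>e t\<close> has the open set \<open>C\<close> as a neighbourhood; so \<open>C\<close>
    meets both sides.\<close>
  have neD: "D \<noteq> {}"
  proof -
    have "e t \<in> closure (inside J)" using jord(9) \<open>e t \<in> J\<close> by (auto simp: frontier_def)
    then show ?thesis unfolding D_def
      using op[OF C(1)] C(3) by (metis IntI disjoint_iff open_Int_closure_eq_empty)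
  qed
  have neE: "E \<noteq> {}"
  proof -
    have "e t \<in> closure (outside J)" using jord(10) \<open>e t \<in> J\<close> by (auto simp: frontier_def)
    then show ?thesis unfolding E_def
      using op[OF C(1)] C(3) by (metis IntI disjoint_iff open_Int_closure_eq_empty)
  qed
  \<comment> \<open>\<open>U\<close> is meant to be one side of \<open>J\<close> and
    \<open>V\<close> the other. Janiszewski's theorem supplies a connected set off
    \<open>X \<union> J\<close> through the two points; it stays in \<open>C\<close> and cannot pass
    from \<open>U\<close> to \<open>V\<close>.\<close>
  have con: "connected (C \<inter> U)" if U: "connected U" "U \<subseteq> - J" "open U" "C \<inter> -U \<inter> - ?e \<subseteq> V" "open V" "U \<inter> V = {}" for U V
  proof -
    have "connected_component (C \<inter> U) a b" if ab: "a \<in> C \<inter> U" "b \<in> C \<inter> U" for a b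
    proof -
      have "connected_component (- X) a b"
        using C ab in_components_connected in_components_subset unfolding connected_component_def by blast
      moreover have "connected_component (- J) a b" using U ab unfolding connected_component_def by blast
      ultimately have "connected_component (- (X \<union> J)) a b"
        by (rule Janiszewski[OF X(1) cJ XJ])
      then obtain T where T: "connected T" "T \<subseteq> - (X \<union> ?e)" "a \<in> T" "b \<in> T"
        unfolding connected_component_def XuJ by auto
      then have TC: "T \<subseteq> C" using ab by (intro components_maximal[OF C(1)]) auto
      have "T \<subseteq> U \<union> V" using TC T(2) U(4) by auto
      moreover have "U \<inter> V \<inter> T = {}" "U \<inter> T \<noteq> {}" using U(6) ab T(3) by auto
      ultimately have "V \<inter> T = {}"
        using connectedD[OF T(1) U(3,5)] by blast
      then have "T \<subseteq> U" using \<open>T \<subseteq> U \<union> V\<close> by auto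
      then show ?thesis unfolding connected_component_def using T TC by blast
    qed
    then show ?thesis by (simp add: connected_iff_connected_component)
  qed
  have sides: "inside J \<subseteq> - J" "outside J \<subseteq> - J" "outside J \<inter> inside J = {}" using jord(7,8) by blast+
  have cover: "C \<inter> - inside J \<inter> - ?e \<subseteq> outside J" "C \<inter> - outside J \<inter> - ?e \<subseteq> inside J"
    using DE unfolding D_def E_def by blast+
  have conD: "connected D" unfolding D_def
    by (rule con[OF jord(3) sides(1) jord(2) cover(1) jord(5,7)])
  have conE: "connected E" unfolding E_def
    by (rule con[OF jord(6) sides(2) jord(5) cover(2) jord(2) sides(3)])
  have disDE: "D \<inter> E = {}" unfolding D_def E_def using jord(7) by blast
  have opDE: "open D" "open E" unfolding D_def E_def using jord op[OF C(1)] by auto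
  have other: "C' \<inter> C = {}" if "C' \<in> components (- X) - {C}" for C'
    using that C(1) components_eq by blast
  have "components (- (X \<union> ?e)) = insert D (insert E (components (- X) - {C}))"
  proof (rule components_eq_partition)
    show "open C' \<and> connected C' \<and> C' \<noteq> {}" if "C' \<in> insert D (insert E (components (- X) - {C}))" for C'
      using that
    proof (elim insertE)
      assume "C' \<in> components (- X) - {C}"
      then show ?thesis using op in_components_connected in_components_nonempty by (metis DiffD1)
    qed (use opDE conD conE neD neE in simp_all)
    have sub: "D \<subseteq> C" "E \<subseteq> C" using DE by auto
    have "pairwise disjnt (components (- X) - {C})"
      using components_eq by (fastforce simp: disjnt_def pairwise_def)
    moreover have "disjnt D C'" "disjnt C' D" "disjnt E C'" "disjnt C' E" if "C' \<in> components (- X) - {C}" for C'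
      using other[OF that] sub by (auto simp: disjnt_def)
    moreover have "disjnt D E" "disjnt E D" using disDE by (auto simp: disjnt_def)
    ultimately show "pairwise disjnt (insert D (insert E (components (- X) - {C})))"
      unfolding pairwise_insert by (metis insertE)
    have U: "\<Union>(components (- X) - {C}) = - X - C"
    proof -
      have "\<Union>(insert C (components (- X) - {C})) = - X"
        by (simp only: insert_Diff[OF C(1)] Union_components)
      moreover have "\<Union>(components (- X) - {C}) \<inter> C = {}" using other by blast
      ultimately show ?thesis by blast
    qed
    have "(- X - C) \<inter> ?e = {}" using int_e eC int by auto
    then have "D \<union> E \<union> (- X - C) = - (X \<union> ?e)" using DE in_components_subset[OF C(1)] by auto
    then show "\<Union> (insert D (insert E (components (- X) - {C}))) = - (X \<union> ?e)"
      using U by auto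
  qed
  then show thesis using that[of D E] disDE neD neE DE opDE conD conE by blast
qed

text \<open>One component is replaced by two that carry the same value, so the sum gains one copy of
  it. Inner points of the chord lie in the old component, and the value may be read off
  there.\<close>

lemma csum_Un_chord:
  fixes X :: "complex set"
  assumes X: "compact X" "path_connected X" and e: "arc e"
    and int: "path_image e \<inter> X = {pathstart e, pathfinish e}"
    and t: "t \<in> {0<..<1}" and g: "loc_const g X" and fin: "finite (components (- X))"
  shows "finite (components (- (X \<union> path_image e)))"
    and "csum g (X \<union> path_image e) = csum g X + g (e t)"
proof -
  have "e t \<in> - X"
  proof
    assume "e t \<in> X"
    then have "e t \<in> {e 0, e 1}" using t int unfolding path_image_def pathstart_def pathfinish_def by fastforce
    then show False using e t unfolding arc_def inj_on_def by force
  qed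
  then obtain C where C: "C \<in> components (- X)" "e t \<in> C"
    by (metis UnionE Union_components)
  obtain D E where DE: "components (- (X \<union> path_image e)) = insert D (insert E (components (- X) - {C}))"
    "D \<noteq> E" "D \<noteq> {}" "E \<noteq> {}" "D \<subseteq> C" "E \<subseteq> C" "connected D" "connected E"
    "D \<union> E = C - path_image e"
    using components_Un_chord[OF X e int C(1) t C(2)] by metis
  show "finite (components (- (X \<union> path_image e)))" unfolding DE(1) using fin by simp
  have CX: "C \<subseteq> - X" "connected C" using C in_components_subset in_components_connected by auto
  have gC: "g z = g (e t)" if "z \<in> C" for z
    using loc_constD[OF g CX(2,1) that C(2)] .
  have v: "cval g D = g (e t)" "cval g E = g (e t)" "cval g C = g (e t)"
    using gC DE C(2) unfolding cval_def by (metis someI_ex ex_in_conv subsetD)+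
  have nD: "D \<notin> components (- X) - {C}" "E \<notin> components (- X) - {C}"
    using DE(3-6) C(1) components_eq by blast+
  have "csum g (X \<union> path_image e) = cval g D + (cval g E + (\<Sum>C\<in>components (- X) - {C}. cval g C))"
    unfolding csum_def DE(1) using nD DE(2) fin by simp
  also have "\<dots> = csum g X + g (e t)"
    unfolding csum_def using v fin C(1) by (simp add: sum.remove)
  finally show "csum g (X \<union> path_image e) = csum g X + g (e t)" .
qed

text \<open>The piece between two events may be a loop instead of an arc. It is therefore halved:
  the first half is attached to \<open>X\<close> at one end only, the second half is either free or
  a chord, according to whether \<open>\<beta> \<tau>\<close> lies on \<open>X\<close>.\<close>

lemma csum_event_step:
  fixes \<beta> :: "real \<Rightarrow> complex"
  assumes X: "compact X" "path_connected X" "finite (components (- X))" "loc_const g X"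
    and \<beta>: "path \<beta>" "0 \<le> \<sigma>" "\<sigma> < \<tau>" "\<tau> \<le> 1" "\<beta> \<sigma> \<in> X"
    and inj: "inj_on \<beta> {\<sigma><..<\<tau>}" "\<beta> ` {\<sigma><..<\<tau>} \<inter> X = {}" "\<beta> \<tau> \<notin> \<beta> ` {\<sigma><..<\<tau>}"
    and u: "u \<in> {\<sigma><..<\<tau>}"
  shows "finite (components (- (X \<union> \<beta> ` {\<sigma>..\<tau>})))"
    and "csum g (X \<union> \<beta> ` {\<sigma>..\<tau>}) = csum g X + (if \<beta> \<tau> \<in> X then g (\<beta> u) else 0)"
proof -
  define \<mu> where "\<mu> = (\<sigma> + \<tau>) / 2"
  have \<mu>: "\<sigma> < \<mu>" "\<mu> < \<tau>" using \<beta> by (auto simp: \<mu>_def)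
  define e1 where "e1 = subpath \<sigma> \<mu> \<beta>"
  define e2 where "e2 = subpath \<mu> \<tau> \<beta>"
  have im1: "path_image e1 = \<beta> ` {\<sigma>..\<mu>}" and im2: "path_image e2 = \<beta> ` {\<mu>..\<tau>}"
    using \<mu> by (simp_all add: e1_def e2_def path_image_subpath)
  have inX: "\<beta> x \<notin> X" if "x \<in> {\<sigma><..<\<tau>}" for x using inj(2) that by blast
  \<comment> \<open>The one coincidence not excluded is
    \<open>\<beta> \<sigma> = \<beta> \<tau>\<close>, a loop that closes up at its starting
    point.\<close>
  have neq: "\<beta> x \<noteq> \<beta> y" if "\<sigma> \<le> x" "x < y" "y \<le> \<tau>" "\<sigma> < x \<or> y < \<tau>" for x y
  proof -
    have "(x = \<sigma> \<and> y < \<tau>) \<or> (\<sigma> < x \<and> y = \<tau>) \<or> (\<sigma> < x \<and> y < \<tau>)" using that by auto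
    then consider "x = \<sigma>" "y < \<tau>" | "\<sigma> < x" "y = \<tau>" | "\<sigma> < x" "y < \<tau>" by blast
    then show ?thesis
    proof cases
      case 1 then show ?thesis using inX[of y] \<beta>(5) that by auto
    next
      case 2
      then have "\<beta> x \<in> \<beta> ` {\<sigma><..<\<tau>}" using that by auto
      then show ?thesis using inj(3) 2 by metis
    next
      case 3 then show ?thesis using inj(1) that unfolding inj_on_def by force
    qed
  qed
  have "inj_on \<beta> {\<sigma>..\<mu>}" "inj_on \<beta> {\<mu>..\<tau>}"
    using neq \<mu> by (force intro!: linorder_inj_onI)+
  then have arcs: "arc e1" "arc e2"
    using \<beta> \<mu> unfolding e1_def e2_def
    by (simp_all add: arc_subpath_eq closed_segment_eq_real_ivl inj_on_eq_iff)
  have ends: "pathstart e1 = \<beta> \<sigma>" "pathfinish e1 = \<beta> \<mu>" "pathstart e2 = \<beta> \<mu>" "pathfinish e2 = \<beta> \<tau>"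
    by (simp_all add: e1_def e2_def)
  have i1: "X \<inter> path_image e1 = {\<beta> \<sigma>}"
  proof -
    have "x = \<sigma>" if "x \<in> {\<sigma>..\<mu>}" "\<beta> x \<in> X" for x using inX[of x] that \<mu> by fastforce
    then have "z = \<beta> \<sigma>" if "z \<in> X" "z \<in> path_image e1" for z using that unfolding im1 by fastforce
    moreover have "\<beta> \<sigma> \<in> path_image e1" unfolding im1 using \<mu> by auto
    ultimately show ?thesis using \<beta>(5) by blast
  qed
  define X1 where "X1 = X \<union> path_image e1"
  have f1: "finite (components (- X1))" "csum g X1 = csum g X"
    unfolding X1_def using csum_Un_free_arc[OF X(1) arcs(1) _ X(4)] X(3) i1 by auto
  have X1: "compact X1" "path_connected X1" "loc_const g X1"
    unfolding X1_def
    using X arcs i1 compact_arc_image path_connected_path_image arc_imp_path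
    by (auto intro!: path_connected_Un loc_const_mono[OF X(4)])
  have tot: "X \<union> \<beta> ` {\<sigma>..\<tau>} = X1 \<union> path_image e2"
  proof -
    have "{\<sigma>..\<tau>} = {\<sigma>..\<mu>} \<union> {\<mu>..\<tau>}" using \<mu> by auto
    then show ?thesis unfolding X1_def im1 im2 by auto
  qed
  have i2: "path_image e2 \<inter> X1 = (if \<beta> \<tau> \<in> X then {\<beta> \<mu>, \<beta> \<tau>} else {\<beta> \<mu>})"
  proof -
    have a: "x = \<tau>" if "x \<in> {\<mu>..\<tau>}" "\<beta> x \<in> X" for x using inX[of x] that \<mu> by fastforce
    have b: "x = \<mu> \<or> (x = \<tau> \<and> y = \<sigma>)" if "x \<in> {\<mu>..\<tau>}" "y \<in> {\<sigma>..\<mu>}" "\<beta> x = \<beta> y" for x y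
      using neq[of y x] that \<mu> by fastforce
    have c: "\<beta> x \<in> {\<beta> \<mu>} \<union> (if \<beta> \<tau> \<in> X then {\<beta> \<tau>} else {})" if "x \<in> {\<mu>..\<tau>}" "\<beta> x \<in> X1" for x
      using a[OF that(1)] b[OF that(1)] that(2) \<beta>(5) unfolding X1_def im1 by fastforce
    have d: "\<beta> \<mu> \<in> X1" "\<beta> \<tau> \<in> X \<Longrightarrow> \<beta> \<tau> \<in> X1" using \<mu> by (auto simp: X1_def im1)
    have e: "\<beta> \<mu> \<in> path_image e2" "\<beta> \<tau> \<in> path_image e2" using \<mu> by (auto simp: im2)
    show ?thesis
    proof (intro equalityI subsetI)
      fix z assume z: "z \<in> path_image e2 \<inter> X1"
      then obtain x where "x \<in> {\<mu>..\<tau>}" "z = \<beta> x" unfolding im2 by auto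
      then show "z \<in> (if \<beta> \<tau> \<in> X then {\<beta> \<mu>, \<beta> \<tau>} else {\<beta> \<mu>})" using c z by fastforce
    qed (use d e in \<open>auto split: if_splits\<close>)
  qed
  have "finite (components (- (X1 \<union> path_image e2))) \<and>
    csum g (X1 \<union> path_image e2) = csum g X1 + (if \<beta> \<tau> \<in> X then g (\<beta> u) else 0)"
  proof (cases "\<beta> \<tau> \<in> X")
    case True
    have i: "path_image e2 \<inter> X1 = {pathstart e2, pathfinish e2}" using i2 True ends by simp
    have "(\<tau> - \<mu>) * (1/2) + \<mu> = (\<mu> + \<tau>) / 2" by (simp add: field_simps)
    then have half: "e2 (1/2) = \<beta> ((\<mu> + \<tau>) / 2)" unfolding e2_def subpath_def by (simp only:)
    have "connected (\<beta> ` {\<sigma><..<\<tau>})"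
      using \<beta> unfolding path_def
      by (intro connected_continuous_image) (auto elim!: continuous_on_subset)
    then have "g (\<beta> ((\<mu> + \<tau>) / 2)) = g (\<beta> u)"
    proof (rule loc_constD[OF X(4)])
      show "\<beta> ` {\<sigma><..<\<tau>} \<subseteq> - X" using inj(2) by blast
    qed (use u \<mu> in auto)
    then show ?thesis
      using csum_Un_chord[OF X1(1,2) arcs(2) i _ X1(3) f1(1), of "1/2"] True half by simp
  next
    case False
    then have "connected (X1 \<inter> path_image e2)" using i2 by (simp add: Int_commute)
    then show ?thesis
      using csum_Un_free_arc[OF X1(1) arcs(2) _ X1(3)] f1(1) False by simp
  qed
  then show "finite (components (- (X \<union> \<beta> ` {\<sigma>..\<tau>})))"
    and "csum g (X \<union> \<beta> ` {\<sigma>..\<tau>}) = csum g X + (if \<beta> \<tau> \<in> X then g (\<beta> u) else 0)"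
    unfolding tot f1(2)[symmetric] by auto
qed

text \<open>\<open>T\<close> lists every time at which the curve may meet what is already drawn, or
  will be met again later; only the times at which the former happens close off a component. The
  final time 1 belongs to \<open>T\<close> so that the last piece, too, ends at an event.
  \<open>gb t\<close> is the value of \<open>g\<close> seen along the curve just before
  \<open>t\<close>.\<close>

lemma csum_events:
  fixes \<beta> :: "real \<Rightarrow> complex"
  assumes A: "compact A" "path_connected A" "finite (components (- A))" "loc_const g A"
    and \<beta>: "path \<beta>" "\<beta> 0 \<in> A"
    and T: "finite T" "T \<subseteq> {0<..1}" "1 \<in> T"
    and simple: "\<And>u v. u \<in> {0<..1} - T \<Longrightarrow> v \<in> {0..1} \<Longrightarrow> v \<noteq> u \<Longrightarrow> \<beta> v \<noteq> \<beta> u"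
      "\<And>u. u \<in> {0<..1} - T \<Longrightarrow> \<beta> u \<notin> A"
    and before: "\<And>t. t \<in> T \<Longrightarrow> \<beta> t \<in> A \<union> \<beta> ` {0..<t} \<Longrightarrow> \<forall>\<^sub>F u in at_left t. g (\<beta> u) = gb t"
  shows "finite (components (- (A \<union> path_image \<beta>)))"
    and "csum g (A \<union> path_image \<beta>) = csum g A + (\<Sum>t\<in>{t\<in>T. \<beta> t \<in> A \<union> \<beta> ` {0..<t}}. gb t)"
proof -
  define E where "E = {t\<in>T. \<beta> t \<in> A \<union> \<beta> ` {0..<t}}"
  have finE: "finite E" using T(1) by (simp add: E_def)
  define X where "X \<tau> = A \<union> \<beta> ` {0..\<tau>}" for \<tau>
  have X: "compact (X \<tau>)" "path_connected (X \<tau>)" if "0 \<le> \<tau>" "\<tau> \<le> 1" for \<tau>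
  proof -
    have c: "continuous_on {0..\<tau>} \<beta>" using \<beta>(1) that unfolding path_def by (auto elim!: continuous_on_subset)
    show "compact (X \<tau>)" unfolding X_def
      using A(1) compact_continuous_image[OF c] by (simp add: compact_Un)
    have "path_connected (\<beta> ` {0..\<tau>})"
      by (rule path_connected_continuous_image[OF c]) (simp add: convex_imp_path_connected)
    moreover have "\<beta> 0 \<in> A \<inter> \<beta> ` {0..\<tau>}" using \<beta>(2) that by auto
    ultimately show "path_connected (X \<tau>)" unfolding X_def
      using A(2) path_connected_Un by blast
  qed
  have main: "finite (components (- X \<tau>)) \<and> csum g (X \<tau>) = csum g A + sum gb {t\<in>E. t \<le> \<tau>}"
    if "\<tau> \<in> insert 0 T" for \<tau>
    using that
  proof (induction "card {t\<in>T. t < \<tau>}" arbitrary: \<tau> rule: less_induct)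
    case less
    show ?case
    proof (cases "\<tau> = 0")
      case True
      have e: "{t \<in> E. t \<le> \<tau>} = {}" using True T(2) by (auto simp: E_def)
      have "X \<tau> = A" using True \<beta>(2) by (auto simp: X_def)
      then show ?thesis using A unfolding e by simp
    next
      case False
      then have \<tau>: "\<tau> \<in> T" "0 < \<tau>" "\<tau> \<le> 1" using less.prems T(2) by auto
      \<comment> \<open>The previous event, or the start 0 if there is none. Between
        \<open>\<sigma>\<close> and \<open>\<tau>\<close> the curve is injective and meets nothing
        drawn before.\<close>
      define \<sigma> where "\<sigma> = Max (insert 0 {t\<in>T. t < \<tau>})"
      have fin: "finite (insert 0 {t\<in>T. t < \<tau>})" using T(1) by simp
      have \<sigma>in: "\<sigma> \<in> insert 0 {t\<in>T. t < \<tau>}" unfolding \<sigma>_def by (rule Max_in[OF fin]) simp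
      have \<sigma>max: "t \<le> \<sigma>" if "t \<in> T" "t < \<tau>" for t unfolding \<sigma>_def using that by (intro Max_ge[OF fin]) auto
      have \<sigma>: "0 \<le> \<sigma>" "\<sigma> < \<tau>" "\<sigma> \<in> insert 0 T" using \<sigma>in \<tau> T(2) by auto
      have noT: "x \<in> {0<..1} - T" if "x \<in> {\<sigma><..<\<tau>}" for x
        using that \<sigma> \<tau> \<sigma>max[of x] by auto
      have IH: "finite (components (- X \<sigma>)) \<and> csum g (X \<sigma>) = csum g A + sum gb {t\<in>E. t \<le> \<sigma>}"
      proof (cases "\<sigma> = 0")
        case True
        have e: "{t \<in> E. t \<le> \<sigma>} = {}" using True T(2) by (auto simp: E_def)
        have "X \<sigma> = A" using True \<beta>(2) by (auto simp: X_def)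
        then show ?thesis using A unfolding e by simp
      next
        case False
        then have "\<sigma> \<in> T" using \<sigma> by auto
        have "{t\<in>T. t < \<sigma>} \<subset> {t\<in>T. t < \<tau>}" using \<sigma> \<open>\<sigma> \<in> T\<close> by auto
        then have "card {t\<in>T. t < \<sigma>} < card {t\<in>T. t < \<tau>}" using T(1) by (intro psubset_card_mono) auto
        then show ?thesis using less.hyps[OF _ \<sigma>(3)] by blast
      qed
      have Xs: "X \<tau> = X \<sigma> \<union> \<beta> ` {\<sigma>..\<tau>}"
      proof -
        have "{0..\<tau>} = {0..\<sigma>} \<union> {\<sigma>..\<tau>}" using \<sigma> by auto
        then show ?thesis by (auto simp: X_def)
      qed
      have inj: "inj_on \<beta> {\<sigma><..<\<tau>}" "\<beta> ` {\<sigma><..<\<tau>} \<inter> X \<sigma> = {}" "\<beta> \<tau> \<notin> \<beta> ` {\<sigma><..<\<tau>}"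
      proof -
        show "inj_on \<beta> {\<sigma><..<\<tau>}"
        proof (rule inj_onI)
          fix x y assume "x \<in> {\<sigma><..<\<tau>}" "y \<in> {\<sigma><..<\<tau>}" "\<beta> x = \<beta> y"
          then show "x = y" using simple(1)[of y x] noT \<sigma> \<tau> by fastforce
        qed
        have "\<beta> x \<notin> X \<sigma>" if x: "x \<in> {\<sigma><..<\<tau>}" for x
        proof -
          have "\<beta> v \<noteq> \<beta> x" if "v \<in> {0..\<sigma>}" for v
            using simple(1)[OF noT[OF x], of v] that x \<sigma> \<tau> by auto
          then show ?thesis using simple(2)[OF noT[OF x]] unfolding X_def by force
        qed
        then show "\<beta> ` {\<sigma><..<\<tau>} \<inter> X \<sigma> = {}" by blast
        show "\<beta> \<tau> \<notin> \<beta> ` {\<sigma><..<\<tau>}"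
        proof
          assume "\<beta> \<tau> \<in> \<beta> ` {\<sigma><..<\<tau>}"
          then obtain x where "x \<in> {\<sigma><..<\<tau>}" "\<beta> \<tau> = \<beta> x" by auto
          then show False using simple(1)[OF noT, of x \<tau>] \<tau> by auto
        qed
      qed
      have Xsig: "compact (X \<sigma>)" "path_connected (X \<sigma>)" "loc_const g (X \<sigma>)" "\<beta> \<sigma> \<in> X \<sigma>"
        using X[of \<sigma>] \<sigma> \<tau> loc_const_mono[OF A(4), of "X \<sigma>"] by (auto simp: X_def)
      have iff: "\<beta> \<tau> \<in> X \<sigma> \<longleftrightarrow> \<tau> \<in> E"
      proof -
        have "{0..<\<tau>} = {0..\<sigma>} \<union> {\<sigma><..<\<tau>}" using \<sigma> by auto
        then show ?thesis unfolding X_def E_def using inj(3) \<tau>(1) by auto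
      qed
      \<comment> \<open>If \<open>\<tau>\<close> is a return, \<open>u\<close> has to be late enough
        for \<open>g\<close> to show its left-hand value; otherwise nothing is counted and any
        \<open>u\<close> in between will do.\<close>
      obtain u where u: "u \<in> {\<sigma><..<\<tau>}" "\<tau> \<in> E \<Longrightarrow> g (\<beta> u) = gb \<tau>"
      proof (cases "\<tau> \<in> E")
        case True
        then have "\<forall>\<^sub>F u in at_left \<tau>. g (\<beta> u) = gb \<tau>" using before by (auto simp: E_def)
        moreover have "\<forall>\<^sub>F u in at_left \<tau>. u \<in> {\<sigma><..<\<tau>}"
          using \<sigma>(2) by (rule eventually_at_left_real)
        ultimately have "\<forall>\<^sub>F u in at_left \<tau>. u \<in> {\<sigma><..<\<tau>} \<and> g (\<beta> u) = gb \<tau>" by (auto elim: eventually_elim2)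
        then obtain u where "u \<in> {\<sigma><..<\<tau>} \<and> g (\<beta> u) = gb \<tau>"
          using eventually_happens' trivial_limit_at_left_real by blast
        then show thesis using that by blast
      next
        case False
        then show thesis using that[of "(\<sigma> + \<tau>) / 2"] \<sigma> by auto
      qed
      note step = csum_event_step[OF Xsig(1,2) conjunct1[OF IH] Xsig(3) \<beta>(1) \<sigma>(1,2) \<tau>(3) Xsig(4) inj u(1)]
      have Eset: "{t\<in>E. t \<le> \<tau>} = (if \<tau> \<in> E then insert \<tau> {t\<in>E. t \<le> \<sigma>} else {t\<in>E. t \<le> \<sigma>})"
      proof -
        have "t \<le> \<sigma> \<or> t = \<tau>" if "t \<in> E" "t \<le> \<tau>" for t
          using \<sigma>max[of t] that by (auto simp: E_def)
        then show ?thesis using \<sigma>(2) by (auto intro: order_trans)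
      qed
      have "sum gb {t\<in>E. t \<le> \<tau>} = sum gb {t\<in>E. t \<le> \<sigma>} + (if \<tau> \<in> E then gb \<tau> else 0)"
        unfolding Eset using \<sigma>(2) finE by auto
      then show ?thesis using step IH u(2) iff unfolding Xs by auto
    qed
  qed
  have "{t\<in>E. t \<le> 1} = E" using T(2) by (auto simp: E_def)
  moreover have "X 1 = A \<union> path_image \<beta>" by (simp add: X_def path_image_def)
  ultimately show "finite (components (- (A \<union> path_image \<beta>)))"
    and "csum g (A \<union> path_image \<beta>) = csum g A + (\<Sum>t\<in>{t\<in>T. \<beta> t \<in> A \<union> \<beta> ` {0..<t}}. gb t)"
    using main[of 1] T(3) unfolding E_def by auto
qed

section \<open>Adding a closed curve\<close>

definition double_times :: "(real \<Rightarrow> complex) \<Rightarrow> real set" where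
  "double_times \<gamma> = {t\<in>{0..<1}. \<exists>s\<in>{0..<1}. s \<noteq> t \<and> \<gamma> s = \<gamma> t}"

definition at_most_double :: "(real \<Rightarrow> complex) \<Rightarrow> bool" where
  "at_most_double \<gamma> \<longleftrightarrow> (\<forall>s\<in>{0..<1}. \<forall>t\<in>{0..<1}. \<forall>u\<in>{0..<1}. \<gamma> s = \<gamma> t \<and> \<gamma> t = \<gamma> u \<longrightarrow> s = t \<or> t = u \<or> s = u)"

lemma loc_const_eventually:
  assumes "compact A" "loc_const g A" "z \<notin> A" "(f \<longlongrightarrow> z) F"
  shows "\<forall>\<^sub>F u in F. g (f u) = g z"
proof -
  define C where "C = connected_component_set (- A) z"
  have "open C" unfolding C_def using assms(1) by (intro open_connected_component open_Compl compact_imp_closed)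
  moreover have "z \<in> C" using assms(3) by (simp add: C_def)
  ultimately have "\<forall>\<^sub>F u in F. f u \<in> C" using assms(4) by (simp add: topological_tendstoD)
  then show ?thesis
    by (rule eventually_mono) (use assms(2) in \<open>auto simp: C_def loc_const_def\<close>)
qed

text \<open>The curve starts on \<open>A\<close>, and the base point counts once, at time 1 when the
  curve closes. A node of \<open>\<beta>\<close> off \<open>A\<close> is passed twice but closes a
  component only at the second passage, which gives one term per node. There the value just before
  is the value at the node itself, because \<open>g\<close> is locally constant off
  \<open>A\<close>.\<close>

lemma csum_closed_curve:
  fixes \<beta> :: "real \<Rightarrow> complex"
  assumes A: "compact A" "path_connected A" "finite (components (- A))" "loc_const g A"
    and \<beta>: "path \<beta>" "\<beta> 0 \<in> A" "\<beta> 1 = \<beta> 0"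
    and D: "finite (double_times \<beta>)" "at_most_double \<beta>" "\<beta> ` double_times \<beta> \<inter> A = {}"
    and H: "finite {t\<in>{0..<1}. \<beta> t \<in> A}"
    and before: "\<And>t. t \<in> {0<..1} \<Longrightarrow> \<beta> t \<in> A \<Longrightarrow> \<forall>\<^sub>F u in at_left t. g (\<beta> u) = gb (\<beta> t)"
  shows "finite (components (- (A \<union> path_image \<beta>)))"
    and "csum g (A \<union> path_image \<beta>) = csum g A + (\<Sum>p\<in>\<beta> ` double_times \<beta>. g p) + (\<Sum>q\<in>A \<inter> path_image \<beta>. gb q)"
proof -
  define H1 where "H1 = {t\<in>{0<..1}. \<beta> t \<in> A}"
  define D2 where "D2 = {t\<in>double_times \<beta>. \<exists>s\<in>{0..<t}. \<beta> s = \<beta> t}"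
  define T where "T = H1 \<union> double_times \<beta>"
  have dt: "s \<in> double_times \<beta>" "t \<in> double_times \<beta>" if "\<beta> s = \<beta> t" "s \<noteq> t" "s \<in> {0..<1}" "t \<in> {0..<1}" for s t
    using that by (auto simp: double_times_def)
  have dA: "\<beta> t \<notin> A" if "t \<in> double_times \<beta>" for t using that D(3) by auto
  have "0 \<notin> double_times \<beta>" using dA \<beta>(2) by auto
  have "finite H1"
  proof -
    have "H1 \<subseteq> insert 1 {t\<in>{0..<1}. \<beta> t \<in> A}" by (auto simp: H1_def)
    then show ?thesis using H finite_subset by blast
  qed
  have T: "finite T" "T \<subseteq> {0<..1}" "1 \<in> T"
    using \<open>finite H1\<close> D(1) \<open>0 \<notin> double_times \<beta>\<close> \<beta> unfolding T_def
    by (auto simp: H1_def double_times_def less_le)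
  have simple: "\<beta> v \<noteq> \<beta> u" if "u \<in> {0<..1} - T" "v \<in> {0..1}" "v \<noteq> u" for u v
  proof
    assume eq: "\<beta> v = \<beta> u"
    have u: "u \<in> {0<..<1}" "\<beta> u \<notin> A" using that T(3) by (auto simp: T_def H1_def less_le)
    then have "v \<noteq> 1" using eq \<beta> by auto
    then show False using dt(1)[of u v] that u eq by (auto simp: T_def)
  qed
  have E: "{t\<in>T. \<beta> t \<in> A \<union> \<beta> ` {0..<t}} = H1 \<union> D2"
  proof -
    have "t \<in> H1 \<union> D2" if "t \<in> T" "\<beta> t \<in> \<beta> ` {0..<t}" for t
      using that by (auto simp: T_def D2_def image_iff)
    moreover have "t \<in> H1 \<union> D2" if "t \<in> T" "\<beta> t \<in> A" for t
      using that T(2) by (auto simp: H1_def)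
    moreover have "t \<in> {t\<in>T. \<beta> t \<in> A \<union> \<beta> ` {0..<t}}" if "t \<in> H1 \<union> D2" for t
    proof -
      have "\<beta> t \<in> \<beta> ` {0..<t}" if D2: "t \<in> D2"
      proof -
        obtain s where "s \<in> {0..<t}" "\<beta> s = \<beta> t" using D2 unfolding D2_def by blast
        then show ?thesis by (metis image_eqI)
      qed
      then show ?thesis using that by (auto simp: T_def H1_def D2_def)
    qed
    ultimately show ?thesis by blast
  qed
  define gc where "gc t = (if t \<in> H1 then gb (\<beta> t) else g (\<beta> t))" for t
  have disj: "H1 \<inter> D2 = {}" using dA by (auto simp: H1_def D2_def)
  have before': "\<forall>\<^sub>F u in at_left t. g (\<beta> u) = gc t" if "t \<in> T" "\<beta> t \<in> A \<union> \<beta> ` {0..<t}" for t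
  proof (cases "t \<in> H1")
    case True then show ?thesis using before by (auto simp: gc_def H1_def)
  next
    case False
    then have "\<beta> t \<notin> A" using that T(2) by (auto simp: H1_def)
    have "continuous_on {0..1} \<beta>" using \<beta>(1) by (simp add: path_def)
    moreover have "t \<in> {0<..1}" using that T(2) by auto
    ultimately have "(\<beta> \<longlongrightarrow> \<beta> t) (at_left t)"
      by (metis at_within_Icc_at_left continuous_on_Icc_at_leftD continuous_on_subset greaterThanAtMost_iff
          atLeastatMost_subset_iff order_refl less_imp_le)
    then have "\<forall>\<^sub>F u in at_left t. g (\<beta> u) = g (\<beta> t)"
      by (rule loc_const_eventually[OF A(1,4) \<open>\<beta> t \<notin> A\<close>])
    then show ?thesis using False by (simp add: gc_def)
  qed
  note ev = csum_events[OF A \<beta>(1,2) T simple _ before']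
  have notA: "\<beta> u \<notin> A" if "u \<in> {0<..1} - T" for u using that by (auto simp: T_def H1_def)
  have "finite D2" using D(1) by (simp add: D2_def)
  have injH: "inj_on \<beta> H1"
  proof (rule inj_onI)
    fix x y assume xy: "x \<in> H1" "y \<in> H1" "\<beta> x = \<beta> y"
    show "x = y"
    proof (rule ccontr)
      assume ne: "x \<noteq> y"
      \<comment> \<open>Returns are indexed by \<open>{0<..1}\<close> but double times by
        \<open>{0..<1}\<close>; the time 1 is renamed 0 for the comparison.\<close>
      define x' y' where "x' = (if x = 1 then 0 else x)" and "y' = (if y = 1 then 0 else y)"
      have "x' \<in> {0..<1}" "y' \<in> {0..<1}" "x' \<noteq> y'" "\<beta> x' = \<beta> y'" "\<beta> x' \<in> A"
        using xy ne \<beta> by (auto simp: x'_def y'_def H1_def)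
      then show False using dt(1)[of x' y'] dA[of x'] by auto
    qed
  qed
  have imH: "\<beta> ` H1 = A \<inter> path_image \<beta>"
  proof
    show "A \<inter> path_image \<beta> \<subseteq> \<beta> ` H1"
    proof
      fix q assume "q \<in> A \<inter> path_image \<beta>"
      then obtain t where t: "t \<in> {0..1}" "q = \<beta> t" "q \<in> A" by (auto simp: path_image_def)
      show "q \<in> \<beta> ` H1"
      proof (cases "t = 0")
        case True
        then show ?thesis using t \<beta> by (intro image_eqI[of _ _ 1]) (auto simp: H1_def)
      next
        case False
        then show ?thesis using t by (intro image_eqI[of _ _ t]) (auto simp: H1_def)
      qed
    qed
  qed (auto simp: H1_def path_image_def)
  have injD: "inj_on \<beta> D2"
  proof (rule inj_onI)
    fix x y assume xy: "x \<in> D2" "y \<in> D2" "\<beta> x = \<beta> y"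
    then obtain s t where st: "s \<in> {0..<x}" "\<beta> s = \<beta> x" "t \<in> {0..<y}" "\<beta> t = \<beta> y"
      by (auto simp: D2_def)
    have "x \<in> {0..<1}" "y \<in> {0..<1}" using xy by (auto simp: D2_def double_times_def)
    then show "x = y" using st xy D(2)[unfolded at_most_double_def, rule_format, of s x y]
      D(2)[unfolded at_most_double_def, rule_format, of t x y] by force
  qed
  have imD: "\<beta> ` D2 = \<beta> ` double_times \<beta>"
  proof
    show "\<beta> ` double_times \<beta> \<subseteq> \<beta> ` D2"
    proof
      fix p assume "p \<in> \<beta> ` double_times \<beta>"
      then obtain s t where "s \<in> {0..<1}" "t \<in> {0..<1}" "s < t" "\<beta> s = p" "\<beta> t = p"
        unfolding double_times_def by (auto, metis linorder_neqE_linordered_idom)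
      then show "p \<in> \<beta> ` D2" by (intro image_eqI[of _ _ t]) (auto simp: D2_def double_times_def)
    qed
  qed (auto simp: D2_def)
  show "finite (components (- (A \<union> path_image \<beta>)))" using ev(1) notA by blast
  have "csum g (A \<union> path_image \<beta>) = csum g A + (\<Sum>t\<in>H1 \<union> D2. gc t)"
    using ev(2) notA E by simp
  also have "(\<Sum>t\<in>H1 \<union> D2. gc t) = (\<Sum>t\<in>H1. gc t) + (\<Sum>t\<in>D2. gc t)"
    using \<open>finite H1\<close> \<open>finite D2\<close> disj by (rule sum.union_disjoint)
  also have "(\<Sum>t\<in>H1. gc t) = (\<Sum>q\<in>A \<inter> path_image \<beta>. gb q)"
    unfolding imH[symmetric] sum.reindex[OF injH] by (simp add: gc_def)
  also have "(\<Sum>t\<in>D2. gc t) = (\<Sum>p\<in>\<beta> ` double_times \<beta>. g p)"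
    unfolding imD[symmetric] sum.reindex[OF injD] using disj by (intro sum.cong) (auto simp: gc_def)
  finally show "csum g (A \<union> path_image \<beta>) = csum g A + (\<Sum>p\<in>\<beta> ` double_times \<beta>. g p) + (\<Sum>q\<in>A \<inter> path_image \<beta>. gb q)"
    by simp
qed

section \<open>Winding numbers near a point of a curve\<close>

text \<open>Unlike the ray from \<open>p\<close> in direction \<open>d\<close>, this filter is met by every curve that leaves \<open>p\<close> with
  velocity \<open>d\<close>.\<close>

definition dirf :: "complex \<Rightarrow> complex \<Rightarrow> complex filter" where
  "dirf p d = filtermap (\<lambda>(r, e). p + r *\<^sub>R e) (at_right (0::real) \<times>\<^sub>F nhds d)"

lemma dirf_neq_bot [simp]: "dirf p d \<noteq> bot"
  by (simp add: dirf_def filtermap_bot_iff prod_filter_eq_bot)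

text \<open>The basic sets are truncated cones with apex \<open>p\<close> around the ray in
  direction \<open>d\<close>. They are connected, which is what makes winding numbers constant along
  the filter.\<close>

lemma eventually_dirf_iff:
  "eventually P (dirf p d) \<longleftrightarrow> (\<exists>\<epsilon>>0. \<forall>r\<in>{0<..<\<epsilon>}. \<forall>e\<in>ball d \<epsilon>. P (p + r *\<^sub>R e))"
proof
  assume "eventually P (dirf p d)"
  then obtain Pf Pg where P: "eventually Pf (at_right (0::real))" "eventually Pg (nhds d)"
    "\<And>r e. Pf r \<Longrightarrow> Pg e \<Longrightarrow> P (p + r *\<^sub>R e)"
    unfolding dirf_def eventually_filtermap eventually_prod_filter by auto
  obtain b where b: "b > 0" "\<And>r. 0 < r \<Longrightarrow> r < b \<Longrightarrow> Pf r"
    using P(1) unfolding eventually_at_right_field by auto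
  obtain c where c: "c > 0" "\<And>e. dist e d < c \<Longrightarrow> Pg e"
    using P(2) unfolding eventually_nhds_metric by auto
  show "\<exists>\<epsilon>>0. \<forall>r\<in>{0<..<\<epsilon>}. \<forall>e\<in>ball d \<epsilon>. P (p + r *\<^sub>R e)"
    using b c P(3) by (intro exI[of _ "min b c"]) (auto simp: dist_commute)
next
  assume "\<exists>\<epsilon>>0. \<forall>r\<in>{0<..<\<epsilon>}. \<forall>e\<in>ball d \<epsilon>. P (p + r *\<^sub>R e)"
  then obtain \<epsilon> where e: "\<epsilon> > 0" "\<And>r e. r \<in> {0<..<\<epsilon>} \<Longrightarrow> e \<in> ball d \<epsilon> \<Longrightarrow> P (p + r *\<^sub>R e)" by auto
  have "\<forall>\<^sub>F r in at_right (0::real). r \<in> {0<..<\<epsilon>}" using e(1) by (rule eventually_at_right_real)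
  moreover have "\<forall>\<^sub>F z in nhds d. z \<in> ball d \<epsilon>" using e(1) by (intro eventually_nhds_in_open) auto
  ultimately show "eventually P (dirf p d)"
    unfolding dirf_def eventually_filtermap eventually_prod_filter
    by (intro exI[of _ "\<lambda>r. r \<in> {0<..<\<epsilon>}"] exI[of _ "\<lambda>z. z \<in> ball d \<epsilon>"]) (use e(2) in auto)
qed

lemma tendsto_dirf: "((\<lambda>z. z) \<longlongrightarrow> p) (dirf p d)"
proof -
  have "((\<lambda>x. p + fst x *\<^sub>R snd x) \<longlongrightarrow> p + 0 *\<^sub>R d) (at_right (0::real) \<times>\<^sub>F nhds d)"
  proof (intro tendsto_intros)
    have "filterlim fst (at_right (0::real)) (at_right 0 \<times>\<^sub>F nhds d)" by (rule filterlim_fst)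
    then show "(fst \<longlongrightarrow> (0::real)) (at_right (0::real) \<times>\<^sub>F nhds d)"
      by (rule filterlim_mono) (auto simp: at_within_le_nhds)
    show "(snd \<longlongrightarrow> d) (at_right (0::real) \<times>\<^sub>F nhds d)" by (rule filterlim_snd)
  qed
  then show ?thesis unfolding dirf_def filterlim_filtermap by (simp add: case_prod_beta)
qed

text \<open>The link to \<open>quadrant\<close>, which follows a straight ray.\<close>

lemma filterlim_dirf_ray: "filterlim (\<lambda>r. p + r *\<^sub>R d) (dirf p d) (at_right (0::real))"
proof -
  have "filterlim (\<lambda>r. (r, d)) (at_right 0 \<times>\<^sub>F nhds d) (at_right (0::real))"
    by (intro filterlim_Pair filterlim_ident tendsto_const)
  then show ?thesis
    using filterlim_compose[of "\<lambda>(r, e). p + r *\<^sub>R e" "dirf p d" "at_right 0 \<times>\<^sub>F nhds d" "\<lambda>r. (r, d)"]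
    by (simp add: dirf_def filterlim_def)
qed

section \<open>One-sided tangents and the directions in which a curve leaves or reaches a
  point\<close>

lemma right_quotient_tendsto:
  fixes \<gamma> :: "real \<Rightarrow> complex"
  assumes "(\<gamma> has_vector_derivative v) (at_right t)"
  shows "((\<lambda>u. (\<gamma> u - \<gamma> t) /\<^sub>R (u - t)) \<longlongrightarrow> v) (at_right t)"
proof -
  have "((\<lambda>u. (\<gamma> u - \<gamma> t - (u - t) *\<^sub>R v) /\<^sub>R norm (u - t)) \<longlongrightarrow> 0) (at_right t)"
    using assms unfolding has_vector_derivative_def has_derivative_at_within by blast
  then have "((\<lambda>u. (\<gamma> u - \<gamma> t - (u - t) *\<^sub>R v) /\<^sub>R norm (u - t) + v) \<longlongrightarrow> 0 + v) (at_right t)"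
    by (intro tendsto_add tendsto_const)
  moreover have "\<forall>\<^sub>F u in at_right t. (\<gamma> u - \<gamma> t - (u - t) *\<^sub>R v) /\<^sub>R norm (u - t) + v = (\<gamma> u - \<gamma> t) /\<^sub>R (u - t)"
    unfolding eventually_at_filter by (rule always_eventually) (auto simp: scaleR_diff_right)
  ultimately show ?thesis by (simp add: filterlim_cong)
qed

lemma left_quotient_tendsto:
  fixes \<gamma> :: "real \<Rightarrow> complex"
  assumes "(\<gamma> has_vector_derivative v) (at_left t)"
  shows "((\<lambda>u. (\<gamma> u - \<gamma> t) /\<^sub>R (t - u)) \<longlongrightarrow> - v) (at_left t)"
proof -
  have "((\<lambda>u. (\<gamma> u - \<gamma> t - (u - t) *\<^sub>R v) /\<^sub>R norm (u - t)) \<longlongrightarrow> 0) (at_left t)"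
    using assms unfolding has_vector_derivative_def has_derivative_at_within by blast
  then have "((\<lambda>u. (\<gamma> u - \<gamma> t - (u - t) *\<^sub>R v) /\<^sub>R norm (u - t) - v) \<longlongrightarrow> 0 - v) (at_left t)"
    by (intro tendsto_diff tendsto_const)
  moreover have "\<forall>\<^sub>F u in at_left t. (\<gamma> u - \<gamma> t - (u - t) *\<^sub>R v) /\<^sub>R norm (u - t) - v = (\<gamma> u - \<gamma> t) /\<^sub>R (t - u)"
    unfolding eventually_at_filter
  proof (rule always_eventually, intro allI impI)
    fix u :: real assume "u \<noteq> t" "u \<in> {..<t}"
    then have "u < t" by simp
    have "inverse (t - u) * (u - t) = - 1" using \<open>u < t\<close> by (simp add: field_simps)
    then have "((u - t) *\<^sub>R v) /\<^sub>R (t - u) = - v" by (metis scaleR_scaleR scaleR_minus1_left)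
    then show "(\<gamma> u - \<gamma> t - (u - t) *\<^sub>R v) /\<^sub>R norm (u - t) - v = (\<gamma> u - \<gamma> t) /\<^sub>R (t - u)"
      using \<open>u < t\<close> by (simp add: scaleR_diff_right)
  qed
  ultimately show ?thesis by (simp add: filterlim_cong)
qed

text \<open>\<open>\<gamma> u\<close> is \<open>\<gamma> t\<close> plus \<open>u - t\<close> times
  the difference quotient; the first factor is a small positive radius and the second tends to
  \<open>v\<close>, so the curve enters every cone around \<open>v\<close>.\<close>

lemma filterlim_dirf_right:
  assumes "(\<gamma> has_vector_derivative v) (at_right t)"
  shows "filterlim \<gamma> (dirf (\<gamma> t) v) (at_right t)"
proof -
  have "filterlim (\<lambda>u. u - t) (at_right 0) (at_right t)"
    unfolding filterlim_at
  proof
    show "((\<lambda>u. u - t) \<longlongrightarrow> 0) (at_right t)" by (rule tendsto_eq_intros refl | simp)+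
    show "\<forall>\<^sub>F u in at_right t. u - t \<in> {0<..} \<and> u - t \<noteq> 0"
      unfolding eventually_at_filter by (rule always_eventually) simp
  qed
  then have "filterlim (\<lambda>u. (u - t, (\<gamma> u - \<gamma> t) /\<^sub>R (u - t))) (at_right 0 \<times>\<^sub>F nhds v) (at_right t)"
    by (intro filterlim_Pair right_quotient_tendsto assms)
  then have "filterlim (\<lambda>u. case (u - t, (\<gamma> u - \<gamma> t) /\<^sub>R (u - t)) of (r, e) \<Rightarrow> \<gamma> t + r *\<^sub>R e) (dirf (\<gamma> t) v) (at_right t)"
    by (rule filterlim_compose[rotated]) (simp add: dirf_def filterlim_def)
  moreover have "\<forall>\<^sub>F u in at_right t. (case (u - t, (\<gamma> u - \<gamma> t) /\<^sub>R (u - t)) of (r, e) \<Rightarrow> \<gamma> t + r *\<^sub>R e) = \<gamma> u"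
    unfolding eventually_at_filter by (rule always_eventually) simp
  ultimately show ?thesis by (simp only: filterlim_cong[OF refl refl])
qed

lemma filterlim_dirf_left:
  assumes "(\<gamma> has_vector_derivative v) (at_left t)"
  shows "filterlim \<gamma> (dirf (\<gamma> t) (- v)) (at_left t)"
proof -
  have "filterlim (\<lambda>u. t - u) (at_right 0) (at_left t)"
    unfolding filterlim_at
  proof
    show "((\<lambda>u. t - u) \<longlongrightarrow> 0) (at_left t)" by (rule tendsto_eq_intros refl | simp)+
    show "\<forall>\<^sub>F u in at_left t. t - u \<in> {0<..} \<and> t - u \<noteq> 0"
      unfolding eventually_at_filter by (rule always_eventually) simp
  qed
  then have "filterlim (\<lambda>u. (t - u, (\<gamma> u - \<gamma> t) /\<^sub>R (t - u))) (at_right 0 \<times>\<^sub>F nhds (- v)) (at_left t)"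
    by (intro filterlim_Pair left_quotient_tendsto assms)
  then have "filterlim (\<lambda>u. case (t - u, (\<gamma> u - \<gamma> t) /\<^sub>R (t - u)) of (r, e) \<Rightarrow> \<gamma> t + r *\<^sub>R e) (dirf (\<gamma> t) (- v)) (at_left t)"
    by (rule filterlim_compose[rotated]) (simp add: dirf_def filterlim_def)
  moreover have "\<forall>\<^sub>F u in at_left t. (case (t - u, (\<gamma> u - \<gamma> t) /\<^sub>R (t - u)) of (r, e) \<Rightarrow> \<gamma> t + r *\<^sub>R e) = \<gamma> u"
    unfolding eventually_at_filter by (rule always_eventually) simp
  ultimately show ?thesis by (simp only: filterlim_cong[OF refl refl])
qed

lemma sgn_eq_scaled:
  assumes "sgn (d::complex) = sgn v" "v \<noteq> 0" shows "Im (d / v) = 0"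
proof -
  have "d = norm d *\<^sub>R sgn d" by (cases "d = 0") (simp_all add: sgn_div_norm)
  also have "\<dots> = (norm d / norm v) *\<^sub>R v" using assms by (simp add: sgn_div_norm divide_inverse)
  finally have "d / v = of_real (norm d / norm v)" using assms(2) by (simp add: scaleR_conv_of_real field_simps)
  then show ?thesis by (metis Im_complex_of_real)
qed

text \<open>Close to a visit of \<open>p\<close> the unit vectors from \<open>p\<close> to the curve
  tend to a one-sided tangent direction other than that of \<open>d\<close>. Away from the finitely
  many visits the curve is compact and stays at positive distance from \<open>p\<close>.\<close>

lemma dirf_avoids:
  fixes \<gamma> :: "real \<Rightarrow> complex"
  assumes "path \<gamma>" "finite {t\<in>{0..1}. \<gamma> t = p}" "d \<noteq> 0"
    and right: "\<And>t. t \<in> {0..<1} \<Longrightarrow> \<gamma> t = p \<Longrightarrow> \<exists>v. (\<gamma> has_vector_derivative v) (at_right t) \<and> v \<noteq> 0 \<and> sgn v \<noteq> sgn d"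
    and left: "\<And>t. t \<in> {0<..1} \<Longrightarrow> \<gamma> t = p \<Longrightarrow> \<exists>v. (\<gamma> has_vector_derivative v) (at_left t) \<and> v \<noteq> 0 \<and> sgn (- v) \<noteq> sgn d"
  shows "\<forall>\<^sub>F z in dirf p d. z \<notin> path_image \<gamma>"
proof -
  define V where "V = {t\<in>{0..1}. \<gamma> t = p}"
  \<comment> \<open>Half the distance between the two unit vectors leaves room for both: the curve
    stays within \<open>\<epsilon>\<close> of \<open>s\<close>, the cone stays at least
    \<open>\<epsilon>\<close> away from it.\<close>
  have aux: "\<exists>\<epsilon>>0. (\<forall>\<^sub>F u in F. norm (sgn (\<gamma> u - p) - s) < \<epsilon>) \<and> (\<forall>\<^sub>F z in dirf p d. norm (sgn (z - p) - s) \<ge> \<epsilon>)"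
    if "((\<lambda>u. sgn (\<gamma> u - p)) \<longlongrightarrow> s) F" "s \<noteq> sgn d" for F :: "real filter" and s
  proof -
    define \<epsilon> where "\<epsilon> = norm (sgn d - s) / 2"
    have "\<epsilon> > 0" using that by (simp add: \<epsilon>_def)
    have "\<forall>\<^sub>F u in F. norm (sgn (\<gamma> u - p) - s) < \<epsilon>"
      using tendstoD[OF that(1) \<open>\<epsilon> > 0\<close>] by (simp add: dist_norm)
    moreover have "\<forall>\<^sub>F z in dirf p d. norm (sgn (z - p) - s) \<ge> \<epsilon>"
    proof -
      have "(sgn \<longlongrightarrow> sgn d) (nhds d)"
        using tendsto_sgn[OF filterlim_ident assms(3)] by simp
      then have "\<forall>\<^sub>F e in nhds d. norm (sgn e - sgn d) < \<epsilon>"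
        using \<open>\<epsilon> > 0\<close> by (auto dest!: tendstoD simp: dist_norm)
      then have E: "\<forall>\<^sub>F e in nhds d. norm (sgn e - s) \<ge> \<epsilon>"
      proof (rule eventually_mono)
        fix e assume "norm (sgn e - sgn d) < \<epsilon>"
        moreover have "norm (sgn d - s) \<le> norm (sgn e - sgn d) + norm (sgn e - s)"
          using norm_triangle_ineq[of "sgn d - sgn e" "sgn e - s"] by (simp add: norm_minus_commute)
        ultimately show "norm (sgn e - s) \<ge> \<epsilon>" unfolding \<epsilon>_def by linarith
      qed
      have "\<forall>\<^sub>F r in at_right (0::real). r > 0" by (simp add: eventually_at_filter)
      with E show ?thesis
        unfolding dirf_def eventually_filtermap eventually_prod_filter
        by (intro exI[of _ "\<lambda>r. r > 0"] exI[of _ "\<lambda>e. norm (sgn e - s) \<ge> \<epsilon>"]) (auto simp: sgn_scaleR)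
    qed
    ultimately show ?thesis using \<open>\<epsilon> > 0\<close> by blast
  qed
  have neq: "\<forall>\<^sub>F z in dirf p d. z \<noteq> p"
  proof -
    have "\<forall>\<^sub>F r in at_right (0::real). r > 0" by (simp add: eventually_at_filter)
    moreover have "\<forall>\<^sub>F e in nhds d. e \<noteq> 0" using assms(3) by (intro t1_space_nhds) auto
    ultimately show ?thesis
      unfolding dirf_def eventually_filtermap eventually_prod_filter by fastforce
  qed
  have rt: "\<exists>\<delta>>0. \<forall>\<^sub>F z in dirf p d. z \<notin> \<gamma> ` {t<..<t+\<delta>}" if tV: "t \<in> V" "t < 1" for t
  proof -
    obtain v where v: "(\<gamma> has_vector_derivative v) (at_right t)" "v \<noteq> 0" "sgn v \<noteq> sgn d"
      using right[of t] tV by (auto simp: V_def)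
    have "((\<lambda>u. sgn ((\<gamma> u - \<gamma> t) /\<^sub>R (u - t))) \<longlongrightarrow> sgn v) (at_right t)"
      by (intro tendsto_sgn right_quotient_tendsto v)
    moreover have "\<forall>\<^sub>F u in at_right t. sgn ((\<gamma> u - \<gamma> t) /\<^sub>R (u - t)) = sgn (\<gamma> u - p)"
      using that unfolding eventually_at_filter V_def by (intro always_eventually) (auto simp: sgn_scaleR)
    ultimately have "((\<lambda>u. sgn (\<gamma> u - p)) \<longlongrightarrow> sgn v) (at_right t)" by (simp add: filterlim_cong)
    from aux[OF this v(3)] obtain \<epsilon> where e: "\<epsilon> > 0" "\<forall>\<^sub>F u in at_right t. norm (sgn (\<gamma> u - p) - sgn v) < \<epsilon>"
       "\<forall>\<^sub>F z in dirf p d. norm (sgn (z - p) - sgn v) \<ge> \<epsilon>" by auto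
    obtain b where b: "b > t" "\<And>u. t < u \<Longrightarrow> u < b \<Longrightarrow> norm (sgn (\<gamma> u - p) - sgn v) < \<epsilon>"
      using e(2) unfolding eventually_at_right_field by auto
    have "\<forall>\<^sub>F z in dirf p d. z \<notin> \<gamma> ` {t<..<t+(b-t)}"
      using e(3) by (rule eventually_mono) (use b(2) in \<open>force simp: not_less[symmetric]\<close>)
    then show ?thesis using b(1) by (intro exI[of _ "b - t"]) auto
  qed
  have lt: "\<exists>\<delta>>0. \<forall>\<^sub>F z in dirf p d. z \<notin> \<gamma> ` {t-\<delta><..<t}" if tV: "t \<in> V" "t > 0" for t
  proof -
    obtain v where v: "(\<gamma> has_vector_derivative v) (at_left t)" "v \<noteq> 0" "sgn (- v) \<noteq> sgn d"
      using left[of t] tV by (auto simp: V_def)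
    have "((\<lambda>u. sgn ((\<gamma> u - \<gamma> t) /\<^sub>R (t - u))) \<longlongrightarrow> sgn (- v)) (at_left t)"
      by (intro tendsto_sgn left_quotient_tendsto v) (use v in auto)
    moreover have "\<forall>\<^sub>F u in at_left t. sgn ((\<gamma> u - \<gamma> t) /\<^sub>R (t - u)) = sgn (\<gamma> u - p)"
      using that unfolding eventually_at_filter V_def by (intro always_eventually) (auto simp: sgn_scaleR)
    ultimately have "((\<lambda>u. sgn (\<gamma> u - p)) \<longlongrightarrow> sgn (- v)) (at_left t)" by (simp only: filterlim_cong[OF refl refl])
    from aux[OF this v(3)] obtain \<epsilon> where e: "\<epsilon> > 0" "\<forall>\<^sub>F u in at_left t. norm (sgn (\<gamma> u - p) - sgn (- v)) < \<epsilon>"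
       "\<forall>\<^sub>F z in dirf p d. norm (sgn (z - p) - sgn (- v)) \<ge> \<epsilon>" by auto
    obtain b where b: "b < t" "\<And>u. b < u \<Longrightarrow> u < t \<Longrightarrow> norm (sgn (\<gamma> u - p) - sgn (- v)) < \<epsilon>"
      using e(2) unfolding eventually_at_left_field by auto
    have "\<forall>\<^sub>F z in dirf p d. z \<notin> \<gamma> ` {t-(t-b)<..<t}"
      using e(3) by (rule eventually_mono) (use b(2) in \<open>force simp: not_less[symmetric]\<close>)
    then show ?thesis using b(1) by (intro exI[of _ "t - b"]) auto
  qed
  have "\<exists>\<delta>>0. \<forall>\<^sub>F z in dirf p d. z \<notin> \<gamma> ` ({t-\<delta><..<t+\<delta>} \<inter> {0..1})" if tV: "t \<in> V" for t
  proof -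
    obtain \<delta>1 where d1: "\<delta>1 > 0" "\<forall>\<^sub>F z in dirf p d. z \<notin> \<gamma> ` ({t<..<t+\<delta>1} \<inter> {0..1})"
    proof (cases "t < 1")
      case True
      obtain \<delta> where "\<delta> > 0" "\<forall>\<^sub>F z in dirf p d. z \<notin> \<gamma> ` {t<..<t+\<delta>}" using rt[OF tV True] by auto
      then show thesis by (intro that[of \<delta>]) (auto elim!: eventually_mono)
    next
      case False
      then have e: "{t<..<t+1} \<inter> {0..1} = {}" using tV by auto
      show thesis by (rule that[of 1]) (simp_all only: e image_empty empty_iff not_False_eq_True eventually_True zero_less_one)
    qed
    obtain \<delta>2 where d2: "\<delta>2 > 0" "\<forall>\<^sub>F z in dirf p d. z \<notin> \<gamma> ` ({t-\<delta>2<..<t} \<inter> {0..1})"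
    proof (cases "t > 0")
      case True
      obtain \<delta> where "\<delta> > 0" "\<forall>\<^sub>F z in dirf p d. z \<notin> \<gamma> ` {t-\<delta><..<t}" using lt[OF tV True] by auto
      then show thesis by (intro that[of \<delta>]) (auto elim!: eventually_mono)
    next
      case False
      then have e: "{t-1<..<t} \<inter> {0..1} = {}" using tV by auto
      show thesis by (rule that[of 1]) (simp_all only: e image_empty empty_iff not_False_eq_True eventually_True zero_less_one)
    qed
    define \<delta> where "\<delta> = min \<delta>1 \<delta>2"
    have sub: "{t-\<delta><..<t+\<delta>} \<inter> {0..1} \<subseteq> insert t (({t<..<t+\<delta>1} \<inter> {0..1}) \<union> ({t-\<delta>2<..<t} \<inter> {0..1}))"
      unfolding \<delta>_def by auto
    have "\<forall>\<^sub>F z in dirf p d. z \<notin> \<gamma> ` ({t-\<delta><..<t+\<delta>} \<inter> {0..1})"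
      using d1(2) d2(2) neq
    proof eventually_elim
      case (elim z)
      have "\<gamma> t = p" using that by (simp add: V_def)
      then show ?case using elim sub by (force simp del: greaterThanLessThan_iff)
    qed
    then show ?thesis using d1(1) d2(1) by (intro exI[of _ \<delta>]) (auto simp: \<delta>_def)
  qed
  then obtain \<delta> where \<delta>: "\<And>t. t \<in> V \<Longrightarrow> \<delta> t > 0"
      "\<And>t. t \<in> V \<Longrightarrow> \<forall>\<^sub>F z in dirf p d. z \<notin> \<gamma> ` ({t-\<delta> t<..<t+\<delta> t} \<inter> {0..1})" by metis
  define U where "U = (\<Union>t\<in>V. {t-\<delta> t<..<t+\<delta> t})"
  have "open U" unfolding U_def by auto
  have cont: "continuous_on {0..1} \<gamma>" using assms(1) by (simp add: path_def)
  have "compact ({0..1} - U)" using \<open>open U\<close> by (intro compact_diff) auto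
  then have "closed (\<gamma> ` ({0..1} - U))"
    by (intro compact_imp_closed compact_continuous_image continuous_on_subset[OF cont]) auto
  moreover have "p \<notin> \<gamma> ` ({0..1} - U)"
  proof
    assume "p \<in> \<gamma> ` ({0..1} - U)"
    then obtain t where "t \<in> V" "t \<notin> U" by (auto simp: V_def)
    then show False using \<delta>(1)[of t] unfolding U_def by force
  qed
  ultimately have "\<forall>\<^sub>F z in dirf p d. z \<in> - \<gamma> ` ({0..1} - U)"
    by (intro topological_tendstoD[OF tendsto_dirf]) (auto simp: open_Compl)
  moreover have "\<forall>\<^sub>F z in dirf p d. \<forall>t\<in>V. z \<notin> \<gamma> ` ({t-\<delta> t<..<t+\<delta> t} \<inter> {0..1})"
    using \<delta>(2) assms(2) by (intro eventually_ball_finite) (auto simp: V_def)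
  ultimately show ?thesis
  proof eventually_elim
    case (elim z)
    show ?case
    proof
      assume "z \<in> path_image \<gamma>"
      then obtain u where u: "u \<in> {0..1}" "z = \<gamma> u" by (auto simp: path_image_def)
      show False
      proof (cases "u \<in> U")
        case True
        then obtain t where "t \<in> V" "u \<in> {t-\<delta> t<..<t+\<delta> t}" unfolding U_def by auto
        then show False using elim(2) u by blast
      next
        case False
        then show False using elim(1) u by blast
      qed
    qed
  qed
qed

text \<open>\<open>V\<close> lists the velocities of the branches through \<open>p\<close>; crossing such a branch changes the winding
  number by one, and \<open>m\<close> is the mean of the winding numbers in opposite directions at \<open>p\<close>.\<close>

definition has_index :: "(real \<Rightarrow> complex) \<Rightarrow> complex \<Rightarrow> complex list \<Rightarrow> complex \<Rightarrow> bool" where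
  "has_index \<gamma> p V m \<longleftrightarrow> (\<forall>d. (\<forall>v\<in>set V. Im (d / v) \<noteq> 0) \<longrightarrow>
     (\<forall>\<^sub>F z in dirf p d. z \<notin> path_image \<gamma>) \<and>
     (winding_number \<gamma> \<longlongrightarrow> m + (\<Sum>v\<leftarrow>V. of_real (sgn (Im (d / v)))) / 2) (dirf p d))"

lemma has_index_off_path:
  assumes "path \<gamma>" "p \<notin> path_image \<gamma>"
  shows "has_index \<gamma> p [] (winding_number \<gamma> p)"
proof -
  have "open (- path_image \<gamma>)" using assms(1) by (simp add: closed_path_image open_Compl)
  then have "\<forall>\<^sub>F z in dirf p d. z \<in> - path_image \<gamma>" for d
    using assms(2) by (intro topological_tendstoD[OF tendsto_dirf]) auto
  moreover have "(winding_number \<gamma> \<longlongrightarrow> winding_number \<gamma> p) (dirf p d)" for d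
    using continuous_at_winding_number[OF assms] tendsto_dirf
    unfolding isCont_def by (rule isCont_tendsto_compose[unfolded isCont_def])
  ultimately show ?thesis by (simp add: has_index_def)
qed

lemma has_indexD:
  assumes "has_index \<gamma> p V m" "\<And>v. v \<in> set V \<Longrightarrow> Im (d / v) \<noteq> 0"
  shows "\<forall>\<^sub>F z in dirf p d. z \<notin> path_image \<gamma>"
    and "(winding_number \<gamma> \<longlongrightarrow> m + (\<Sum>v\<leftarrow>V. of_real (sgn (Im (d / v)))) / 2) (dirf p d)"
  using assms unfolding has_index_def by auto

lemma has_index_add:
  assumes "has_index \<alpha> p V m" "has_index \<beta> p W n" "path_image \<gamma> \<subseteq> path_image \<alpha> \<union> path_image \<beta>"
    and "\<And>z. z \<notin> path_image \<alpha> \<Longrightarrow> z \<notin> path_image \<beta> \<Longrightarrow>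
      winding_number \<gamma> z = winding_number \<alpha> z + winding_number \<beta> z"
  shows "has_index \<gamma> p (V @ W) (m + n)"
  unfolding has_index_def
proof (intro allI impI)
  fix d assume d: "\<forall>v\<in>set (V @ W). Im (d / v) \<noteq> 0"
  have a: "\<forall>\<^sub>F z in dirf p d. z \<notin> path_image \<alpha>"
    "(winding_number \<alpha> \<longlongrightarrow> m + (\<Sum>v\<leftarrow>V. of_real (sgn (Im (d / v)))) / 2) (dirf p d)"
    using has_indexD[OF assms(1)] d by auto
  have b: "\<forall>\<^sub>F z in dirf p d. z \<notin> path_image \<beta>"
    "(winding_number \<beta> \<longlongrightarrow> n + (\<Sum>v\<leftarrow>W. of_real (sgn (Im (d / v)))) / 2) (dirf p d)"
    using has_indexD[OF assms(2)] d by auto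
  have off: "\<forall>\<^sub>F z in dirf p d. z \<notin> path_image \<alpha> \<and> z \<notin> path_image \<beta>"
    using a(1) b(1) by (rule eventually_conj)
  then have "\<forall>\<^sub>F z in dirf p d. z \<notin> path_image \<gamma>" by (rule eventually_mono) (use assms(3) in auto)
  moreover have "((\<lambda>z. winding_number \<alpha> z + winding_number \<beta> z) \<longlongrightarrow>
     (m + (\<Sum>v\<leftarrow>V. of_real (sgn (Im (d / v)))) / 2) + (n + (\<Sum>v\<leftarrow>W. of_real (sgn (Im (d / v)))) / 2)) (dirf p d)"
    by (intro tendsto_add a b)
  then have "(winding_number \<gamma> \<longlongrightarrow>
     (m + (\<Sum>v\<leftarrow>V. of_real (sgn (Im (d / v)))) / 2) + (n + (\<Sum>v\<leftarrow>W. of_real (sgn (Im (d / v)))) / 2)) (dirf p d)"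
    by (rule Lim_transform_eventually) (rule eventually_mono[OF off], simp add: assms(4))
  ultimately show "(\<forall>\<^sub>F z in dirf p d. z \<notin> path_image \<gamma>) \<and>
     (winding_number \<gamma> \<longlongrightarrow> m + n + (\<Sum>v\<leftarrow>V @ W. of_real (sgn (Im (d / v)))) / 2) (dirf p d)"
    by (simp add: add_divide_distrib algebra_simps)
qed

section \<open>The half-jump of the winding number across a smooth branch\<close>

lemma winding_number_subpath_split:
  assumes "path \<gamma>" "0 \<le> a" "a \<le> b" "b \<le> c" "c \<le> 1" "z \<notin> \<gamma> ` {a..c}"
  shows "winding_number (subpath a c \<gamma>) z = winding_number (subpath a b \<gamma>) z + winding_number (subpath b c \<gamma>) z"
proof -
  \<comment> \<open>Only the part of the curve over \<open>{a..c}\<close> is known to miss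
    \<open>z\<close>. Freezing the curve at its endpoints outside that interval produces a path that
    misses \<open>z\<close> everywhere and has the same subpaths.\<close>
  define g where "g = (\<lambda>t. \<gamma> (max a (min c t)))"
  have cont: "continuous_on {0..1} \<gamma>" using assms(1) by (simp add: path_def)
  have "path g" unfolding path_def g_def
    by (rule continuous_on_compose2[OF cont]) (use assms in \<open>auto intro!: continuous_intros\<close>)
  moreover have "z \<notin> path_image g"
  proof -
    have "max a (min c t) \<in> {a..c}" for t using assms by auto
    then have "path_image g \<subseteq> \<gamma> ` {a..c}" unfolding path_image_def g_def by auto
    then show ?thesis using assms(6) by auto
  qed
  ultimately have "winding_number (subpath a b g) z + winding_number (subpath b c g) z = winding_number (subpath a c g) z"
    using assms by (intro winding_number_subpath_combine) auto
  moreover have "winding_number (subpath u v g) z = winding_number (subpath u v \<gamma>) z" if "a \<le> u" "u \<le> v" "v \<le> c" for u v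
  proof (rule winding_number_cong)
    fix t :: real assume t: "0 \<le> t" "t \<le> 1"
    have "(v - u) * t + u \<ge> u" using t that by simp
    moreover have "(v - u) * t \<le> (v - u) * 1" using t that by (intro mult_left_mono) auto
    ultimately have "max a (min c ((v - u) * t + u)) = (v - u) * t + u" using that by auto
    then show "subpath u v g t = subpath u v \<gamma> t" unfolding subpath_def g_def by simp
  qed
  ultimately show ?thesis using assms by auto
qed

lemma has_index_subpath_split:
  assumes "path \<gamma>" "0 \<le> a" "a \<le> b" "b \<le> c" "c \<le> 1"
    and "has_index (subpath a b \<gamma>) p V m" "has_index (subpath b c \<gamma>) p W n"
  shows "has_index (subpath a c \<gamma>) p (V @ W) (m + n)"
proof -
  have im: "\<gamma> ` {a..c} = path_image (subpath a b \<gamma>) \<union> path_image (subpath b c \<gamma>)"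
  proof -
    have "{a..c} = {a..b} \<union> {b..c}" using assms by auto
    then show ?thesis using assms by (simp add: path_image_subpath image_Un)
  qed
  show ?thesis
  proof (rule has_index_add[OF assms(6,7)])
    show "path_image (subpath a c \<gamma>) \<subseteq> path_image (subpath a b \<gamma>) \<union> path_image (subpath b c \<gamma>)"
      using im assms by (simp add: path_image_subpath)
  qed (use winding_number_subpath_split[OF assms(1-5)] im in auto)
qed

text \<open>A quarter turn in either direction moves the right half-plane without touching the cut
  of \<open>Ln\<close>. One such turn at each end of a branch, in opposite senses, makes up the jump
  of one half.\<close>

lemma Ln_ii_half_plane:
  assumes "Re w > 0"
  shows "Ln (\<i> * w) = Ln w + \<i> * (pi / 2)" "Ln (- (\<i> * w)) = Ln w - \<i> * (pi / 2)"
proof -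
  have "w \<noteq> 0" using assms by auto
  then have b: "\<bar>Im (Ln w)\<bar> < pi / 2" using Re_Ln_pos_lt assms by simp
  have e: "exp (\<i> * (pi / 2)) = \<i>" using cis_pi_half by (simp add: cis_conv_exp)
  show "Ln (\<i> * w) = Ln w + \<i> * (pi / 2)"
    by (rule Ln_unique) (use b e \<open>w \<noteq> 0\<close> in \<open>auto simp: exp_add\<close>)
  show "Ln (- (\<i> * w)) = Ln w - \<i> * (pi / 2)"
  proof (rule Ln_unique)
    show "exp (Ln w - \<i> * (pi / 2)) = - (\<i> * w)"
      unfolding exp_diff e exp_Ln[OF \<open>w \<noteq> 0\<close>] by simp
  qed (use b in auto)
qed

text \<open>A curve that avoids a ray from \<open>\<zeta>\<close> has a continuous logarithm
  relative to \<open>\<zeta>\<close>. The factor \<open>c\<close> rotates the avoided ray onto the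
  cut of \<open>Ln\<close>.\<close>

lemma winding_number_slit:
  assumes "path \<gamma>" "c \<noteq> 0" and slit: "\<And>u. u \<in> {0..1} \<Longrightarrow> c * (\<gamma> u - \<zeta>) \<notin> \<real>\<^sub>\<le>\<^sub>0"
  shows "winding_number \<gamma> \<zeta> = (Ln (c * (\<gamma> 1 - \<zeta>)) - Ln (c * (\<gamma> 0 - \<zeta>))) / (2 * of_real pi * \<i>)"
proof -
  define q where "q = (\<lambda>u. Ln (c * (\<gamma> u - \<zeta>)) - Ln c)"
  have cont: "continuous_on {0..1} \<gamma>" using assms(1) by (simp add: path_def)
  have "path q" unfolding path_def q_def
    by (intro continuous_intros continuous_on_Ln' cont) (use slit in auto)
  have "winding_number \<gamma> \<zeta> = winding_number (\<lambda>u. \<gamma> u - \<zeta>) 0" by (rule winding_number_offset)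
  also have "\<dots> = winding_number (exp \<circ> q) 0"
  proof (rule winding_number_cong)
    fix t :: real assume "0 \<le> t" "t \<le> 1"
    then have "c * (\<gamma> t - \<zeta>) \<noteq> 0" using slit[of t] by auto
    then show "\<gamma> t - \<zeta> = (exp \<circ> q) t" using assms(2) by (simp add: q_def exp_diff)
  qed
  also have "\<dots> = (pathfinish q - pathstart q) / (2 * of_real pi * \<i>)"
    by (rule winding_number_compose_exp[OF \<open>path q\<close>])
  finally show ?thesis by (simp add: q_def pathfinish_def pathstart_def)
qed

text \<open>Seen from a point \<open>\<zeta>\<close> close to \<open>p\<close> in a transverse direction \<open>d\<close>, the branch through \<open>p\<close>
  stays off the ray \<open>\<zeta> + \<real>\<^sub>\<ge>\<^sub>0 s i v\<close>, \<open>s = sgn (Im (d / v))\<close>, so that its winding number is the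
  difference of the values of one branch of the logarithm at its endpoints.\<close>

lemma has_index_branch:
  fixes \<gamma> :: "real \<Rightarrow> complex"
  assumes \<gamma>: "path \<gamma>" "0 \<le> a" "a < t0" "t0 < b" "b \<le> 1"
    and der: "(\<gamma> has_vector_derivative v) (at t0)" "v \<noteq> 0" "\<gamma> t0 = p"
    and win: "\<And>t. t \<in> {a..b} \<Longrightarrow> norm ((\<gamma> t - p) / v - of_real (t - t0)) \<le> \<bar>t - t0\<bar> / 2"
  shows "\<exists>m. has_index (subpath a b \<gamma>) p [v] m"
proof -
  define Z where "Z t = (\<gamma> t - p) / v" for t
  \<comment> \<open>What is left of the difference of logarithms once the quarter turns at the two
    ends are split off. It does not depend on the direction \<open>d\<close>, hence serves as the
    mean for both sides.\<close>
  define K where "K = (Ln (Z b) - Ln (- Z a)) / (2 * of_real pi * \<i>)"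
  have Zwin: "norm (Z t - of_real (t - t0)) \<le> \<bar>t - t0\<bar> / 2" if "t \<in> {a..b}" for t
    using win[OF that] by (simp add: Z_def)
  have ReZ: "\<bar>Re (Z t) - (t - t0)\<bar> \<le> \<bar>t - t0\<bar> / 2" if "t \<in> {a..b}" for t
    using order_trans[OF abs_Re_le_cmod Zwin[OF that]] by simp
  have ends: "Re (Z b) > 0" "Re (Z a) < 0" using ReZ[of a] ReZ[of b] \<gamma> by (auto simp: abs_if split: if_splits)
  have small: "\<exists>\<delta>>0. \<forall>t. \<bar>t - t0\<bar> < \<delta> \<longrightarrow> norm (Z t - of_real (t - t0)) \<le> \<eta> * \<bar>t - t0\<bar>" if "\<eta> > 0" for \<eta>
  proof -
    have "\<eta> * norm v > 0" using that der(2) by simp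
    then obtain \<delta> where d: "\<delta> > 0" "\<And>t. norm (t - t0) < \<delta> \<Longrightarrow> norm (\<gamma> t - \<gamma> t0 - (t - t0) *\<^sub>R v) \<le> \<eta> * norm v * norm (t - t0)"
      using der(1) unfolding has_vector_derivative_def has_derivative_at_alt by metis
    have "norm (Z t - of_real (t - t0)) \<le> \<eta> * \<bar>t - t0\<bar>" if "\<bar>t - t0\<bar> < \<delta>" for t
    proof -
      have "Z t - of_real (t - t0) = (\<gamma> t - \<gamma> t0 - (t - t0) *\<^sub>R v) / v"
        using der(2,3) by (simp add: Z_def scaleR_conv_of_real field_simps)
      then have "norm (Z t - of_real (t - t0)) = norm (\<gamma> t - \<gamma> t0 - (t - t0) *\<^sub>R v) / norm v"
        by (simp only: norm_divide)
      also have "\<dots> \<le> \<eta> * norm v * \<bar>t - t0\<bar> / norm v"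
        using d(2)[of t] that by (intro divide_right_mono) auto
      finally show ?thesis using der(2) by simp
    qed
    then show ?thesis using d(1) by auto
  qed
  have "has_index (subpath a b \<gamma>) p [v] K"
    unfolding has_index_def
  proof (intro allI impI)
    fix d assume "\<forall>w\<in>set [v]. Im (d / w) \<noteq> 0"
    then have Imc: "Im (d / v) \<noteq> 0" by simp
    define c where "c = d / v"
    define s where "s = sgn (Im c)"
    have s: "s = 1 \<or> s = -1" "s * Im c = \<bar>Im c\<bar>" "\<bar>Im c\<bar> > 0" using Imc by (auto simp: s_def c_def sgn_if)
    define M where "M = norm c + 1"
    have "M > 0" by (simp add: M_def add_nonneg_pos)
    \<comment> \<open>In the coordinate \<open>Z\<close> the tangent is the real axis. For
      \<open>\<bar>t - t0\<bar> \<le> 2 * r * M\<close> the deviation of the curve from it is then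
      at most \<open>r * \<bar>Im c\<bar> / 4\<close>, half of the least height
      \<open>r * \<bar>Im c\<bar> / 2\<close> of the viewpoint over the axis.\<close>
    define \<eta> where "\<eta> = \<bar>Im c\<bar> / (8 * M)"
    have "\<eta> > 0" using s \<open>M > 0\<close> by (simp add: \<eta>_def)
    then obtain \<delta> where \<delta>: "\<delta> > 0" "\<And>t. \<bar>t - t0\<bar> < \<delta> \<Longrightarrow> norm (Z t - of_real (t - t0)) \<le> \<eta> * \<bar>t - t0\<bar>"
      using small by metis
    \<comment> \<open>The bound 1 keeps the real part of \<open>e / v\<close> below
      \<open>M\<close>; the other bound keeps its imaginary part, with sign \<open>s\<close>, above
      \<open>\<bar>Im c\<bar> / 2\<close>.\<close>
    define slope where "slope = min 1 (\<bar>Im c\<bar> / 2)"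
    have "slope > 0" using s by (simp add: slope_def)
    \<comment> \<open>A point of the branch on the slit would have real part
      \<open>r * Re w\<close>, which forces \<open>t\<close> to lie so close to \<open>t0\<close>
      that the branch cannot rise to the height at which the slit begins.\<close>
    have slit: "(\<i> * of_real s / v) * (\<gamma> t - (p + r *\<^sub>R e)) \<notin> \<real>\<^sub>\<le>\<^sub>0"
      if t: "t \<in> {a..b}" and r: "0 < r" "r < \<delta> / (2 * M)" and e: "norm (e / v - c) < slope" for t r e
    proof
      define w where "w = e / v"
      define x where "x = \<bar>t - t0\<bar>"
      assume "(\<i> * of_real s / v) * (\<gamma> t - (p + r *\<^sub>R e)) \<in> \<real>\<^sub>\<le>\<^sub>0"
      moreover have "(\<i> * of_real s / v) * (\<gamma> t - (p + r *\<^sub>R e)) = \<i> * of_real s * (Z t - of_real r * w)"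
        using der(2) by (simp add: Z_def w_def scaleR_conv_of_real field_simps)
      ultimately have "\<i> * of_real s * (Z t - of_real r * w) \<in> \<real>\<^sub>\<le>\<^sub>0" by simp
      then have "s * (Re (Z t) - r * Re w) = 0" "- (s * (Im (Z t) - r * Im w)) \<le> 0"
        by (auto simp: complex_nonpos_Reals_iff)
      then have eq: "Re (Z t) = r * Re w" and le: "s * Im (Z t) \<ge> r * (s * Im w)" using s(1) by (auto simp: algebra_simps)
      have "\<bar>Im w - Im c\<bar> < slope" "\<bar>Re w - Re c\<bar> < slope"
        using e abs_Im_le_cmod[of "w - c"] abs_Re_le_cmod[of "w - c"] unfolding w_def by auto
      then have "s * Im w \<ge> \<bar>Im c\<bar> / 2" "\<bar>Re w\<bar> \<le> M"
        using s(1,2) abs_Re_le_cmod[of c] unfolding slope_def M_def by (auto simp: abs_if split: if_splits)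
      have "x / 2 \<le> \<bar>Re (Z t)\<bar>" using ReZ[OF t] unfolding x_def by (auto simp: abs_if split: if_splits)
      also have "\<dots> = r * \<bar>Re w\<bar>" using eq r by (simp add: abs_mult)
      also have "\<dots> \<le> r * M" using r \<open>\<bar>Re w\<bar> \<le> M\<close> by (intro mult_left_mono) auto
      finally have x: "x \<le> 2 * r * M" by simp
      also have "\<dots> < \<delta>" using r \<open>M > 0\<close> by (simp add: field_simps)
      finally have "norm (Z t - of_real (t - t0)) \<le> \<eta> * x" using \<delta>(2)[of t] unfolding x_def by simp
      then have "\<bar>Im (Z t)\<bar> \<le> \<eta> * x" using abs_Im_le_cmod[of "Z t - of_real (t - t0)"] by simp
      also have "\<dots> \<le> \<eta> * (2 * r * M)" using x \<open>\<eta> > 0\<close> by (intro mult_left_mono) auto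
      also have "\<dots> = r * (\<bar>Im c\<bar> / 4)" using \<open>M > 0\<close> by (simp add: \<eta>_def field_simps)
      also have "\<dots> < r * (\<bar>Im c\<bar> / 2)" using r s(3) by simp
      also have "\<dots> \<le> r * (s * Im w)" using r \<open>s * Im w \<ge> \<bar>Im c\<bar> / 2\<close> by (intro mult_left_mono) auto
      finally have "\<bar>Im (Z t)\<bar> < r * (s * Im w)" .
      moreover have "s * Im (Z t) \<le> \<bar>Im (Z t)\<bar>" using s(1) by (auto simp: abs_if)
      ultimately show False using le by linarith
    qed
    have ev: "\<forall>\<^sub>F z in dirf p d. \<forall>t\<in>{a..b}. (\<i> * of_real s / v) * (\<gamma> t - z) \<notin> \<real>\<^sub>\<le>\<^sub>0"
    proof -
      have "\<delta> / (2 * M) > 0" using \<delta>(1) \<open>M > 0\<close> by simp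
      then have "\<forall>\<^sub>F r in at_right (0::real). r \<in> {0<..<\<delta> / (2 * M)}" by (rule eventually_at_right_real)
      moreover have "((\<lambda>e. e / v) \<longlongrightarrow> d / v) (nhds d)" using der(2) by (intro tendsto_intros) (auto intro: filterlim_ident)
      then have "\<forall>\<^sub>F e in nhds d. norm (e / v - c) < slope"
        using \<open>slope > 0\<close> unfolding c_def by (auto dest!: tendstoD simp: dist_norm)
      ultimately show ?thesis
        unfolding dirf_def eventually_filtermap eventually_prod_filter
        by (intro exI[of _ "\<lambda>r. r \<in> {0<..<\<delta> / (2 * M)}"] exI[of _ "\<lambda>e. norm (e / v - c) < slope"])
          (use slit in simp)
    qed
    have lin: "(b - a) * u + a \<in> {a..b}" if "u \<in> {0..1}" for u
    proof -
      have "(b - a) * u \<le> (b - a) * 1" using that \<gamma> by (intro mult_left_mono) auto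
      then have "(b - a) * u + a \<le> b" by simp
      moreover have "0 \<le> (b - a) * u" using that \<gamma> by simp
      ultimately show ?thesis by simp
    qed
    have off: "\<forall>\<^sub>F z in dirf p d. z \<notin> path_image (subpath a b \<gamma>)"
      using ev by (rule eventually_mono) (use \<gamma> in \<open>force simp: path_image_subpath\<close>)
    let ?F = "\<lambda>z. (Ln ((\<i> * of_real s / v) * (\<gamma> b - z)) - Ln ((\<i> * of_real s / v) * (\<gamma> a - z))) / (2 * of_real pi * \<i>)"
    have psub: "path (subpath a b \<gamma>)" using \<gamma> by (intro path_subpath) auto
    have wn: "\<forall>\<^sub>F z in dirf p d. ?F z = winding_number (subpath a b \<gamma>) z"
      using ev
    proof (rule eventually_mono)
      fix z assume z: "\<forall>t\<in>{a..b}. (\<i> * of_real s / v) * (\<gamma> t - z) \<notin> \<real>\<^sub>\<le>\<^sub>0"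
      have "winding_number (subpath a b \<gamma>) z = (Ln ((\<i> * of_real s / v) * (subpath a b \<gamma> 1 - z))
          - Ln ((\<i> * of_real s / v) * (subpath a b \<gamma> 0 - z))) / (2 * of_real pi * \<i>)"
      proof (rule winding_number_slit[OF psub])
        show "\<i> * of_real s / v \<noteq> 0" using s(1) der(2) by auto
        show "\<i> * of_real s / v * (subpath a b \<gamma> u - z) \<notin> \<real>\<^sub>\<le>\<^sub>0" if "u \<in> {0..1}" for u
          using z lin[OF that] unfolding subpath_def by blast
      qed
      then show "?F z = winding_number (subpath a b \<gamma>) z" by (simp add: subpath_def)
    qed
    have nonp: "(\<i> * of_real s / v) * (\<gamma> b - p) \<notin> \<real>\<^sub>\<le>\<^sub>0" "(\<i> * of_real s / v) * (\<gamma> a - p) \<notin> \<real>\<^sub>\<le>\<^sub>0"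
    proof -
      have "(\<i> * of_real s / v) * (\<gamma> t - p) = \<i> * of_real s * Z t" for t by (simp add: Z_def)
      then show "(\<i> * of_real s / v) * (\<gamma> b - p) \<notin> \<real>\<^sub>\<le>\<^sub>0" "(\<i> * of_real s / v) * (\<gamma> a - p) \<notin> \<real>\<^sub>\<le>\<^sub>0"
        using ends s(1) by (auto simp: complex_nonpos_Reals_iff)
    qed
    have "(?F \<longlongrightarrow> ?F p) (dirf p d)"
      by (intro tendsto_intros tendsto_dirf nonp) auto
    then have lim: "(winding_number (subpath a b \<gamma>) \<longlongrightarrow> ?F p) (dirf p d)"
      by (rule Lim_transform_eventually) (rule wn)
    have Fp: "?F p = K + of_real s / 2"
    proof -
      have eqs: "(\<i> * of_real s / v) * (\<gamma> b - p) = of_real s * (\<i> * Z b)"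
           "(\<i> * of_real s / v) * (\<gamma> a - p) = - (of_real s * (\<i> * (- Z a)))" by (simp_all add: Z_def)
      have Lnb: "Ln (of_real s * (\<i> * Z b)) = Ln (Z b) + of_real s * (\<i> * (pi / 2))"
        using s(1) Ln_ii_half_plane[OF ends(1)] by auto
      have "Re (- Z a) > 0" using ends by simp
      note La = Ln_ii_half_plane[OF this]
      have Lna: "Ln (- (of_real s * (\<i> * (- Z a)))) = Ln (- Z a) - of_real s * (\<i> * (pi / 2))"
        using s(1) La by auto
      show ?thesis unfolding eqs Lna Lnb K_def by (simp add: field_simps)
    qed
    show "(\<forall>\<^sub>F z in dirf p d. z \<notin> path_image (subpath a b \<gamma>)) \<and>
      (winding_number (subpath a b \<gamma>) \<longlongrightarrow> K + (\<Sum>v\<leftarrow>[v]. of_real (sgn (Im (d / v)))) / 2) (dirf p d)"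
      using off lim unfolding Fp by (simp add: s_def c_def)
  qed
  then show ?thesis by blast
qed

text \<open>Induction over the visits of \<open>p\<close>. Around the first visit a window is cut
  out in which the curve follows its tangent and \<open>has_index_branch\<close> applies; before the
  window the curve misses \<open>p\<close>, after it there is one visit fewer. The sorted list keeps
  the velocities in the order of time.\<close>

lemma has_index_exists_subpath:
  fixes \<gamma> :: "real \<Rightarrow> complex"
  assumes "path \<gamma>" "0 \<le> a" "a \<le> c" "c \<le> 1"
    and "finite {t\<in>{a..c}. \<gamma> t = p}" "\<gamma> a \<noteq> p" "\<gamma> c \<noteq> p"
    and "\<And>t. t \<in> {a..c} \<Longrightarrow> \<gamma> t = p \<Longrightarrow> (\<gamma> has_vector_derivative v t) (at t) \<and> v t \<noteq> 0"
  shows "\<exists>m. has_index (subpath a c \<gamma>) p (map v (sorted_list_of_set {t\<in>{a..c}. \<gamma> t = p})) m"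
  using assms
proof (induction "card {t\<in>{a..c}. \<gamma> t = p}" arbitrary: a rule: less_induct)
  case less
  define F where "F = {t\<in>{a..c}. \<gamma> t = p}"
  show ?case
  proof (cases "F = {}")
    case True
    have "p \<notin> path_image (subpath a c \<gamma>)" using True less.prems by (auto simp: path_image_subpath F_def)
    then have "has_index (subpath a c \<gamma>) p [] (winding_number (subpath a c \<gamma>) p)"
      using less.prems by (intro has_index_off_path path_subpath) auto
    then show ?thesis using True unfolding F_def[symmetric] by auto
  next
    case False
    have finF: "finite F" using less.prems by (simp add: F_def)
    define t0 where "t0 = Min F"
    have t0: "t0 \<in> F" using False finF by (simp add: t0_def)
    have t0min: "t0 \<le> t" if "t \<in> F" for t using that finF by (simp add: t0_def)
    have t0': "a < t0" "t0 < c" "\<gamma> t0 = p" using t0 less.prems(6,7) by (auto simp: F_def less_le)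
    have der: "(\<gamma> has_vector_derivative v t0) (at t0)" "v t0 \<noteq> 0" using less.prems(8) t0 by (auto simp: F_def)
    have "norm (v t0) / 2 > 0" using der(2) by simp
    then obtain \<delta> where d: "\<delta> > 0" "\<And>t. norm (t - t0) < \<delta> \<Longrightarrow>
        norm (\<gamma> t - \<gamma> t0 - (t - t0) *\<^sub>R v t0) \<le> norm (v t0) / 2 * norm (t - t0)"
      using der(1) unfolding has_vector_derivative_def has_derivative_at_alt by metis
    have win: "norm ((\<gamma> t - p) / v t0 - of_real (t - t0)) \<le> \<bar>t - t0\<bar> / 2" if "\<bar>t - t0\<bar> < \<delta>" for t
    proof -
      have "(\<gamma> t - p) / v t0 - of_real (t - t0) = (\<gamma> t - \<gamma> t0 - (t - t0) *\<^sub>R v t0) / v t0"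
        using der(2) t0'(3) by (simp add: scaleR_conv_of_real field_simps)
      then have "norm ((\<gamma> t - p) / v t0 - of_real (t - t0)) = norm (\<gamma> t - \<gamma> t0 - (t - t0) *\<^sub>R v t0) / norm (v t0)"
        by (simp only: norm_divide)
      also have "\<dots> \<le> norm (v t0) / 2 * \<bar>t - t0\<bar> / norm (v t0)"
        using d(2)[of t] that by (intro divide_right_mono) auto
      finally show ?thesis using der(2) by simp
    qed
    define a' where "a' = max a (t0 - \<delta> / 2)"
    define b' where "b' = min c (t0 + \<delta> / 2)"
    have ab: "a \<le> a'" "a' < t0" "t0 < b'" "b' \<le> c" using t0' d(1) by (auto simp: a'_def b'_def)
    have inwin: "\<bar>t - t0\<bar> < \<delta>" if "t \<in> {a'..b'}" for t
      using that d(1) unfolding a'_def b'_def by (auto simp: abs_if max_def min_def split: if_splits)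
    \<comment> \<open>In the window the curve departs from \<open>p\<close> at no less than half the
      speed of the tangent, so it does not return to \<open>p\<close> there.\<close>
    have noF: "t \<notin> F" if "t \<in> {a'..b'}" "t \<noteq> t0" for t
    proof
      assume "t \<in> F"
      then have "norm (of_real (t - t0) :: complex) \<le> \<bar>t - t0\<bar> / 2"
        using win[OF inwin[OF that(1)]] by (simp add: F_def norm_minus_commute flip: of_real_diff)
      then have "\<bar>t - t0\<bar> \<le> \<bar>t - t0\<bar> / 2" by (simp only: norm_of_real)
      moreover have "\<not> x \<le> x / 2" if "x > 0" for x :: real using that by simp
      moreover have "\<bar>t - t0\<bar> > 0" using that(2) by simp
      ultimately show False by blast
    qed
    have "b' \<notin> F" "a' \<notin> F" using noF ab by auto
    then have pb: "\<gamma> b' \<noteq> p" using ab less.prems by (auto simp: F_def)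
    obtain m2 where m2: "has_index (subpath a' b' \<gamma>) p [v t0] m2"
    proof -
      have "\<exists>m. has_index (subpath a' b' \<gamma>) p [v t0] m"
        by (rule has_index_branch[of \<gamma> a' t0 b']) (use less.prems ab der t0' win inwin in auto)
      then show thesis using that by blast
    qed
    have m1: "has_index (subpath a a' \<gamma>) p [] (winding_number (subpath a a' \<gamma>) p)"
    proof (rule has_index_off_path)
      show "path (subpath a a' \<gamma>)" using less.prems ab by (intro path_subpath) auto
      show "p \<notin> path_image (subpath a a' \<gamma>)"
        using t0min ab less.prems(3) by (fastforce simp: path_image_subpath F_def)
    qed
    define F' where "F' = {t\<in>{b'..c}. \<gamma> t = p}"
    have FF: "F = insert t0 F'" "t0 \<notin> F'" "F' \<subseteq> F"
    proof -
      have "t = t0 \<or> t \<in> F'" if "t \<in> F" for t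
        using t0min[OF that] noF[of t] ab that by (fastforce simp: F_def F'_def)
      then show "F = insert t0 F'" using t0 ab by (auto simp: F_def F'_def)
      show "t0 \<notin> F'" "F' \<subseteq> F" using ab by (auto simp: F_def F'_def)
    qed
    have "\<exists>m. has_index (subpath b' c \<gamma>) p (map v (sorted_list_of_set F')) m"
      unfolding F'_def
    proof (rule less.hyps)
      have "F' \<subset> F" using FF by auto
      then have "card F' < card F" using finF by (intro psubset_card_mono)
      then show "card {t\<in>{b'..c}. \<gamma> t = p} < card {t\<in>{a..c}. \<gamma> t = p}" unfolding F_def F'_def .
      show "finite {t\<in>{b'..c}. \<gamma> t = p}" using FF(3) finF finite_subset unfolding F'_def by blast
    qed (use less.prems ab t0' pb in auto)
    then obtain m3 where m3: "has_index (subpath b' c \<gamma>) p (map v (sorted_list_of_set F')) m3" by blast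
    have "has_index (subpath a b' \<gamma>) p ([] @ [v t0]) (winding_number (subpath a a' \<gamma>) p + m2)"
      by (rule has_index_subpath_split[OF less.prems(1) _ _ _ _ m1 m2]) (use less.prems ab in auto)
    from has_index_subpath_split[OF less.prems(1) _ _ _ _ this m3]
    have "has_index (subpath a c \<gamma>) p ([v t0] @ map v (sorted_list_of_set F')) (winding_number (subpath a a' \<gamma>) p + m2 + m3)"
      using less.prems ab by auto
    moreover have "sorted_list_of_set F = t0 # sorted_list_of_set F'"
    proof -
      have "finite F'" using FF(3) finF finite_subset by blast
      have "sorted_list_of_set F = sorted_list_of_set (insert t0 F')" using FF(1) by simp
      also have "\<dots> = insort t0 (sorted_list_of_set F')"
        using FF(2) \<open>finite F'\<close> by (simp add: sorted_list_of_set.fold_insort_key.insert)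
      also have "\<dots> = t0 # sorted_list_of_set F'"
        using t0min FF \<open>finite F'\<close> by (intro insort_is_Cons) auto
      finally show ?thesis .
    qed
    ultimately have "has_index (subpath a c \<gamma>) p (map v (sorted_list_of_set F)) (winding_number (subpath a a' \<gamma>) p + m2 + m3)"
      by simp
    then show ?thesis unfolding F_def[symmetric] by (rule exI)
  qed
qed

lemma has_index_exists:
  fixes \<gamma> :: "real \<Rightarrow> complex"
  assumes "path \<gamma>" "finite {t\<in>{0..1}. \<gamma> t = p}" "\<gamma> 0 \<noteq> p" "\<gamma> 1 \<noteq> p"
    and "\<And>t. t \<in> {0..1} \<Longrightarrow> \<gamma> t = p \<Longrightarrow> (\<gamma> has_vector_derivative v t) (at t) \<and> v t \<noteq> 0"
  shows "\<exists>m. has_index \<gamma> p (map v (sorted_list_of_set {t\<in>{0..1}. \<gamma> t = p})) m"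
proof -
  have "\<exists>m. has_index (subpath 0 1 \<gamma>) p (map v (sorted_list_of_set {t\<in>{0..1}. \<gamma> t = p})) m"
    by (rule has_index_exists_subpath) (use assms in auto)
  then show ?thesis by (simp only: subpath_trivial)
qed

section \<open>Integer winding numbers of closed curves near a point\<close>

definition wind :: "(real \<Rightarrow> complex) \<Rightarrow> complex \<Rightarrow> real" where
  "wind \<gamma> z = Re (winding_number \<gamma> z)"

lemma winding_number_eq_wind:
  assumes "path \<gamma>" "\<gamma> 1 = \<gamma> 0" "z \<notin> path_image \<gamma>"
  shows "winding_number \<gamma> z = of_real (wind \<gamma> z)" and "wind \<gamma> z \<in> \<int>"
proof -
  have "winding_number \<gamma> z \<in> \<int>"
    using integer_winding_number[of \<gamma> z] assms by (simp add: pathstart_def pathfinish_def)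
  then obtain k where "winding_number \<gamma> z = of_int k" by (auto elim: Ints_cases)
  then show "winding_number \<gamma> z = of_real (wind \<gamma> z)" and "wind \<gamma> z \<in> \<int>" by (auto simp: wind_def)
qed

lemma loc_const_wind:
  assumes "path \<gamma>" "\<gamma> 1 = \<gamma> 0"
  shows "loc_const (\<lambda>z. h (wind \<gamma> z)) (path_image \<gamma>)"
  unfolding loc_const_def
proof (intro allI impI)
  fix a b assume "connected_component (- path_image \<gamma>) a b"
  then obtain S where S: "connected S" "S \<subseteq> - path_image \<gamma>" "a \<in> S" "b \<in> S"
    unfolding connected_component_def by blast
  then have "winding_number \<gamma> a = winding_number \<gamma> b"
    using assms by (intro winding_number_eq[where S = S]) (auto simp: pathstart_def pathfinish_def)
  then show "h (wind \<gamma> a) = h (wind \<gamma> b)" by (simp add: wind_def)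
qed

text \<open>For a closed curve the limit in \<open>has_index\<close> is attained, because winding
  numbers are integers. The eventual equation can be evaluated along any curve that approaches
  \<open>p\<close> in direction \<open>d\<close>.\<close>

definition cindex :: "(real \<Rightarrow> complex) \<Rightarrow> complex \<Rightarrow> complex list \<Rightarrow> real \<Rightarrow> bool" where
  "cindex \<gamma> p V m \<longleftrightarrow> (\<forall>d. (\<forall>v\<in>set V. Im (d / v) \<noteq> 0) \<longrightarrow>
     (\<forall>\<^sub>F z in dirf p d. z \<notin> path_image \<gamma> \<and> wind \<gamma> z = m + (\<Sum>v\<leftarrow>V. sgn (Im (d / v))) / 2))"

lemma cindexD:
  assumes "cindex \<gamma> p V m" "\<And>v. v \<in> set V \<Longrightarrow> Im (d / v) \<noteq> 0"
  shows "\<forall>\<^sub>F z in dirf p d. z \<notin> path_image \<gamma> \<and> wind \<gamma> z = m + (\<Sum>v\<leftarrow>V. sgn (Im (d / v))) / 2"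
  using assms unfolding cindex_def by auto

lemma has_index_imp_cindex:
  assumes "path \<gamma>" "\<gamma> 1 = \<gamma> 0" "has_index \<gamma> p V m"
  shows "cindex \<gamma> p V (Re m)"
  unfolding cindex_def
proof (intro allI impI)
  fix d assume d: "\<forall>v\<in>set V. Im (d / v) \<noteq> 0"
  let ?L = "m + (\<Sum>v\<leftarrow>V. of_real (sgn (Im (d / v)))) / 2"
  have off: "\<forall>\<^sub>F z in dirf p d. z \<notin> path_image \<gamma>" and lim: "(winding_number \<gamma> \<longlongrightarrow> ?L) (dirf p d)"
    using has_indexD[OF assms(3)] d by auto
  have int: "\<forall>\<^sub>F z in dirf p d. winding_number \<gamma> z \<in> \<int>"
    using off by (rule eventually_mono)
      (use assms in \<open>auto intro!: integer_winding_number simp: pathstart_def pathfinish_def\<close>)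
  \<comment> \<open>The integers form a closed set, so the limit is an integer too, and integers at
    distance less than 1 coincide.\<close>
  have L: "?L \<in> \<int>" by (rule Lim_in_closed_set[OF closed_Ints int _ lim]) simp
  have "\<forall>\<^sub>F z in dirf p d. dist (winding_number \<gamma> z) ?L < 1" using lim by (rule tendstoD) simp
  with off int show "\<forall>\<^sub>F z in dirf p d. z \<notin> path_image \<gamma> \<and> wind \<gamma> z = Re m + (\<Sum>v\<leftarrow>V. sgn (Im (d / v))) / 2"
  proof eventually_elim
    case (elim z)
    have "winding_number \<gamma> z - ?L \<in> \<int>" using elim(2) L by (rule Ints_diff)
    then obtain k where k: "winding_number \<gamma> z - ?L = of_int k" by (auto elim: Ints_cases)
    then have "norm (of_int k :: complex) < 1" using elim(3) unfolding dist_norm by metis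
    then have "k = 0" unfolding norm_of_int by linarith
    then have "winding_number \<gamma> z = ?L" using k by (simp only: of_int_0 right_minus_eq)
    then have "wind \<gamma> z = Re ?L" by (simp only: wind_def)
    also have "\<dots> = Re m + (\<Sum>v\<leftarrow>V. sgn (Im (d / v))) / 2"
    proof -
      have "(\<Sum>v\<leftarrow>V. of_real (sgn (Im (d / v)))) = (of_real (\<Sum>v\<leftarrow>V. sgn (Im (d / v))) :: complex)"
        by (induction V) auto
      then show ?thesis by simp
    qed
    finally show ?case using elim(1) by simp
  qed
qed

lemma cindex_Nil_eq:
  assumes "path \<gamma>" "\<gamma> 1 = \<gamma> 0" "p \<notin> path_image \<gamma>"
  shows "cindex \<gamma> p [] (wind \<gamma> p)"
  using has_index_imp_cindex[OF assms(1,2) has_index_off_path[OF assms(1,3)]] by (simp add: wind_def)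

lemma Im_divide_scale:
  fixes c c' :: real
  shows "Im ((c *\<^sub>R d) / (c' *\<^sub>R v)) = c / c' * Im (d / v)"
proof -
  have "(c *\<^sub>R d) / (c' *\<^sub>R v) = (c / c') *\<^sub>R (d / v)" by (simp add: scaleR_conv_of_real)
  then show ?thesis by simp
qed

text \<open>Velocities enter only through the signs of \<open>Im (d / v)\<close>, so positive
  factors, as they arise from reparametrised pieces of a curve, change nothing.\<close>

lemma cindex_scale2:
  assumes "cindex \<gamma> p [v, w] m" "c > 0" "c' > 0"
  shows "cindex \<gamma> p [c *\<^sub>R v, c' *\<^sub>R w] m"
proof -
  have "Im (d / (k *\<^sub>R u)) = Im (d / u) / k" for d k u
    using Im_divide_scale[of 1 d k u] by simp
  then show ?thesis using assms unfolding cindex_def by (simp add: sgn_divide)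
qed

text \<open>The curve misses a truncated cone around \<open>d\<close>, and this cone is connected;
  every direction close to \<open>d\<close> has a smaller cone inside it.\<close>

lemma dirf_const:
  assumes "path \<gamma>" "\<gamma> 1 = \<gamma> 0" "\<forall>\<^sub>F z in dirf p d. z \<notin> path_image \<gamma>"
  shows "\<exists>k. \<exists>U. open U \<and> d \<in> U \<and> (\<forall>e\<in>U. \<forall>\<^sub>F z in dirf p e. z \<notin> path_image \<gamma> \<and> wind \<gamma> z = k)"
proof -
  obtain \<epsilon> where \<epsilon>: "\<epsilon> > 0" "\<And>r e. r \<in> {0<..<\<epsilon>} \<Longrightarrow> e \<in> ball d \<epsilon> \<Longrightarrow> p + r *\<^sub>R e \<notin> path_image \<gamma>"
    using assms(3) unfolding eventually_dirf_iff by auto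
  define S where "S = (\<lambda>(r, e). p + r *\<^sub>R e) ` ({0<..<\<epsilon>} \<times> ball d \<epsilon>)"
  have "connected S" unfolding S_def case_prod_beta
    by (intro connected_continuous_image connected_Times continuous_intros) auto
  have sub: "S \<subseteq> - path_image \<gamma>" unfolding S_def using \<epsilon>(2) by auto
  define k where "k = wind \<gamma> (p + (\<epsilon>/2) *\<^sub>R d)"
  have k: "wind \<gamma> z = k" if "z \<in> S" for z
  proof -
    have "p + (\<epsilon>/2) *\<^sub>R d \<in> S" using \<epsilon>(1) unfolding S_def by (intro rev_image_eqI[of "(\<epsilon>/2, d)"]) auto
    then show ?thesis
      unfolding k_def by (rule loc_constD[OF loc_const_wind[OF assms(1,2), of "\<lambda>x. x"] \<open>connected S\<close> sub that])
  qed
  have "\<forall>\<^sub>F z in dirf p e. z \<notin> path_image \<gamma> \<and> wind \<gamma> z = k" if e: "e \<in> ball d \<epsilon>" for e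
  proof -
    have "\<epsilon> - dist d e > 0" using e by simp
    moreover have "p + r *\<^sub>R e' \<in> S" if "r \<in> {0<..<\<epsilon> - dist d e}" "e' \<in> ball e (\<epsilon> - dist d e)" for r e'
    proof -
      have "dist d e' < \<epsilon>" using that(2) dist_triangle[of d e' e] by simp
      moreover have "r \<in> {0<..<\<epsilon>}" using that(1) zero_le_dist[of d e] unfolding greaterThanLessThan_iff by linarith
      ultimately show ?thesis unfolding S_def by (intro rev_image_eqI[of "(r, e')"]) auto
    qed
    ultimately show ?thesis unfolding eventually_dirf_iff
      using k sub by (intro exI[of _ "\<epsilon> - dist d e"]) blast
  qed
  then show ?thesis using \<epsilon>(1) by (intro exI[of _ k] exI[of _ "ball d \<epsilon>"]) auto
qed

text \<open>A direction matters only up to a positive factor: the factor is moved into the radius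
  \<open>r\<close>.\<close>

lemma eventually_dirf_scale:
  assumes "\<forall>\<^sub>F z in dirf p d. P z" "c > 0"
  shows "\<forall>\<^sub>F z in dirf p (c *\<^sub>R d). P z"
proof -
  obtain \<epsilon> where \<epsilon>: "\<epsilon> > 0" "\<And>r e. r \<in> {0<..<\<epsilon>} \<Longrightarrow> e \<in> ball d \<epsilon> \<Longrightarrow> P (p + r *\<^sub>R e)"
    using assms(1) unfolding eventually_dirf_iff by auto
  have "P (p + r *\<^sub>R e)" if r: "r \<in> {0<..<min (\<epsilon> / c) (\<epsilon> * c)}" and e: "e \<in> ball (c *\<^sub>R d) (min (\<epsilon> / c) (\<epsilon> * c))" for r e
  proof -
    have "dist (c *\<^sub>R d) e = c * dist d (e /\<^sub>R c)"
    proof -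
      have "dist (c *\<^sub>R d) (c *\<^sub>R (e /\<^sub>R c)) = c * dist d (e /\<^sub>R c)"
        unfolding dist_norm scaleR_diff_right[symmetric] norm_scaleR using assms(2) by simp
      then show ?thesis using assms(2) by simp
    qed
    then have "c * dist d (e /\<^sub>R c) < c * \<epsilon>" using e by (simp add: mult.commute)
    then have "e /\<^sub>R c \<in> ball d \<epsilon>" using assms(2) by simp
    moreover have "r * c \<in> {0<..<\<epsilon>}" using r assms(2) by (simp add: pos_less_divide_eq)
    ultimately have "P (p + (r * c) *\<^sub>R (e /\<^sub>R c))" using \<epsilon>(2) by blast
    moreover have "(r * c) *\<^sub>R (e /\<^sub>R c) = r *\<^sub>R e" using assms(2) by (simp add: field_simps)
    ultimately show ?thesis by metis
  qed
  then show ?thesis unfolding eventually_dirf_iff using \<epsilon>(1) assms(2)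
    by (intro exI[of _ "min (\<epsilon> / c) (\<epsilon> * c)"]) auto
qed

text \<open>\<open>dirf\<close> is a proper filter. Mean indices obtained in different ways are
  compared by evaluating both in a common direction.\<close>

lemma eventually_const_unique:
  assumes "\<forall>\<^sub>F z in dirf p d. P z \<and> f z = (a::real)" "\<forall>\<^sub>F z in dirf p d. Q z \<and> f z = b"
  shows "a = b"
proof -
  have "\<forall>\<^sub>F z in dirf p d. a = b" using assms by eventually_elim auto
  then show ?thesis by simp
qed

text \<open>A closed curve with a corner at \<open>p\<close>, left in direction \<open>vo\<close> and reached from direction
  \<open>- vi\<close>, has the same winding number in the whole sector swept out by the directions
  \<open>x vi + y vo\<close> with \<open>x > 0\<close>, together with \<open>- vo\<close>.\<close>

lemma corner_sector:
  assumes "path \<gamma>" "\<gamma> 0 = p" "\<gamma> 1 = p" "\<And>t. t \<in> {0<..<1} \<Longrightarrow> \<gamma> t \<noteq> p"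
    and vo: "(\<gamma> has_vector_derivative vo) (at_right 0)"
    and vi: "(\<gamma> has_vector_derivative vi) (at_left 1)"
    and tr: "Im (vi / vo) \<noteq> 0"
  shows "\<exists>k. \<forall>d. d = - vo \<or> Im (d / vo) * Im (vi / vo) > 0 \<longrightarrow> (\<forall>\<^sub>F z in dirf p d. z \<notin> path_image \<gamma> \<and> wind \<gamma> z = k)"
proof -
  define s where "s = sgn (Im (vi / vo))"
  have s: "s = 1 \<or> s = -1" "s * Im (vi / vo) > 0" using tr by (auto simp: s_def sgn_if)
  have nz: "vo \<noteq> 0" "vi \<noteq> 0" using tr by auto
  \<comment> \<open>An open half-plane with one point of its boundary line added is still convex.
    The added direction is the one from which the other curve will arrive when a node is
    cut.\<close>
  define G where "G = insert (- vo) {d. s * Im (d / vo) > 0}"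
  have lin: "Im ((x + y) / vo) = Im (x / vo) + Im (y / vo)" "Im ((c *\<^sub>R x) / vo) = c * Im (x / vo)"
    "Im ((- x) / vo) = - Im (x / vo)" for x y :: complex and c :: real
    using Im_divide_scale[of c x 1 vo] by (simp_all add: add_divide_distrib)
  have "convex G"
  proof (rule convexI)
    fix x y and a b :: real assume xy: "x \<in> G" "y \<in> G" and ab: "a \<ge> 0" "b \<ge> 0" "a + b = 1"
    have Imvo: "Im ((- vo) / vo) = 0" using nz by simp
    have nn: "s * Im (x / vo) \<ge> 0" "s * Im (y / vo) \<ge> 0" using xy Imvo by (auto simp: G_def)
    have eq: "s * Im ((a *\<^sub>R x + b *\<^sub>R y) / vo) = a * (s * Im (x / vo)) + b * (s * Im (y / vo))"
      by (simp only: lin) (simp add: algebra_simps)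
    show "a *\<^sub>R x + b *\<^sub>R y \<in> G"
    proof (cases "s * Im ((a *\<^sub>R x + b *\<^sub>R y) / vo) > 0")
      case False
      then have 0: "a * (s * Im (x / vo)) = 0" "b * (s * Im (y / vo)) = 0"
        using eq nn ab mult_nonneg_nonneg[of a "s * Im (x / vo)"] mult_nonneg_nonneg[of b "s * Im (y / vo)"] by linarith+
      have "a *\<^sub>R x = a *\<^sub>R (- vo)" "b *\<^sub>R y = b *\<^sub>R (- vo)" using 0 xy by (auto simp: G_def)
      then have "a *\<^sub>R x + b *\<^sub>R y = (a + b) *\<^sub>R (- vo)" by (simp add: scaleR_add_left)
      then show ?thesis using ab by (simp add: G_def)
    qed (simp add: G_def)
  qed
  have ends: "t = 0 \<or> t = 1" if "t \<in> {0..1}" "\<gamma> t = p" for t using assms(4)[of t] that by fastforce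
  \<comment> \<open>The arms of the corner point in the directions \<open>vo\<close> and
    \<open>- vi\<close>. The first lies on the boundary line opposite to \<open>- vo\<close>, the
    second in the other half-plane, so no direction in \<open>G\<close> is parallel to an
    arm.\<close>
  have off: "\<forall>\<^sub>F z in dirf p d. z \<notin> path_image \<gamma>" if d: "d \<in> G" for d
  proof -
    have vvo: "Im (vo / vo) = 0" using nz by simp
    have d0: "d \<noteq> 0" using d nz by (auto simp: G_def)
    have n1: "sgn vo \<noteq> sgn d"
    proof
      assume eq: "sgn vo = sgn d"
      then have "Im (d / vo) = 0" using sgn_eq_scaled[of d vo] nz by simp
      then have "d = - vo" using d by (auto simp: G_def)
      then show False using eq nz by (simp add: sgn_minus sgn_zero_iff)
    qed
    have n2: "sgn (- vi) \<noteq> sgn d"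
    proof
      assume eq: "sgn (- vi) = sgn d"
      have "d = norm d *\<^sub>R sgn d" using d0 by (simp add: sgn_div_norm)
      also have "\<dots> = (norm d / norm vi) *\<^sub>R (- vi)" unfolding eq[symmetric] by (simp add: sgn_div_norm divide_inverse)
      finally have dd: "d = (norm d / norm vi) *\<^sub>R (- vi)" .
      have "Im (d / vo) = - (norm d / norm vi * Im (vi / vo))"
        by (subst dd) (simp only: lin mult_minus_right)
      then have "s * Im (d / vo) = - (norm d / norm vi * (s * Im (vi / vo)))" by simp
      also have "\<dots> < 0" using s(2) d0 nz by simp
      finally have neg: "s * Im (d / vo) < 0" .
      then have "d = - vo" using d by (auto simp: G_def)
      then show False using neg vvo nz by simp
    qed
    show ?thesis
    proof (rule dirf_avoids[OF assms(1) _ d0])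
      show "finite {t\<in>{0..1}. \<gamma> t = p}" by (rule finite_subset[of _ "{0, 1}"]) (use ends in auto)
      show "\<exists>v. (\<gamma> has_vector_derivative v) (at_right t) \<and> v \<noteq> 0 \<and> sgn v \<noteq> sgn d"
        if "t \<in> {0..<1}" "\<gamma> t = p" for t
      proof -
        have "t = 0" using that ends[of t] by auto
        then show ?thesis using vo nz n1 by blast
      qed
      show "\<exists>v. (\<gamma> has_vector_derivative v) (at_left t) \<and> v \<noteq> 0 \<and> sgn (- v) \<noteq> sgn d"
        if "t \<in> {0<..1}" "\<gamma> t = p" for t
      proof -
        have "t = 1" using that ends[of t] by auto
        then show ?thesis using vi nz n2 by blast
      qed
    qed
  qed
  \<comment> \<open>By \<open>dirf_const\<close> this value is locally constant in the direction,
    and \<open>G\<close> is connected.\<close>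
  define K where "K d = (SOME k. \<forall>\<^sub>F z in dirf p d. z \<notin> path_image \<gamma> \<and> wind \<gamma> z = k)" for d
  have closed: "\<gamma> 1 = \<gamma> 0" using assms by simp
  have K: "\<forall>\<^sub>F z in dirf p d. z \<notin> path_image \<gamma> \<and> wind \<gamma> z = K d" if "d \<in> G" for d
    unfolding K_def by (rule someI_ex) (use dirf_const[OF assms(1) closed off[OF that]] in blast)
  have "K constant_on G"
  proof (rule locally_constant_imp_constant)
    show "connected G" using \<open>convex G\<close> by (rule convex_connected)
    fix a assume a: "a \<in> G"
    obtain k U where U: "open U" "a \<in> U" "\<And>e. e \<in> U \<Longrightarrow> \<forall>\<^sub>F z in dirf p e. z \<notin> path_image \<gamma> \<and> wind \<gamma> z = k"
      using dirf_const[OF assms(1) closed off[OF a]] by blast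
    have "K x = k" if "x \<in> G \<inter> U" for x
      using eventually_const_unique[OF K[of x] U(3)[of x]] that by blast
    then show "\<exists>T. openin (top_of_set G) T \<and> a \<in> T \<and> (\<forall>x\<in>T. K x = K a)"
      using U a by (intro exI[of _ "G \<inter> U"]) (auto intro: openin_open_Int)
  qed
  then obtain k where "\<And>d. d \<in> G \<Longrightarrow> K d = k" unfolding constant_on_def by blast
  moreover have "d \<in> G" if "d = - vo \<or> Im (d / vo) * Im (vi / vo) > 0" for d
    using s that by (auto simp: G_def zero_less_mult_iff)
  ultimately show ?thesis using K by (intro exI[of _ k]) metis
qed

section \<open>Running a closed curve backwards\<close>

lemma double_times_reversepath:
  assumes "\<beta> 1 = \<beta> 0"
  defines "\<rho> \<equiv> (\<lambda>t::real. if t = 0 then 0 else 1 - t)"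
  shows "double_times (reversepath \<beta>) = \<rho> ` double_times \<beta>"
    and "reversepath \<beta> ` double_times (reversepath \<beta>) = \<beta> ` double_times \<beta>"
    and "at_most_double \<beta> \<Longrightarrow> at_most_double (reversepath \<beta>)"
proof -
  have \<rho>: "\<rho> t \<in> {0..<1}" "\<rho> (\<rho> t) = t" "reversepath \<beta> (\<rho> t) = \<beta> t" "\<beta> (\<rho> t) = reversepath \<beta> t" if "t \<in> {0..<1}" for t
    using that assms(1) by (auto simp: \<rho>_def reversepath_def)
  have inj: "\<rho> s = \<rho> t \<Longrightarrow> s = t" if "s \<in> {0..<1}" "t \<in> {0..<1}" for s t
    using \<rho>(2)[OF that(1)] \<rho>(2)[OF that(2)] by metis
  have a: "\<rho> t \<in> double_times (reversepath \<beta>)" if dt: "t \<in> double_times \<beta>" for t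
  proof -
    obtain s where "s \<in> {0..<1}" "t \<in> {0..<1}" "s \<noteq> t" "\<beta> s = \<beta> t" using dt by (auto simp: double_times_def)
    then have "\<rho> t \<in> {0..<1}" "\<rho> s \<in> {0..<1}" "\<rho> s \<noteq> \<rho> t" "reversepath \<beta> (\<rho> s) = reversepath \<beta> (\<rho> t)"
      using \<rho>(1,3) inj by metis+
    then show ?thesis unfolding double_times_def by blast
  qed
  have b: "\<rho> t \<in> double_times \<beta>" if dt: "t \<in> double_times (reversepath \<beta>)" for t
  proof -
    obtain s where "s \<in> {0..<1}" "t \<in> {0..<1}" "s \<noteq> t" "reversepath \<beta> s = reversepath \<beta> t"
      using dt by (auto simp: double_times_def)
    then have "\<rho> t \<in> {0..<1}" "\<rho> s \<in> {0..<1}" "\<rho> s \<noteq> \<rho> t" "\<beta> (\<rho> s) = \<beta> (\<rho> t)"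
      using \<rho>(1,4) inj by metis+
    then show ?thesis unfolding double_times_def by blast
  qed
  have r: "t \<in> {0..<1}" if "t \<in> double_times \<delta>" for t \<delta> using that by (auto simp: double_times_def)
  show eq: "double_times (reversepath \<beta>) = \<rho> ` double_times \<beta>"
  proof
    show "double_times (reversepath \<beta>) \<subseteq> \<rho> ` double_times \<beta>"
    proof
      fix t assume t: "t \<in> double_times (reversepath \<beta>)"
      show "t \<in> \<rho> ` double_times \<beta>" by (rule image_eqI[OF _ b[OF t]]) (use \<rho>(2)[OF r[OF t]] in simp)
    qed
  qed (use a in auto)
  show "reversepath \<beta> ` double_times (reversepath \<beta>) = \<beta> ` double_times \<beta>"
    unfolding eq image_image by (rule image_cong) (use \<rho>(3) r in auto)
  show "at_most_double (reversepath \<beta>)" if amd: "at_most_double \<beta>"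
    unfolding at_most_double_def
  proof (intro ballI impI)
    fix s t u assume stu: "s \<in> {0..<1}" "t \<in> {0..<1}" "u \<in> {0..<1::real}"
      "reversepath \<beta> s = reversepath \<beta> t \<and> reversepath \<beta> t = reversepath \<beta> u"
    then have "\<rho> s = \<rho> t \<or> \<rho> t = \<rho> u \<or> \<rho> s = \<rho> u"
      using amd[unfolded at_most_double_def, rule_format, of "\<rho> s" "\<rho> t" "\<rho> u"] \<rho> by metis
    then show "s = t \<or> t = u \<or> s = u" using inj stu by blast
  qed
qed

lemma eventually_at_left_reverse:
  fixes t :: real
  assumes "\<forall>\<^sub>F u in at_right (1 - t). P u"
  shows "\<forall>\<^sub>F u in at_left t. P (1 - u)"
proof -
  obtain b where "b > 1 - t" "\<And>u. 1 - t < u \<Longrightarrow> u < b \<Longrightarrow> P u"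
    using assms unfolding eventually_at_right_field by auto
  then show ?thesis unfolding eventually_at_left_field by (intro exI[of _ "1 - b"]) auto
qed

text \<open>The set that is drawn, and with it the component sum, does not depend on the direction
  of travel. For the reversed curve, the value just before a return is the value just after the
  crossing in the original direction.\<close>

lemma before_after_sum:
  fixes \<beta> :: "real \<Rightarrow> complex"
  assumes A: "compact A" "path_connected A" "finite (components (- A))" "loc_const g A"
    and \<beta>: "path \<beta>" "\<beta> 0 \<in> A" "\<beta> 1 = \<beta> 0"
    and D: "finite (double_times \<beta>)" "at_most_double \<beta>" "\<beta> ` double_times \<beta> \<inter> A = {}"
    and H: "finite {t\<in>{0..<1}. \<beta> t \<in> A}"
    and before: "\<And>t. t \<in> {0<..1} \<Longrightarrow> \<beta> t \<in> A \<Longrightarrow> \<forall>\<^sub>F u in at_left t. g (\<beta> u) = gb (\<beta> t)"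
    and after: "\<And>t. t \<in> {0..<1} \<Longrightarrow> \<beta> t \<in> A \<Longrightarrow> \<forall>\<^sub>F u in at_right t. g (\<beta> u) = ga (\<beta> t)"
  shows "(\<Sum>q\<in>A \<inter> path_image \<beta>. gb q) = (\<Sum>q\<in>A \<inter> path_image \<beta>. ga q)"
proof -
  let ?\<beta>' = "reversepath \<beta>"
  note rev = double_times_reversepath[where \<beta> = \<beta>, OF \<beta>(3)]
  have "csum g (A \<union> path_image ?\<beta>') = csum g A + (\<Sum>p\<in>?\<beta>' ` double_times ?\<beta>'. g p) + (\<Sum>q\<in>A \<inter> path_image ?\<beta>'. ga q)"
  proof (rule csum_closed_curve(2)[OF A])
    show "path ?\<beta>'" using \<beta>(1) by simp
    show "?\<beta>' 0 \<in> A" "?\<beta>' 1 = ?\<beta>' 0" using \<beta> by (auto simp: reversepath_def[of \<beta>])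
    show "finite (double_times ?\<beta>')" unfolding rev(1) using D(1) by simp
    show "at_most_double ?\<beta>'" using rev(3) D(2) by simp
    show "?\<beta>' ` double_times ?\<beta>' \<inter> A = {}" unfolding rev(2) by (rule D(3))
    have "{t\<in>{0..<1}. ?\<beta>' t \<in> A} \<subseteq> insert 0 ((\<lambda>t. 1 - t) ` {t\<in>{0..<1}. \<beta> t \<in> A})"
    proof
      fix t assume "t \<in> {t\<in>{0..<1}. ?\<beta>' t \<in> A}"
      then show "t \<in> insert 0 ((\<lambda>t. 1 - t) ` {t\<in>{0..<1}. \<beta> t \<in> A})"
        by (cases "t = 0") (auto simp: reversepath_def intro!: image_eqI[of _ _ "1 - t"])
    qed
    then show "finite {t\<in>{0..<1}. ?\<beta>' t \<in> A}" using H finite_subset by blast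
    show "\<forall>\<^sub>F u in at_left t. g (?\<beta>' u) = ga (?\<beta>' t)" if "t \<in> {0<..1}" "?\<beta>' t \<in> A" for t
      using eventually_at_left_reverse[OF after[of "1 - t"]] that by (auto simp: reversepath_def)
  qed
  moreover have "csum g (A \<union> path_image \<beta>) = csum g A + (\<Sum>p\<in>\<beta> ` double_times \<beta>. g p) + (\<Sum>q\<in>A \<inter> path_image \<beta>. gb q)"
    by (rule csum_closed_curve(2)[OF A \<beta> D H before])
  ultimately show ?thesis unfolding rev(2) by simp
qed

text \<open>The sweep applied to a single point with the constant function 1: the punctured plane
  has one component, closing up at the base point adds one, and every node adds one. This is Euler's
  formula for the curve.\<close>

lemma finite_components_closed_curve:
  fixes \<beta> :: "real \<Rightarrow> complex"
  assumes \<beta>: "path \<beta>" "\<beta> 1 = \<beta> 0" and D: "finite (double_times \<beta>)" "at_most_double \<beta>" "0 \<notin> double_times \<beta>"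
  shows "finite (components (- path_image \<beta>))"
    and "csum (\<lambda>z. 1) (path_image \<beta>) = card (\<beta> ` double_times \<beta>) + 2"
proof -
  let ?A = "{\<beta> 0}"
  have con: "connected (- ?A)"
    using connected_complement_bounded_convex[of ?A] by simp
  then have comp: "components (- ?A) = {- ?A}"
    unfolding components_eq_sing_iff by (metis infinite_UNIV_char_0 finite.emptyI finite_insert Compl_empty_eq double_complement)
  have z: "t = 0" if "t \<in> {0..<1}" "\<beta> t = \<beta> 0" for t
    using that D(3) by (auto simp: double_times_def)
  have zd: "\<beta> t \<noteq> \<beta> 0" if t: "t \<in> double_times \<beta>" for t
  proof -
    have "t \<in> {0..<1}" using t by (auto simp: double_times_def)
    then show ?thesis using z[of t] t D(3) by auto
  qed
  have disj: "\<beta> ` double_times \<beta> \<inter> ?A = {}" using zd by blast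
  have i: "?A \<inter> path_image \<beta> = ?A" by (auto simp: path_image_def)
  note c = csum_closed_curve[of ?A "\<lambda>z. 1" \<beta> "\<lambda>q. 1"]
  have "{t\<in>{0..<1}. \<beta> t \<in> ?A} = {0}" using z by auto
  then have fin: "finite {t\<in>{0..<1}. \<beta> t \<in> ?A}" by simp
  have U: "?A \<union> path_image \<beta> = path_image \<beta>" by (auto simp: path_image_def)
  have "finite (components (- (?A \<union> path_image \<beta>)))"
    by (rule csum_closed_curve(1)[of ?A "\<lambda>z. 1" \<beta> "\<lambda>q. 1"]) (use comp \<beta> D disj fin in \<open>auto simp: loc_const_def\<close>)
  then show "finite (components (- path_image \<beta>))" unfolding U .
  have "csum (\<lambda>z. 1) (?A \<union> path_image \<beta>) = csum (\<lambda>z. 1) ?A + (\<Sum>p\<in>\<beta> ` double_times \<beta>. 1) + (\<Sum>q\<in>?A \<inter> path_image \<beta>. 1)"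
    by (rule csum_closed_curve(2)[of ?A "\<lambda>z. 1" \<beta> "\<lambda>q. 1"]) (use comp \<beta> D disj fin in \<open>auto simp: loc_const_def\<close>)
  then show "csum (\<lambda>z. 1) (path_image \<beta>) = card (\<beta> ` double_times \<beta>) + 2"
    unfolding U i by (simp add: csum_def comp cval_def)
qed

text \<open>\<open>sgn (Im (b / a))\<close> is the orientation of the frame \<open>(a, b)\<close>,
  hence antisymmetric.\<close>

lemma sgn_Im_swap:
  fixes a b :: complex
  shows "sgn (Im (a / b)) = - sgn (Im (b / a))"
proof (cases "a = 0 \<or> b = 0")
  case False
  then have "Im (a / b) = - Im (b / a) * (norm a / norm b)\<^sup>2"
  proof -
    have "Im (inverse w) = - Im w * (1 / norm w)\<^sup>2" for w :: complex
      by (simp add: cmod_power2 power_divide)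
    from this[of "b / a"] show ?thesis by (simp add: norm_divide)
  qed
  then show ?thesis using False by (simp add: sgn_mult sgn_minus)
qed auto

section \<open>Parity for curves with transverse double points\<close>

text \<open>Velocities are demanded at double times only, and the base point must not be one of
  them: the pieces produced by the induction have a corner at their base point.\<close>

definition nodal :: "(real \<Rightarrow> complex) \<Rightarrow> (real \<Rightarrow> complex) \<Rightarrow> bool" where
  "nodal \<gamma> v \<longleftrightarrow> path \<gamma> \<and> \<gamma> 1 = \<gamma> 0 \<and> finite (double_times \<gamma>) \<and> at_most_double \<gamma> \<and> 0 \<notin> double_times \<gamma> \<and>
     (\<forall>t\<in>double_times \<gamma>. (\<gamma> has_vector_derivative v t) (at t)) \<and>
     (\<forall>s\<in>double_times \<gamma>. \<forall>t\<in>double_times \<gamma>. s \<noteq> t \<and> \<gamma> s = \<gamma> t \<longrightarrow> Im (v t / v s) \<noteq> 0)"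

definition node_index :: "(real \<Rightarrow> complex) \<Rightarrow> (real \<Rightarrow> complex) \<Rightarrow> (complex \<Rightarrow> real) \<Rightarrow> bool" where
  "node_index \<gamma> v M \<longleftrightarrow>
     (\<forall>s\<in>double_times \<gamma>. \<forall>t\<in>double_times \<gamma>. s \<noteq> t \<and> \<gamma> s = \<gamma> t \<longrightarrow> cindex \<gamma> (\<gamma> s) [v s, v t] (M (\<gamma> s)))"

text \<open>\<open>\<delta>\<close> is a closed curve that runs through the part \<open>I\<close> of \<open>\<gamma>\<close>. Derivatives are only recorded at
  the double points of \<open>\<gamma>\<close> and up to a positive factor, because \<open>\<delta>\<close> has a corner at the node where
  \<open>\<gamma>\<close> is cut.\<close>

definition piece :: "(real \<Rightarrow> complex) \<Rightarrow> (real \<Rightarrow> complex) \<Rightarrow> (real \<Rightarrow> complex) \<Rightarrow> (real \<Rightarrow> real) \<Rightarrow> real set \<Rightarrow> bool" where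
  "piece \<gamma> v \<delta> \<tau> I \<longleftrightarrow> path \<delta> \<and> \<delta> 1 = \<delta> 0 \<and> bij_betw \<tau> {0..<1} I \<and> I \<subseteq> {0..<1} \<and>
     (\<forall>u\<in>{0..<1}. \<delta> u = \<gamma> (\<tau> u)) \<and>
     (\<forall>u\<in>{0<..<1}. \<tau> u \<in> double_times \<gamma> \<longrightarrow> (\<exists>c>0. (\<delta> has_vector_derivative c *\<^sub>R v (\<tau> u)) (at u))) \<and>
     0 \<notin> double_times \<delta>"

section \<open>Cutting a curve at a node\<close>

lemma double_timesI: "s \<in> {0..<1} \<Longrightarrow> t \<in> {0..<1} \<Longrightarrow> s \<noteq> t \<Longrightarrow> \<gamma> s = \<gamma> t \<Longrightarrow> t \<in> double_times \<gamma>"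
  unfolding double_times_def by blast

lemma double_timesE:
  assumes "t \<in> double_times \<gamma>"
  obtains s where "s \<in> double_times \<gamma>" "s \<noteq> t" "\<gamma> s = \<gamma> t" "s \<in> {0..<1}" "t \<in> {0..<1}"
  using assms unfolding double_times_def by force

lemma at_most_doubleD:
  "at_most_double \<gamma> \<Longrightarrow> s \<in> {0..<1} \<Longrightarrow> t \<in> {0..<1} \<Longrightarrow> u \<in> {0..<1} \<Longrightarrow> \<gamma> s = \<gamma> t \<Longrightarrow> \<gamma> t = \<gamma> u \<Longrightarrow> s = t \<or> t = u \<or> s = u"
  unfolding at_most_double_def by blast

lemma path_image_closed:
  assumes "\<delta> 1 = \<delta> (0::real)" shows "path_image \<delta> = \<delta> ` {0..<1}"
proof -
  have "{0..1} = insert 1 {0..<1::real}" by auto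
  then have "path_image \<delta> = insert (\<delta> 1) (\<delta> ` {0..<1})" unfolding path_image_def by simp
  then show ?thesis using assms by auto
qed

text \<open>\<open>\<tau>\<close> embeds the parameters of the piece into those of
  \<open>\<gamma>\<close>, so a coincidence on \<open>\<delta>\<close> is one on
  \<open>\<gamma>\<close> with both parameters in \<open>I\<close>. Coincidences between
  \<open>I\<close> and its complement are lost, among them the node at which the curve is
  cut.\<close>

lemma
  assumes \<gamma>: "nodal \<gamma> v" and p: "piece \<gamma> v \<delta> \<tau> I"
  shows piece_path_image: "path_image \<delta> = \<gamma> ` I"
    and piece_double_times: "u \<in> double_times \<delta> \<Longrightarrow> \<tau> u \<in> double_times \<gamma>"
    and piece_nodes: "\<delta> ` double_times \<delta> = {\<gamma> x | x y. x \<in> I \<and> y \<in> I \<and> x \<noteq> y \<and> \<gamma> x = \<gamma> y}"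
    and piece_nodal: "\<exists>w. nodal \<delta> w \<and> (\<forall>u\<in>double_times \<delta>. \<exists>c>0. w u = c *\<^sub>R v (\<tau> u))"
proof -
  have \<tau>: "inj_on \<tau> {0..<1}" "\<tau> ` {0..<1} = I" "I \<subseteq> {0..<1}" using p by (auto simp: piece_def bij_betw_def)
  have eq: "\<delta> u = \<gamma> (\<tau> u)" if "u \<in> {0..<1}" for u using p that by (auto simp: piece_def)
  have r: "\<tau> u \<in> I" "\<tau> u \<in> {0..<1}" if "u \<in> {0..<1}" for u using that \<tau>(2,3) by blast+
  show "path_image \<delta> = \<gamma> ` I"
    using path_image_closed[of \<delta>] p eq \<tau>(2) unfolding piece_def by (metis image_cong image_image)
  have dt: "\<tau> u \<in> double_times \<gamma>" if "u \<in> double_times \<delta>" for u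
  proof -
    from that obtain s where s: "s \<in> {0..<1}" "u \<in> {0..<1}" "s \<noteq> u" "\<delta> s = \<delta> u" by (rule double_timesE)
    then have "\<tau> s \<noteq> \<tau> u" using \<tau>(1) by (auto simp: inj_on_def)
    then show ?thesis using s eq r by (intro double_timesI[of "\<tau> s"]) auto
  qed
  then show "u \<in> double_times \<delta> \<Longrightarrow> \<tau> u \<in> double_times \<gamma>" .
  show "\<delta> ` double_times \<delta> = {\<gamma> x | x y. x \<in> I \<and> y \<in> I \<and> x \<noteq> y \<and> \<gamma> x = \<gamma> y}"
  proof (intro equalityI subsetI)
    fix q assume "q \<in> \<delta> ` double_times \<delta>"
    then obtain u where u: "u \<in> double_times \<delta>" "q = \<delta> u" by auto
    from u(1) obtain s where s: "s \<in> {0..<1}" "u \<in> {0..<1}" "s \<noteq> u" "\<delta> s = \<delta> u" by (rule double_timesE)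
    have "\<tau> u \<in> I" "\<tau> s \<in> I" using r s by blast+
    moreover have "\<tau> u \<noteq> \<tau> s" using inj_onD[OF \<tau>(1), of u s] s by blast
    moreover have "\<gamma> (\<tau> u) = \<gamma> (\<tau> s)" "q = \<gamma> (\<tau> u)" using eq[of s] eq[of u] s u(2) by simp_all
    ultimately show "q \<in> {\<gamma> x | x y. x \<in> I \<and> y \<in> I \<and> x \<noteq> y \<and> \<gamma> x = \<gamma> y}" by blast
  next
    fix q assume "q \<in> {\<gamma> x | x y. x \<in> I \<and> y \<in> I \<and> x \<noteq> y \<and> \<gamma> x = \<gamma> y}"
    then obtain x y where xy: "x \<in> I" "y \<in> I" "x \<noteq> y" "\<gamma> x = \<gamma> y" "q = \<gamma> x" by auto
    then obtain a b where ab: "a \<in> {0..<1}" "b \<in> {0..<1}" "x = \<tau> a" "y = \<tau> b" using \<tau>(2) by blast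
    then have "a \<in> double_times \<delta>" using xy eq by (intro double_timesI[of b]) auto
    moreover have "q = \<delta> a" using xy(5) ab eq by simp
    ultimately show "q \<in> \<delta> ` double_times \<delta>" by blast
  qed
  have pos: "u \<in> {0<..<1}" if "u \<in> double_times \<delta>" for u
  proof -
    have "u \<in> {0..<1}" using that by (rule double_timesE)
    moreover have "u \<noteq> 0" using that p by (auto simp: piece_def)
    ultimately show ?thesis by auto
  qed
  have "\<forall>u\<in>double_times \<delta>. \<exists>w. (\<exists>c>0. w = c *\<^sub>R v (\<tau> u)) \<and> (\<delta> has_vector_derivative w) (at u)"
  proof
    fix u assume u: "u \<in> double_times \<delta>"
    then obtain c where "c > 0" "(\<delta> has_vector_derivative c *\<^sub>R v (\<tau> u)) (at u)"
      using dt[OF u] pos[OF u] p unfolding piece_def by blast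
    then show "\<exists>w. (\<exists>c>0. w = c *\<^sub>R v (\<tau> u)) \<and> (\<delta> has_vector_derivative w) (at u)" by blast
  qed
  from bchoice[OF this] obtain w where w: "\<And>u. u \<in> double_times \<delta> \<Longrightarrow> \<exists>c>0. w u = c *\<^sub>R v (\<tau> u)"
    "\<And>u. u \<in> double_times \<delta> \<Longrightarrow> (\<delta> has_vector_derivative w u) (at u)" by metis
  have "nodal \<delta> w"
    unfolding nodal_def
  proof (intro conjI ballI impI)
    have "inj_on \<tau> (double_times \<delta>)" using \<tau>(1) by (rule inj_on_subset) (auto simp: double_times_def)
    moreover have "\<tau> ` double_times \<delta> \<subseteq> double_times \<gamma>" using dt by auto
    ultimately show "finite (double_times \<delta>)" using \<gamma> unfolding nodal_def by (meson inj_on_finite)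
    show "at_most_double \<delta>" unfolding at_most_double_def
    proof (intro ballI impI)
      fix s t u assume a: "s \<in> {0..<1}" "t \<in> {0..<1}" "u \<in> {0..<1::real}" "\<delta> s = \<delta> t \<and> \<delta> t = \<delta> u"
      then have "\<tau> s = \<tau> t \<or> \<tau> t = \<tau> u \<or> \<tau> s = \<tau> u"
        using at_most_doubleD[of \<gamma> "\<tau> s" "\<tau> t" "\<tau> u"] \<gamma> r eq unfolding nodal_def by metis
      then show "s = t \<or> t = u \<or> s = u" using \<tau>(1) a by (auto simp: inj_on_def)
    qed
    fix s t assume st: "s \<in> double_times \<delta>" "t \<in> double_times \<delta>" "s \<noteq> t \<and> \<delta> s = \<delta> t"
    have i: "s \<in> {0..<1}" "t \<in> {0..<1}" using pos st by force+
    then have "\<tau> s \<noteq> \<tau> t" "\<gamma> (\<tau> s) = \<gamma> (\<tau> t)" using \<tau>(1) st eq by (auto simp: inj_on_def)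
    then have "Im (v (\<tau> t) / v (\<tau> s)) \<noteq> 0" using \<gamma> dt st unfolding nodal_def by blast
    moreover obtain c c' where "c > 0" "c' > 0" "w s = c *\<^sub>R v (\<tau> s)" "w t = c' *\<^sub>R v (\<tau> t)"
      using w(1) st by metis
    ultimately show "Im (w t / w s) \<noteq> 0" using Im_divide_scale[of c' "v (\<tau> t)" c "v (\<tau> s)"] by simp
  qed (use p w in \<open>auto simp: piece_def\<close>)
  then show "\<exists>w. nodal \<delta> w \<and> (\<forall>u\<in>double_times \<delta>. \<exists>c>0. w u = c *\<^sub>R v (\<tau> u))" using w(1) by blast
qed

lemma has_vector_derivative_affine:
  fixes \<gamma> :: "real \<Rightarrow> complex"
  assumes "(\<gamma> has_vector_derivative w) (at (c * u + a))"
  shows "((\<lambda>u. \<gamma> (c * u + a)) has_vector_derivative c *\<^sub>R w) (at u)"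
proof -
  have "((\<lambda>u. c * u + a) has_vector_derivative c) (at u)"
    by (auto intro!: derivative_eq_intros simp flip: has_real_derivative_iff_has_vector_derivative)
  from vector_diff_chain_at[OF this assms] show ?thesis by (simp add: o_def)
qed

text \<open>\<open>A\<close> is the loop of \<open>\<gamma>\<close> from the first passage through
  the node to the second, \<open>B\<close> the rest of the circle, passing through the base point of
  \<open>\<gamma>\<close>. Each leaves the node along one branch and comes back along the other,
  which is why the velocities at the two ends are exchanged.\<close>

lemma cut_at_node:
  assumes \<gamma>: "nodal \<gamma> v" and st: "s \<in> double_times \<gamma>" "t \<in> double_times \<gamma>" "s < t" "\<gamma> s = \<gamma> t"
  obtains A B \<tau>A \<tau>B a a' b b' where
    "piece \<gamma> v A \<tau>A {s..<t}" "piece \<gamma> v B \<tau>B ({t..<1} \<union> {0..<s})" "\<tau>A 0 = s" "\<tau>B 0 = t"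
    "a > 0" "(A has_vector_derivative a *\<^sub>R v s) (at_right 0)" "a' > 0" "(A has_vector_derivative a' *\<^sub>R v t) (at_left 1)"
    "b > 0" "(B has_vector_derivative b *\<^sub>R v t) (at_right 0)" "b' > 0" "(B has_vector_derivative b' *\<^sub>R v s) (at_left 1)"
    "\<And>z. z \<notin> path_image A \<Longrightarrow> z \<notin> path_image B \<Longrightarrow> wind \<gamma> z = wind A z + wind B z"
proof -
  have path: "path \<gamma>" and closed: "\<gamma> 1 = \<gamma> 0" and n0: "0 \<notin> double_times \<gamma>" and amd: "at_most_double \<gamma>"
    using \<gamma> by (auto simp: nodal_def)
  have r: "0 < s" "t < 1" using st n0 by (auto simp: double_times_def less_le)
  have der: "(\<gamma> has_vector_derivative v x) (at x)" if "x \<in> double_times \<gamma>" for x using \<gamma> that by (auto simp: nodal_def)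
  define A where "A = subpath s t \<gamma>"
  define B where "B = subpath t 1 \<gamma> +++ subpath 0 s \<gamma>"
  define \<tau>A where "\<tau>A u = (t - s) * u + s" for u
  \<comment> \<open>The slopes come from \<open>+++\<close>, which allots half of the unit interval
    to each part.\<close>
  define \<tau>B where "\<tau>B u = (if u < 1/2 then (2 * (1 - t)) * u + t else (2 * s) * u + - s)" for u
  have A: "A u = \<gamma> ((t - s) * u + s)" for u by (simp add: A_def subpath_def)
  have B1: "B u = \<gamma> ((2 * (1 - t)) * u + t)" if "u \<le> 1/2" for u
    using that by (simp add: B_def joinpaths_def subpath_def algebra_simps)
  have B2: "B u = \<gamma> ((2 * s) * u + - s)" if "u > 1/2" for u
    using that by (simp add: B_def joinpaths_def subpath_def algebra_simps)
  \<comment> \<open>At the junction \<open>\<tau>B\<close> takes the value 0 instead of 1, because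
    the parameters of a piece have to lie in \<open>{0..<1}\<close>; both give the same point as
    \<open>\<gamma>\<close> is closed.\<close>
  have B2': "B u = \<gamma> ((2 * s) * u + - s)" if "u = 1/2" for u
  proof -
    have e: "(2 * (1 - t)) * u + t = 1" "(2 * s) * u + - s = 0" and "u \<le> 1/2" using that by (simp_all add: field_simps)
    show ?thesis unfolding B1[OF \<open>u \<le> 1/2\<close>] e by (rule closed)
  qed
  have pA: "path A" unfolding A_def using path r st by (intro path_subpath) auto
  have subs: "path (subpath t 1 \<gamma>)" "path (subpath 0 s \<gamma>)" using path r st by (auto intro!: path_subpath)
  have pB: "path B" unfolding B_def using subs closed by (simp add: path_join)
  have A01: "A 0 = \<gamma> s" "A 1 = \<gamma> s" using st(4) by (simp_all add: A)
  have B01: "B 0 = \<gamma> s" "B 1 = \<gamma> s" using st(4) by (simp_all add: B1 B2)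
  have bijA: "bij_betw \<tau>A {0..<1} {s..<t}"
    unfolding bij_betw_def
  proof
    show "inj_on \<tau>A {0..<1}" using st by (auto simp: inj_on_def \<tau>A_def)
    show "\<tau>A ` {0..<1} = {s..<t}"
    proof (intro equalityI subsetI)
      fix x assume "x \<in> {s..<t}"
      then show "x \<in> \<tau>A ` {0..<1}" using st
        by (intro image_eqI[of _ _ "(x - s) / (t - s)"]) (auto simp: \<tau>A_def field_simps)
    next
      fix x assume "x \<in> \<tau>A ` {0..<1}"
      then obtain u where u: "u \<in> {0..<1}" "x = \<tau>A u" by auto
      have "(t - s) * u < (t - s) * 1" using u st by (intro mult_strict_left_mono) auto
      then have "(t - s) * u + s < t" by simp
      moreover have "(t - s) * u \<ge> 0" using u st by simp
      ultimately show "x \<in> {s..<t}" using u by (simp add: \<tau>A_def)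
    qed
  qed
  have \<tau>B1: "\<tau>B u \<in> {t..<1}" if "0 \<le> u" "u < 1/2" for u
  proof -
    have "(2 * (1 - t)) * u < (2 * (1 - t)) * (1/2)" using that r by (intro mult_strict_left_mono) auto
    then have "(2 * (1 - t)) * u + t < 1" by simp
    moreover have "(2 * (1 - t)) * u \<ge> 0" using that r by simp
    ultimately show ?thesis using that unfolding \<tau>B_def by simp
  qed
  have \<tau>B2: "\<tau>B u \<in> {0..<s}" if "1/2 \<le> u" "u < 1" for u
  proof -
    have "(2 * s) * u < (2 * s) * 1" "(2 * s) * (1/2) \<le> (2 * s) * u"
      using that r by (intro mult_strict_left_mono mult_left_mono; auto)+
    then have "(2 * s) * u + - s < s" "0 \<le> (2 * s) * u + - s" by simp_all
    then show ?thesis using that unfolding \<tau>B_def by simp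
  qed
  have bijB: "bij_betw \<tau>B {0..<1} ({t..<1} \<union> {0..<s})"
    unfolding bij_betw_def
  proof
    show "inj_on \<tau>B {0..<1}"
    proof (rule inj_onI)
      fix x y assume xy: "x \<in> {0..<1}" "y \<in> {0..<1}" "\<tau>B x = \<tau>B y"
      have "x < 1/2 \<longleftrightarrow> y < 1/2"
      proof -
        have "(z < 1/2 \<longrightarrow> t \<le> \<tau>B z) \<and> (\<not> z < 1/2 \<longrightarrow> \<tau>B z < s)" if "z \<in> {0..<1}" for z
          using \<tau>B1[of z] \<tau>B2[of z] that by (cases "z < 1/2") auto
        from this[OF xy(1)] this[OF xy(2)] show ?thesis using xy(3) st(3) by linarith
      qed
      then show "x = y" using xy(3) r by (auto simp: \<tau>B_def split: if_splits)
    qed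
    show "\<tau>B ` {0..<1} = {t..<1} \<union> {0..<s}"
    proof (intro equalityI subsetI)
      fix x assume "x \<in> {t..<1} \<union> {0..<s}"
      then show "x \<in> \<tau>B ` {0..<1}"
      proof
        assume "x \<in> {t..<1}"
        then show ?thesis using r
          by (intro image_eqI[of _ _ "(x - t) / (2 * (1 - t))"]) (auto simp: \<tau>B_def field_simps)
      next
        assume "x \<in> {0..<s}"
        then show ?thesis using r
          by (intro image_eqI[of _ _ "(x + s) / (2 * s)"]) (auto simp: \<tau>B_def field_simps)
      qed
    next
      fix x assume "x \<in> \<tau>B ` {0..<1}"
      then obtain u where u: "u \<in> {0..<1}" "x = \<tau>B u" by auto
      then show "x \<in> {t..<1} \<union> {0..<s}" using \<tau>B1[of u] \<tau>B2[of u] by (cases "u < 1/2") auto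
    qed
  qed
  have uniq: "x = s \<or> x = t" if "x \<in> {0..<1}" "\<gamma> x = \<gamma> s" for x
    using at_most_doubleD[OF amd, of x s t] that st r by auto
  have Beq: "B u = \<gamma> (\<tau>B u)" for u
  proof -
    consider "u < 1/2" | "u = 1/2" | "u > 1/2" by linarith
    then show ?thesis
    proof cases
      case 1
      then show ?thesis using B1[of u] by (simp add: \<tau>B_def)
    next
      case 2
      then show ?thesis unfolding B2'[OF 2] by (simp add: \<tau>B_def)
    next
      case 3
      then show ?thesis unfolding B2[OF 3] by (simp add: \<tau>B_def)
    qed
  qed
  have Aeq: "A u = \<gamma> (\<tau>A u)" for u by (simp add: A \<tau>A_def)
  have dA: "(A has_vector_derivative (t - s) *\<^sub>R v (\<tau>A u)) (at u)" if "\<tau>A u \<in> double_times \<gamma>" for u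
    using has_vector_derivative_affine[of \<gamma> "v (\<tau>A u)" "t - s" u s] der[OF that]
    by (simp add: A[abs_def] \<tau>A_def)
  have "piece \<gamma> v A \<tau>A {s..<t}"
    unfolding piece_def
  proof (intro conjI ballI impI)
    show "\<exists>c>0. (A has_vector_derivative c *\<^sub>R v (\<tau>A u)) (at u)" if "\<tau>A u \<in> double_times \<gamma>" for u
      using dA[OF that] st(3) by (intro exI[of _ "t - s"]) auto
    show "0 \<notin> double_times A"
    proof
      assume "0 \<in> double_times A"
      then obtain u where u: "u \<noteq> 0" "A u = A 0" "u \<in> {0..<1}" by (rule double_timesE)
      have "\<tau>A u \<in> {s..<t}" using u(3) bijA unfolding bij_betw_def by blast
      moreover have "\<tau>A u \<noteq> s" using u(1) st(3) by (simp add: \<tau>A_def)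
      moreover have "\<gamma> (\<tau>A u) = \<gamma> s" using u(2) A01 Aeq[of u] by simp
      ultimately show False using uniq[of "\<tau>A u"] r by auto
    qed
  qed (use pA A01 bijA r st Aeq in auto)
  moreover have "piece \<gamma> v B \<tau>B ({t..<1} \<union> {0..<s})"
    unfolding piece_def
  proof (intro conjI ballI impI)
    show "\<exists>c>0. (B has_vector_derivative c *\<^sub>R v (\<tau>B u)) (at u)" if u: "u \<in> {0<..<1}" "\<tau>B u \<in> double_times \<gamma>" for u
    proof -
      have "\<tau>B (1/2) = 0" by (simp add: \<tau>B_def)
      then have "u \<noteq> 1/2" using u(2) n0 by metis
      then consider "u < 1/2" | "u > 1/2" by linarith
      then show ?thesis
      proof cases
        case 1
        have "((\<lambda>x. \<gamma> ((2 * (1 - t)) * x + t)) has_vector_derivative (2 * (1 - t)) *\<^sub>R v (\<tau>B u)) (at u)"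
          using der[OF u(2)] 1 by (intro has_vector_derivative_affine) (simp add: \<tau>B_def)
        then have "(B has_vector_derivative (2 * (1 - t)) *\<^sub>R v (\<tau>B u)) (at u)"
          by (rule has_vector_derivative_transform_within_open[of _ _ _ "{..<1/2}"]) (use 1 B1 in auto)
        then show ?thesis using r by (intro exI[of _ "2 * (1 - t)"]) auto
      next
        case 2
        have "((\<lambda>x. \<gamma> ((2 * s) * x + - s)) has_vector_derivative (2 * s) *\<^sub>R v (\<tau>B u)) (at u)"
          using der[OF u(2)] 2 by (intro has_vector_derivative_affine) (simp add: \<tau>B_def)
        then have "(B has_vector_derivative (2 * s) *\<^sub>R v (\<tau>B u)) (at u)"
          by (rule has_vector_derivative_transform_within_open[of _ _ _ "{1/2<..}"]) (use 2 B2 in auto)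
        then show ?thesis using r by (intro exI[of _ "2 * s"]) auto
      qed
    qed
    show "0 \<notin> double_times B"
    proof
      assume "0 \<in> double_times B"
      then obtain u where u: "u \<noteq> 0" "B u = B 0" "u \<in> {0..<1}" by (rule double_timesE)
      have "\<tau>B u \<noteq> \<tau>B 0" using u(1,3) bijB unfolding bij_betw_def inj_on_def by force
      then have "\<tau>B u \<noteq> t" by (simp add: \<tau>B_def)
      moreover have "\<tau>B u \<in> {t..<1} \<union> {0..<s}" using u(3) bijB unfolding bij_betw_def by blast
      moreover have "\<gamma> (\<tau>B u) = \<gamma> s" using u(2) B01 Beq[of u] by simp
      ultimately show False using uniq[of "\<tau>B u"] r st(3) by auto
    qed
  qed (use pB B01 bijB r st Beq in auto)
  moreover have "(A has_vector_derivative (t - s) *\<^sub>R v s) (at_right 0)" "(A has_vector_derivative (t - s) *\<^sub>R v t) (at_left 1)"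
    using dA[of 0] dA[of 1] st by (auto simp: \<tau>A_def intro: has_vector_derivative_at_within)
  moreover have "(B has_vector_derivative (2 * (1 - t)) *\<^sub>R v t) (at_right 0)"
  proof -
    have "((\<lambda>x. \<gamma> ((2 * (1 - t)) * x + t)) has_vector_derivative (2 * (1 - t)) *\<^sub>R v t) (at 0)"
      using der[OF st(2)] by (intro has_vector_derivative_affine) simp
    then have "(B has_vector_derivative (2 * (1 - t)) *\<^sub>R v t) (at 0)"
      by (rule has_vector_derivative_transform_within_open[of _ _ _ "{..<1/2}"]) (use B1 in auto)
    then show ?thesis by (rule has_vector_derivative_at_within)
  qed
  moreover have "(B has_vector_derivative (2 * s) *\<^sub>R v s) (at_left 1)"
  proof -
    have "((\<lambda>x. \<gamma> ((2 * s) * x + - s)) has_vector_derivative (2 * s) *\<^sub>R v s) (at 1)"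
      using der[OF st(1)] by (intro has_vector_derivative_affine) simp
    then have "(B has_vector_derivative (2 * s) *\<^sub>R v s) (at 1)"
      by (rule has_vector_derivative_transform_within_open[of _ _ _ "{1/2<..}"]) (use B2 in auto)
    then show ?thesis by (rule has_vector_derivative_at_within)
  qed
  moreover have "wind \<gamma> z = wind A z + wind B z" if z: "z \<notin> path_image A" "z \<notin> path_image B" for z
  proof -
    have imB: "path_image B = path_image (subpath t 1 \<gamma>) \<union> path_image (subpath 0 s \<gamma>)"
      unfolding B_def using closed by (intro path_image_join) simp
    have "path_image \<gamma> = \<gamma> ` {0..s} \<union> \<gamma> ` {s..t} \<union> \<gamma> ` {t..1}"
    proof -
      have "{0..1} = {0..s} \<union> {s..t} \<union> {t..1}" using r st by auto
      then show ?thesis unfolding path_image_def by (simp add: image_Un)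
    qed
    then have zg: "z \<notin> path_image \<gamma>" using z r st unfolding imB A_def by (simp add: path_image_subpath)
    have "winding_number B z = winding_number (subpath t 1 \<gamma>) z + winding_number (subpath 0 s \<gamma>) z"
      unfolding B_def using subs z closed unfolding imB by (intro winding_number_join) auto
    moreover have "winding_number (subpath 0 s \<gamma>) z + winding_number A z = winding_number (subpath 0 t \<gamma>) z"
      unfolding A_def using path zg r st by (intro winding_number_subpath_combine) auto
    moreover have "winding_number (subpath 0 t \<gamma>) z + winding_number (subpath t 1 \<gamma>) z = winding_number (subpath 0 1 \<gamma>) z"
      using path zg r st by (intro winding_number_subpath_combine) auto
    ultimately have "winding_number \<gamma> z = winding_number A z + winding_number B z"
      unfolding subpath_trivial by algebra
    then show ?thesis by (simp add: wind_def)
  qed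
  moreover have "\<tau>A 0 = s" "\<tau>B 0 = t" by (simp_all add: \<tau>A_def \<tau>B_def)
  moreover have "t - s > 0" "2 * (1 - t) > 0" "2 * s > 0" using r st by auto
  ultimately show thesis using that[of A \<tau>A B \<tau>B "t - s" "t - s" "2 * (1 - t)" "2 * s"] by blast
qed

section \<open>The parity induction\<close>

lemma csum_add:
  assumes "\<And>z. z \<notin> X \<Longrightarrow> f z = g z + h z"
  shows "csum f X = csum g X + csum h X"
proof -
  have "cval f C = cval g C + cval h C" if "C \<in> components (- X)" for C
  proof -
    have "(SOME z. z \<in> C) \<in> C" using in_components_nonempty[OF that] by (simp add: some_in_eq)
    then have "(SOME z. z \<in> C) \<notin> X" using in_components_subset[OF that] by auto
    then show ?thesis unfolding cval_def by (rule assms)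
  qed
  then show ?thesis unfolding csum_def by (simp add: sum.distrib)
qed

text \<open>Jordan curve theorem: the outside has winding number 0, the inside 1 or -1.\<close>

lemma parity_simple:
  assumes "path \<gamma>" "\<gamma> 1 = \<gamma> 0" "double_times \<gamma> = {}"
  shows "csum (wind \<gamma>) (path_image \<gamma>) = 1 \<or> csum (wind \<gamma>) (path_image \<gamma>) = - 1"
proof -
  have sp: "simple_path \<gamma>"
    unfolding simple_path_def loop_free_def
  proof (intro conjI ballI impI)
    fix x y :: real assume xy: "x \<in> {0..1}" "y \<in> {0..1}" "\<gamma> x = \<gamma> y"
    define x' y' where "x' = (if x = 1 then 0 else x)" and "y' = (if y = 1 then 0 else y)"
    have "x' \<in> {0..<1}" "y' \<in> {0..<1}" "\<gamma> x' = \<gamma> y'" using xy assms(2) by (auto simp: x'_def y'_def)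
    then have "x' = y'" using double_timesI[of x' y' \<gamma>] assms(3) by auto
    then show "x = y \<or> x = 0 \<and> y = 1 \<or> x = 1 \<and> y = 0" by (auto simp: x'_def y'_def split: if_splits)
  qed (rule assms(1))
  have cl: "pathfinish \<gamma> = pathstart \<gamma>" using assms(2) by (simp add: pathstart_def pathfinish_def)
  let ?J = "path_image \<gamma>"
  note jj = Jordan_inside_outside[OF sp cl]
  have jord: "inside ?J \<noteq> {}" "open (inside ?J)" "connected (inside ?J)" "outside ?J \<noteq> {}"
     "open (outside ?J)" "connected (outside ?J)" "inside ?J \<inter> outside ?J = {}" "inside ?J \<union> outside ?J = - ?J"
    using jj by blast+
  have comp: "components (- ?J) = {inside ?J, outside ?J}"
  proof (rule components_eq_partition)
    show "open C \<and> connected C \<and> C \<noteq> {}" if "C \<in> {inside ?J, outside ?J}" for C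
      using that jord by auto
    show "pairwise disjnt {inside ?J, outside ?J}"
      using jord(7) by (simp add: pairwise_insert disjnt_def Int_commute)
    show "\<Union>{inside ?J, outside ?J} = - ?J" using jord(8) by simp
  qed
  have "(SOME z. z \<in> outside ?J) \<in> outside ?J" "(SOME z. z \<in> inside ?J) \<in> inside ?J"
    using jord(1,4) by (simp_all add: some_in_eq)
  then have in_out: "(SOME z. z \<in> outside ?J) \<in> outside ?J" "(SOME z. z \<in> inside ?J) \<in> inside ?J" .
  have "cval (wind \<gamma>) (outside ?J) = 0"
    using winding_number_zero_in_outside[OF assms(1) cl in_out(1)] unfolding cval_def wind_def by simp
  moreover have "cval (wind \<gamma>) (inside ?J) = 1 \<or> cval (wind \<gamma>) (inside ?J) = -1"
    by (rule simple_closed_path_winding_number_inside[OF sp]) (use in_out(2) in \<open>auto simp: cval_def wind_def\<close>)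
  moreover have "inside ?J \<noteq> outside ?J" using jord(1,7) by blast
  ultimately show ?thesis unfolding csum_def comp by auto
qed

lemma csum_cong:
  assumes "\<And>z. z \<notin> X \<Longrightarrow> f z = g z" shows "csum f X = csum g X"
proof -
  have "csum f X = csum g X + csum (\<lambda>z. 0) X" by (rule csum_add) (simp add: assms)
  then show ?thesis by (simp add: csum_def cval_def)
qed

lemma sum_signs_zero_imp_even:
  fixes f :: "'a \<Rightarrow> real"
  assumes "finite Q" "\<And>q. q \<in> Q \<Longrightarrow> f q = 1 \<or> f q = - 1" "sum f Q = 0"
  shows "even (card Q)"
proof -
  define P where "P = {q\<in>Q. f q = 1}"
  have Q: "Q = P \<union> (Q - P)" "P \<subseteq> Q" by (auto simp: P_def)
  have fin: "finite P" using assms(1) by (simp add: P_def)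
  have "sum f Q = sum f P + sum f (Q - P)" using Q(2) assms(1) by (simp add: sum.subset_diff add.commute)
  also have "sum f P = card P" by (simp add: P_def)
  also have "sum f (Q - P) = (\<Sum>q\<in>Q - P. -1)" using assms(2) by (intro sum.cong) (auto simp: P_def)
  finally have "real (card P) = real (card (Q - P))" using assms(3) by simp
  moreover have "card Q = card P + card (Q - P)" using Q assms(1) fin by (metis card_Un_disjoint finite_Diff Diff_disjoint)
  ultimately show ?thesis by simp
qed

text \<open>Cutting at a node \<open>p\<close> turns every other node into a node of
  \<open>A\<close>, a node of \<open>B\<close> or a crossing of the two. Sweeping \<open>B\<close>
  across \<open>A\<close> and \<open>A\<close> across \<open>B\<close> expresses the component sum
  of \<open>wind A + wind B\<close> by the sums for the two pieces; the values at mixed points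
  cancel against the mean indices, and of the crossings only their number remains, which is
  even.\<close>

theorem nodal_parity:
  assumes "nodal \<gamma> v" "node_index \<gamma> v M"
  shows "\<exists>k::int. csum (wind \<gamma>) (path_image \<gamma>) - (\<Sum>p\<in>\<gamma> ` double_times \<gamma>. M p) + card (\<gamma> ` double_times \<gamma>) + 1 = 2 * of_int k"
  using assms
proof (induction "card (\<gamma> ` double_times \<gamma>)" arbitrary: \<gamma> v M rule: less_induct)
  case less
  have \<gamma>: "path \<gamma>" "\<gamma> 1 = \<gamma> 0" "finite (double_times \<gamma>)" "at_most_double \<gamma>" "0 \<notin> double_times \<gamma>"
    using less.prems(1) by (auto simp: nodal_def)
  have ind: "Im (v t / v s) \<noteq> 0" if "s \<in> double_times \<gamma>" "t \<in> double_times \<gamma>" "s \<noteq> t" "\<gamma> s = \<gamma> t" for s t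
    using less.prems(1) that by (auto simp: nodal_def)
  show ?case
  proof (cases "double_times \<gamma> = {}")
    case True
    then consider "csum (wind \<gamma>) (path_image \<gamma>) = 1" | "csum (wind \<gamma>) (path_image \<gamma>) = - 1"
      using parity_simple[OF \<gamma>(1,2) True] by blast
    then show ?thesis
      using True by cases (auto intro: exI[of _ 1] exI[of _ 0])
  next
    case False
    then obtain t0 where t0: "t0 \<in> double_times \<gamma>" by auto
    then obtain s0 where "s0 \<in> double_times \<gamma>" "s0 \<noteq> t0" "\<gamma> s0 = \<gamma> t0" by (rule double_timesE)
    then obtain s t where st: "s \<in> double_times \<gamma>" "t \<in> double_times \<gamma>" "s < t" "\<gamma> s = \<gamma> t"
      using t0 by (metis linorder_neqE_linordered_idom)
    define p where "p = \<gamma> s"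
    have p: "\<gamma> s = p" "\<gamma> t = p" using st by (auto simp: p_def)
    obtain A B \<tau>A \<tau>B a a' b b' where cut:
      "piece \<gamma> v A \<tau>A {s..<t}" "piece \<gamma> v B \<tau>B ({t..<1} \<union> {0..<s})" "\<tau>A 0 = s" "\<tau>B 0 = t"
      "a > 0" "(A has_vector_derivative a *\<^sub>R v s) (at_right 0)" "a' > 0" "(A has_vector_derivative a' *\<^sub>R v t) (at_left 1)"
      "b > 0" "(B has_vector_derivative b *\<^sub>R v t) (at_right 0)" "b' > 0" "(B has_vector_derivative b' *\<^sub>R v s) (at_left 1)"
      "\<And>z. z \<notin> path_image A \<Longrightarrow> z \<notin> path_image B \<Longrightarrow> wind \<gamma> z = wind A z + wind B z"
      using cut_at_node[OF less.prems(1) st] by metis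
    define IA where "IA = {s..<t}"
    define IB where "IB = {t..<1} \<union> {0..<s}"
    have pc: "piece \<gamma> v A \<tau>A IA" "piece \<gamma> v B \<tau>B IB" using cut(1,2) by (simp_all add: IA_def IB_def)
    have r: "0 < s" "t < 1" using st \<gamma>(5) by (auto simp: double_times_def less_le)
    have I: "IA \<union> IB = {0..<1}" "IA \<inter> IB = {}" "s \<in> IA" "t \<in> IB" using r st(3) by (auto simp: IA_def IB_def)
    have imA: "path_image A = \<gamma> ` IA" and imB: "path_image B = \<gamma> ` IB"
      using piece_path_image[OF less.prems(1)] pc by auto
    have im\<gamma>: "path_image \<gamma> = path_image A \<union> path_image B"
      unfolding imA imB image_Un[symmetric] I(1) by (rule path_image_closed[OF \<gamma>(2)])
    define NA where "NA = A ` double_times A"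
    define NB where "NB = B ` double_times B"
    define N where "N = \<gamma> ` double_times \<gamma>"
    define Q where "Q = path_image A \<inter> path_image B - {p}"
    have A: "path A" "A 1 = A 0" and B: "path B" "B 1 = B 0" using pc by (auto simp: piece_def)
    have Aeq: "A u = \<gamma> (\<tau>A u)" and \<tau>A: "\<tau>A u \<in> IA" if "u \<in> {0..<1}" for u
      using pc(1) that by (auto simp: piece_def bij_betw_def)
    have Beq: "B u = \<gamma> (\<tau>B u)" and \<tau>B: "\<tau>B u \<in> IB" if "u \<in> {0..<1}" for u
      using pc(2) that unfolding piece_def bij_betw_def by blast+
    have inj: "inj_on \<tau>A {0..<1}" "inj_on \<tau>B {0..<1}" using pc by (auto simp: piece_def bij_betw_def)
    have A0: "A 0 = p" "A 1 = p" and B0: "B 0 = p" "B 1 = p"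
      using Aeq[of 0] Beq[of 0] cut(3,4) A(2) B(2) p by auto
    have uniq: "x = s \<or> x = t" if "x \<in> {0..<1}" "\<gamma> x = p" for x
      using at_most_doubleD[OF \<gamma>(4), of x s t] that st r p by auto
    have triple: "x = y \<or> y = z \<or> x = z" if "x \<in> {0..<1}" "y \<in> {0..<1}" "z \<in> {0..<1}" "\<gamma> x = \<gamma> y" "\<gamma> y = \<gamma> z" for x y z
      using at_most_doubleD[OF \<gamma>(4) that] .
    have NAeq: "NA = {\<gamma> x | x y. x \<in> IA \<and> y \<in> IA \<and> x \<noteq> y \<and> \<gamma> x = \<gamma> y}"
      and NBeq: "NB = {\<gamma> x | x y. x \<in> IB \<and> y \<in> IB \<and> x \<noteq> y \<and> \<gamma> x = \<gamma> y}"
      unfolding NA_def NB_def using piece_nodes[OF less.prems(1)] pc by auto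
    \<comment> \<open>A node of one piece that lies on the other piece would be a triple point of
      \<open>\<gamma>\<close>.\<close>
    have NA_B: "NA \<inter> path_image B = {}"
    proof (rule ccontr)
      assume "NA \<inter> path_image B \<noteq> {}"
      then obtain q where q: "q \<in> NA" "q \<in> path_image B" by blast
      obtain x y where xy: "x \<in> IA" "y \<in> IA" "x \<noteq> y" "\<gamma> x = \<gamma> y" "q = \<gamma> x" using q(1) unfolding NAeq by blast
      obtain z where z: "z \<in> IB" "q = \<gamma> z" using q(2) unfolding imB by blast
      have i: "x \<in> {0..<1}" "y \<in> {0..<1}" "z \<in> {0..<1}" using xy z I(1) by blast+
      have "x \<noteq> z" "y \<noteq> z" using xy z I(2) by blast+
      then show False using triple[OF i] xy z by metis
    qed
    have NB_A: "NB \<inter> path_image A = {}"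
    proof (rule ccontr)
      assume "NB \<inter> path_image A \<noteq> {}"
      then obtain q where q: "q \<in> NB" "q \<in> path_image A" by blast
      obtain x y where xy: "x \<in> IB" "y \<in> IB" "x \<noteq> y" "\<gamma> x = \<gamma> y" "q = \<gamma> x" using q(1) unfolding NBeq by blast
      obtain z where z: "z \<in> IA" "q = \<gamma> z" using q(2) unfolding imA by blast
      have i: "x \<in> {0..<1}" "y \<in> {0..<1}" "z \<in> {0..<1}" using xy z I(1) by blast+
      have "x \<noteq> z" "y \<noteq> z" using xy z I(2) by blast+
      then show False using triple[OF i] xy z by metis
    qed
    have pAB: "p \<in> path_image A" "p \<in> path_image B" unfolding imA imB using p I(3,4) by (metis imageI)+
    have sub: "NA \<subseteq> path_image A" "NB \<subseteq> path_image B"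
      unfolding NA_def NB_def path_image_def double_times_def by auto
    have N: "N = insert p (NA \<union> NB \<union> Q)"
    proof (intro equalityI subsetI)
      fix q assume "q \<in> N"
      then obtain x where x: "x \<in> double_times \<gamma>" "q = \<gamma> x" by (auto simp: N_def)
      from x(1) obtain y where y: "y \<noteq> x" "\<gamma> y = \<gamma> x" "y \<in> {0..<1}" "x \<in> {0..<1}" by (rule double_timesE)
      have "x \<in> IA \<union> IB" "y \<in> IA \<union> IB" unfolding I(1) using y(3,4) by simp_all
      then consider "x \<in> IA" "y \<in> IA" | "x \<in> IB" "y \<in> IB" | "x \<in> IA" "y \<in> IB" | "x \<in> IB" "y \<in> IA" by blast
      then show "q \<in> insert p (NA \<union> NB \<union> Q)"
      proof cases
        case 1
        have "q \<in> NA" unfolding NAeq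
          by (intro CollectI exI[of _ x] exI[of _ y]) (use 1 x(2) y(1,2) in simp)
        then show ?thesis by simp
      next
        case 2
        have "q \<in> NB" unfolding NBeq
          by (intro CollectI exI[of _ x] exI[of _ y]) (use 2 x(2) y(1,2) in simp)
        then show ?thesis by simp
      next
        case 3
        then have "q \<in> path_image A" "q \<in> path_image B" unfolding imA imB using x(2) y(2) by (metis imageI)+
        then show ?thesis by (cases "q = p") (simp_all add: Q_def)
      next
        case 4
        then have "q \<in> path_image A" "q \<in> path_image B" unfolding imA imB using x(2) y(2) by (metis imageI)+
        then show ?thesis by (cases "q = p") (simp_all add: Q_def)
      qed
    next
      fix q assume q: "q \<in> insert p (NA \<union> NB \<union> Q)"
      have "\<exists>x y. x \<in> {0..<1} \<and> y \<in> {0..<1} \<and> x \<noteq> y \<and> \<gamma> x = q \<and> \<gamma> y = q"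
      proof -
        consider "q = p" | "q \<in> NA" | "q \<in> NB" | "q \<in> Q" using q by blast
        then show ?thesis
        proof cases
          case 1 then show ?thesis using p st r by (intro exI[of _ s] exI[of _ t]) auto
        next
          case 2
          then obtain x y where "x \<in> IA" "y \<in> IA" "x \<noteq> y" "\<gamma> x = \<gamma> y" "q = \<gamma> x" unfolding NAeq by blast
          moreover from this have "x \<in> {0..<1}" "y \<in> {0..<1}" using I(1) by blast+
          ultimately show ?thesis by metis
        next
          case 3
          then obtain x y where "x \<in> IB" "y \<in> IB" "x \<noteq> y" "\<gamma> x = \<gamma> y" "q = \<gamma> x" unfolding NBeq by blast
          moreover from this have "x \<in> {0..<1}" "y \<in> {0..<1}" using I(1) by blast+
          ultimately show ?thesis by metis
        next
          case 4 then obtain x y where "x \<in> IA" "y \<in> IB" "q = \<gamma> x" "q = \<gamma> y" unfolding Q_def imA imB by blast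
          moreover from this have "x \<in> {0..<1}" "y \<in> {0..<1}" "x \<noteq> y" using I(1,2) by blast+
          ultimately show ?thesis by metis
        qed
      qed
      then obtain x y where "x \<in> {0..<1}" "y \<in> {0..<1}" "x \<noteq> y" "\<gamma> x = q" "\<gamma> y = q" by blast
      then show "q \<in> N" unfolding N_def using double_timesI[of x y \<gamma>] by (intro image_eqI[of _ _ y]) auto
    qed
    have disj: "p \<notin> NA" "p \<notin> NB" "p \<notin> Q" "NA \<inter> NB = {}" "NA \<inter> Q = {}" "NB \<inter> Q = {}"
      using NA_B NB_A pAB sub unfolding Q_def by blast+
    have finN: "finite N" unfolding N_def using \<gamma>(3) by simp
    then have fin: "finite NA" "finite NB" "finite Q" unfolding N by auto
    have sumN: "sum f N = f p + sum f NA + sum f NB + sum f Q" for f :: "complex \<Rightarrow> real"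
    proof -
      have "sum f N = f p + sum f ((NA \<union> NB) \<union> Q)" unfolding N using fin disj by (subst sum.insert) auto
      also have "sum f ((NA \<union> NB) \<union> Q) = sum f (NA \<union> NB) + sum f Q" using fin disj by (intro sum.union_disjoint) auto
      also have "sum f (NA \<union> NB) = sum f NA + sum f NB" using fin disj by (intro sum.union_disjoint) auto
      finally show ?thesis by simp
    qed
    have cardN: "real (card N) = 1 + real (card NA) + real (card NB) + real (card Q)"
      using sumN[of "\<lambda>_. 1"] by simp

    obtain vA where vA: "nodal A vA" "\<And>u. u \<in> double_times A \<Longrightarrow> \<exists>c>0. vA u = c *\<^sub>R v (\<tau>A u)"
      using piece_nodal[OF less.prems(1) pc(1)] by blast
    obtain vB where vB: "nodal B vB" "\<And>u. u \<in> double_times B \<Longrightarrow> \<exists>c>0. vB u = c *\<^sub>R v (\<tau>B u)"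
      using piece_nodal[OF less.prems(1) pc(2)] by blast
    have NAfin: "finite (double_times A)" "at_most_double A" "0 \<notin> double_times A"
      and NBfin: "finite (double_times B)" "at_most_double B" "0 \<notin> double_times B"
      using vA(1) vB(1) by (auto simp: nodal_def)
    \<comment> \<open>A node of \<open>A\<close> is off \<open>B\<close>, where
      \<open>wind B\<close> is locally constant; removing that constant from the mean index of
      \<open>\<gamma>\<close> leaves the mean index of \<open>A\<close>.\<close>
    define MA where "MA q = M q - wind B q" for q
    define MB where "MB q = M q - wind A q" for q
    have idx: "cindex X q [x, y] (M q - wind Y q)"
      if "path Y" "Y 1 = Y 0" "q \<notin> path_image Y" "cindex \<gamma> q [x, y] (M q)"
        "path_image X \<subseteq> path_image \<gamma>" "path_image Y \<subseteq> path_image \<gamma>"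
        "\<And>z. z \<notin> path_image X \<Longrightarrow> z \<notin> path_image Y \<Longrightarrow> wind \<gamma> z = wind X z + wind Y z" for X Y q x y
      unfolding cindex_def
    proof (intro allI impI)
      fix d assume "\<forall>v\<in>set [x, y]. Im (d / v) \<noteq> 0"
      then have "\<forall>\<^sub>F z in dirf q d. z \<notin> path_image \<gamma> \<and> wind \<gamma> z = M q + (\<Sum>v\<leftarrow>[x, y]. sgn (Im (d / v))) / 2"
        using that(4) unfolding cindex_def by blast
      moreover have "\<forall>\<^sub>F z in dirf q d. wind Y z = wind Y q"
        using loc_const_eventually[OF compact_path_image[OF that(1)] loc_const_wind[OF that(1,2), of "\<lambda>x. x"] that(3) tendsto_dirf] .
      ultimately show "\<forall>\<^sub>F z in dirf q d. z \<notin> path_image X \<and> wind X z = M q - wind Y q + (\<Sum>v\<leftarrow>[x, y]. sgn (Im (d / v))) / 2"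
      proof eventually_elim
        case (elim z)
        have "z \<notin> path_image X" "z \<notin> path_image Y" using elim that(5,6) by auto
        then show ?case using elim that(7)[of z] by simp
      qed
    qed
    have cut13': "wind \<gamma> z = wind B z + wind A z" if "z \<notin> path_image B" "z \<notin> path_image A" for z
      using cut(13)[OF that(2,1)] by simp
    have MA: "node_index A vA MA"
      unfolding node_index_def
    proof (intro ballI impI)
      fix x y assume xy: "x \<in> double_times A" "y \<in> double_times A" "x \<noteq> y \<and> A x = A y"
      have i: "x \<in> {0..<1}" "y \<in> {0..<1}" using xy by (auto simp: double_times_def)
      have dd: "\<tau>A x \<in> double_times \<gamma>" "\<tau>A y \<in> double_times \<gamma>" using piece_double_times[OF less.prems(1) pc(1)] xy by auto
      have "\<tau>A x \<noteq> \<tau>A y" "\<gamma> (\<tau>A x) = \<gamma> (\<tau>A y)" using xy i inj(1) Aeq by (auto simp: inj_on_def)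
      then have "cindex \<gamma> (A x) [v (\<tau>A x), v (\<tau>A y)] (M (A x))"
        using less.prems(2) dd Aeq[OF i(1)] unfolding node_index_def by metis
      moreover obtain c c' where "c > 0" "c' > 0" "vA x = c *\<^sub>R v (\<tau>A x)" "vA y = c' *\<^sub>R v (\<tau>A y)" using vA(2) xy by metis
      ultimately have "cindex \<gamma> (A x) [vA x, vA y] (M (A x))" using cindex_scale2 by metis
      moreover have "A x \<notin> path_image B" using NA_B xy(1) by (auto simp: NA_def)
      ultimately show "cindex A (A x) [vA x, vA y] (MA (A x))" unfolding MA_def
        using B im\<gamma> cut(13) by (intro idx[of B]) auto
    qed
    have MB: "node_index B vB MB"
      unfolding node_index_def
    proof (intro ballI impI)
      fix x y assume xy: "x \<in> double_times B" "y \<in> double_times B" "x \<noteq> y \<and> B x = B y"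
      have i: "x \<in> {0..<1}" "y \<in> {0..<1}" using xy by (auto simp: double_times_def)
      have dd: "\<tau>B x \<in> double_times \<gamma>" "\<tau>B y \<in> double_times \<gamma>" using piece_double_times[OF less.prems(1) pc(2)] xy by auto
      have "\<tau>B x \<noteq> \<tau>B y" "\<gamma> (\<tau>B x) = \<gamma> (\<tau>B y)" using xy i inj(2) Beq by (auto simp: inj_on_def)
      then have "cindex \<gamma> (B x) [v (\<tau>B x), v (\<tau>B y)] (M (B x))"
        using less.prems(2) dd Beq[OF i(1)] unfolding node_index_def by metis
      moreover obtain c c' where "c > 0" "c' > 0" "vB x = c *\<^sub>R v (\<tau>B x)" "vB y = c' *\<^sub>R v (\<tau>B y)" using vB(2) xy by metis
      ultimately have "cindex \<gamma> (B x) [vB x, vB y] (M (B x))" using cindex_scale2 by metis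
      moreover have "B x \<notin> path_image A" using NB_A xy(1) by (auto simp: NB_def)
      ultimately show "cindex B (B x) [vB x, vB y] (MB (B x))" unfolding MB_def
        using A im\<gamma> cut13' by (intro idx[of A]) auto
    qed

    \<comment> \<open>One record per crossing: the two parameters, the velocities and the mean
      indices of both branches.\<close>
    have cross: "\<exists>D. case D of (xA, xB, wA, wB, mA, mB) \<Rightarrow> xA \<in> {0<..<1} \<and> xB \<in> {0<..<1} \<and> A xA = q \<and> B xB = q \<and>
        (A has_vector_derivative wA) (at xA) \<and> (B has_vector_derivative wB) (at xB) \<and> Im (wB / wA) \<noteq> 0 \<and>
        cindex A q [wA] mA \<and> cindex B q [wB] mB \<and> (\<forall>u\<in>{0..1}. A u = q \<longrightarrow> u = xA) \<and> (\<forall>u\<in>{0..1}. B u = q \<longrightarrow> u = xB) \<and>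
        M q = mA + mB" if q: "q \<in> Q" for q
    proof -
      have qp: "q \<noteq> p" using q by (simp add: Q_def)
      obtain x y where "x \<in> IA" "y \<in> IB" "q = \<gamma> x" "q = \<gamma> y" using q unfolding Q_def imA imB by blast
      then have xy: "x \<in> IA" "y \<in> IB" "\<gamma> x = q" "\<gamma> y = q" by auto
      have ne: "x \<noteq> y" using xy I(2) by blast
      have xd: "x \<in> double_times \<gamma>" "y \<in> double_times \<gamma>"
      proof -
        have i: "x \<in> {0..<1}" "y \<in> {0..<1}" using xy(1,2) I(1) by blast+
        have "\<gamma> x = \<gamma> y" using xy by simp
        then show "x \<in> double_times \<gamma>" "y \<in> double_times \<gamma>"
          using double_timesI[OF i(2,1) ne[symmetric]] double_timesI[OF i(1,2) ne] by simp_all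
      qed
      obtain xA where xA: "xA \<in> {0..<1}" "\<tau>A xA = x" using pc(1) xy(1) unfolding piece_def bij_betw_def by blast
      obtain xB where xB: "xB \<in> {0..<1}" "\<tau>B xB = y" using pc(2) xy(2) unfolding piece_def bij_betw_def by blast
      have Aq: "A xA = q" "B xB = q" using Aeq[OF xA(1)] Beq[OF xB(1)] xA xB xy by simp_all
      have pos: "xA \<in> {0<..<1}" "xB \<in> {0<..<1}" using xA xB Aq A0 B0 qp by (auto simp: less_le)
      obtain c where c: "c > 0" "(A has_vector_derivative c *\<^sub>R v x) (at xA)"
        using pc(1) pos(1) xd(1) xA(2) unfolding piece_def by blast
      obtain c' where c': "c' > 0" "(B has_vector_derivative c' *\<^sub>R v y) (at xB)"
        using pc(2) pos(2) xd(2) xB(2) unfolding piece_def by blast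
      have Im0: "Im (v y / v x) \<noteq> 0" using ind[OF xd ne] xy by simp
      then have nz: "v x \<noteq> 0" "v y \<noteq> 0" by auto
      have Im1: "Im ((c' *\<^sub>R v y) / (c *\<^sub>R v x)) \<noteq> 0" using Im_divide_scale[of c' "v y" c "v x"] c c' Im0 by simp
      have uA: "u = xA" if "u \<in> {0..1}" "A u = q" for u
      proof -
        have u: "u \<in> {0..<1}" using that A0 qp by (auto simp: less_le)
        have "\<tau>A u \<in> {0..<1}" "x \<in> {0..<1}" "y \<in> {0..<1}" "\<tau>A u \<noteq> y" using \<tau>A[OF u] xy(1,2) I(1,2) by blast+
        moreover have "\<gamma> (\<tau>A u) = \<gamma> x" "\<gamma> x = \<gamma> y" using Aeq[OF u] that(2) xy by simp_all
        ultimately have "\<tau>A u = x" using triple ne by metis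
        then show ?thesis using inj(1) u xA by (auto simp: inj_on_def)
      qed
      have uB: "u = xB" if "u \<in> {0..1}" "B u = q" for u
      proof -
        have u: "u \<in> {0..<1}" using that B0 qp by (auto simp: less_le)
        have "\<tau>B u \<in> {0..<1}" "x \<in> {0..<1}" "y \<in> {0..<1}" "\<tau>B u \<noteq> x" using \<tau>B[OF u] xy(1,2) I(1,2) by blast+
        moreover have "\<gamma> (\<tau>B u) = \<gamma> x" "\<gamma> x = \<gamma> y" using Beq[OF u] that(2) xy by simp_all
        ultimately have "\<tau>B u = y" using triple ne by metis
        then show ?thesis using inj(2) u xB by (auto simp: inj_on_def)
      qed
      have "{u\<in>{0..1}. A u = q} = {xA}" "{u\<in>{0..1}. B u = q} = {xB}" using uA uB pos Aq by auto
      then have lists: "sorted_list_of_set {u\<in>{0..1}. A u = q} = [xA]" "sorted_list_of_set {u\<in>{0..1}. B u = q} = [xB]"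
        and fins: "finite {u\<in>{0..1}. A u = q}" "finite {u\<in>{0..1}. B u = q}" by simp_all
      have "\<exists>m. has_index A q (map (\<lambda>_. c *\<^sub>R v x) (sorted_list_of_set {u\<in>{0..1}. A u = q})) m"
        by (rule has_index_exists[OF A(1) fins(1)]) (use A0 qp uA c nz in auto)
      then obtain nA where nA: "cindex A q [c *\<^sub>R v x] nA"
        unfolding lists using has_index_imp_cindex[OF A] by auto
      have "\<exists>m. has_index B q (map (\<lambda>_. c' *\<^sub>R v y) (sorted_list_of_set {u\<in>{0..1}. B u = q})) m"
        by (rule has_index_exists[OF B(1) fins(2)]) (use B0 qp uB c' nz in auto)
      then obtain nB where nB: "cindex B q [c' *\<^sub>R v y] nB"
        unfolding lists using has_index_imp_cindex[OF B] by auto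
      have "M q = nA + nB"
      proof -
        \<comment> \<open>In the direction \<open>?a + ?b\<close>, between the two branches, their
          half-jumps have opposite signs. There \<open>wind \<gamma>\<close> is both
          \<open>M q\<close> and \<open>nA + nB\<close>.\<close>
        let ?a = "c *\<^sub>R v x" and ?b = "c' *\<^sub>R v y"
        have "cindex \<gamma> q [v x, v y] (M q)" using less.prems(2) xd ne xy unfolding node_index_def by metis
        then have nG: "cindex \<gamma> q [?a, ?b] (M q)" using cindex_scale2 c c' by blast
        have nz': "?a \<noteq> 0" "?b \<noteq> 0" using nz c c' by auto
        have da: "(?a + ?b) / ?a = 1 + ?b / ?a" "(?a + ?b) / ?b = ?a / ?b + 1"
        proof -
          have "(k + l) / k = 1 + l / k" "(l + k) / k = l / k + 1" if "k \<noteq> 0" for k l :: complex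
            using that by (simp_all add: add_divide_distrib)
          then show "(?a + ?b) / ?a = 1 + ?b / ?a" "(?a + ?b) / ?b = ?a / ?b + 1" using nz' by blast+
        qed
        have Ia: "Im ((?a + ?b) / ?a) = Im (?b / ?a)" and Ib: "Im ((?a + ?b) / ?b) = Im (?a / ?b)"
          unfolding da by simp_all
        have sw: "sgn (Im (?a / ?b)) = - sgn (Im (?b / ?a))" by (rule sgn_Im_swap)
        then have Im2: "Im (?a / ?b) \<noteq> 0" using Im1 by (metis sgn_0_0 neg_equal_0_iff_equal)
        have "\<forall>\<^sub>F z in dirf q (?a + ?b). z \<notin> path_image A \<and> wind A z = nA + sgn (Im (?b / ?a)) / 2"
          using cindexD[OF nA, of "?a + ?b"] Im1 Ia by simp
        moreover have "\<forall>\<^sub>F z in dirf q (?a + ?b). z \<notin> path_image B \<and> wind B z = nB - sgn (Im (?b / ?a)) / 2"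
          using cindexD[OF nB, of "?a + ?b"] Im2 Ib sw by simp
        ultimately have e1: "\<forall>\<^sub>F z in dirf q (?a + ?b). True \<and> wind \<gamma> z = nA + nB"
          by eventually_elim (use cut(13) in auto)
        have "\<forall>\<^sub>F z in dirf q (?a + ?b). z \<notin> path_image \<gamma> \<and> wind \<gamma> z = M q"
        proof -
          have "Im ((?a + ?b) / w) \<noteq> 0" if "w \<in> set [?a, ?b]" for w
          proof -
            have "w = ?a \<or> w = ?b" using that by simp
            then show ?thesis using Im1 Im2 Ia Ib by metis
          qed
          from cindexD[OF nG this] show ?thesis using Ia Ib sw by simp
        qed
        from eventually_const_unique[OF this e1] show ?thesis .
      qed
      then show ?thesis using pos Aq c(2) c'(2) Im1 nA nB uA uB
        by (intro exI[of _ "(xA, xB, c *\<^sub>R v x, c' *\<^sub>R v y, nA, nB)"]) auto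
    qed
    then obtain xA xB wA wB mA mB where Qd: "\<And>q. q \<in> Q \<Longrightarrow> xA q \<in> {0<..<1} \<and> xB q \<in> {0<..<1} \<and> A (xA q) = q \<and> B (xB q) = q \<and>
        (A has_vector_derivative wA q) (at (xA q)) \<and> (B has_vector_derivative wB q) (at (xB q)) \<and> Im (wB q / wA q) \<noteq> 0 \<and>
        cindex A q [wA q] (mA q) \<and> cindex B q [wB q] (mB q) \<and> (\<forall>u\<in>{0..1}. A u = q \<longrightarrow> u = xA q) \<and> (\<forall>u\<in>{0..1}. B u = q \<longrightarrow> u = xB q) \<and>
        M q = mA q + mB q"
    proof -
      have "\<forall>q\<in>Q. \<exists>D. case D of (xA, xB, wA, wB, mA, mB) \<Rightarrow> xA \<in> {0<..<1} \<and> xB \<in> {0<..<1} \<and> A xA = q \<and> B xB = q \<and>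
        (A has_vector_derivative wA) (at xA) \<and> (B has_vector_derivative wB) (at xB) \<and> Im (wB / wA) \<noteq> 0 \<and>
        cindex A q [wA] mA \<and> cindex B q [wB] mB \<and> (\<forall>u\<in>{0..1}. A u = q \<longrightarrow> u = xA) \<and> (\<forall>u\<in>{0..1}. B u = q \<longrightarrow> u = xB) \<and>
        M q = mA + mB" using cross by blast
      from bchoice[OF this] obtain D where D: "\<forall>q\<in>Q. case D q of (xA, xB, wA, wB, mA, mB) \<Rightarrow> xA \<in> {0<..<1} \<and> xB \<in> {0<..<1} \<and> A xA = q \<and> B xB = q \<and>
        (A has_vector_derivative wA) (at xA) \<and> (B has_vector_derivative wB) (at xB) \<and> Im (wB / wA) \<noteq> 0 \<and>
        cindex A q [wA] mA \<and> cindex B q [wB] mB \<and> (\<forall>u\<in>{0..1}. A u = q \<longrightarrow> u = xA) \<and> (\<forall>u\<in>{0..1}. B u = q \<longrightarrow> u = xB) \<and>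
        M q = mA + mB" by blast
      show thesis
        by (rule that[of "\<lambda>q. fst (D q)" "\<lambda>q. fst (snd (D q))" "\<lambda>q. fst (snd (snd (D q)))" "\<lambda>q. fst (snd (snd (snd (D q))))"
            "\<lambda>q. fst (snd (snd (snd (snd (D q)))))" "\<lambda>q. snd (snd (snd (snd (snd (D q)))))"])
          (use D in \<open>auto simp: case_prod_beta\<close>)
    qed
    define \<sigma> where "\<sigma> q = sgn (Im (wB q / wA q))" for q
    have \<sigma>: "\<sigma> q = 1 \<or> \<sigma> q = - 1" if "q \<in> Q" for q using Qd[OF that] by (auto simp: \<sigma>_def sgn_if)

    have st_ind: "Im (v t / v s) \<noteq> 0" "Im (v s / v t) \<noteq> 0" using ind[of s t] ind[of t s] st by auto
    have vnz: "v s \<noteq> 0" "v t \<noteq> 0" using st_ind by auto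
    have onlyp: "u = 0 \<or> u = 1" if "u \<in> {0..1}" "A u = p" for u
    proof (rule ccontr)
      assume "\<not> (u = 0 \<or> u = 1)"
      then have u: "u \<in> {0..<1}" "u \<noteq> 0" using that by auto
      have "\<tau>A u \<in> {0..<1}" "\<tau>A u \<noteq> t" using \<tau>A[OF u(1)] I by blast+
      then have "\<tau>A u = s" using uniq[of "\<tau>A u"] Aeq[OF u(1)] that(2) by auto
      then show False using inj(1) u cut(3) by (auto simp: inj_on_def)
    qed
    have onlypB: "u = 0 \<or> u = 1" if "u \<in> {0..1}" "B u = p" for u
    proof (rule ccontr)
      assume "\<not> (u = 0 \<or> u = 1)"
      then have u: "u \<in> {0..<1}" "u \<noteq> 0" using that by auto
      have "\<tau>B u \<in> {0..<1}" "\<tau>B u \<noteq> s" using \<tau>B[OF u(1)] I by blast+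
      then have "\<tau>B u = t" using uniq[of "\<tau>B u"] Beq[OF u(1)] that(2) by auto
      then show False using inj(2) u cut(4) by (auto simp: inj_on_def)
    qed
    have Im_sum: "Im ((v s + v t) / v s) = Im (v t / v s)" "Im ((v s + v t) / v t) = Im (v s / v t)"
      using vnz by (simp_all add: add_divide_distrib)
    \<comment> \<open>\<open>B\<close> arrives from direction \<open>- v s\<close> and leaves in
      direction \<open>v t\<close>. By \<open>corner_sector\<close> both lie in one sector of the
      corner of \<open>A\<close>, so \<open>B\<close> does not cross \<open>A\<close> at
      \<open>p\<close>. The third direction \<open>v s + v t\<close> allows a comparison with the
      mean index \<open>M p\<close>.\<close>
    obtain KA where KA: "\<forall>\<^sub>F z in dirf p (- (b' *\<^sub>R v s)). z \<notin> path_image A \<and> wind A z = KA"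
       "\<forall>\<^sub>F z in dirf p (b *\<^sub>R v t). z \<notin> path_image A \<and> wind A z = KA"
       "\<forall>\<^sub>F z in dirf p (v s + v t). z \<notin> path_image A \<and> wind A z = KA"
    proof -
      have "Im ((a' *\<^sub>R v t) / (a *\<^sub>R v s)) \<noteq> 0" unfolding Im_divide_scale using st_ind cut(5,7) by simp
      moreover have "A x \<noteq> p" if "x \<in> {0<..<1}" for x using onlyp[of x] that by auto
      ultimately obtain k where k: "\<And>d. d = - (a *\<^sub>R v s) \<or> Im (d / (a *\<^sub>R v s)) * Im ((a' *\<^sub>R v t) / (a *\<^sub>R v s)) > 0 \<Longrightarrow>
          \<forall>\<^sub>F z in dirf p d. z \<notin> path_image A \<and> wind A z = k"
        using corner_sector[OF A(1) A0 _ cut(6,8)] by blast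
      have pos: "Im (v t / v s) * Im (v t / v s) > 0" using st_ind not_real_square_gt_zero by blast
      have sc: "- (b' *\<^sub>R v s) = (b' / a) *\<^sub>R (- (a *\<^sub>R v s))" using cut(5) by simp
      have 1: "\<forall>\<^sub>F z in dirf p (- (b' *\<^sub>R v s)). z \<notin> path_image A \<and> wind A z = k"
        unfolding sc by (rule eventually_dirf_scale[OF k]) (use cut(5,11) in auto)
      have 2: "\<forall>\<^sub>F z in dirf p (b *\<^sub>R v t). z \<notin> path_image A \<and> wind A z = k"
      proof (rule k, rule disjI2)
        have "Im (b *\<^sub>R v t / a *\<^sub>R v s) * Im (a' *\<^sub>R v t / a *\<^sub>R v s) = (b / a * (a' / a)) * (Im (v t / v s) * Im (v t / v s))"
          unfolding Im_divide_scale by (simp add: mult_ac)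
        also have "\<dots> > 0" by (rule mult_pos_pos[OF _ pos]) (use cut(5,7,9) in simp)
        finally show "Im (b *\<^sub>R v t / a *\<^sub>R v s) * Im (a' *\<^sub>R v t / a *\<^sub>R v s) > 0" .
      qed
      have 3: "\<forall>\<^sub>F z in dirf p (v s + v t). z \<notin> path_image A \<and> wind A z = k"
      proof (rule k, rule disjI2)
        have "Im ((v s + v t) / (a *\<^sub>R v s)) = 1 / a * Im (v t / v s)"
          using Im_divide_scale[of 1 "v s + v t" a "v s"] Im_sum(1) by simp
        then have "Im ((v s + v t) / (a *\<^sub>R v s)) * Im (a' *\<^sub>R v t / a *\<^sub>R v s) = (1 / a * (a' / a)) * (Im (v t / v s) * Im (v t / v s))"
          unfolding Im_divide_scale by (simp add: mult_ac)
        also have "\<dots> > 0" by (rule mult_pos_pos[OF _ pos]) (use cut(5,7,9) in simp)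
        finally show "Im ((v s + v t) / (a *\<^sub>R v s)) * Im (a' *\<^sub>R v t / a *\<^sub>R v s) > 0" .
      qed
      show thesis by (rule that[OF 1 2 3])
    qed
    obtain KB where KB: "\<forall>\<^sub>F z in dirf p (- (a' *\<^sub>R v t)). z \<notin> path_image B \<and> wind B z = KB"
       "\<forall>\<^sub>F z in dirf p (v s + v t). z \<notin> path_image B \<and> wind B z = KB"
    proof -
      have "Im ((b' *\<^sub>R v s) / (b *\<^sub>R v t)) \<noteq> 0" unfolding Im_divide_scale using st_ind cut(9,11) by simp
      moreover have "B x \<noteq> p" if "x \<in> {0<..<1}" for x using onlypB[of x] that by auto
      ultimately obtain k where k: "\<And>d. d = - (b *\<^sub>R v t) \<or> Im (d / (b *\<^sub>R v t)) * Im ((b' *\<^sub>R v s) / (b *\<^sub>R v t)) > 0 \<Longrightarrow>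
          \<forall>\<^sub>F z in dirf p d. z \<notin> path_image B \<and> wind B z = k"
        using corner_sector[OF B(1) B0 _ cut(10,12)] by blast
      have pos: "Im (v s / v t) * Im (v s / v t) > 0" using st_ind not_real_square_gt_zero by blast
      have sc: "- (a' *\<^sub>R v t) = (a' / b) *\<^sub>R (- (b *\<^sub>R v t))" using cut(9) by simp
      have 1: "\<forall>\<^sub>F z in dirf p (- (a' *\<^sub>R v t)). z \<notin> path_image B \<and> wind B z = k"
        unfolding sc by (rule eventually_dirf_scale[OF k]) (use cut(7,9) in auto)
      have 3: "\<forall>\<^sub>F z in dirf p (v s + v t). z \<notin> path_image B \<and> wind B z = k"
      proof (rule k, rule disjI2)
        have "Im ((v s + v t) / (b *\<^sub>R v t)) = 1 / b * Im (v s / v t)"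
          using Im_divide_scale[of 1 "v s + v t" b "v t"] Im_sum(2) by simp
        then have "Im ((v s + v t) / (b *\<^sub>R v t)) * Im (b' *\<^sub>R v s / b *\<^sub>R v t) = (1 / b * (b' / b)) * (Im (v s / v t) * Im (v s / v t))"
          unfolding Im_divide_scale by (simp add: mult_ac)
        also have "\<dots> > 0" by (rule mult_pos_pos[OF _ pos]) (use cut(9,11) in simp)
        finally show "Im ((v s + v t) / (b *\<^sub>R v t)) * Im (b' *\<^sub>R v s / b *\<^sub>R v t) > 0" .
      qed
      show thesis by (rule that[OF 1 3])
    qed
    have Mp: "M p = KA + KB"
    proof -
      have ci: "cindex \<gamma> p [v s, v t] (M p)" using less.prems(2) st p less_imp_neq[OF st(3)] unfolding node_index_def by metis
      then have "\<forall>\<^sub>F z in dirf p (v s + v t). z \<notin> path_image \<gamma> \<and> wind \<gamma> z = M p + (sgn (Im (v t / v s)) + sgn (Im (v s / v t))) / 2"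
      proof -
        have "Im ((v s + v t) / w) \<noteq> 0" if "w \<in> set [v s, v t]" for w
        proof -
          have "w = v s \<or> w = v t" using that by simp
          then show ?thesis using Im_sum st_ind by metis
        qed
        from cindexD[OF ci this] show ?thesis using Im_sum by simp
      qed
      then have e1: "\<forall>\<^sub>F z in dirf p (v s + v t). z \<notin> path_image \<gamma> \<and> wind \<gamma> z = M p"
        using sgn_Im_swap[of "v s" "v t"] by simp
      have "\<forall>\<^sub>F z in dirf p (v s + v t). True \<and> wind \<gamma> z = KA + KB"
        using KA(3) KB(2) by eventually_elim (use cut(13) in auto)
      from eventually_const_unique[OF e1 this] show ?thesis .
    qed

    have PA: "compact (path_image A)" "path_connected (path_image A)" "finite (components (- path_image A))" "loc_const (wind A) (path_image A)"
      using A NAfin compact_path_image path_connected_path_image finite_components_closed_curve(1)[OF A] loc_const_wind[OF A, of "\<lambda>x. x"] by auto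
    have PB: "compact (path_image B)" "path_connected (path_image B)" "finite (components (- path_image B))" "loc_const (wind B) (path_image B)"
      using B NBfin compact_path_image path_connected_path_image finite_components_closed_curve(1)[OF B] loc_const_wind[OF B, of "\<lambda>x. x"] by auto
    have AB: "path_image A \<inter> path_image B = insert p Q" using pAB by (auto simp: Q_def)
    have finH: "finite {u\<in>{0..<1}. B u \<in> path_image A}" "finite {u\<in>{0..<1}. A u \<in> path_image B}"
    proof -
      have "{u\<in>{0..<1}. B u \<in> path_image A} \<subseteq> insert 0 (xB ` Q)"
      proof
        fix u assume "u \<in> {u\<in>{0..<1}. B u \<in> path_image A}"
        then have u: "u \<in> {0..<1}" "B u \<in> path_image A \<inter> path_image B" by (auto simp: path_image_def)
        then have u: "u \<in> {0..<1}" "B u \<in> insert p Q" unfolding AB by auto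
        show "u \<in> insert 0 (xB ` Q)"
        proof (cases "B u = p")
          case True then show ?thesis using onlypB[of u] u by auto
        next
          case False
          then have "B u \<in> Q" using u by simp
          moreover have "u \<in> {0..1}" using u(1) by simp
          ultimately have "u = xB (B u)" using Qd by blast
          then show ?thesis using \<open>B u \<in> Q\<close> by (metis image_eqI insertCI)
        qed
      qed
      then show "finite {u\<in>{0..<1}. B u \<in> path_image A}" using fin(3) by (meson finite_imageI finite_insert finite_subset)
      have "{u\<in>{0..<1}. A u \<in> path_image B} \<subseteq> insert 0 (xA ` Q)"
      proof
        fix u assume "u \<in> {u\<in>{0..<1}. A u \<in> path_image B}"
        then have u: "u \<in> {0..<1}" "A u \<in> path_image A \<inter> path_image B" by (auto simp: path_image_def)
        then have u: "u \<in> {0..<1}" "A u \<in> insert p Q" unfolding AB by auto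
        show "u \<in> insert 0 (xA ` Q)"
        proof (cases "A u = p")
          case True then show ?thesis using onlyp[of u] u by auto
        next
          case False
          then have "A u \<in> Q" using u by simp
          moreover have "u \<in> {0..1}" using u(1) by simp
          ultimately have "u = xA (A u)" using Qd by blast
          then show ?thesis using \<open>A u \<in> Q\<close> by (metis image_eqI insertCI)
        qed
      qed
      then show "finite {u\<in>{0..<1}. A u \<in> path_image B}" using fin(3) by (meson finite_imageI finite_insert finite_subset)
    qed
    \<comment> \<open>\<open>gb\<close> and \<open>ga\<close> are the values of
      \<open>wind A\<close> just before and just after \<open>B\<close> meets \<open>A\<close>;
      \<open>hb\<close> is the value of \<open>wind B\<close> just before \<open>A\<close> meets
      \<open>B\<close>. The sign in \<open>hb\<close> is opposite because exchanging the curves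
      reverses the orientation of the crossing.\<close>
    define gb where "gb q = (if q = p then KA else mA q - \<sigma> q / 2)" for q
    define ga where "ga q = (if q = p then KA else mA q + \<sigma> q / 2)" for q
    define hb where "hb q = (if q = p then KB else mB q + \<sigma> q / 2)" for q
    have evF: "\<forall>\<^sub>F u in F. f (\<delta> u) = (k::real)" if "\<forall>\<^sub>F z in dirf q d. z \<notin> X \<and> f z = k" "filterlim \<delta> (dirf q d) F"
      for f :: "complex \<Rightarrow> real" and \<delta> :: "real \<Rightarrow> complex" and F q d k X
    proof -
      have "\<forall>\<^sub>F z in dirf q d. f z = k" using that(1) by (rule eventually_mono) simp
      then show ?thesis using that(2) by (rule eventually_compose_filterlim)
    qed
    have befA: "\<forall>\<^sub>F u in at_left x. wind A (B u) = gb (B x)" if x: "x \<in> {0<..1}" "B x \<in> path_image A" for x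
    proof (cases "B x = p")
      case True
      then have "x = 1" using onlypB[of x] x by auto
      have "filterlim B (dirf p (- (b' *\<^sub>R v s))) (at_left 1)" using filterlim_dirf_left[OF cut(12)] B0 by simp
      then show ?thesis using evF[OF KA(1)] True \<open>x = 1\<close> by (simp add: gb_def)
    next
      case False
      define q where "q = B x"
      have "q \<in> path_image B" using x by (auto simp: q_def path_image_def)
      then have q: "q \<in> Q" using x(2) False by (auto simp: Q_def q_def)
      have xq: "x = xB q" using Qd[OF q] x(1) q_def by auto
      have "filterlim B (dirf q (- wB q)) (at_left x)"
        using filterlim_dirf_left[of B "wB q" x] Qd[OF q] unfolding xq by (metis has_vector_derivative_at_within)
      moreover have "Im (- wB q / wA q) = - Im (wB q / wA q)" by simp
      then have "\<forall>\<^sub>F z in dirf q (- wB q). z \<notin> path_image A \<and> wind A z = mA q - \<sigma> q / 2"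
        using cindexD[of A q "[wA q]" "mA q" "- wB q"] Qd[OF q] by (simp add: \<sigma>_def sgn_minus)
      ultimately show ?thesis using evF False unfolding gb_def q_def[symmetric] by simp
    qed
    have aftA: "\<forall>\<^sub>F u in at_right x. wind A (B u) = ga (B x)" if x: "x \<in> {0..<1}" "B x \<in> path_image A" for x
    proof (cases "B x = p")
      case True
      then have "x = 0" using onlypB[of x] x by auto
      have "filterlim B (dirf p (b *\<^sub>R v t)) (at_right 0)" using filterlim_dirf_right[OF cut(10)] B0 by simp
      then show ?thesis using evF[OF KA(2)] True \<open>x = 0\<close> by (simp add: ga_def)
    next
      case False
      define q where "q = B x"
      have "q \<in> path_image B" using x by (auto simp: q_def path_image_def)
      then have q: "q \<in> Q" using x(2) False by (auto simp: Q_def q_def)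
      have xq: "x = xB q" using Qd[OF q] x(1) q_def by auto
      have "filterlim B (dirf q (wB q)) (at_right x)"
        using filterlim_dirf_right[of B "wB q" x] Qd[OF q] unfolding xq by (metis has_vector_derivative_at_within)
      moreover have "\<forall>\<^sub>F z in dirf q (wB q). z \<notin> path_image A \<and> wind A z = mA q + \<sigma> q / 2"
        using cindexD[of A q "[wA q]" "mA q" "wB q"] Qd[OF q] by (simp add: \<sigma>_def)
      ultimately show ?thesis using evF False unfolding ga_def q_def[symmetric] by simp
    qed
    have befB: "\<forall>\<^sub>F u in at_left x. wind B (A u) = hb (A x)" if x: "x \<in> {0<..1}" "A x \<in> path_image B" for x
    proof (cases "A x = p")
      case True
      then have "x = 1" using onlyp[of x] x by auto
      have "filterlim A (dirf p (- (a' *\<^sub>R v t))) (at_left 1)" using filterlim_dirf_left[OF cut(8)] A0 by simp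
      then show ?thesis using evF[OF KB(1)] True \<open>x = 1\<close> by (simp add: hb_def)
    next
      case False
      define q where "q = A x"
      have "q \<in> path_image A" using x by (auto simp: q_def path_image_def)
      then have q: "q \<in> Q" using x(2) False by (auto simp: Q_def q_def)
      have xq: "x = xA q" using Qd[OF q] x(1) q_def by auto
      have "filterlim A (dirf q (- wA q)) (at_left x)"
        using filterlim_dirf_left[of A "wA q" x] Qd[OF q] unfolding xq by (metis has_vector_derivative_at_within)
      moreover have "Im (- wA q / wB q) = - Im (wA q / wB q)" by simp
      moreover have "sgn (Im (wA q / wB q)) = - \<sigma> q" unfolding \<sigma>_def by (rule sgn_Im_swap)
      moreover then have "Im (wA q / wB q) \<noteq> 0" using \<sigma>[OF q] by auto
      ultimately have "\<forall>\<^sub>F z in dirf q (- wA q). z \<notin> path_image B \<and> wind B z = mB q + \<sigma> q / 2"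
        and "filterlim A (dirf q (- wA q)) (at_left x)"
        using cindexD[of B q "[wB q]" "mB q" "- wA q"] Qd[OF q] by (simp_all add: sgn_minus)
      then show ?thesis using evF False unfolding hb_def q_def[symmetric] by simp
    qed
    have EA: "csum (wind A) (path_image \<gamma>) = csum (wind A) (path_image A) + (\<Sum>q\<in>NB. wind A q) + (\<Sum>q\<in>insert p Q. gb q)"
      using csum_closed_curve(2)[OF PA B(1) _ B(2) NBfin(1,2) _ finH(1) befA] B0 pAB NB_A
      unfolding im\<gamma> AB NB_def by simp
    have EB: "csum (wind B) (path_image \<gamma>) = csum (wind B) (path_image B) + (\<Sum>q\<in>NA. wind B q) + (\<Sum>q\<in>insert p Q. hb q)"
      using csum_closed_curve(2)[OF PB A(1) _ A(2) NAfin(1,2) _ finH(2) befB] A0 pAB NA_B AB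
      unfolding im\<gamma> NA_def by (simp add: Un_commute Int_commute)
    \<comment> \<open>The terms at \<open>p\<close> and the means are the same on both sides, so
      what this says is that the crossing signs add up to zero.\<close>
    have before_after: "(\<Sum>q\<in>insert p Q. gb q) = (\<Sum>q\<in>insert p Q. ga q)"
      using before_after_sum[OF PA B(1) _ B(2) NBfin(1,2) _ finH(1) befA aftA] B0 pAB NB_A
      unfolding AB NB_def by simp
    have sums: "(\<Sum>q\<in>insert p Q. gb q) = KA + (\<Sum>q\<in>Q. mA q) - (\<Sum>q\<in>Q. \<sigma> q) / 2"
       "(\<Sum>q\<in>insert p Q. ga q) = KA + (\<Sum>q\<in>Q. mA q) + (\<Sum>q\<in>Q. \<sigma> q) / 2"
       "(\<Sum>q\<in>insert p Q. hb q) = KB + (\<Sum>q\<in>Q. mB q) + (\<Sum>q\<in>Q. \<sigma> q) / 2"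
    proof -
      have "(\<Sum>q\<in>Q. gb q) = (\<Sum>q\<in>Q. mA q - \<sigma> q / 2)" "(\<Sum>q\<in>Q. ga q) = (\<Sum>q\<in>Q. mA q + \<sigma> q / 2)"
        "(\<Sum>q\<in>Q. hb q) = (\<Sum>q\<in>Q. mB q + \<sigma> q / 2)"
        by (rule sum.cong; use disj(3) in \<open>auto simp: gb_def ga_def hb_def\<close>)+
      then show "(\<Sum>q\<in>insert p Q. gb q) = KA + (\<Sum>q\<in>Q. mA q) - (\<Sum>q\<in>Q. \<sigma> q) / 2"
       "(\<Sum>q\<in>insert p Q. ga q) = KA + (\<Sum>q\<in>Q. mA q) + (\<Sum>q\<in>Q. \<sigma> q) / 2"
       "(\<Sum>q\<in>insert p Q. hb q) = KB + (\<Sum>q\<in>Q. mB q) + (\<Sum>q\<in>Q. \<sigma> q) / 2"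
        using fin(3) disj(3) by (simp_all add: gb_def ga_def hb_def sum.distrib sum_subtractf sum_divide_distrib)
    qed
    have \<sigma>0: "(\<Sum>q\<in>Q. \<sigma> q) = 0" using before_after unfolding sums by simp
    have evenQ: "even (card Q)" by (rule sum_signs_zero_imp_even[OF fin(3) \<sigma> \<sigma>0])
    have W: "csum (wind \<gamma>) (path_image \<gamma>) = csum (wind A) (path_image \<gamma>) + csum (wind B) (path_image \<gamma>)"
      by (rule csum_add) (use cut(13) im\<gamma> in auto)
    have MN: "sum M N = KA + KB + (sum MA NA + (\<Sum>q\<in>NA. wind B q)) + (sum MB NB + (\<Sum>q\<in>NB. wind A q)) + ((\<Sum>q\<in>Q. mA q) + (\<Sum>q\<in>Q. mB q))"
    proof -
      have "sum M Q = (\<Sum>q\<in>Q. mA q + mB q)" using Qd by (intro sum.cong) auto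
      then show ?thesis unfolding sumN Mp MA_def MB_def by (simp add: sum_subtractf sum.distrib)
    qed
    have cardlt: "card NA < card N" "card NB < card N" using cardN by linarith+
    obtain k1 where k1: "csum (wind A) (path_image A) - sum MA NA + card NA + 1 = 2 * of_int k1"
      using less.hyps[OF _ vA(1) MA] cardlt(1) unfolding NA_def N_def by blast
    obtain k2 where k2: "csum (wind B) (path_image B) - sum MB NB + card NB + 1 = 2 * of_int k2"
      using less.hyps[OF _ vB(1) MB] cardlt(2) unfolding NB_def N_def by blast
    obtain j where j: "card Q = 2 * j" using evenQ by (rule evenE)
    \<comment> \<open>The formula contains a single \<open>+ 1\<close>, the two pieces contain one
      each: the second comes from the node \<open>p\<close>, which is counted in
      \<open>card N\<close> but is a node of neither piece.\<close>
    have "csum (wind \<gamma>) (path_image \<gamma>) - sum M N + card N + 1 = 2 * of_int (k1 + k2 + int j)"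
      unfolding W EA EB sums MN \<sigma>0 cardN using k1 k2 j by simp
    then show ?thesis unfolding N_def by blast
  qed
qed

section \<open>Generic curves and pairs\<close>

definition vel :: "(real \<Rightarrow> complex) \<Rightarrow> real \<Rightarrow> complex" where
  "vel S t = vector_derivative S (at t)"

text \<open>An immersion of class C^1. Continuity of the velocity makes the curve locally injective,
  which keeps double times from accumulating at the diagonal.\<close>

definition reg_curve :: "(real \<Rightarrow> complex) \<Rightarrow> bool" where
  "reg_curve S \<longleftrightarrow> (\<forall>t. S (t + 1) = S t) \<and> (\<forall>t. (S has_vector_derivative vel S t) (at t)) \<and>
     continuous_on UNIV (vel S) \<and> (\<forall>t. vel S t \<noteq> 0)"

text \<open>Stated for all real parameters modulo \<open>\<int>\<close> instead of \<open>{0..<1}\<close>, the conditions are stable under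
  shifts of the base point and under reversal.\<close>

definition generic_curve :: "(real \<Rightarrow> complex) \<Rightarrow> bool" where
  "generic_curve S \<longleftrightarrow> reg_curve S \<and>
     (\<forall>s t. S s = S t \<and> s - t \<notin> \<int> \<longrightarrow> Im (vel S s / vel S t) \<noteq> 0) \<and>
     (\<forall>s t u. S s = S t \<and> S t = S u \<longrightarrow> s - t \<in> \<int> \<or> t - u \<in> \<int> \<or> s - u \<in> \<int>)"

definition generic_pair :: "(real \<Rightarrow> complex) \<Rightarrow> (real \<Rightarrow> complex) \<Rightarrow> bool" where
  "generic_pair S T \<longleftrightarrow> generic_curve S \<and> generic_curve T \<and>
     (\<forall>s t. S s = T t \<longrightarrow> Im (vel S s / vel T t) \<noteq> 0) \<and>
     (\<forall>s t u. S s = S t \<and> S t = T u \<longrightarrow> s - t \<in> \<int>) \<and>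
     (\<forall>s t u. T s = T t \<and> T t = S u \<longrightarrow> s - t \<in> \<int>)"

lemma Im_divide_sym_ne: "Im (a / b) \<noteq> 0 \<longleftrightarrow> Im (b / a) \<noteq> (0::real)"
  using sgn_Im_swap[of a b] by (metis neg_equal_0_iff_equal sgn_zero_iff)

lemma generic_pair_sym: "generic_pair S T \<Longrightarrow> generic_pair T S"
  unfolding generic_pair_def by (metis Im_divide_sym_ne)

lemma periodic_of_int:
  assumes "\<And>t::real. f (t + 1) = f t" shows "f (t + of_int k) = f t"
proof -
  have n: "f (t + of_nat n) = f t" for n t
  proof (induction n)
    case (Suc n)
    have "t + of_nat (Suc n) = (t + of_nat n) + 1" by simp
    then show ?case using assms[of "t + of_nat n"] Suc by metis
  qed simp
  show ?thesis
  proof (cases "k \<ge> 0")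
    case True
    then show ?thesis using n[of t "nat k"] by simp
  next
    case False
    then show ?thesis using n[of "t + of_int k" "nat (- k)"] by simp
  qed
qed

lemma periodic_Ints:
  assumes "\<And>t::real. f (t + 1) = f t" "s - t \<in> \<int>" shows "f s = f t"
proof -
  obtain k where "s - t = of_int k" using assms(2) by (auto elim: Ints_cases)
  then have "s = t + of_int k" by simp
  then show ?thesis using periodic_of_int[of f t k] assms(1) by simp
qed

section \<open>Regular closed curves under shift and reversal\<close>

context
  fixes S :: "real \<Rightarrow> complex"
  assumes S: "reg_curve S"
begin

lemma reg_periodic: "S (t + 1) = S t" and reg_deriv: "(S has_vector_derivative vel S t) (at t)"
  and reg_cont_vel: "continuous_on UNIV (vel S)" and reg_nonzero: "vel S t \<noteq> 0"
  using S by (auto simp: reg_curve_def)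

lemma reg_cont: "continuous_on X S"
  using reg_deriv by (meson continuous_at_imp_continuous_on has_vector_derivative_continuous)

lemma reg_path: "path S" unfolding path_def by (rule reg_cont)

lemma reg_closed: "S 1 = S 0" using reg_periodic[of 0] by simp

lemma reg_shift_deriv: "((\<lambda>t. S (t + c)) has_vector_derivative vel S (t + c)) (at t)"
  using has_vector_derivative_affine[of S "vel S (t + c)" 1 t c] reg_deriv by simp

lemma vel_shift: "vel (\<lambda>t. S (t + c)) t = vel S (t + c)"
  unfolding vel_def[of "\<lambda>t. S (t + c)"] by (rule vector_derivative_at[OF reg_shift_deriv])

lemma vel_periodic: "vel S (t + 1) = vel S t"
proof -
  have "(\<lambda>t. S (t + 1)) = S" using reg_periodic by auto
  then show ?thesis using vel_shift[of 1 t] by simp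
qed

lemma reg_shift: "reg_curve (\<lambda>t. S (t + c))"
  unfolding reg_curve_def vel_shift[abs_def]
proof (intro conjI allI)
  show "S (t + 1 + c) = S (t + c)" for t using reg_periodic[of "t + c"] by (simp add: add_ac)
  show "continuous_on UNIV (\<lambda>t. vel S (t + c))"
    by (rule continuous_on_compose2[OF reg_cont_vel]) (auto intro!: continuous_intros)
qed (use reg_shift_deriv reg_nonzero in auto)

lemma reg_frac: "S (frac t) = S t" "vel S (frac t) = vel S t"
  using periodic_Ints[of S "frac t" t] periodic_Ints[of "vel S" "frac t" t] reg_periodic vel_periodic
  by (auto simp: frac_def)

lemma reg_path_image: "path_image S = range S"
proof
  show "range S \<subseteq> path_image S"
  proof
    fix z assume "z \<in> range S"
    then obtain t where "z = S (frac t)" using reg_frac by auto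
    then show "z \<in> path_image S" unfolding path_image_def using frac_ge_0[of t] frac_lt_1[of t] by auto
  qed
qed (auto simp: path_image_def)

lemma reg_reverse_deriv: "(reversepath S has_vector_derivative - vel S (1 - t)) (at t)"
  using has_vector_derivative_affine[of S "vel S (1 - t)" "-1" t 1] reg_deriv[of "1 - t"]
  by (simp add: reversepath_def[abs_def])

lemma vel_reverse: "vel (reversepath S) t = - vel S (1 - t)"
  unfolding vel_def[of "reversepath S"] by (rule vector_derivative_at[OF reg_reverse_deriv])

lemma reg_reverse: "reg_curve (reversepath S)"
  unfolding reg_curve_def vel_reverse[abs_def]
proof (intro conjI allI)
  show "reversepath S (t + 1) = reversepath S t" for t
    using reg_periodic[of "- t"] by (simp add: reversepath_def)
  show "continuous_on UNIV (\<lambda>t. - vel S (1 - t))"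
    by (intro continuous_intros continuous_on_compose2[OF reg_cont_vel]) auto
qed (use reg_reverse_deriv reg_nonzero in auto)

lemma winding_number_shift:
  assumes "c \<in> {0..1}" "z \<notin> path_image S"
  shows "winding_number (\<lambda>t. S (t + c)) z = winding_number S z"
proof -
  have "winding_number (\<lambda>t. S (t + c)) z = winding_number (shiftpath c S) z"
  proof (rule winding_number_cong)
    fix t :: real
    show "S (t + c) = shiftpath c S t"
      using reg_periodic[of "c + t - 1"] by (simp add: shiftpath_def add.commute)
  qed
  also have "\<dots> = winding_number S z"
    using assms reg_path reg_closed by (intro winding_number_shiftpath) (auto simp: pathstart_def pathfinish_def)
  finally show ?thesis .
qed

text \<open>Measured along the tangent at \<open>t0\<close>, the curve moves forward: the real part
  of \<open>S / v\<close> has positive derivative near \<open>t0\<close> by continuity of the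
  velocity.\<close>

lemma reg_locally_inj: "\<exists>\<epsilon>>0. \<forall>s t. \<bar>s - t0\<bar> < \<epsilon> \<longrightarrow> \<bar>t - t0\<bar> < \<epsilon> \<longrightarrow> S s = S t \<longrightarrow> s = t"
proof -
  define v where "v = vel S t0"
  have "v \<noteq> 0" using reg_nonzero by (simp add: v_def)
  have "isCont (vel S) t0" using reg_cont_vel by (simp add: continuous_on_eq_continuous_at)
  then have "isCont (\<lambda>u. Re (vel S u / v)) t0" using \<open>v \<noteq> 0\<close> unfolding isCont_def by (intro tendsto_intros)
  moreover have "Re (vel S t0 / v) > 0" using \<open>v \<noteq> 0\<close> by (simp add: v_def)
  ultimately have "\<forall>\<^sub>F u in at t0. Re (vel S u / v) > 0" unfolding isCont_def by (rule order_tendstoD)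
  then obtain \<epsilon> where e: "\<epsilon> > 0" "\<And>u. u \<noteq> t0 \<Longrightarrow> dist u t0 < \<epsilon> \<Longrightarrow> Re (vel S u / v) > 0"
    unfolding eventually_at by auto
  have pos: "Re (vel S u / v) > 0" if "\<bar>u - t0\<bar> < \<epsilon>" for u
    using e(2)[of u] that \<open>Re (vel S t0 / v) > 0\<close> by (cases "u = t0") (auto simp: dist_real_def)
  have der: "((\<lambda>u. Re (S u / v)) has_real_derivative Re (vel S u / v)) (at u)" for u
  proof -
    have "((\<lambda>u. S u / v) has_vector_derivative vel S u / v) (at u)"
      using reg_deriv by (intro has_vector_derivative_divide)
    then show ?thesis
      unfolding has_real_derivative_iff_has_vector_derivative
      by (rule bounded_linear.has_vector_derivative[OF bounded_linear_Re])
  qed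
  have lt: "S s \<noteq> S t" if "\<bar>s - t0\<bar> < \<epsilon>" "\<bar>t - t0\<bar> < \<epsilon>" "s < t" for s t
  proof -
    have "Re (S s / v) < Re (S t / v)"
    proof (rule DERIV_pos_imp_increasing[OF that(3)])
      fix x assume "s \<le> x" "x \<le> t"
      then have "\<bar>x - t0\<bar> < \<epsilon>" using that by auto
      then show "\<exists>y. ((\<lambda>u. Re (S u / v)) has_real_derivative y) (at x) \<and> 0 < y" using der pos by blast
    qed
    then show ?thesis by auto
  qed
  show ?thesis using e(1) lt by (intro exI[of _ \<epsilon>]) (metis linorder_neqE_linordered_idom)
qed

end

section \<open>Finiteness of double points and crossings\<close>

lemma transverse_isolated:
  fixes \<gamma> \<delta> :: "real \<Rightarrow> complex"
  assumes "(\<gamma> has_vector_derivative v) (at s0)" "(\<delta> has_vector_derivative w) (at t0)"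
    and "Im (v / w) \<noteq> 0" "\<gamma> s0 = \<delta> t0"
  shows "\<exists>\<epsilon>>0. \<forall>s t. \<bar>s - s0\<bar> < \<epsilon> \<longrightarrow> \<bar>t - t0\<bar> < \<epsilon> \<longrightarrow> \<gamma> s = \<delta> t \<longrightarrow> s = s0 \<and> t = t0"
proof -
  have nz: "v \<noteq> 0" "w \<noteq> 0" and Im': "Im (w / v) \<noteq> 0" using assms(3) Im_divide_sym_ne by auto
  have bound: "\<bar>h\<bar> * (\<bar>Im (x / y)\<bar> * norm y) \<le> norm (h *\<^sub>R x - k *\<^sub>R y)" if "y \<noteq> 0" for h k and x y :: complex
  proof -
    have "(h *\<^sub>R x - k *\<^sub>R y) / y = h *\<^sub>R (x / y) - of_real k" using that by (simp add: diff_divide_distrib scaleR_conv_of_real)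
    then have "\<bar>h * Im (x / y)\<bar> \<le> norm ((h *\<^sub>R x - k *\<^sub>R y) / y)" using abs_Im_le_cmod[of "(h *\<^sub>R x - k *\<^sub>R y) / y"] by simp
    then show ?thesis using that by (simp add: norm_divide abs_mult field_simps)
  qed
  \<comment> \<open>By transversality \<open>norm (h *\<^sub>R v - k *\<^sub>R w)\<close> is at
    least \<open>4 * c * \<bar>h\<bar>\<close> and at least \<open>4 * c * \<bar>k\<bar>\<close>. At
    a second coincidence the first-order errors bound it by
    \<open>c * (\<bar>h\<bar> + \<bar>k\<bar>)\<close>, which forces
    \<open>h = k = 0\<close>.\<close>
  define c where "c = min (\<bar>Im (v / w)\<bar> * norm w) (\<bar>Im (w / v)\<bar> * norm v) / 4"
  have "c > 0" using assms(3) Im' nz by (simp add: c_def)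
  obtain d1 where d1: "d1 > 0" "\<And>s. norm (s - s0) < d1 \<Longrightarrow> norm (\<gamma> s - \<gamma> s0 - (s - s0) *\<^sub>R v) \<le> c * norm (s - s0)"
    using assms(1) \<open>c > 0\<close> unfolding has_vector_derivative_def has_derivative_at_alt by metis
  obtain d2 where d2: "d2 > 0" "\<And>t. norm (t - t0) < d2 \<Longrightarrow> norm (\<delta> t - \<delta> t0 - (t - t0) *\<^sub>R w) \<le> c * norm (t - t0)"
    using assms(2) \<open>c > 0\<close> unfolding has_vector_derivative_def has_derivative_at_alt by metis
  have "s = s0 \<and> t = t0" if st: "\<bar>s - s0\<bar> < min d1 d2" "\<bar>t - t0\<bar> < min d1 d2" "\<gamma> s = \<delta> t" for s t
  proof -
    let ?h = "s - s0" and ?k = "t - t0"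
    have "norm (?h *\<^sub>R v - ?k *\<^sub>R w) \<le> c * \<bar>?h\<bar> + c * \<bar>?k\<bar>"
    proof -
      have "?h *\<^sub>R v - ?k *\<^sub>R w = (\<delta> t - \<delta> t0 - ?k *\<^sub>R w) - (\<gamma> s - \<gamma> s0 - ?h *\<^sub>R v)"
        using st(3) assms(4) by simp
      also have "norm \<dots> \<le> norm (\<delta> t - \<delta> t0 - ?k *\<^sub>R w) + norm (\<gamma> s - \<gamma> s0 - ?h *\<^sub>R v)" by (rule norm_triangle_ineq4)
      also have "\<dots> \<le> c * \<bar>?k\<bar> + c * \<bar>?h\<bar>" using d1(2)[of s] d2(2)[of t] st by (intro add_mono) auto
      finally show ?thesis by simp
    qed
    moreover have "\<bar>?h\<bar> * (4 * c) \<le> norm (?h *\<^sub>R v - ?k *\<^sub>R w)"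
    proof -
      have "\<bar>?h\<bar> * (4 * c) \<le> \<bar>?h\<bar> * (\<bar>Im (v / w)\<bar> * norm w)" by (rule mult_left_mono) (auto simp: c_def)
      then show ?thesis using bound[OF nz(2), of ?h v ?k] by linarith
    qed
    moreover have "\<bar>?k\<bar> * (4 * c) \<le> norm (?h *\<^sub>R v - ?k *\<^sub>R w)"
    proof -
      have "\<bar>?k\<bar> * (4 * c) \<le> \<bar>?k\<bar> * (\<bar>Im (w / v)\<bar> * norm v)" by (rule mult_left_mono) (auto simp: c_def)
      then show ?thesis using bound[OF nz(1), of ?k w ?h] by (simp add: norm_minus_commute)
    qed
    ultimately have "4 * (\<bar>?h\<bar> * c) \<le> \<bar>?h\<bar> * c + \<bar>?k\<bar> * c" "4 * (\<bar>?k\<bar> * c) \<le> \<bar>?h\<bar> * c + \<bar>?k\<bar> * c"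
      by (simp_all add: mult_ac)
    moreover have "\<bar>?h\<bar> * c \<ge> 0" "\<bar>?k\<bar> * c \<ge> 0" using \<open>c > 0\<close> by auto
    ultimately have "\<bar>?h\<bar> * c = 0" "\<bar>?k\<bar> * c = 0" by linarith+
    then show ?thesis using \<open>c > 0\<close> by simp
  qed
  then show ?thesis using d1(1) d2(1) by (intro exI[of _ "min d1 d2"]) auto
qed

text \<open>Infinitely many pairs would accumulate somewhere in the compact square, and the
  assumption at the accumulation point rules this out.\<close>

lemma finite_isolated_pairs:
  fixes B :: "(real \<times> real) set"
  assumes "\<And>s0 t0. \<exists>\<epsilon>>0. \<forall>s t. \<bar>s - s0\<bar> < \<epsilon> \<longrightarrow> \<bar>t - t0\<bar> < \<epsilon> \<longrightarrow> (s, t) \<in> B \<longrightarrow> s = s0 \<and> t = t0"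
  shows "finite (({0..1} \<times> {0..1}) \<inter> B)"
proof (rule finite_not_islimpt_in_compact)
  show "compact ({0..1::real} \<times> {0..1::real})" by (intro compact_Times) auto
  fix z :: "real \<times> real"
  obtain s0 t0 where z: "z = (s0, t0)" by (cases z)
  obtain \<epsilon> where e: "\<epsilon> > 0" "\<And>s t. \<bar>s - s0\<bar> < \<epsilon> \<Longrightarrow> \<bar>t - t0\<bar> < \<epsilon> \<Longrightarrow> (s, t) \<in> B \<Longrightarrow> s = s0 \<and> t = t0"
    using assms[of s0 t0] by metis
  show "\<not> z islimpt B"
  proof
    assume "z islimpt B"
    then obtain y where y: "y \<in> B" "y \<noteq> z" "dist y z < \<epsilon>" using e(1) unfolding islimpt_approachable by blast
    obtain s t where st: "y = (s, t)" by (cases y)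
    have "\<bar>s - s0\<bar> < \<epsilon>" "\<bar>t - t0\<bar> < \<epsilon>"
      using y(3) dist_fst_le[of y z] dist_snd_le[of y z] by (auto simp: st z dist_real_def)
    then show False using e(2) y st z by auto
  qed
qed

lemma distinct_isolated:
  fixes \<gamma> \<delta> :: "real \<Rightarrow> complex"
  assumes "isCont \<gamma> s0" "isCont \<delta> t0" "\<gamma> s0 \<noteq> \<delta> t0"
  shows "\<exists>\<epsilon>>0. \<forall>s t. \<bar>s - s0\<bar> < \<epsilon> \<longrightarrow> \<bar>t - t0\<bar> < \<epsilon> \<longrightarrow> \<gamma> s \<noteq> \<delta> t"
proof -
  define r where "r = dist (\<gamma> s0) (\<delta> t0) / 2"
  have "r > 0" using assms(3) by (simp add: r_def)
  obtain d1 where d1: "d1 > 0" "\<And>s. dist s s0 < d1 \<Longrightarrow> dist (\<gamma> s) (\<gamma> s0) < r"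
    using assms(1) \<open>r > 0\<close> unfolding continuous_at_eps_delta by metis
  obtain d2 where d2: "d2 > 0" "\<And>t. dist t t0 < d2 \<Longrightarrow> dist (\<delta> t) (\<delta> t0) < r"
    using assms(2) \<open>r > 0\<close> unfolding continuous_at_eps_delta by metis
  have "\<gamma> s \<noteq> \<delta> t" if "\<bar>s - s0\<bar> < min d1 d2" "\<bar>t - t0\<bar> < min d1 d2" for s t
  proof
    assume "\<gamma> s = \<delta> t"
    have "dist (\<gamma> s) (\<gamma> s0) < r" "dist (\<delta> t) (\<delta> t0) < r" using d1(2)[of s] d2(2)[of t] that by (auto simp: dist_real_def)
    then have "dist (\<gamma> s0) (\<delta> t0) < r + r"
      using dist_triangle3[of "\<gamma> s0" "\<delta> t0" "\<gamma> s"] \<open>\<gamma> s = \<delta> t\<close> by simp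
    then show False by (simp add: r_def)
  qed
  then show ?thesis using d1(1) d2(1) by (intro exI[of _ "min d1 d2"]) auto
qed

lemma not_Ints_unit_interval: "s \<in> {0..<1} \<Longrightarrow> t \<in> {0..<1} \<Longrightarrow> s \<noteq> t \<Longrightarrow> s - t \<notin> (\<int> :: real set)"
proof
  assume a: "s \<in> {0..<1}" "t \<in> {0..<1}" "s \<noteq> t" "s - t \<in> \<int>"
  then obtain k where k: "s - t = of_int k" by (auto elim: Ints_cases)
  then have "real_of_int k > -1" "real_of_int k < 1" using a by auto
  then have "k = 0" by linarith
  then show False using k a by simp
qed

text \<open>A pair of parameters is isolated from other coincidences for one of three reasons: its
  images differ, the branches are transverse, or the pair lies on an integer translate of the
  diagonal, where local injectivity applies after a shift by that integer.\<close>

lemma finite_double_times: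
  assumes "generic_curve S"
  shows "finite (double_times S)"
proof -
  have S: "reg_curve S" using assms by (simp add: generic_curve_def)
  define B where "B = {(s, t). S s = S t \<and> s - t \<notin> \<int>}"
  have c: "isCont S t" for t using reg_deriv[OF S] has_vector_derivative_continuous by blast
  have "finite (({0..1} \<times> {0..1}) \<inter> B)"
  proof (rule finite_isolated_pairs)
    fix s0 t0
    consider "S s0 \<noteq> S t0" | "S s0 = S t0" "s0 - t0 \<notin> \<int>" | "s0 - t0 \<in> \<int>" by blast
    then show "\<exists>\<epsilon>>0. \<forall>s t. \<bar>s - s0\<bar> < \<epsilon> \<longrightarrow> \<bar>t - t0\<bar> < \<epsilon> \<longrightarrow> (s, t) \<in> B \<longrightarrow> s = s0 \<and> t = t0"
    proof cases
      case 1
      from distinct_isolated[OF c c this] show ?thesis by (auto simp: B_def)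
    next
      case 2
      then have "Im (vel S s0 / vel S t0) \<noteq> 0" using assms by (simp add: generic_curve_def)
      from transverse_isolated[OF reg_deriv[OF S] reg_deriv[OF S] this 2(1)] show ?thesis by (auto simp: B_def)
    next
      case 3
      obtain \<epsilon> where e: "\<epsilon> > 0" "\<And>s t. \<bar>s - s0\<bar> < \<epsilon> \<Longrightarrow> \<bar>t - s0\<bar> < \<epsilon> \<Longrightarrow> S s = S t \<Longrightarrow> s = t"
        using reg_locally_inj[OF S] by metis
      have "(s, t) \<notin> B" if "\<bar>s - s0\<bar> < \<epsilon>" "\<bar>t - t0\<bar> < \<epsilon>" for s t
      proof
        assume "(s, t) \<in> B"
        have "(t + (s0 - t0)) - t \<in> \<int>" using 3 by simp
        from periodic_Ints[of S, OF reg_periodic[OF S] this] have "S (t + (s0 - t0)) = S t" .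
        then have "S s = S (t + (s0 - t0))" using \<open>(s, t) \<in> B\<close> by (simp add: B_def)
        then have "s = t + (s0 - t0)" using e(2)[of s "t + (s0 - t0)"] that by (simp add: algebra_simps)
        then show False using \<open>(s, t) \<in> B\<close> 3 by (simp add: B_def)
      qed
      then show ?thesis using e(1) by blast
    qed
  qed
  moreover have "double_times S \<subseteq> snd ` (({0..1} \<times> {0..1}) \<inter> B)"
  proof
    fix t assume "t \<in> double_times S"
    then obtain s where s: "s \<noteq> t" "S s = S t" "s \<in> {0..<1}" "t \<in> {0..<1}" by (rule double_timesE)
    then have "(s, t) \<in> ({0..1} \<times> {0..1}) \<inter> B" using not_Ints_unit_interval[OF s(3,4,1)] by (auto simp: B_def)
    then show "t \<in> snd ` (({0..1} \<times> {0..1}) \<inter> B)" by (metis image_eqI snd_conv)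
  qed
  ultimately show ?thesis by (meson finite_imageI finite_subset)
qed

lemma finite_crossings:
  assumes "generic_pair S T"
  shows "finite {t\<in>{0..<1}. T t \<in> path_image S}"
proof -
  have S: "reg_curve S" and T: "reg_curve T" using assms by (auto simp: generic_pair_def generic_curve_def)
  define B where "B = {(s, t). S s = T t}"
  have c: "isCont S t" "isCont T t" for t using reg_deriv[OF S] reg_deriv[OF T] has_vector_derivative_continuous by blast+
  have "finite (({0..1} \<times> {0..1}) \<inter> B)"
  proof (rule finite_isolated_pairs)
    fix s0 t0
    show "\<exists>\<epsilon>>0. \<forall>s t. \<bar>s - s0\<bar> < \<epsilon> \<longrightarrow> \<bar>t - t0\<bar> < \<epsilon> \<longrightarrow> (s, t) \<in> B \<longrightarrow> s = s0 \<and> t = t0"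
    proof (cases "S s0 = T t0")
      case False
      from distinct_isolated[OF c(1,2) this] show ?thesis by (auto simp: B_def)
    next
      case True
      then have "Im (vel S s0 / vel T t0) \<noteq> 0" using assms by (simp add: generic_pair_def)
      from transverse_isolated[OF reg_deriv[OF S] reg_deriv[OF T] this True] show ?thesis by (auto simp: B_def)
    qed
  qed
  moreover have "{t\<in>{0..<1}. T t \<in> path_image S} \<subseteq> snd ` (({0..1} \<times> {0..1}) \<inter> B)"
  proof
    fix t assume "t \<in> {t\<in>{0..<1}. T t \<in> path_image S}"
    then obtain s where "s \<in> {0..1}" "S s = T t" "t \<in> {0..<1}" by (auto simp: path_image_def)
    then have "(s, t) \<in> ({0..1} \<times> {0..1}) \<inter> B" by (auto simp: B_def)
    then show "t \<in> snd ` (({0..1} \<times> {0..1}) \<inter> B)" by (metis image_eqI snd_conv)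
  qed
  ultimately show ?thesis by (meson finite_imageI finite_subset)
qed

section \<open>Genericity under shift and reversal\<close>

lemma generic_curve_shift:
  assumes "generic_curve S" shows "generic_curve (\<lambda>t. S (t + c))"
proof -
  have S: "reg_curve S" using assms by (simp add: generic_curve_def)
  have sh: "(x + c) - (y + c) = x - y" for x y by simp
  show ?thesis using assms reg_shift[OF S] unfolding generic_curve_def vel_shift[OF S] by (metis sh)
qed

lemma generic_curve_reverse:
  assumes "generic_curve S" shows "generic_curve (reversepath S)"
proof -
  have S: "reg_curve S" using assms by (simp add: generic_curve_def)
  have sh: "(1 - x) - (1 - y) \<in> \<int> \<longleftrightarrow> x - y \<in> \<int>" for x y :: real
    using Ints_minus[of "x - y"] Ints_minus[of "y - x"] by auto
  show ?thesis unfolding generic_curve_def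
  proof (intro conjI allI impI)
    show "reg_curve (reversepath S)" by (rule reg_reverse[OF S])
    show "Im (vel (reversepath S) s / vel (reversepath S) t) \<noteq> 0" if "reversepath S s = reversepath S t \<and> s - t \<notin> \<int>" for s t
    proof -
      have "S (1 - s) = S (1 - t)" "(1 - s) - (1 - t) \<notin> \<int>" using that sh[of s t] by (auto simp: reversepath_def)
      then have "Im (vel S (1 - s) / vel S (1 - t)) \<noteq> 0" using assms unfolding generic_curve_def by blast
      then show ?thesis by (simp add: vel_reverse[OF S])
    qed
    show "s - t \<in> \<int> \<or> t - u \<in> \<int> \<or> s - u \<in> \<int>" if "reversepath S s = reversepath S t \<and> reversepath S t = reversepath S u" for s t u
      using assms that sh unfolding generic_curve_def reversepath_def by blast
  qed
qed

lemma generic_pair_reverse: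
  assumes "generic_pair S T" shows "generic_pair (reversepath S) T"
proof -
  have S: "generic_curve S" and T: "generic_curve T" using assms by (auto simp: generic_pair_def)
  then have r: "reg_curve S" by (simp add: generic_curve_def)
  have sh: "(1 - x) - (1 - y) \<in> \<int> \<longleftrightarrow> x - y \<in> \<int>" for x y :: real
    using Ints_minus[of "x - y"] Ints_minus[of "y - x"] by auto
  show ?thesis unfolding generic_pair_def
  proof (intro conjI allI impI)
    show "Im (vel (reversepath S) s / vel T t) \<noteq> 0" if "reversepath S s = T t" for s t
    proof -
      have "S (1 - s) = T t" using that by (simp add: reversepath_def)
      then have "Im (vel S (1 - s) / vel T t) \<noteq> 0" using assms unfolding generic_pair_def by blast
      then show ?thesis by (simp add: vel_reverse[OF r])
    qed
    show "s - t \<in> \<int>" if "reversepath S s = reversepath S t \<and> reversepath S t = T u" for s t u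
      using assms that sh unfolding generic_pair_def reversepath_def by blast
    show "s - t \<in> \<int>" if "T s = T t \<and> T t = reversepath S u" for s t u
      using assms that unfolding generic_pair_def reversepath_def by blast
  qed (use generic_curve_reverse[OF S] T in auto)
qed

section \<open>Visits of a point and mean indices\<close>

definition visits :: "(real \<Rightarrow> complex) \<Rightarrow> complex \<Rightarrow> real set" where
  "visits S p = {t\<in>{0..<1}. S t = p}"

lemma path_image_shift:
  assumes "reg_curve S" shows "path_image (\<lambda>t. S (t + c)) = path_image S"
proof -
  have "range S \<subseteq> range (\<lambda>t. S (t + c))"
  proof
    fix z assume "z \<in> range S"
    then obtain t where "z = S ((t - c) + c)" by auto
    then show "z \<in> range (\<lambda>t. S (t + c))" by blast
  qed
  then have "range (\<lambda>t. S (t + c)) = range S" by auto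
  then show ?thesis using reg_path_image[OF assms(1)] reg_path_image[OF reg_shift[OF assms(1)]] by simp
qed

lemma cindex_shift:
  assumes "reg_curve S" "c \<in> {0..1}"
  shows "cindex (\<lambda>t. S (t + c)) p V m \<longleftrightarrow> cindex S p V m"
proof -
  note im = path_image_shift[OF assms(1), of c]
  have w: "wind (\<lambda>t. S (t + c)) z = wind S z" if "z \<notin> path_image S" for z
    unfolding wind_def using winding_number_shift[OF assms(1,2) that] by simp
  have "(\<forall>\<^sub>F z in F. z \<notin> path_image S \<and> wind (\<lambda>t. S (t + c)) z = k) \<longleftrightarrow>
      (\<forall>\<^sub>F z in F. z \<notin> path_image S \<and> wind S z = k)" for F k
  proof -
    have "(z \<notin> path_image S \<and> wind (\<lambda>t. S (t + c)) z = k) = (z \<notin> path_image S \<and> wind S z = k)" for z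
      using w by auto
    then show ?thesis by simp
  qed
  then show ?thesis unfolding cindex_def im by simp
qed

lemma cindex_swap: "cindex S p [v, w] m \<Longrightarrow> cindex S p [w, v] m"
  unfolding cindex_def by (simp add: add.commute)

lemma visits_classes:
  assumes "generic_curve S" "S s = p" "S t = p" "s - t \<notin> \<int>" "S u = p"
  shows "u - s \<in> \<int> \<or> u - t \<in> \<int>"
proof -
  have "s - t \<in> \<int> \<or> t - u \<in> \<int> \<or> s - u \<in> \<int>" using assms unfolding generic_curve_def by metis
  then show ?thesis using assms(4) Ints_minus[of "t - u"] Ints_minus[of "s - u"] by auto
qed

lemma frac_neq: "s - t \<notin> \<int> \<Longrightarrow> frac s \<noteq> frac (t::real)"
proof
  assume a: "s - t \<notin> \<int>" and eq: "frac s = frac t"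
  have "s - t = of_int (\<lfloor>s\<rfloor> - \<lfloor>t\<rfloor>)" using eq by (simp add: frac_def)
  then show False using a by (metis Ints_of_int)
qed

lemma frac_eq_of_Ints: "u - s \<in> \<int> \<Longrightarrow> u \<in> {0..<1} \<Longrightarrow> u = frac (s :: real)"
proof (rule ccontr)
  assume a: "u - s \<in> \<int>" "u \<in> {0..<1}" "u \<noteq> frac s"
  have "u - frac s = (u - s) + of_int \<lfloor>s\<rfloor>" by (simp add: frac_def)
  also have "\<dots> \<in> \<int>" using a(1) by simp
  finally show False using not_Ints_unit_interval[of u "frac s"] a frac_ge_0[of s] frac_lt_1[of s] by simp
qed

text \<open>An index at \<open>p\<close> is constructed for a curve that starts away from
  \<open>p\<close>. If no such start existed, three parameters in one period would already form a
  triple point.\<close>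

lemma base_off:
  assumes "generic_curve S" shows "\<exists>c\<in>{0..<1}. S c \<noteq> p"
proof (rule ccontr)
  assume "\<not> ?thesis"
  then have "S 0 = S (1/3)" "S (1/3) = S (2/3)" by auto
  then have "0 - 1/3 \<in> (\<int>::real set) \<or> 1/3 - 2/3 \<in> (\<int>::real set) \<or> 0 - 2/3 \<in> (\<int>::real set)"
    using assms unfolding generic_curve_def by blast
  then show False
    using not_Ints_unit_interval[of 0 "1/3"] not_Ints_unit_interval[of "1/3" "2/3"] not_Ints_unit_interval[of 0 "2/3"] by auto
qed

lemma generic_cindex_off:
  assumes "generic_curve S" "p \<notin> path_image S"
  shows "cindex S p [] (wind S p)"
  using assms reg_path reg_closed by (intro cindex_Nil_eq) (auto simp: generic_curve_def)

text \<open>Moving the base point to \<open>c\<close>, off \<open>p\<close>, changes neither the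
  image nor the winding numbers.\<close>

lemma generic_cindex_exists:
  assumes S: "generic_curve S" and c: "c \<in> {0..<1}" "S c \<noteq> p"
    and F: "{u\<in>{0..1}. S (u + c) = p} = F" "finite F"
  shows "\<exists>m. cindex S p (map (\<lambda>u. vel S (u + c)) (sorted_list_of_set F)) m"
proof -
  let ?g = "\<lambda>t. S (t + c)"
  have r: "reg_curve S" using S by (simp add: generic_curve_def)
  note rg = reg_shift[OF r, of c]
  have g1: "?g 1 = ?g 0" using reg_closed[OF rg] by simp
  have "\<exists>m. has_index ?g p (map (\<lambda>u. vel S (u + c)) (sorted_list_of_set {u\<in>{0..1}. ?g u = p})) m"
  proof (rule has_index_exists)
    show "path ?g" by (rule reg_path[OF rg])
    show "finite {u\<in>{0..1}. ?g u = p}" unfolding F(1) by (rule F(2))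
    show "?g 0 \<noteq> p" "?g 1 \<noteq> p" using c(2) g1 by simp_all
    show "(?g has_vector_derivative vel S (t + c)) (at t) \<and> vel S (t + c) \<noteq> 0" for t
      using reg_shift_deriv[OF r] reg_nonzero[OF r] by blast
  qed
  then obtain m where "has_index ?g p (map (\<lambda>u. vel S (u + c)) (sorted_list_of_set F)) m" unfolding F(1) by blast
  then have "cindex ?g p (map (\<lambda>u. vel S (u + c)) (sorted_list_of_set F)) (Re m)"
    using has_index_imp_cindex[OF reg_path[OF rg]] g1 by simp
  then show ?thesis using cindex_shift[OF r, of c] c(1) by auto
qed

lemma generic_cindex_single:
  assumes S: "generic_curve S" and t: "S t = p" and uniq: "\<And>u. S u = p \<Longrightarrow> u - t \<in> \<int>"
  shows "\<exists>m. cindex S p [vel S t] m"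
proof -
  have r: "reg_curve S" using S by (simp add: generic_curve_def)
  obtain c where c: "c \<in> {0..<1}" "S c \<noteq> p" using base_off[OF S] by blast
  let ?u = "frac (t - c)"
  have fr: "?u \<in> {0..<1}" using frac_ge_0[of "t - c"] frac_lt_1[of "t - c"] by simp
  have int: "?u + c - t \<in> \<int>" by (simp add: frac_def)
  have F: "{u\<in>{0..1}. S (u + c) = p} = {?u}"
  proof (intro equalityI subsetI)
    fix u assume u: "u \<in> {u\<in>{0..1}. S (u + c) = p}"
    have "u \<noteq> 1" using u c(2) reg_periodic[OF r, of c] by (auto simp: add.commute)
    then have "u \<in> {0..<1}" using u by auto
    moreover have "u - (t - c) \<in> \<int>" using uniq[of "u + c"] u by (simp add: algebra_simps)
    ultimately show "u \<in> {?u}" using frac_eq_of_Ints by blast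
  next
    fix u assume "u \<in> {?u}"
    then show "u \<in> {u\<in>{0..1}. S (u + c) = p}"
      using fr periodic_Ints[of S, OF reg_periodic[OF r] int] t by auto
  qed
  have "vel S (?u + c) = vel S t" by (rule periodic_Ints[of "vel S", OF vel_periodic[OF r] int])
  then show ?thesis using generic_cindex_exists[OF S c F] by simp
qed

lemma generic_cindex_double:
  assumes S: "generic_curve S" and st: "S s = p" "S t = p" "s - t \<notin> \<int>"
  shows "\<exists>m. cindex S p [vel S s, vel S t] m"
proof -
  have r: "reg_curve S" using S by (simp add: generic_curve_def)
  obtain c where c: "c \<in> {0..<1}" "S c \<noteq> p" using base_off[OF S] by blast
  define a where "a = frac (s - c)"
  define b where "b = frac (t - c)"
  have fr: "a \<in> {0..<1}" "b \<in> {0..<1}" unfolding a_def b_def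
    using frac_ge_0[of "t - c"] frac_lt_1[of "t - c"] frac_ge_0[of "s - c"] frac_lt_1[of "s - c"] by simp_all
  have int: "a + c - s \<in> \<int>" "b + c - t \<in> \<int>" by (simp_all add: frac_def a_def b_def)
  have ne: "a \<noteq> b"
  proof
    assume "a = b"
    then have "(b + c - t) - (a + c - s) = s - t" by simp
    then show False using Ints_diff[OF int(2,1)] st(3) by simp
  qed
  have F: "{u\<in>{0..1}. S (u + c) = p} = {a, b}"
  proof (intro equalityI subsetI)
    fix u assume u: "u \<in> {u\<in>{0..1}. S (u + c) = p}"
    have "u \<noteq> 1" using u c(2) reg_periodic[OF r, of c] by (auto simp: add.commute)
    then have "u \<in> {0..<1}" using u by auto
    moreover have "u - (s - c) \<in> \<int> \<or> u - (t - c) \<in> \<int>"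
      using visits_classes[OF S st, of "u + c"] u by (simp add: algebra_simps)
    ultimately show "u \<in> {a, b}" using frac_eq_of_Ints unfolding a_def b_def by blast
  next
    fix u assume "u \<in> {a, b}"
    moreover have "S (a + c) = p" "S (b + c) = p"
      using periodic_Ints[of S, OF reg_periodic[OF r] int(1)] periodic_Ints[of S, OF reg_periodic[OF r] int(2)] st by auto
    ultimately show "u \<in> {u\<in>{0..1}. S (u + c) = p}" using fr by auto
  qed
  have v: "vel S (a + c) = vel S s" "vel S (b + c) = vel S t"
    using periodic_Ints[of "vel S", OF vel_periodic[OF r] int(1)] periodic_Ints[of "vel S", OF vel_periodic[OF r] int(2)] .
  obtain m where m: "cindex S p (map (\<lambda>u. vel S (u + c)) (sorted_list_of_set {a, b})) m"
    using generic_cindex_exists[OF S c F] by blast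
  show ?thesis
  proof (cases "a < b")
    case True
    then have "sorted_list_of_set {a, b} = [a, b]" by simp
    then show ?thesis using m v by auto
  next
    case False
    then have "sorted_list_of_set {a, b} = [b, a]" using ne by (simp add: insert_commute)
    then show ?thesis using m v cindex_swap[of S p "vel S t" "vel S s"] by auto
  qed
qed

text \<open>One function for all points of the plane: the winding number off the curve, the mean of
  the two sides at a simple point, the mean of the four quadrants at a node. Sums over the double
  points of a pair can then be split without regard to their type.\<close>

definition mean_index :: "(real \<Rightarrow> complex) \<Rightarrow> complex \<Rightarrow> real" where
  "mean_index S p = (SOME m. cindex S p (map (vel S) (sorted_list_of_set (visits S p))) m)"

lemma visits_single:
  assumes "reg_curve S" "S t = p" "\<And>u. S u = p \<Longrightarrow> u - t \<in> \<int>"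
  shows "visits S p = {frac t}"
proof (intro equalityI subsetI)
  fix u assume "u \<in> visits S p"
  then show "u \<in> {frac t}" using assms(3)[of u] frac_eq_of_Ints[of u t] by (auto simp: visits_def)
next
  fix u assume "u \<in> {frac t}"
  then show "u \<in> visits S p" using reg_frac[OF assms(1), of t] assms(2) frac_ge_0[of t] frac_lt_1[of t] by (auto simp: visits_def)
qed

lemma visits_double:
  assumes "generic_curve S" "S s = p" "S t = p" "s - t \<notin> \<int>"
  shows "visits S p = {frac s, frac t}" and "frac s \<noteq> frac t"
proof -
  have r: "reg_curve S" using assms(1) by (simp add: generic_curve_def)
  show "visits S p = {frac s, frac t}"
  proof (intro equalityI subsetI)
    fix u assume "u \<in> visits S p"
    then have "u \<in> {0..<1}" "u - s \<in> \<int> \<or> u - t \<in> \<int>" using visits_classes[OF assms, of u] by (auto simp: visits_def)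
    then show "u \<in> {frac s, frac t}" using frac_eq_of_Ints by blast
  next
    fix u assume "u \<in> {frac s, frac t}"
    then show "u \<in> visits S p"
      using reg_frac[OF r] assms(2,3) frac_ge_0 frac_lt_1 by (auto simp: visits_def)
  qed
  show "frac s \<noteq> frac t" by (rule frac_neq[OF assms(4)])
qed

lemma mean_index_off:
  assumes "generic_curve S" "p \<notin> path_image S"
  shows "cindex S p [] (mean_index S p)" and "mean_index S p = wind S p"
proof -
  have "visits S p = {}" using assms(2) by (auto simp: visits_def path_image_def)
  then show c: "cindex S p [] (mean_index S p)"
    using someI[of "cindex S p []", OF generic_cindex_off[OF assms]] by (simp add: mean_index_def)
  have "\<forall>\<^sub>F z in dirf p 1. z \<notin> path_image S \<and> wind S z = mean_index S p" using cindexD[OF c, of 1] by simp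
  moreover have "\<forall>\<^sub>F z in dirf p 1. z \<notin> path_image S \<and> wind S z = wind S p"
    using cindexD[OF generic_cindex_off[OF assms], of 1] by simp
  ultimately show "mean_index S p = wind S p" by (rule eventually_const_unique)
qed

lemma mean_index_single:
  assumes "generic_curve S" "S t = p" "\<And>u. S u = p \<Longrightarrow> u - t \<in> \<int>"
  shows "cindex S p [vel S t] (mean_index S p)"
proof -
  have r: "reg_curve S" using assms(1) by (simp add: generic_curve_def)
  have "visits S p = {frac t}" by (rule visits_single[OF r assms(2)]) (rule assms(3))
  then have "map (vel S) (sorted_list_of_set (visits S p)) = [vel S t]" using reg_frac[OF r] by simp
  moreover have "\<exists>m. cindex S p [vel S t] m" by (rule generic_cindex_single[OF assms(1,2)]) (rule assms(3))
  then have "cindex S p [vel S t] (SOME m. cindex S p [vel S t] m)" by (rule someI_ex)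
  ultimately show ?thesis by (simp add: mean_index_def)
qed

lemma mean_index_double:
  assumes "generic_curve S" "S s = p" "S t = p" "s - t \<notin> \<int>"
  shows "cindex S p [vel S s, vel S t] (mean_index S p)"
proof -
  have r: "reg_curve S" using assms(1) by (simp add: generic_curve_def)
  have sw: "cindex S p [v, w] m \<longleftrightarrow> cindex S p [w, v] m" for v w m using cindex_swap by blast
  have "map (vel S) (sorted_list_of_set (visits S p)) = [vel S s, vel S t] \<or>
        map (vel S) (sorted_list_of_set (visits S p)) = [vel S t, vel S s]"
  proof (cases "frac s < frac t")
    case True
    then have "sorted_list_of_set {frac s, frac t} = [frac s, frac t]" by simp
    then show ?thesis unfolding visits_double(1)[OF assms] using reg_frac[OF r] by simp
  next
    case False
    then have "sorted_list_of_set {frac s, frac t} = [frac t, frac s]"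
      using visits_double(2)[OF assms] by (simp add: insert_commute)
    then show ?thesis unfolding visits_double(1)[OF assms] using reg_frac[OF r] by simp
  qed
  moreover have "cindex S p [vel S s, vel S t] (SOME m. cindex S p [vel S s, vel S t] m)"
    by (rule someI_ex[OF generic_cindex_double[OF assms]])
  moreover have "cindex S p [vel S s, vel S t] = cindex S p [vel S t, vel S s]" using sw by blast
  ultimately show ?thesis unfolding mean_index_def by (elim disjE) simp_all
qed

lemma at_most_double_generic:
  assumes "generic_curve S" shows "at_most_double S"
  unfolding at_most_double_def
proof (intro ballI impI)
  fix s t u assume i: "s \<in> {0..<1}" "t \<in> {0..<1}" "u \<in> {0..<1::real}" "S s = S t \<and> S t = S u"
  then have "s - t \<in> \<int> \<or> t - u \<in> \<int> \<or> s - u \<in> \<int>" using assms unfolding generic_curve_def by metis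
  then show "s = t \<or> t = u \<or> s = u" using not_Ints_unit_interval i by blast
qed

definition nodes :: "(real \<Rightarrow> complex) \<Rightarrow> complex set" where
  "nodes S = S ` double_times S"

lemma nodesE:
  assumes "p \<in> nodes S"
  obtains s t where "s \<in> {0..<1}" "t \<in> {0..<1}" "s \<noteq> t" "S s = p" "S t = p" "s - t \<notin> \<int>"
proof -
  obtain t where t: "t \<in> double_times S" "S t = p" using assms by (auto simp: nodes_def)
  from t(1) obtain s where "s \<noteq> t" "S s = S t" "s \<in> {0..<1}" "t \<in> {0..<1}" by (rule double_timesE)
  then show thesis using that[of s t] t(2) not_Ints_unit_interval[of s t] by simp
qed

lemma nodesI:
  assumes "reg_curve S" "S s = p" "S t = p" "s - t \<notin> \<int>" shows "p \<in> nodes S"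
proof -
  have "frac s \<noteq> frac t" by (rule frac_neq[OF assms(4)])
  then have "frac t \<in> double_times S"
    using reg_frac[OF assms(1)] assms(2,3) frac_ge_0 frac_lt_1 by (intro double_timesI[of "frac s"]) auto
  then show ?thesis unfolding nodes_def using reg_frac[OF assms(1)] assms(3) by (intro image_eqI[of _ _ "frac t"]) auto
qed

lemma card_visits:
  assumes "generic_curve S"
  shows "p \<in> nodes S \<longleftrightarrow> card (visits S p) = 2" and "card (visits S p) \<le> 2"
    and "finite (visits S p)" and "visits S p = {} \<longleftrightarrow> p \<notin> path_image S"
proof -
  have r: "reg_curve S" using assms by (simp add: generic_curve_def)
  have iff: "visits S p = {} \<longleftrightarrow> p \<notin> path_image S"
    using path_image_closed[OF reg_closed[OF r]] by (auto simp: visits_def)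
  then show "visits S p = {} \<longleftrightarrow> p \<notin> path_image S" .
  consider "p \<in> nodes S" | "p \<notin> nodes S" "p \<in> path_image S" | "p \<notin> nodes S" "p \<notin> path_image S" by blast
  then have "(p \<in> nodes S \<longleftrightarrow> card (visits S p) = 2) \<and> card (visits S p) \<le> 2 \<and> finite (visits S p)"
  proof cases
    case 1
    then obtain s t where st: "S s = p" "S t = p" "s - t \<notin> \<int>" by (metis nodesE)
    show ?thesis using 1 visits_double[OF assms st] by simp
  next
    case 2
    then obtain t where t: "S t = p" by (auto simp: path_image_def)
    have "visits S p = {frac t}"
      by (rule visits_single[OF r t]) (use nodesI[OF r _ t] 2(1) in blast)
    then show ?thesis using 2 by simp
  next
    case 3
    then show ?thesis using iff by simp
  qed
  then show "p \<in> nodes S \<longleftrightarrow> card (visits S p) = 2" "card (visits S p) \<le> 2" "finite (visits S p)" by auto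
qed

lemma nodes_shift:
  assumes "reg_curve S" shows "nodes (\<lambda>t. S (t + c)) = nodes S"
proof (intro equalityI subsetI)
  fix p assume "p \<in> nodes (\<lambda>t. S (t + c))"
  then obtain s t where "S (s + c) = p" "S (t + c) = p" "s - t \<notin> \<int>" by (rule nodesE)
  then show "p \<in> nodes S" using nodesI[OF assms, of "s + c" p "t + c"] by simp
next
  fix p assume "p \<in> nodes S"
  then obtain s t where "S s = p" "S t = p" "s - t \<notin> \<int>" by (rule nodesE)
  then show "p \<in> nodes (\<lambda>t. S (t + c))" using reg_shift[OF assms] by (intro nodesI[where s = "s - c" and t = "t - c"]) simp_all
qed

lemma base_point_off_double_times:
  assumes "generic_curve S" shows "\<exists>c\<in>{0..<1}. 0 \<notin> double_times (\<lambda>t. S (t + c))"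
proof -
  have r: "reg_curve S" using assms by (simp add: generic_curve_def)
  have "infinite ({0..<1::real} - double_times S)" using finite_double_times[OF assms] by (simp add: Diff_infinite_finite)
  then obtain c where c: "c \<in> {0..<1}" "c \<notin> double_times S" by (metis Diff_iff ex_in_conv finite.emptyI)
  let ?g = "\<lambda>t. S (t + c)"
  have "0 \<notin> double_times ?g"
  proof
    assume "0 \<in> double_times ?g"
    then obtain s where s: "s \<noteq> 0" "?g s = ?g 0" "s \<in> {0..<1}" "(0::real) \<in> {0..<1}" by (rule double_timesE)
    have "(s + c) - c \<notin> \<int>" using not_Ints_unit_interval[OF s(3,4,1)] by simp
    then have "frac (s + c) \<noteq> frac c" by (rule frac_neq)
    then have "frac (s + c) \<noteq> c" using c(1) frac_eq[of c] by simp
    then have "c \<in> double_times S"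
      using s(2) c(1) reg_frac[OF r, of "s + c"] frac_ge_0[of "s + c"] frac_lt_1[of "s + c"]
      by (intro double_timesI[of "frac (s + c)"]) auto
    then show False using c(2) by simp
  qed
  then show ?thesis using c(1) by blast
qed

text \<open>\<open>nodal_parity\<close> wants a base point that is not a double time. The shift
  leaves the image, the nodes and the winding numbers as they are.\<close>

lemma generic_curve_parity:
  assumes "generic_curve S"
  shows "\<exists>k::int. csum (wind S) (path_image S) - (\<Sum>p\<in>nodes S. mean_index S p) + card (nodes S) + 1 = 2 * of_int k"
proof -
  have r: "reg_curve S" using assms by (simp add: generic_curve_def)
  obtain c where c: "c \<in> {0..<1}" "0 \<notin> double_times (\<lambda>t. S (t + c))" using base_point_off_double_times[OF assms] by blast
  let ?g = "\<lambda>t. S (t + c)"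
  have g: "generic_curve ?g" by (rule generic_curve_shift[OF assms])
  then have rg: "reg_curve ?g" by (simp add: generic_curve_def)
  have im: "path_image ?g = path_image S" by (rule path_image_shift[OF r])
  have nod: "nodes ?g = nodes S" by (rule nodes_shift[OF r])
  have nodal: "nodal ?g (vel ?g)" unfolding nodal_def
  proof (intro conjI ballI impI)
    show "0 \<notin> double_times ?g" by (rule c(2))
    fix s t assume "s \<in> double_times ?g" "t \<in> double_times ?g" "s \<noteq> t \<and> ?g s = ?g t"
    then have "t - s \<notin> \<int>" "?g t = ?g s" using not_Ints_unit_interval[of t s] by (auto simp: double_times_def)
    then show "Im (vel ?g t / vel ?g s) \<noteq> 0" using g unfolding generic_curve_def by blast
  qed (use reg_path[OF rg] reg_closed[OF rg] finite_double_times[OF g] at_most_double_generic[OF g] reg_deriv[OF rg] in auto)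
  have "node_index ?g (vel ?g) (mean_index S)" unfolding node_index_def
  proof (intro ballI impI)
    fix s t assume "s \<in> double_times ?g" "t \<in> double_times ?g" "s \<noteq> t \<and> ?g s = ?g t"
    then have "s - t \<notin> \<int>" "?g s = ?g t" using not_Ints_unit_interval[of s t] by (auto simp: double_times_def)
    then have "cindex S (?g s) [vel S (s + c), vel S (t + c)] (mean_index S (?g s))"
      by (intro mean_index_double[OF assms]) auto
    then show "cindex ?g (?g s) [vel ?g s, vel ?g t] (mean_index S (?g s))"
      using cindex_shift[OF r, of c] c(1) vel_shift[OF r] by auto
  qed
  from nodal_parity[OF nodal this] obtain k :: int where
    k: "csum (wind ?g) (path_image ?g) - (\<Sum>p\<in>nodes ?g. mean_index S p) + card (nodes ?g) + 1 = 2 * of_int k"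
    unfolding nodes_def by blast
  have "csum (wind ?g) (path_image S) = csum (wind S) (path_image S)"
    by (rule csum_cong) (use winding_number_shift[OF r, of c] c(1) in \<open>auto simp: wind_def\<close>)
  then show ?thesis using k unfolding im nod by auto
qed

section \<open>The invariants in terms of winding numbers\<close>

lemma sum_list_of_real: "(\<Sum>x\<leftarrow>xs. of_real (f x)) = (of_real (\<Sum>x\<leftarrow>xs. f x) :: complex)"
  by (induction xs) auto

definition total_wind :: "(real \<Rightarrow> complex) list \<Rightarrow> complex \<Rightarrow> real" where
  "total_wind \<Gamma> z = (\<Sum>\<gamma>\<leftarrow>\<Gamma>. wind \<gamma> z)"

lemma sum_list_Ints: "(\<And>x. x \<in> set xs \<Longrightarrow> f x \<in> \<int>) \<Longrightarrow> (\<Sum>x\<leftarrow>xs. f x :: real) \<in> \<int>"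
  by (induction xs) auto

text \<open>The total winding number is an integer and constant on the component, so exactly one
  integer fits the description in \<open>omega\<close>.\<close>

lemma omega_eq:
  assumes "\<And>\<gamma>. \<gamma> \<in> set \<Gamma> \<Longrightarrow> path \<gamma> \<and> \<gamma> 1 = \<gamma> 0" and C: "C \<in> components (- curve_image \<Gamma>)" and z: "z \<in> C"
  shows "of_int (omega \<Gamma> C) = total_wind \<Gamma> z"
proof -
  have off: "y \<notin> path_image \<gamma>" if "y \<in> C" "\<gamma> \<in> set \<Gamma>" for y \<gamma>
    using in_components_subset[OF C] that by (auto simp: curve_image_def)
  have wn: "(\<Sum>\<gamma>\<leftarrow>\<Gamma>. winding_number \<gamma> y) = of_real (total_wind \<Gamma> y)" if "y \<in> C" for y
  proof -
    have "map (\<lambda>\<gamma>. winding_number \<gamma> y) \<Gamma> = map (\<lambda>\<gamma>. of_real (wind \<gamma> y)) \<Gamma>"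
      using winding_number_eq_wind(1) assms(1) off[OF that] by (intro map_cong) auto
    then show ?thesis unfolding total_wind_def sum_list_of_real[symmetric] by (rule arg_cong)
  qed
  have const: "total_wind \<Gamma> y = total_wind \<Gamma> z" if "y \<in> C" for y
  proof -
    have "map (\<lambda>\<gamma>. wind \<gamma> y) \<Gamma> = map (\<lambda>\<gamma>. wind \<gamma> z) \<Gamma>"
    proof (rule map_cong[OF refl])
      fix \<gamma> assume "\<gamma> \<in> set \<Gamma>"
      then show "wind \<gamma> y = wind \<gamma> z"
        using loc_constD[OF loc_const_wind[of \<gamma> "\<lambda>x. x"] in_components_connected[OF C] _ that z] assms(1) off by auto
    qed
    then show ?thesis unfolding total_wind_def by (rule arg_cong)
  qed
  have "total_wind \<Gamma> z \<in> \<int>" unfolding total_wind_def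
    by (rule sum_list_Ints) (use winding_number_eq_wind(2) assms(1) off[OF z] in auto)
  then obtain k where k: "total_wind \<Gamma> z = of_int k" by (auto elim: Ints_cases)
  have "omega \<Gamma> C = k" unfolding omega_def
  proof (rule the_equality)
    show "\<forall>z\<in>C. (\<Sum>\<gamma>\<leftarrow>\<Gamma>. winding_number \<gamma> z) = of_int k" using wn const k by simp
    fix j assume "\<forall>z\<in>C. (\<Sum>\<gamma>\<leftarrow>\<Gamma>. winding_number \<gamma> z) = of_int j"
    then have "(of_int j :: complex) = of_real (total_wind \<Gamma> z)" using wn[OF z] z by metis
    then show "j = k" unfolding k by simp
  qed
  then show ?thesis using k by simp
qed

text \<open>An initial segment of the ray is connected and avoids the curves, so it lies in one
  component; components that share points of the ray are equal, which settles the description in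
  \<open>quadrant\<close>.\<close>

lemma omega_quadrant:
  assumes cl: "\<And>\<gamma>. \<gamma> \<in> set \<Gamma> \<Longrightarrow> path \<gamma> \<and> \<gamma> 1 = \<gamma> 0"
    and ev: "\<forall>\<^sub>F z in dirf p d. z \<notin> curve_image \<Gamma> \<and> total_wind \<Gamma> z = k"
  shows "of_int (omega \<Gamma> (quadrant \<Gamma> p d)) = k"
proof -
  have "\<forall>\<^sub>F r in at_right (0::real). p + r *\<^sub>R d \<notin> curve_image \<Gamma> \<and> total_wind \<Gamma> (p + r *\<^sub>R d) = k"
    using ev filterlim_dirf_ray by (rule eventually_compose_filterlim)
  then obtain \<epsilon> where e: "\<epsilon> > 0" "\<And>r. 0 < r \<Longrightarrow> r < \<epsilon> \<Longrightarrow> p + r *\<^sub>R d \<notin> curve_image \<Gamma> \<and> total_wind \<Gamma> (p + r *\<^sub>R d) = k"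
    unfolding eventually_at_right_field by auto
  define R where "R = (\<lambda>r. p + r *\<^sub>R d) ` {0<..<\<epsilon>}"
  have "connected R" unfolding R_def by (intro connected_continuous_image continuous_intros) auto
  moreover have "R \<subseteq> - curve_image \<Gamma>" "R \<noteq> {}" using e by (auto simp: R_def)
  moreover from this have "- curve_image \<Gamma> \<noteq> {}" by blast
  ultimately obtain C where C: "C \<in> components (- curve_image \<Gamma>)" "R \<subseteq> C"
    using exists_component_superset[of R "- curve_image \<Gamma>"] by blast
  have RC: "p + y *\<^sub>R d \<in> C" if "0 < y" "y < \<epsilon>" for y
  proof -
    have "p + y *\<^sub>R d \<in> R" using that unfolding R_def by (intro imageI) simp
    then show ?thesis using C(2) by blast
  qed
  have ray: "\<forall>\<^sub>F r in at_right (0::real). p + r *\<^sub>R d \<in> C"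
    unfolding eventually_at_right_field using e(1) RC by blast
  have "quadrant \<Gamma> p d = C" unfolding quadrant_def
  proof (rule the_equality)
    show "C \<in> components (- curve_image \<Gamma>) \<and> (\<forall>\<^sub>F r in at_right 0. p + r *\<^sub>R d \<in> C)" using C(1) ray by simp
    fix D assume D: "D \<in> components (- curve_image \<Gamma>) \<and> (\<forall>\<^sub>F r in at_right (0::real). p + r *\<^sub>R d \<in> D)"
    then have "\<forall>\<^sub>F r in at_right (0::real). p + r *\<^sub>R d \<in> C \<inter> D" using ray by (auto elim: eventually_elim2)
    then have "\<exists>r. p + r *\<^sub>R d \<in> C \<inter> D" using eventually_happens' trivial_limit_at_right_real by blast
    then show "D = C" using components_eq[of C "- curve_image \<Gamma>" D] C(1) D by blast
  qed
  moreover have "p + (\<epsilon>/2) *\<^sub>R d \<in> C" using e(1) by (intro RC) auto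
  ultimately show ?thesis using omega_eq[OF cl C(1)] e(2)[of "\<epsilon>/2"] e(1) by simp
qed

text \<open>The half-jumps of the two branches cancel in two opposite quadrants and reinforce each
  other in the remaining two. The four values are \<open>m\<close>, \<open>m\<close>,
  \<open>m + \<sigma>\<close> and \<open>m - \<sigma>\<close>, with mean \<open>m\<close>.\<close>

lemma ind_eq:
  assumes cl: "\<And>\<gamma>. \<gamma> \<in> set \<Gamma> \<Longrightarrow> path \<gamma> \<and> \<gamma> 1 = \<gamma> 0"
    and fib: "fibre \<Gamma> p = {a, b}" "a \<noteq> b" and vw: "velocity \<Gamma> a = v" "velocity \<Gamma> b = w" "Im (w / v) \<noteq> 0"
    and idx: "\<And>d. Im (d / v) \<noteq> 0 \<Longrightarrow> Im (d / w) \<noteq> 0 \<Longrightarrow>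
      \<forall>\<^sub>F z in dirf p d. z \<notin> curve_image \<Gamma> \<and> total_wind \<Gamma> z = m + (sgn (Im (d / v)) + sgn (Im (d / w))) / 2"
  shows "ind \<Gamma> p = m"
proof -
  have nz: "v \<noteq> 0" "w \<noteq> 0" and Im': "Im (v / w) \<noteq> 0" using vw(3) Im_divide_sym_ne by auto
  have dirs: "quadrant_dirs \<Gamma> p = {v + w, v - w, - v + w, - v - w}"
  proof
    show "quadrant_dirs \<Gamma> p \<subseteq> {v + w, v - w, - v + w, - v - w}"
    proof
      fix d assume "d \<in> quadrant_dirs \<Gamma> p"
      then obtain s where s: "\<forall>a. s a \<in> {-1, 1 :: real}" "d = (\<Sum>a\<in>fibre \<Gamma> p. s a *\<^sub>R velocity \<Gamma> a)"
        unfolding quadrant_dirs_def by blast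
      have "d = s a *\<^sub>R v + s b *\<^sub>R w" using s(2) fib vw by simp
      moreover have "s a = -1 \<or> s a = 1" "s b = -1 \<or> s b = 1" using spec[OF s(1), of a] spec[OF s(1), of b] by auto
      ultimately show "d \<in> {v + w, v - w, - v + w, - v - w}" by auto
    qed
    have mem: "x *\<^sub>R v + y *\<^sub>R w \<in> quadrant_dirs \<Gamma> p" if "x \<in> {-1, 1}" "y \<in> {-1, 1}" for x y
      unfolding quadrant_dirs_def
      by (intro CollectI exI[of _ "\<lambda>c. if c = a then x else y"]) (use that fib vw in auto)
    show "{v + w, v - w, - v + w, - v - w} \<subseteq> quadrant_dirs \<Gamma> p"
      using mem[of 1 1] mem[of 1 "-1"] mem[of "-1" 1] mem[of "-1" "-1"] by auto
  qed
  have vne: "v \<noteq> w" "v \<noteq> - w" using vw(3) nz by auto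
  \<comment> \<open>\<open>ind\<close> sums over a set of directions and divides by 4, so coinciding
    directions would spoil the mean.\<close>
  have distinct: "v + w \<noteq> v - w" "v + w \<noteq> - v + w" "v + w \<noteq> - v - w" "v - w \<noteq> - v + w" "v - w \<noteq> - v - w" "- v + w \<noteq> - v - w"
  proof -
    have z: "x = 0" if "x = - x" for x :: complex using that by (simp add: complex_eq_iff)
    show "v + w \<noteq> v - w" using z[of w] nz by auto
    show "v + w \<noteq> - v + w" using z[of v] nz by auto
    show "v + w \<noteq> - v - w" using z[of "v + w"] vne by (auto simp: add_eq_0_iff)
    show "v - w \<noteq> - v + w" using z[of "v - w"] vne by auto
    show "v - w \<noteq> - v - w" using z[of v] nz by auto
    show "- v + w \<noteq> - v - w" using z[of w] nz by auto
  qed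
  define \<sigma> where "\<sigma> = sgn (Im (w / v))"
  have sw: "sgn (Im (v / w)) = - \<sigma>" unfolding \<sigma>_def by (rule sgn_Im_swap)
  have q: "of_int (omega \<Gamma> (quadrant \<Gamma> p (x *\<^sub>R v + y *\<^sub>R w))) = m + (y * \<sigma> - x * \<sigma>) / 2"
    if xy: "x = 1 \<or> x = -1" "y = 1 \<or> y = -1" for x y :: real
  proof (rule omega_quadrant[OF cl])
    have 1: "Im ((x *\<^sub>R v + y *\<^sub>R w) / v) = y * Im (w / v)"
      using nz Im_divide_scale[of y w 1 v] Im_divide_scale[of x v 1 v] by (simp add: add_divide_distrib)
    have 2: "Im ((x *\<^sub>R v + y *\<^sub>R w) / w) = x * Im (v / w)"
      using nz Im_divide_scale[of x v 1 w] Im_divide_scale[of y w 1 w] by (simp add: add_divide_distrib)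
    have "\<forall>\<^sub>F z in dirf p (x *\<^sub>R v + y *\<^sub>R w). z \<notin> curve_image \<Gamma> \<and> total_wind \<Gamma> z = m + (sgn (y * Im (w / v)) + sgn (x * Im (v / w))) / 2"
      using idx[of "x *\<^sub>R v + y *\<^sub>R w"] unfolding 1 2 using xy vw(3) Im' by auto
    moreover have "sgn (y * Im (w / v)) + sgn (x * Im (v / w)) = y * \<sigma> - x * \<sigma>"
      unfolding sgn_mult sw \<sigma>_def[symmetric] using xy by auto
    ultimately show "\<forall>\<^sub>F z in dirf p (x *\<^sub>R v + y *\<^sub>R w). z \<notin> curve_image \<Gamma> \<and> total_wind \<Gamma> z = m + (y * \<sigma> - x * \<sigma>) / 2"
      by simp
  qed
  have "(\<Sum>d\<in>quadrant_dirs \<Gamma> p. of_int (omega \<Gamma> (quadrant \<Gamma> p d))) =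
    (of_int (omega \<Gamma> (quadrant \<Gamma> p (v + w))) + of_int (omega \<Gamma> (quadrant \<Gamma> p (v - w)))
    + of_int (omega \<Gamma> (quadrant \<Gamma> p (- v + w))) + of_int (omega \<Gamma> (quadrant \<Gamma> p (- v - w))) :: real)"
    unfolding dirs using distinct by simp
  also have "\<dots> = 4 * m" using q[of 1 1] q[of 1 "-1"] q[of "-1" 1] q[of "-1" "-1"] by simp
  finally show ?thesis by (simp add: ind_def)
qed

lemma sum_omega_eq_csum:
  assumes cl: "\<And>\<gamma>. \<gamma> \<in> set \<Gamma> \<Longrightarrow> path \<gamma> \<and> \<gamma> 1 = \<gamma> 0"
  shows "(\<Sum>C\<in>components (- curve_image \<Gamma>). (of_int (omega \<Gamma> C))\<^sup>2) = csum (\<lambda>z. (total_wind \<Gamma> z)\<^sup>2) (curve_image \<Gamma>)"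
  unfolding csum_def
proof (rule sum.cong[OF refl])
  fix C assume C: "C \<in> components (- curve_image \<Gamma>)"
  then have "(SOME z. z \<in> C) \<in> C" using in_components_nonempty by (simp add: some_in_eq)
  then show "(of_int (omega \<Gamma> C))\<^sup>2 = cval (\<lambda>z. (total_wind \<Gamma> z)\<^sup>2) C"
    using omega_eq[OF cl C] by (simp add: cval_def)
qed

section \<open>Double points of a curve and of a pair\<close>

lemma fibre_single: "fibre [S] p = Pair 0 ` visits S p"
  by (auto simp: fibre_def params_def point_def visits_def image_iff)

lemma fibre_pair: "fibre [S, T] p = Pair 0 ` visits S p \<union> Pair 1 ` visits T p"
proof (intro equalityI subsetI)
  fix a assume a: "a \<in> fibre [S, T] p"
  obtain i t where it: "a = (i, t)" by (cases a)
  have "i = 0 \<or> i = 1" using a it by (auto simp: fibre_def params_def)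
  then show "a \<in> Pair 0 ` visits S p \<union> Pair 1 ` visits T p"
    using a it by (auto simp: fibre_def params_def point_def visits_def)
qed (auto simp: fibre_def params_def point_def visits_def)

lemma velocity_pair: "velocity [S, T] (0, t) = vel S t" "velocity [S, T] (1, t) = vel T t" "velocity [S] (0, t) = vel S t"
  by (simp_all add: velocity_def vel_def)

lemma curve_image_pair: "curve_image [S, T] = path_image S \<union> path_image T" "curve_image [S] = path_image S"
  by (auto simp: curve_image_def)

lemma total_wind_pair: "total_wind [S, T] z = wind S z + wind T z" "total_wind [S] z = wind S z"
  by (simp_all add: total_wind_def)

lemma double_points_single:
  assumes "generic_curve S" shows "double_points [S] = nodes S"
proof -
  have "card (Pair (0::nat) ` visits S p) = card (visits S p)" for p by (rule card_image) (auto simp: inj_on_def)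
  then show ?thesis unfolding double_points_def fibre_single using card_visits(1)[OF assms] by auto
qed

theorem J_plus_eq:
  assumes "generic_curve S"
  shows "J_plus S = 1 + card (nodes S) - csum (\<lambda>z. (wind S z)\<^sup>2) (path_image S) + (\<Sum>p\<in>nodes S. (mean_index S p)\<^sup>2)"
proof -
  have r: "reg_curve S" using assms by (simp add: generic_curve_def)
  have cl: "path \<gamma> \<and> \<gamma> 1 = \<gamma> 0" if "\<gamma> \<in> set [S]" for \<gamma> using that reg_path[OF r] reg_closed[OF r] by simp
  have "ind [S] p = mean_index S p" if p: "p \<in> nodes S" for p
  proof -
    obtain s t where st: "s \<in> {0..<1}" "t \<in> {0..<1}" "s \<noteq> t" "S s = p" "S t = p" "s - t \<notin> \<int>" using nodesE[OF p] by metis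
    have "frac s = s" "frac t = t" using st(1,2) by (simp_all add: frac_eq)
    then have vis: "visits S p = {s, t}" using visits_double(1)[OF assms st(4-6)] by simp
    have "t - s \<notin> \<int>" using st(6) Ints_minus[of "t - s"] by auto
    then have Im: "Im (vel S t / vel S s) \<noteq> 0" using assms st unfolding generic_curve_def by metis
    show ?thesis
    proof (rule ind_eq[OF cl])
      show "fibre [S] p = {(0, s), (0, t)}" unfolding fibre_single vis by simp
      show "\<forall>\<^sub>F z in dirf p d. z \<notin> curve_image [S] \<and> total_wind [S] z = mean_index S p + (sgn (Im (d / vel S s)) + sgn (Im (d / vel S t))) / 2"
        if "Im (d / vel S s) \<noteq> 0" "Im (d / vel S t) \<noteq> 0" for d
      proof -
        have "Im (d / x) \<noteq> 0" if x: "x \<in> set [vel S s, vel S t]" for x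
        proof -
          have "x = vel S s \<or> x = vel S t" using x by simp
          then show ?thesis using \<open>Im (d / vel S s) \<noteq> 0\<close> \<open>Im (d / vel S t) \<noteq> 0\<close> by metis
        qed
        from cindexD[OF mean_index_double[OF assms st(4-6)] this] show ?thesis
          unfolding curve_image_pair total_wind_pair by simp
      qed
    qed (use st Im in \<open>auto simp: velocity_pair\<close>)
  qed
  then have "(\<Sum>p\<in>nodes S. (ind [S] p)\<^sup>2) = (\<Sum>p\<in>nodes S. (mean_index S p)\<^sup>2)" by (intro sum.cong) auto
  moreover have "(\<Sum>C\<in>components (- curve_image [S]). (of_int (omega [S] C))\<^sup>2) = csum (\<lambda>z. (wind S z)\<^sup>2) (path_image S)"
    using sum_omega_eq_csum[of "[S]", OF cl] unfolding curve_image_pair total_wind_pair .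
  ultimately show ?thesis unfolding J_plus_def double_points_single[OF assms] by simp
qed

lemma generic_pairD:
  assumes "generic_pair S T"
  shows "generic_curve S" "generic_curve T" "reg_curve S" "reg_curve T"
    "nodes S \<inter> path_image T = {}" "nodes T \<inter> path_image S = {}" "nodes S \<subseteq> path_image S" "nodes T \<subseteq> path_image T"
proof -
  show c: "generic_curve S" "generic_curve T" "reg_curve S" "reg_curve T"
    using assms by (auto simp: generic_pair_def generic_curve_def)
  have key: "nodes X \<inter> path_image Y = {}" if "generic_pair X Y" for X Y
  proof (rule ccontr)
    assume "nodes X \<inter> path_image Y \<noteq> {}"
    then obtain p where p: "p \<in> nodes X" "p \<in> path_image Y" by blast
    obtain s t where st: "X s = p" "X t = p" "s - t \<notin> \<int>" using nodesE[OF p(1)] by metis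
    obtain u where "Y u = p" using p(2) by (auto simp: path_image_def)
    then show False using that st unfolding generic_pair_def by metis
  qed
  show "nodes S \<inter> path_image T = {}" "nodes T \<inter> path_image S = {}" using key assms generic_pair_sym by auto
  show "nodes S \<subseteq> path_image S" "nodes T \<subseteq> path_image T"
    unfolding nodes_def double_times_def path_image_def by auto
qed

lemma crossing_single:
  assumes "generic_pair S T" "S s = p" "p \<in> path_image T"
  shows "cindex S p [vel S s] (mean_index S p)" "visits S p = {frac s}"
proof -
  note c = generic_pairD[OF assms(1)]
  have u: "u - s \<in> \<int>" if "S u = p" for u
  proof -
    obtain t where "T t = p" using assms(3) by (auto simp: path_image_def)
    then show ?thesis using assms(1,2) that unfolding generic_pair_def by metis
  qed
  show "cindex S p [vel S s] (mean_index S p)" by (rule mean_index_single[OF c(1) assms(2)]) (rule u)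
  show "visits S p = {frac s}" by (rule visits_single[OF c(3) assms(2)]) (rule u)
qed

lemma double_points_pair:
  assumes "generic_pair S T"
  shows "double_points [S, T] = nodes S \<union> nodes T \<union> (path_image S \<inter> path_image T)"
proof -
  note c = generic_pairD[OF assms]
  have card: "card (fibre [S, T] p) = card (visits S p) + card (visits T p)" for p
  proof -
    have "card (Pair (0::nat) ` visits S p \<union> Pair 1 ` visits T p) = card (Pair (0::nat) ` visits S p) + card (Pair (1::nat) ` visits T p)"
      using card_visits(3)[OF c(1)] card_visits(3)[OF c(2)] by (intro card_Un_disjoint) auto
    then show ?thesis unfolding fibre_pair by (simp add: card_image inj_on_def)
  qed
  have "card (visits S p) + card (visits T p) = 2 \<longleftrightarrow> p \<in> nodes S \<union> nodes T \<union> (path_image S \<inter> path_image T)" for p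
  proof (cases "p \<in> path_image S \<inter> path_image T")
    case True
    then obtain s t where st: "S s = p" "T t = p" by (auto simp: path_image_def)
    have "visits S p = {frac s}" "visits T p = {frac t}"
      using crossing_single(2)[OF assms st(1)] crossing_single(2)[OF generic_pair_sym[OF assms] st(2)] True by auto
    then show ?thesis using True by simp
  next
    case False
    then consider "p \<notin> path_image S" | "p \<notin> path_image T" by blast
    then show ?thesis
    proof cases
      case 1
      then have "visits S p = {}" "p \<notin> nodes S" using card_visits(4)[OF c(1)] c(7) by auto
      then have "card (visits S p) = 0" "p \<notin> nodes S" by simp_all
      then show ?thesis using card_visits(1)[OF c(2)] 1 by auto
    next
      case 2
      then have "visits T p = {}" "p \<notin> nodes T" using card_visits(4)[OF c(2)] c(8) by auto
      then have "card (visits T p) = 0" "p \<notin> nodes T" by simp_all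
      then show ?thesis using card_visits(1)[OF c(1)] 2 by auto
    qed
  qed
  then show ?thesis unfolding double_points_def card by blast
qed

theorem J_two_plus_eq:
  assumes "generic_pair S T"
  shows "J_two_plus S T = 2 + card (nodes S \<union> nodes T \<union> (path_image S \<inter> path_image T))
    - csum (\<lambda>z. (wind S z + wind T z)\<^sup>2) (path_image S \<union> path_image T)
    + (\<Sum>p\<in>nodes S \<union> nodes T \<union> (path_image S \<inter> path_image T). (mean_index S p + mean_index T p)\<^sup>2)
    + (of_int (encircling_index S T))\<^sup>2"
proof -
  note c = generic_pairD[OF assms]
  have cl: "path \<gamma> \<and> \<gamma> 1 = \<gamma> 0" if "\<gamma> \<in> set [S, T]" for \<gamma>
    using that reg_path[OF c(3)] reg_closed[OF c(3)] reg_path[OF c(4)] reg_closed[OF c(4)] by auto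
  \<comment> \<open>Two branches meet at a double point of the pair. They belong to \<open>S\<close>
    and \<open>T\<close> as 2 + 0, 0 + 2 or 1 + 1; the lists \<open>V\<close> and \<open>W\<close>
    cover all three cases at once.\<close>
  have add: "\<forall>\<^sub>F z in dirf p d. z \<notin> curve_image [S, T] \<and> total_wind [S, T] z = mean_index S p + mean_index T p + (sgn (Im (d / v)) + sgn (Im (d / w))) / 2"
    if "cindex S p V (mean_index S p)" "cindex T p W (mean_index T p)" "V @ W = [v, w]" "Im (d / v) \<noteq> 0" "Im (d / w) \<noteq> 0" for p d V W v w
  proof -
    have "set V \<union> set W = {v, w}" using that(3) by (metis set_append list.simps(15) empty_set)
    then have tr: "Im (d / x) \<noteq> 0" if "x \<in> set V \<union> set W" for x using that \<open>Im (d / v) \<noteq> 0\<close> \<open>Im (d / w) \<noteq> 0\<close> by auto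
    have sums: "(\<Sum>v\<leftarrow>V. sgn (Im (d / v))) + (\<Sum>v\<leftarrow>W. sgn (Im (d / v))) = sgn (Im (d / v)) + sgn (Im (d / w))"
    proof -
      have "(\<Sum>v\<leftarrow>V. sgn (Im (d / v))) + (\<Sum>v\<leftarrow>W. sgn (Im (d / v))) = (\<Sum>v\<leftarrow>V @ W. sgn (Im (d / v)))" by simp
      also have "\<dots> = sgn (Im (d / v)) + sgn (Im (d / w))" unfolding that(3) by simp
      finally show ?thesis .
    qed
    have "\<forall>\<^sub>F z in dirf p d. z \<notin> path_image S \<and> wind S z = mean_index S p + (\<Sum>v\<leftarrow>V. sgn (Im (d / v))) / 2"
      using cindexD[OF that(1)] tr by blast
    moreover have "\<forall>\<^sub>F z in dirf p d. z \<notin> path_image T \<and> wind T z = mean_index T p + (\<Sum>v\<leftarrow>W. sgn (Im (d / v))) / 2"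
      using cindexD[OF that(2)] tr by blast
    ultimately show ?thesis
    proof eventually_elim
      case (elim z)
      then show ?case unfolding curve_image_pair total_wind_pair sums[symmetric] by (simp add: add_divide_distrib)
    qed
  qed
  have "ind [S, T] p = mean_index S p + mean_index T p" if p: "p \<in> nodes S \<union> nodes T \<union> (path_image S \<inter> path_image T)" for p
  proof -
    consider "p \<in> nodes S" | "p \<in> nodes T" | "p \<in> path_image S" "p \<in> path_image T" using p by blast
    then show ?thesis
    proof cases
      case 1
      then have off: "p \<notin> path_image T" using c(5) by auto
      obtain s t where st: "s \<in> {0..<1}" "t \<in> {0..<1}" "s \<noteq> t" "S s = p" "S t = p" "s - t \<notin> \<int>" using nodesE[OF 1] by metis
      have "frac s = s" "frac t = t" using st(1,2) by (simp_all add: frac_eq)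
      then have vis: "visits S p = {s, t}" using visits_double(1)[OF c(1) st(4-6)] by simp
      have visT: "visits T p = {}" using card_visits(4)[OF c(2)] off by simp
      have "t - s \<notin> \<int>" using st(6) Ints_minus[of "t - s"] by auto
      then have Im: "Im (vel S t / vel S s) \<noteq> 0" using c(1) st unfolding generic_curve_def by metis
      show ?thesis
      proof (rule ind_eq[OF cl])
        show "fibre [S, T] p = {(0, s), (0, t)}" unfolding fibre_pair vis visT by simp
        show "\<forall>\<^sub>F z in dirf p d. z \<notin> curve_image [S, T] \<and> total_wind [S, T] z = mean_index S p + mean_index T p + (sgn (Im (d / vel S s)) + sgn (Im (d / vel S t))) / 2"
          if "Im (d / vel S s) \<noteq> 0" "Im (d / vel S t) \<noteq> 0" for d
          by (rule add[OF mean_index_double[OF c(1) st(4-6)] mean_index_off(1)[OF c(2) off] _ that]) simp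
      qed (use st Im in \<open>auto simp: velocity_pair\<close>)
    next
      case 2
      then have off: "p \<notin> path_image S" using c(6) by auto
      obtain s t where st: "s \<in> {0..<1}" "t \<in> {0..<1}" "s \<noteq> t" "T s = p" "T t = p" "s - t \<notin> \<int>" using nodesE[OF 2] by metis
      have "frac s = s" "frac t = t" using st(1,2) by (simp_all add: frac_eq)
      then have vis: "visits T p = {s, t}" using visits_double(1)[OF c(2) st(4-6)] by simp
      have visS: "visits S p = {}" using card_visits(4)[OF c(1)] off by simp
      have "t - s \<notin> \<int>" using st(6) Ints_minus[of "t - s"] by auto
      then have Im: "Im (vel T t / vel T s) \<noteq> 0" using c(2) st unfolding generic_curve_def by metis
      show ?thesis
      proof (rule ind_eq[OF cl])
        show "fibre [S, T] p = {(1, s), (1, t)}" unfolding fibre_pair vis visS by simp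
        show "\<forall>\<^sub>F z in dirf p d. z \<notin> curve_image [S, T] \<and> total_wind [S, T] z = mean_index S p + mean_index T p + (sgn (Im (d / vel T s)) + sgn (Im (d / vel T t))) / 2"
          if "Im (d / vel T s) \<noteq> 0" "Im (d / vel T t) \<noteq> 0" for d
          by (rule add[OF mean_index_off(1)[OF c(1) off] mean_index_double[OF c(2) st(4-6)] _ that]) simp
        show "velocity [S, T] (1, s) = vel T s" "velocity [S, T] (1, t) = vel T t" by (rule velocity_pair)+
      qed (use st Im in auto)
    next
      case 3
      then obtain s0 t0 where st0: "S s0 = p" "T t0 = p" by (auto simp: path_image_def)
      define s where "s = frac s0"
      define t where "t = frac t0"
      have st: "S s = p" "T t = p" using reg_frac[OF c(3)] reg_frac[OF c(4)] st0 by (simp_all add: s_def t_def)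
      have ff: "frac s = s" "frac t = t" by (simp_all add: s_def t_def frac_eq frac_lt_1)
      note cS = crossing_single[OF assms st(1) 3(2)]
      note cT = crossing_single[OF generic_pair_sym[OF assms] st(2) 3(1)]
      have Im: "Im (vel T t / vel S s) \<noteq> 0" using generic_pair_sym[OF assms] st unfolding generic_pair_def by metis
      show ?thesis
      proof (rule ind_eq[OF cl])
        show "fibre [S, T] p = {(0, s), (1, t)}" unfolding fibre_pair cS(2) cT(2) ff by auto
        show "\<forall>\<^sub>F z in dirf p d. z \<notin> curve_image [S, T] \<and> total_wind [S, T] z = mean_index S p + mean_index T p + (sgn (Im (d / vel S s)) + sgn (Im (d / vel T t))) / 2"
          if "Im (d / vel S s) \<noteq> 0" "Im (d / vel T t) \<noteq> 0" for d
          by (rule add[OF cS(1) cT(1) _ that]) simp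
        show "velocity [S, T] (0, s) = vel S s" "velocity [S, T] (1, t) = vel T t" by (rule velocity_pair)+
      qed (use Im in auto)
    qed
  qed
  then have "(\<Sum>p\<in>nodes S \<union> nodes T \<union> (path_image S \<inter> path_image T). (ind [S, T] p)\<^sup>2) =
    (\<Sum>p\<in>nodes S \<union> nodes T \<union> (path_image S \<inter> path_image T). (mean_index S p + mean_index T p)\<^sup>2)" by (intro sum.cong) auto
  moreover have "(\<Sum>C\<in>components (- curve_image [S, T]). (of_int (omega [S, T] C))\<^sup>2) =
    csum (\<lambda>z. (wind S z + wind T z)\<^sup>2) (path_image S \<union> path_image T)"
    using sum_omega_eq_csum[of "[S, T]", OF cl] unfolding curve_image_pair total_wind_pair .
  ultimately show ?thesis unfolding J_two_plus_def double_points_pair[OF assms] by simp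
qed

section \<open>From immersions and fibres to curves on the circle\<close>

lemma immersion_reg_curve:
  assumes "immersion S" shows "reg_curve S"
proof -
  have per: "S (t + 1) = S t" and nz: "vector_derivative S (at t) \<noteq> 0" for t
    using assms by (auto simp: immersion_def)
  have sm: "((\<lambda>f s. vector_derivative f (at s)) ^^ n) S differentiable (at t)" for n t
    using assms by (auto simp: immersion_def smooth_def)
  have d0: "S differentiable (at t)" for t using sm[of 0 t] by simp
  have "((\<lambda>f s. vector_derivative f (at s)) ^^ 1) S = vel S" by (simp add: vel_def[abs_def])
  then have d1: "vel S differentiable (at t)" for t using sm[of 1 t] by metis
  have "continuous_on UNIV (vel S)"
    by (rule continuous_at_imp_continuous_on) (use d1 differentiable_imp_continuous_within in blast)
  moreover have "(S has_vector_derivative vel S t) (at t)" for t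
    unfolding vel_def using d0 vector_derivative_works by blast
  ultimately show ?thesis unfolding reg_curve_def using per nz by (simp add: vel_def)
qed

lemma span_pair_imp_Im:
  assumes "span {v, w} = (UNIV :: complex set)" "w \<noteq> 0" shows "Im (v / w) \<noteq> 0"
proof
  assume 0: "Im (v / w) = 0"
  \<comment> \<open>The real line through \<open>w\<close>; it would contain both velocities and
    hence their span, but not \<open>\<i> * w\<close>.\<close>
  define U where "U = {x. Im (x / w) = 0}"
  have "subspace U"
    unfolding subspace_def U_def using Im_divide_scale[of _ _ 1 w] by (auto simp: add_divide_distrib)
  moreover have "{v, w} \<subseteq> U" using 0 assms(2) by (auto simp: U_def)
  ultimately have "span {v, w} \<subseteq> U" by (rule span_minimal[rotated])
  then have "\<i> * w \<in> U" using assms(1) by auto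
  then show False using assms(2) by (simp add: U_def)
qed

text \<open>\<open>frac\<close> carries arbitrary parameters into the period used by
  \<open>fibre\<close>, and parameters whose difference is not an integer remain distinct points of
  the fibre.\<close>

lemma generic_imp_generic_pair:
  assumes "generic [S, T]" shows "generic_pair S T"
proof -
  have r: "reg_curve S" "reg_curve T" using assms by (auto simp: generic_def immersion_reg_curve)
  have fin: "finite (fibre [S, T] p)" "card (fibre [S, T] p) \<le> 2" for p using assms by (auto simp: generic_def)
  have vis: "frac t \<in> visits S (S t)" "frac t \<in> visits T (T t)" for t
    using reg_frac[OF r(1)] reg_frac[OF r(2)] frac_ge_0 frac_lt_1 unfolding visits_def by auto
  have inS: "(0, frac t) \<in> fibre [S, T] (S t)" for t
    unfolding fibre_pair by (rule UnI1, rule imageI, rule vis(1))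
  have inT: "(1, frac t) \<in> fibre [S, T] (T t)" for t
    unfolding fibre_pair by (rule UnI2, rule imageI, rule vis(2))
  have vS: "velocity [S, T] (0, frac t) = vel S t" and vT: "velocity [S, T] (1, frac t) = vel T t" for t
    unfolding velocity_pair using reg_frac[OF r(1)] reg_frac[OF r(2)] by auto
  have tr: "Im (velocity [S, T] a / velocity [S, T] b) \<noteq> 0" if "a \<in> fibre [S, T] p" "b \<in> fibre [S, T] p" "a \<noteq> b"
     "velocity [S, T] b \<noteq> 0" for a b p
    using assms that unfolding generic_def by (intro span_pair_imp_Im) auto
  have triple: "a = b \<or> b = c \<or> a = c" if "a \<in> fibre [S, T] p" "b \<in> fibre [S, T] p" "c \<in> fibre [S, T] p" for a b c p
  proof (rule ccontr)
    assume "\<not> ?thesis"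
    then have "card {a, b, c} = 3" by simp
    moreover have "card {a, b, c} \<le> card (fibre [S, T] p)" using that fin by (intro card_mono) auto
    ultimately show False using fin(2)[of p] by simp
  qed
  have nz: "vel S t \<noteq> 0" "vel T t \<noteq> 0" for t using reg_nonzero[OF r(1)] reg_nonzero[OF r(2)] by auto
  show ?thesis
    unfolding generic_pair_def generic_curve_def
  proof (intro conjI allI impI)
    show "Im (vel S s / vel S t) \<noteq> 0" if "S s = S t \<and> s - t \<notin> \<int>" for s t
      using tr[OF inS[of s], of "(0, frac t)"] inS[of t] that frac_neq[of s t] nz unfolding vS by auto
    show "Im (vel T s / vel T t) \<noteq> 0" if "T s = T t \<and> s - t \<notin> \<int>" for s t
      using tr[OF inT[of s], of "(1, frac t)"] inT[of t] that frac_neq[of s t] nz unfolding vT by auto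
    show "Im (vel S s / vel T t) \<noteq> 0" if "S s = T t" for s t
      using tr[OF inS[of s], of "(1, frac t)"] inT[of t] that nz unfolding vT vS by auto
    show "s - t \<in> \<int> \<or> t - u \<in> \<int> \<or> s - u \<in> \<int>" if "S s = S t \<and> S t = S u" for s t u
      using triple[OF inS[of s], of "(0, frac t)" "(0, frac u)"] inS[of t] inS[of u] that frac_neq by auto
    show "s - t \<in> \<int> \<or> t - u \<in> \<int> \<or> s - u \<in> \<int>" if "T s = T t \<and> T t = T u" for s t u
      using triple[OF inT[of s], of "(1, frac t)" "(1, frac u)"] inT[of t] inT[of u] that frac_neq by auto
    show "s - t \<in> \<int>" if "S s = S t \<and> S t = T u" for s t u
      using triple[OF inS[of s], of "(0, frac t)" "(1, frac u)"] inS[of t] inT[of u] that frac_neq by auto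
    show "s - t \<in> \<int>" if "T s = T t \<and> T t = S u" for s t u
      using triple[OF inT[of s], of "(1, frac t)" "(0, frac u)"] inT[of t] inS[of u] that frac_neq by auto
  qed (use r in auto)
qed

lemma finite_nodes: "generic_curve S \<Longrightarrow> finite (nodes S)"
  unfolding nodes_def by (intro finite_imageI finite_double_times)

lemma generic_curve_components:
  assumes "generic_curve S"
  shows "finite (components (- path_image S))" and "card (components (- path_image S)) = card (nodes S) + 2"
proof -
  have r: "reg_curve S" using assms by (simp add: generic_curve_def)
  obtain c where c: "c \<in> {0..<1}" "0 \<notin> double_times (\<lambda>t. S (t + c))" using base_point_off_double_times[OF assms] by blast
  let ?g = "\<lambda>t. S (t + c)"
  have g: "generic_curve ?g" by (rule generic_curve_shift[OF assms])
  then have rg: "reg_curve ?g" by (simp add: generic_curve_def)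
  note f = finite_components_closed_curve[OF reg_path[OF rg] reg_closed[OF rg] finite_double_times[OF g] at_most_double_generic[OF g] c(2),
      unfolded path_image_shift[OF r] nodes_def[symmetric] nodes_shift[OF r]]
  show "finite (components (- path_image S))" by (rule f(1))
  have "csum (\<lambda>z. 1) (path_image S) = card (components (- path_image S))" by (simp add: csum_def cval_def)
  then show "card (components (- path_image S)) = card (nodes S) + 2" using f(2) by simp
qed

section \<open>Two crossing curves and two disjoint curves\<close>

text \<open>At a crossing of a generic pair each curve passes once per period, so the velocities do not
  depend on the chosen parameters.\<close>

definition crossing_sign :: "(real \<Rightarrow> complex) \<Rightarrow> (real \<Rightarrow> complex) \<Rightarrow> complex \<Rightarrow> real" where
  "crossing_sign S T q = sgn (Im (vel T (SOME t. T t = q) / vel S (SOME s. S s = q)))"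

lemma crossing_sign_swap: "crossing_sign T S q = - crossing_sign S T q"
  unfolding crossing_sign_def by (rule sgn_Im_swap)

lemma crossing_sign_eq:
  assumes "generic_pair S T" "S s = q" "T t = q"
  shows "crossing_sign S T q = sgn (Im (vel T t / vel S s))" and "crossing_sign S T q = 1 \<or> crossing_sign S T q = - 1"
proof -
  note c = generic_pairD[OF assms(1)]
  have "T (SOME t. T t = q) = q" "S (SOME s. S s = q) = q" using someI[of "\<lambda>t. T t = q"] someI[of "\<lambda>s. S s = q"] assms by auto
  then have "(SOME t. T t = q) - t \<in> \<int>" "(SOME s. S s = q) - s \<in> \<int>"
    using assms unfolding generic_pair_def by metis+
  then have "vel T (SOME t. T t = q) = vel T t" "vel S (SOME s. S s = q) = vel S s"
    using periodic_Ints[of "vel T", OF vel_periodic[OF c(4)]] periodic_Ints[of "vel S", OF vel_periodic[OF c(3)]] by auto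
  then show e: "crossing_sign S T q = sgn (Im (vel T t / vel S s))" by (simp add: crossing_sign_def)
  have "Im (vel T t / vel S s) \<noteq> 0" using generic_pair_sym[OF assms(1)] assms(2,3) unfolding generic_pair_def by metis
  then show "crossing_sign S T q = 1 \<or> crossing_sign S T q = - 1" unfolding e by (auto simp: sgn_if)
qed

text \<open>The velocity of \<open>T\<close> at a crossing points to the side of \<open>S\<close>
  given by the crossing sign, so \<open>wind S\<close> along \<open>T\<close> is the mean minus half
  the sign before the crossing and plus half the sign after it. These are values of an actual
  winding number, hence integers.\<close>

lemma crossing_sums:
  fixes h :: "real \<Rightarrow> real"
  assumes gp: "generic_pair S T" and Q: "path_image S \<inter> path_image T = Q" "Q \<noteq> {}"
  shows "csum (\<lambda>z. h (wind S z)) (path_image S \<union> path_image T) = csum (\<lambda>z. h (wind S z)) (path_image S)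
      + (\<Sum>p\<in>nodes T. h (mean_index S p)) + (\<Sum>q\<in>Q. h (mean_index S q - crossing_sign S T q / 2))"
    and "(\<Sum>q\<in>Q. h (mean_index S q - crossing_sign S T q / 2)) = (\<Sum>q\<in>Q. h (mean_index S q + crossing_sign S T q / 2))"
    and "finite Q" and "q \<in> Q \<Longrightarrow> mean_index S q - crossing_sign S T q / 2 \<in> \<int>"
proof -
  note c = generic_pairD[OF gp]
  obtain q where q: "q \<in> path_image S" "q \<in> path_image T" using Q by blast
  \<comment> \<open>The sweep has to start on \<open>S\<close>, so \<open>T\<close> is given a
    crossing as its base point.\<close>
  then obtain t0 where t0: "T t0 \<in> path_image S" unfolding path_image_def[of T] by blast
  define b where "b = frac t0"
  define \<beta> where "\<beta> = (\<lambda>t. T (t + b))"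
  have b: "b \<in> {0..1}" using frac_ge_0[of t0] frac_lt_1[of t0] by (simp add: b_def)
  have gb: "generic_curve \<beta>" unfolding \<beta>_def by (rule generic_curve_shift[OF c(2)])
  have rb: "reg_curve \<beta>" using gb by (simp add: generic_curve_def)
  have vb: "vel \<beta> t = vel T (t + b)" for t unfolding \<beta>_def by (rule vel_shift[OF c(4)])
  have gpb: "generic_pair S \<beta>"
  proof -
    have sh: "(x + b) - (y + b) = x - y" for x y by simp
    show ?thesis using gp gb unfolding generic_pair_def vb unfolding \<beta>_def by (metis sh)
  qed
  note cb = generic_pairD[OF gpb]
  have im: "path_image \<beta> = path_image T" unfolding \<beta>_def by (rule path_image_shift[OF c(4)])
  have nd: "\<beta> ` double_times \<beta> = nodes T" using nodes_shift[OF c(4), of b] by (simp add: nodes_def \<beta>_def)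
  let ?g = "\<lambda>z. h (wind S z)"
  let ?\<sigma> = "crossing_sign S T"
  have A: "compact (path_image S)" "path_connected (path_image S)" "finite (components (- path_image S))" "loc_const ?g (path_image S)"
    using compact_path_image[OF reg_path[OF c(3)]] path_connected_path_image[OF reg_path[OF c(3)]]
      generic_curve_components(1)[OF c(1)] loc_const_wind[OF reg_path[OF c(3)] reg_closed[OF c(3)], of h] by auto
  have B: "path \<beta>" "\<beta> 0 \<in> path_image S" "\<beta> 1 = \<beta> 0"
    using reg_path[OF rb] reg_closed[OF rb] t0 reg_frac[OF c(4), of t0] by (auto simp: \<beta>_def b_def)
  have D: "finite (double_times \<beta>)" "at_most_double \<beta>" "\<beta> ` double_times \<beta> \<inter> path_image S = {}"
    using finite_double_times[OF gb] at_most_double_generic[OF gb] nd c(6) by auto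
  have H: "finite {t\<in>{0..<1}. \<beta> t \<in> path_image S}" by (rule finite_crossings[OF gpb])
  have key: "(\<forall>\<^sub>F z in dirf (\<beta> t) (vel \<beta> t). z \<notin> path_image S \<and> wind S z = mean_index S (\<beta> t) + ?\<sigma> (\<beta> t) / 2) \<and>
     (\<forall>\<^sub>F z in dirf (\<beta> t) (- vel \<beta> t). z \<notin> path_image S \<and> wind S z = mean_index S (\<beta> t) - ?\<sigma> (\<beta> t) / 2)"
    if t: "\<beta> t \<in> path_image S" for t
  proof -
    obtain s where s: "S s = \<beta> t" using t by (auto simp: path_image_def)
    have ti: "\<beta> t \<in> path_image T" unfolding im[symmetric] reg_path_image[OF rb] by simp
    have Tt: "T (t + b) = \<beta> t" by (simp add: \<beta>_def)
    have ci: "cindex S (\<beta> t) [vel S s] (mean_index S (\<beta> t))" by (rule crossing_single(1)[OF gp s ti])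
    have sg: "?\<sigma> (\<beta> t) = sgn (Im (vel \<beta> t / vel S s))" unfolding vb by (rule crossing_sign_eq(1)[OF gp s Tt])
    have "Im (vel \<beta> t / vel S s) \<noteq> 0" using crossing_sign_eq(2)[OF gp s Tt] unfolding sg by auto
    then show ?thesis
      using cindexD[OF ci, of "vel \<beta> t"] cindexD[OF ci, of "- vel \<beta> t"] unfolding sg by (simp add: sgn_minus)
  qed
  have before: "\<forall>\<^sub>F u in at_left t. ?g (\<beta> u) = h (mean_index S (\<beta> t) - ?\<sigma> (\<beta> t) / 2)" if t: "\<beta> t \<in> path_image S" for t
  proof -
    have "filterlim \<beta> (dirf (\<beta> t) (- vel \<beta> t)) (at_left t)"
      by (rule filterlim_dirf_left[OF has_vector_derivative_at_within[OF reg_deriv[OF rb]]])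
    from eventually_compose_filterlim[OF conjunct2[OF key[OF t]] this] show ?thesis
      by (rule eventually_mono) simp
  qed
  have after: "\<forall>\<^sub>F u in at_right t. ?g (\<beta> u) = h (mean_index S (\<beta> t) + ?\<sigma> (\<beta> t) / 2)" if t: "\<beta> t \<in> path_image S" for t
  proof -
    have "filterlim \<beta> (dirf (\<beta> t) (vel \<beta> t)) (at_right t)"
      by (rule filterlim_dirf_right[OF has_vector_derivative_at_within[OF reg_deriv[OF rb]]])
    from eventually_compose_filterlim[OF conjunct1[OF key[OF t]] this] show ?thesis
      by (rule eventually_mono) simp
  qed
  have nodes: "(\<Sum>p\<in>nodes T. ?g p) = (\<Sum>p\<in>nodes T. h (mean_index S p))"
  proof (rule sum.cong[OF refl])
    fix p assume "p \<in> nodes T"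
    then have "p \<notin> path_image S" using c(6) by blast
    then show "?g p = h (mean_index S p)" using mean_index_off(2)[OF c(1)] by simp
  qed
  show "csum ?g (path_image S \<union> path_image T) = csum ?g (path_image S)
      + (\<Sum>p\<in>nodes T. h (mean_index S p)) + (\<Sum>q\<in>Q. h (mean_index S q - ?\<sigma> q / 2))"
    using csum_closed_curve(2)[OF A B D H before] unfolding im nd Q nodes by simp
  show "(\<Sum>q\<in>Q. h (mean_index S q - ?\<sigma> q / 2)) = (\<Sum>q\<in>Q. h (mean_index S q + ?\<sigma> q / 2))"
    using before_after_sum[OF A B D H before after] unfolding im Q by simp
  have "Q \<subseteq> \<beta> ` {t\<in>{0..<1}. \<beta> t \<in> path_image S}"
    using path_image_closed[OF B(3)] unfolding im Q(1)[symmetric] by auto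
  then show "finite Q" using H finite_subset by blast
  show "mean_index S q - ?\<sigma> q / 2 \<in> \<int>" if q: "q \<in> Q" for q
  proof -
    obtain t where t: "q = \<beta> t" "\<beta> t \<in> path_image S" using q \<open>Q \<subseteq> \<beta> ` {t\<in>{0..<1}. \<beta> t \<in> path_image S}\<close> by blast
    obtain z where "z \<notin> path_image S \<and> wind S z = mean_index S (\<beta> t) - ?\<sigma> (\<beta> t) / 2"
      using eventually_happens'[OF dirf_neq_bot conjunct2[OF key[OF t(2)]]] by blast
    then show ?thesis
      using winding_number_eq_wind(2)[OF reg_path[OF c(3)] reg_closed[OF c(3)], of z] t(1) by simp
  qed
qed

text \<open>In the direction \<open>?v + ?w\<close> the half-jumps of the two branches cancel, so
  the mean index is the winding number in that quadrant.\<close>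

lemma mean_index_node_Ints:
  assumes "generic_curve S" "p \<in> nodes S" shows "mean_index S p \<in> \<int>"
proof -
  have r: "reg_curve S" using assms(1) by (simp add: generic_curve_def)
  obtain s t where st: "S s = p" "S t = p" "s - t \<notin> \<int>" using nodesE[OF assms(2)] by metis
  let ?v = "vel S s" and ?w = "vel S t"
  have Im: "Im (?v / ?w) \<noteq> 0" using assms(1) st unfolding generic_curve_def by metis
  then have Im': "Im (?w / ?v) \<noteq> 0" using Im_divide_sym_ne by blast
  have e: "Im ((?v + ?w) / ?v) = Im (?w / ?v)" "Im ((?v + ?w) / ?w) = Im (?v / ?w)"
    using reg_nonzero[OF r] by (simp_all add: add_divide_distrib)
  have "Im ((?v + ?w) / x) \<noteq> 0" if "x \<in> set [?v, ?w]" for x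
  proof -
    have "x = ?v \<or> x = ?w" using that by simp
    then show ?thesis using Im Im' e by metis
  qed
  from cindexD[OF mean_index_double[OF assms(1) st] this]
  have "\<forall>\<^sub>F z in dirf p (?v + ?w). z \<notin> path_image S \<and> wind S z = mean_index S p"
    using sgn_Im_swap[of ?v ?w] e by simp
  then obtain z where "z \<notin> path_image S" "wind S z = mean_index S p"
    using eventually_happens'[OF dirf_neq_bot] by blast
  then show ?thesis using winding_number_eq_wind(2)[OF reg_path[OF r] reg_closed[OF r]] by metis
qed

section \<open>Two disjoint curves\<close>

lemma component_touches:
  fixes A :: "complex set"
  assumes A: "closed A" "A \<noteq> {}" and E: "E \<in> components (- A)"
  shows "\<exists>a\<in>A. a \<in> closure E"
proof -
  have "frontier E \<subseteq> A" by (rule frontier_of_components_closed_complement[OF A(1) E])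
  moreover have "E \<noteq> {}" "E \<noteq> UNIV" using in_components_nonempty[OF E] in_components_subset[OF E] A(2) by auto
  then have "frontier E \<noteq> {}" by (simp add: frontier_eq_empty)
  ultimately show ?thesis unfolding frontier_def by blast
qed

text \<open>The component has a boundary point in \<open>A\<close>; adding this point keeps it
  connected and attaches it to \<open>A\<close>.\<close>

lemma component_Un_connected:
  fixes A :: "complex set"
  assumes A: "closed A" "A \<noteq> {}" "connected A" and E: "E \<in> components (- A)"
  shows "connected (E \<union> A)"
proof -
  obtain a where a: "a \<in> A" "a \<in> closure E" using component_touches[OF A(1,2) E] by blast
  have "connected (insert a E)"
    by (rule connected_intermediate_closure[of E]) (use in_components_connected[OF E] a(2) closure_subset in auto)
  moreover have "insert a E \<inter> A \<noteq> {}" using a(1) by auto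
  ultimately have "connected (insert a E \<union> A)" using A(3) by (intro connected_Un)
  then show ?thesis using a(1) by (simp add: insert_absorb)
qed

text \<open>Two disjoint connected compact sets: by Janiszewski's theorem the complementary components of
  each set facing the other one intersect in a single component, all others are unchanged.\<close>

lemma components_Un_disjoint:
  fixes A B :: "complex set"
  assumes A: "compact A" "connected A" "A \<noteq> {}" and B: "compact B" "connected B" "B \<noteq> {}" and AB: "A \<inter> B = {}"
    and C: "C \<in> components (- A)" "B \<subseteq> C" and D: "D \<in> components (- B)" "A \<subseteq> D"
  shows "components (- (A \<union> B)) = insert (C \<inter> D) ((components (- A) - {C}) \<union> (components (- B) - {D}))"
    and "E \<in> components (- A) - {C} \<Longrightarrow> E \<subseteq> D" and "F \<in> components (- B) - {D} \<Longrightarrow> F \<subseteq> C"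
    and "C \<inter> D \<noteq> {}"
proof -
  have cl: "closed A" "closed B" using A B by (auto intro: compact_imp_closed)
  have opA: "open E" if "E \<in> components (- A)" for E using that cl by (metis open_Compl open_components)
  have opB: "open E" if "E \<in> components (- B)" for E using that cl by (metis open_Compl open_components)
  \<comment> \<open>\<open>E\<close> together with \<open>A\<close> is connected and misses
    \<open>B\<close>, which lies in the different component \<open>C\<close>; so it stays in the
    component of \<open>- B\<close> that contains \<open>A\<close>.\<close>
  have subD: "E \<subseteq> D" if E: "E \<in> components (- A) - {C}" for E
  proof -
    have "E \<inter> C = {}" using E C components_eq by blast
    then have "E \<union> A \<subseteq> - B" using C(2) AB by blast
    moreover have "connected (E \<union> A)" using component_Un_connected[OF cl(1) A(3,2)] E by blast
    moreover have "D \<inter> (E \<union> A) \<noteq> {}" using D(2) A(3) by blast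
    ultimately have "E \<union> A \<subseteq> D" using components_maximal[OF D(1)] by blast
    then show ?thesis by blast
  qed
  have subC: "F \<subseteq> C" if F: "F \<in> components (- B) - {D}" for F
  proof -
    have "F \<inter> D = {}" using F D components_eq by blast
    then have "F \<union> B \<subseteq> - A" using D(2) AB by blast
    moreover have "connected (F \<union> B)" using component_Un_connected[OF cl(2) B(3,2)] F by blast
    moreover have "C \<inter> (F \<union> B) \<noteq> {}" using C(2) B(3) by blast
    ultimately have "F \<union> B \<subseteq> C" using components_maximal[OF C(1)] by blast
    then show ?thesis by blast
  qed
  show "E \<in> components (- A) - {C} \<Longrightarrow> E \<subseteq> D" by (rule subD)
  show "F \<in> components (- B) - {D} \<Longrightarrow> F \<subseteq> C" by (rule subC)
  \<comment> \<open>\<open>D\<close> has a boundary point in \<open>B\<close>, and the open set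
    \<open>C\<close> is a neighbourhood of that point.\<close>
  show ne: "C \<inter> D \<noteq> {}"
  proof -
    obtain b where "b \<in> B" "b \<in> closure D" using component_touches[OF cl(2) B(3) D(1)] by blast
    then have "b \<in> C \<inter> closure D" using C(2) by blast
    then show ?thesis using opA[OF C(1)] open_Int_closure_eq_empty by blast
  qed
  have con: "connected (C \<inter> D)"
  proof -
    have "connected_component (C \<inter> D) x y" if xy: "x \<in> C \<inter> D" "y \<in> C \<inter> D" for x y
    proof -
      have "connected_component (- A) x y"
        unfolding connected_component_def using xy in_components_connected[OF C(1)] in_components_subset[OF C(1)] by blast
      moreover have "connected_component (- B) x y"
        unfolding connected_component_def using xy in_components_connected[OF D(1)] in_components_subset[OF D(1)] by blast
      moreover have "connected (A \<inter> B)" using AB by simp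
      ultimately have "connected_component (- (A \<union> B)) x y" using Janiszewski[OF A(1) cl(2)] by blast
      then obtain T where T: "connected T" "T \<subseteq> - (A \<union> B)" "x \<in> T" "y \<in> T" unfolding connected_component_def by blast
      have "T \<subseteq> - A" "T \<subseteq> - B" "C \<inter> T \<noteq> {}" "D \<inter> T \<noteq> {}" using T xy by blast+
      then have "T \<subseteq> C" "T \<subseteq> D" using components_maximal[OF C(1) T(1)] components_maximal[OF D(1) T(1)] by blast+
      then show ?thesis unfolding connected_component_def using T by blast
    qed
    then show ?thesis by (simp add: connected_iff_connected_component)
  qed
  show "components (- (A \<union> B)) = insert (C \<inter> D) ((components (- A) - {C}) \<union> (components (- B) - {D}))"
  proof (rule components_eq_partition)
    show "open E \<and> connected E \<and> E \<noteq> {}" if EX: "E \<in> insert (C \<inter> D) ((components (- A) - {C}) \<union> (components (- B) - {D}))" for E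
    proof -
      consider "E = C \<inter> D" | "E \<in> components (- A)" | "E \<in> components (- B)" using EX by blast
      then show ?thesis
      proof cases
        case 1
        then show ?thesis using con ne opA[OF C(1)] opB[OF D(1)] by auto
      next
        case 2
        then show ?thesis using opA in_components_connected in_components_nonempty by metis
      next
        case 3
        then show ?thesis using opB in_components_connected in_components_nonempty by metis
      qed
    qed
    have EE: "E \<inter> E' = {}" if "E \<in> components X" "E' \<in> components X" "E \<noteq> E'" for E E' and X :: "complex set"
      using components_eq[OF that(1,2)] that(3) by blast
    have d1: "E \<inter> (C \<inter> D) = {}" if "E \<in> components (- A) - {C}" for E
      using EE[of E "- A" C] that C(1) by blast
    have d2: "F \<inter> (C \<inter> D) = {}" if "F \<in> components (- B) - {D}" for F
      using EE[of F "- B" D] that D(1) by blast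
    have d3: "E \<inter> F = {}" if "E \<in> components (- A) - {C}" "F \<in> components (- B) - {D}" for E F
      using EE[of F "- B" D] subD[OF that(1)] that(2) D(1) by blast
    show "pairwise disjnt (insert (C \<inter> D) ((components (- A) - {C}) \<union> (components (- B) - {D})))"
      unfolding pairwise_def disjnt_def
    proof (intro ballI impI)
      fix X Y assume X: "X \<in> insert (C \<inter> D) ((components (- A) - {C}) \<union> (components (- B) - {D}))"
        and Y: "Y \<in> insert (C \<inter> D) ((components (- A) - {C}) \<union> (components (- B) - {D}))" and ne: "X \<noteq> Y"
      consider "X = C \<inter> D" | "X \<in> components (- A) - {C}" | "X \<in> components (- B) - {D}" using X by blast
      note cX = this
      consider "Y = C \<inter> D" | "Y \<in> components (- A) - {C}" | "Y \<in> components (- B) - {D}" using Y by blast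
      then show "X \<inter> Y = {}"
      proof cases
        case 1 then show ?thesis using cX d1[of X] d2[of X] ne by auto
      next
        case 2
        show ?thesis
        proof (rule cX)
          assume "X = C \<inter> D" then show ?thesis using d1[OF 2] by blast
        next
          assume "X \<in> components (- A) - {C}" then show ?thesis using EE[of X "- A" Y] 2 ne by blast
        next
          assume "X \<in> components (- B) - {D}" then show ?thesis using d3[OF 2] by blast
        qed
      next
        case 3
        show ?thesis
        proof (rule cX)
          assume "X = C \<inter> D" then show ?thesis using d2[OF 3] by blast
        next
          assume "X \<in> components (- A) - {C}" then show ?thesis using d3[OF _ 3] by blast
        next
          assume "X \<in> components (- B) - {D}" then show ?thesis using EE[of X "- B" Y] 3 ne by blast
        qed
      qed
    qed
    show "\<Union> (insert (C \<inter> D) ((components (- A) - {C}) \<union> (components (- B) - {D}))) = - (A \<union> B)"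
    proof (intro equalityI subsetI)
      fix x assume "x \<in> \<Union> (insert (C \<inter> D) ((components (- A) - {C}) \<union> (components (- B) - {D})))"
      then consider "x \<in> C \<inter> D" | E where "E \<in> components (- A) - {C}" "x \<in> E" | F where "F \<in> components (- B) - {D}" "x \<in> F" by blast
      then show "x \<in> - (A \<union> B)"
      proof cases
        case 1 then show ?thesis using in_components_subset[OF C(1)] in_components_subset[OF D(1)] by blast
      next
        case 2
        then have "x \<in> D" "x \<in> - A" using subD[OF 2(1)] in_components_subset[of E "- A"] by blast+
        then show ?thesis using in_components_subset[OF D(1)] by blast
      next
        case 3
        then have "x \<in> C" "x \<in> - B" using subC[OF 3(1)] in_components_subset[of F "- B"] by blast+
        then show ?thesis using in_components_subset[OF C(1)] by blast
      qed
    next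
      fix x assume x: "x \<in> - (A \<union> B)"
      obtain E where E: "E \<in> components (- A)" "x \<in> E" using x Union_components[of "- A"] by blast
      obtain F where F: "F \<in> components (- B)" "x \<in> F" using x Union_components[of "- B"] by blast
      show "x \<in> \<Union> (insert (C \<inter> D) ((components (- A) - {C}) \<union> (components (- B) - {D})))"
        using E F by (cases "E = C"; cases "F = D") auto
    qed
  qed
qed

text \<open>\<open>C \<inter> D\<close> takes the place of \<open>C\<close>. The other components of
  \<open>- B\<close> all lie inside \<open>C\<close>, where \<open>f\<close> has the constant value
  \<open>f b\<close>.\<close>

lemma csum_Un_disjoint:
  fixes A B :: "complex set"
  assumes A: "compact A" "connected A" "A \<noteq> {}" "finite (components (- A))"
    and B: "compact B" "connected B" "finite (components (- B))" and AB: "A \<inter> B = {}" and b: "b \<in> B"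
    and f: "loc_const f A"
  shows "csum f (A \<union> B) = csum f A + (real (card (components (- B))) - 1) * f b"
proof -
  have "B \<noteq> {}" using b by blast
  have "- A \<noteq> {}" "- B \<noteq> {}" using AB A(3) b by blast+
  then obtain C D where C: "C \<in> components (- A)" "B \<subseteq> C" and D: "D \<in> components (- B)" "A \<subseteq> D"
    using exists_component_superset[of B "- A"] exists_component_superset[of A "- B"] AB A(2) B(2) by blast
  note u = components_Un_disjoint[OF A(1-3) B(1,2) \<open>B \<noteq> {}\<close> AB C D]
  have bC: "b \<in> C" using b C(2) by blast
  have fC: "cval f X = f b" if X: "X \<subseteq> C" "X \<noteq> {}" for X
  proof -
    have "(SOME z. z \<in> X) \<in> C" using X by (metis some_in_eq subsetD)
    then show ?thesis
      unfolding cval_def using loc_constD[OF f in_components_connected[OF C(1)] in_components_subset[OF C(1)] _ bC] by blast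
  qed
  have EE: "E \<inter> E' = {}" if "E \<in> components X" "E' \<in> components X" "E \<noteq> E'" for E E' and X :: "complex set"
    using components_eq[OF that(1,2)] that(3) by blast
  have n1: "C \<inter> D \<notin> (components (- A) - {C}) \<union> (components (- B) - {D})"
    using u(4) EE[of "C \<inter> D" "- A" C] EE[of "C \<inter> D" "- B" D] C(1) D(1) by blast
  have n2: "(components (- A) - {C}) \<inter> (components (- B) - {D}) = {}"
  proof (rule ccontr)
    assume "\<not> ?thesis"
    then obtain E where E: "E \<in> components (- A) - {C}" "E \<in> components (- B) - {D}" by blast
    have "E \<subseteq> D" by (rule u(2)[OF E(1)])
    moreover have "E \<inter> D = {}" using EE[of E "- B" D] E(2) D(1) by blast
    ultimately show False using in_components_nonempty[of E "- A"] E(1) by blast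
  qed
  have "csum f (A \<union> B) = cval f (C \<inter> D) + ((\<Sum>E\<in>components (- A) - {C}. cval f E) + (\<Sum>F\<in>components (- B) - {D}. cval f F))"
    unfolding csum_def u(1) using A(4) B(3) n1 n2 by (simp add: sum.union_disjoint)
  also have "(\<Sum>F\<in>components (- B) - {D}. cval f F) = (\<Sum>F\<in>components (- B) - {D}. f b)"
    by (rule sum.cong[OF refl]) (use fC u(3) in_components_nonempty in blast)
  also have "\<dots> = (real (card (components (- B))) - 1) * f b"
  proof -
    have "card (components (- B)) > 0" using D(1) B(3) card_gt_0_iff by blast
    then show ?thesis using D(1) B(3) by (simp add: card_Diff_singleton of_nat_diff)
  qed
  also have "cval f (C \<inter> D) = f b" using fC[of "C \<inter> D"] u(4) by blast
  also have "f b + ((\<Sum>E\<in>components (- A) - {C}. cval f E) + (real (card (components (- B))) - 1) * f b)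
     = csum f A + (real (card (components (- B))) - 1) * f b"
  proof -
    have "csum f A = cval f C + (\<Sum>E\<in>components (- A) - {C}. cval f E)"
      unfolding csum_def by (rule sum.remove[OF A(4) C(1)])
    moreover have "cval f C = f b" using fC[of C] in_components_nonempty[OF C(1)] by blast
    ultimately show ?thesis by simp
  qed
  finally show ?thesis .
qed

text \<open>By Euler's count \<open>- path_image T\<close> has \<open>card (nodes T) + 2\<close>
  components. All but the one facing \<open>S\<close> are new, and \<open>wind S\<close> equals
  \<open>a\<close> on each of them.\<close>

lemma disjoint_sums:
  fixes h :: "real \<Rightarrow> real"
  assumes gp: "generic_pair S T" and dis: "path_image S \<inter> path_image T = {}"
  defines "a \<equiv> wind S (T 0)"
  shows "csum (\<lambda>z. h (wind S z)) (path_image S \<union> path_image T) = csum (\<lambda>z. h (wind S z)) (path_image S) + (card (nodes T) + 1) * h a"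
    and "p \<in> path_image T \<Longrightarrow> mean_index S p = a" and "a \<in> \<int>"
    and "of_int (omega [S] (THE C. C \<in> components (- path_image S) \<and> path_image T \<subseteq> C)) = a"
proof -
  note c = generic_pairD[OF gp]
  have pS: "compact (path_image S)" "connected (path_image S)" "path_image S \<noteq> {}"
    and pT: "compact (path_image T)" "connected (path_image T)"
    using reg_path[OF c(3)] reg_path[OF c(4)] compact_path_image connected_path_image path_image_nonempty by auto
  have T0: "T 0 \<in> path_image T" by (auto simp: path_image_def)
  have off: "T 0 \<notin> path_image S" using T0 dis by blast
  have lc: "loc_const (\<lambda>z. h (wind S z)) (path_image S)" for h :: "real \<Rightarrow> real"
    by (rule loc_const_wind[OF reg_path[OF c(3)] reg_closed[OF c(3)]])
  have "real (card (components (- path_image T))) - 1 = card (nodes T) + 1" using generic_curve_components(2)[OF c(2)] by simp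
  then show "csum (\<lambda>z. h (wind S z)) (path_image S \<union> path_image T) = csum (\<lambda>z. h (wind S z)) (path_image S) + (card (nodes T) + 1) * h a"
    using csum_Un_disjoint[OF pS generic_curve_components(1)[OF c(1)] pT generic_curve_components(1)[OF c(2)] dis T0 lc[of h]]
    unfolding a_def by simp
  show "mean_index S p = a" if p: "p \<in> path_image T"
  proof -
    have "mean_index S p = wind S p" using mean_index_off(2)[OF c(1)] p dis by blast
    also have "\<dots> = a" unfolding a_def
      by (rule loc_constD[OF lc[of "\<lambda>x. x"] pT(2) _ p T0]) (use dis in blast)
    finally show ?thesis .
  qed
  show "a \<in> \<int>" unfolding a_def by (rule winding_number_eq_wind(2)[OF reg_path[OF c(3)] reg_closed[OF c(3)] off])
  obtain C where C: "C \<in> components (- path_image S)" "path_image T \<subseteq> C"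
    using exists_component_superset[of "path_image T" "- path_image S"] pT(2) dis T0 by blast
  have "(THE C. C \<in> components (- path_image S) \<and> path_image T \<subseteq> C) = C"
  proof (rule the_equality)
    fix D assume "D \<in> components (- path_image S) \<and> path_image T \<subseteq> D"
    then show "D = C" using components_eq[of D "- path_image S" C] C T0 by blast
  qed (use C in blast)
  moreover have "of_int (omega [S] C) = total_wind [S] (T 0)"
  proof (rule omega_eq)
    show "C \<in> components (- curve_image [S])" using C(1) by (simp add: curve_image_pair)
  qed (use reg_path[OF c(3)] reg_closed[OF c(3)] C(2) T0 in auto)
  ultimately show "of_int (omega [S] (THE C. C \<in> components (- path_image S) \<and> path_image T \<subseteq> C)) = a"
    by (simp add: total_wind_pair a_def)
qed

section \<open>Evenness of the invariant of one curve\<close>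

lemma csum_scale: "csum (\<lambda>z. c * f z) X = c * csum f X"
  by (simp add: csum_def cval_def sum_distrib_left)

lemma csum_Ints:
  assumes "\<And>z. z \<notin> X \<Longrightarrow> f z \<in> \<int>" shows "csum f X \<in> \<int>"
  unfolding csum_def
proof (rule Ints_sum)
  fix C assume C: "C \<in> components (- X)"
  then have "(SOME z. z \<in> C) \<in> C" using in_components_nonempty by (simp add: some_in_eq)
  then have "(SOME z. z \<in> C) \<notin> X" using in_components_subset[OF C] by auto
  then show "cval f C \<in> \<int>" unfolding cval_def by (rule assms)
qed

lemma half_square_diff_Ints:
  assumes "x \<in> \<int>" shows "(x\<^sup>2 - x) / 2 \<in> (\<int> :: real set)"
proof -
  obtain k :: int where x: "x = of_int k" using assms by (auto elim: Ints_cases)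
  have "even (k\<^sup>2 - k)" by simp
  then obtain m where "k\<^sup>2 - k = 2 * m" by blast
  then have "of_int (k\<^sup>2 - k) = (of_int (2 * m) :: real)" by simp
  then have "(x\<^sup>2 - x) / 2 = of_int m" unfolding x by simp
  then show ?thesis by simp
qed

lemma wind_Ints:
  assumes "generic_curve S" "z \<notin> path_image S" shows "wind S z \<in> \<int>"
proof -
  have "reg_curve S" using assms(1) by (simp add: generic_curve_def)
  from winding_number_eq_wind(2)[OF reg_path[OF this] reg_closed[OF this] assms(2)] show ?thesis .
qed

text \<open>Integers and their squares have the same parity, so modulo 2 the squares in Viro's
  formula may be replaced by the numbers themselves; what results is the expression in
  \<open>generic_curve_parity\<close>.\<close>

lemma J_plus_even:
  assumes "generic_curve S" shows "J_plus S / 2 \<in> \<int>"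
proof -
  let ?w = "csum (wind S) (path_image S)" and ?m = "\<Sum>p\<in>nodes S. mean_index S p"
  obtain k :: int where k: "?w - ?m + card (nodes S) + 1 = 2 * of_int k"
    using generic_curve_parity[OF assms] by blast
  have w: "?w \<in> \<int>" by (rule csum_Ints) (rule wind_Ints[OF assms])
  have m: "?m \<in> \<int>" by (rule Ints_sum) (rule mean_index_node_Ints[OF assms])
  have "csum (\<lambda>z. (wind S z)\<^sup>2) (path_image S) = ?w + csum (\<lambda>z. 2 * (((wind S z)\<^sup>2 - wind S z) / 2)) (path_image S)"
    by (rule csum_add) (simp add: field_simps)
  then have w2: "csum (\<lambda>z. (wind S z)\<^sup>2) (path_image S) = ?w + 2 * csum (\<lambda>z. ((wind S z)\<^sup>2 - wind S z) / 2) (path_image S)"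
    unfolding csum_scale .
  have m2: "(\<Sum>p\<in>nodes S. (mean_index S p)\<^sup>2) = ?m + 2 * (\<Sum>p\<in>nodes S. ((mean_index S p)\<^sup>2 - mean_index S p) / 2)"
    by (simp add: sum_subtractf field_simps flip: sum_divide_distrib)
  have c: "csum (\<lambda>z. ((wind S z)\<^sup>2 - wind S z) / 2) (path_image S) \<in> \<int>"
    by (rule csum_Ints) (rule half_square_diff_Ints[OF wind_Ints[OF assms]])
  have d: "(\<Sum>p\<in>nodes S. ((mean_index S p)\<^sup>2 - mean_index S p) / 2) \<in> \<int>"
    by (rule Ints_sum) (rule half_square_diff_Ints[OF mean_index_node_Ints[OF assms]])
  have "J_plus S / 2 = of_int k - ?w + ?m - csum (\<lambda>z. ((wind S z)\<^sup>2 - wind S z) / 2) (path_image S)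
      + (\<Sum>p\<in>nodes S. ((mean_index S p)\<^sup>2 - mean_index S p) / 2)"
    unfolding J_plus_eq[OF assms] w2 m2 using k by (simp add: field_simps)
  also have "\<dots> \<in> \<int>" by (intro Ints_add Ints_diff Ints_of_int w m c d)
  finally show ?thesis .
qed

section \<open>Reversing one curve\<close>

lemma nodes_reverse:
  assumes "reg_curve S" shows "nodes (reversepath S) = nodes S"
proof -
  have sub: "nodes (reversepath X) \<subseteq> nodes X" if X: "reg_curve X" for X
  proof
    fix p assume "p \<in> nodes (reversepath X)"
    then obtain s t where st: "reversepath X s = p" "reversepath X t = p" "s - t \<notin> \<int>" using nodesE by metis
    have "(1 - s) - (1 - t) \<notin> \<int>" using st(3) Ints_minus[of "t - s"] by auto
    then show "p \<in> nodes X" using nodesI[OF X] st(1,2) unfolding reversepath_def by blast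
  qed
  show ?thesis using sub[OF assms] sub[OF reg_reverse[OF assms]] by simp
qed

lemma wind_reverse:
  assumes "reg_curve S" "z \<notin> path_image S" shows "wind (reversepath S) z = - wind S z"
  using winding_number_reversepath[OF reg_path[OF assms(1)] assms(2)] by (simp add: wind_def)

lemma cindex_reverse:
  assumes "reg_curve S" "cindex S p V m" shows "cindex (reversepath S) p (map uminus V) (- m)"
  unfolding cindex_def
proof (intro allI impI)
  fix d assume d: "\<forall>v\<in>set (map uminus V). Im (d / v) \<noteq> 0"
  have "Im (d / v) \<noteq> 0" if "v \<in> set V" for v
  proof -
    have "Im (d / (- v)) \<noteq> 0" using d that by (simp del: divide_minus_right)
    then show ?thesis by simp
  qed
  then have "\<forall>\<^sub>F z in dirf p d. z \<notin> path_image S \<and> wind S z = m + (\<Sum>v\<leftarrow>V. sgn (Im (d / v))) / 2"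
    by (rule cindexD[OF assms(2)])
  moreover have "(\<Sum>v\<leftarrow>map uminus V. sgn (Im (d / v))) = - (\<Sum>v\<leftarrow>V. sgn (Im (d / v)))"
    by (induction V) (simp_all add: sgn_minus)
  ultimately show "\<forall>\<^sub>F z in dirf p d. z \<notin> path_image (reversepath S) \<and>
      wind (reversepath S) z = - m + (\<Sum>v\<leftarrow>map uminus V. sgn (Im (d / v))) / 2"
    using wind_reverse[OF assms(1)] by (auto elim!: eventually_mono)
qed

lemma cindex_unique:
  assumes "cindex S p V m" "cindex S p V m'" "\<And>v. v \<in> set V \<Longrightarrow> Im (d / v) \<noteq> 0" shows "m = m'"
  using eventually_const_unique[OF cindexD[OF assms(1,3)] cindexD[OF assms(2,3)]] by simp

lemma mean_index_reverse:
  assumes "generic_curve S" shows "mean_index (reversepath S) p = - mean_index S p"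
proof -
  let ?R = "reversepath S"
  have r: "reg_curve S" using assms by (simp add: generic_curve_def)
  note R = generic_curve_reverse[OF assms]
  consider "p \<notin> path_image S" | "p \<in> nodes S" | "p \<in> path_image S" "p \<notin> nodes S" by blast
  then show ?thesis
  proof cases
    case 1
    then have "p \<notin> path_image ?R" by simp
    then show ?thesis using mean_index_off(2)[OF assms 1] mean_index_off(2)[OF R] wind_reverse[OF r 1] by simp
  next
    case 2
    obtain s t where st: "S s = p" "S t = p" "s - t \<notin> \<int>" using nodesE[OF 2] by metis
    let ?v = "vel S s" and ?w = "vel S t"
    have ne: "(1 - s) - (1 - t) \<notin> \<int>" using st(3) Ints_minus[of "t - s"] by auto
    have "cindex ?R p [vel ?R (1 - s), vel ?R (1 - t)] (mean_index ?R p)"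
      by (rule mean_index_double[OF R _ _ ne]) (simp_all add: reversepath_def st)
    then have a: "cindex ?R p [- ?v, - ?w] (mean_index ?R p)" by (simp add: vel_reverse[OF r])
    have b: "cindex ?R p [- ?v, - ?w] (- mean_index S p)"
      using cindex_reverse[OF r mean_index_double[OF assms st]] by simp
    have Im: "Im (?v / ?w) \<noteq> 0" using assms st unfolding generic_curve_def by metis
    then have Im': "Im (?w / ?v) \<noteq> 0" using Im_divide_sym_ne by blast
    have e: "Im ((?v + ?w) / ?v) = Im (?w / ?v)" "Im ((?v + ?w) / ?w) = Im (?v / ?w)"
      using reg_nonzero[OF r] by (simp_all add: add_divide_distrib)
    have "Im ((?v + ?w) / x) \<noteq> 0" if "x \<in> set [- ?v, - ?w]" for x
    proof -
      have "x = - ?v \<or> x = - ?w" using that by simp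
      then show ?thesis using Im Im' e by (metis divide_minus_right neg_equal_0_iff_equal uminus_complex.sel(2))
    qed
    then show ?thesis by (rule cindex_unique[OF a b])
  next
    case 3
    obtain t where t: "S t = p" using 3(1) by (auto simp: path_image_def)
    have u: "u - t \<in> \<int>" if "S u = p" for u using nodesI[OF r that t] 3(2) by blast
    have u': "u - (1 - t) \<in> \<int>" if "?R u = p" for u
    proof -
      have "(1 - u) - t \<in> \<int>" using u that by (simp add: reversepath_def)
      then show ?thesis using Ints_minus[of "(1 - u) - t"] by (simp add: algebra_simps)
    qed
    have "cindex ?R p [vel ?R (1 - t)] (mean_index ?R p)"
      by (rule mean_index_single[OF R]) (use t u' in \<open>auto simp: reversepath_def\<close>)
    then have a: "cindex ?R p [- vel S t] (mean_index ?R p)" by (simp add: vel_reverse[OF r])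
    have b: "cindex ?R p [- vel S t] (- mean_index S p)"
      using cindex_reverse[OF r mean_index_single[OF assms t u]] by simp
    \<comment> \<open>\<open>\<i> * vel S t\<close> is normal to the branch, hence an admissible
      direction for the comparison.\<close>
    show ?thesis by (rule cindex_unique[OF a b, of "\<i> * vel S t"]) (use reg_nonzero[OF r] in simp)
  qed
qed

lemma J_plus_reverse:
  assumes "generic_curve S" shows "J_plus (reversepath S) = J_plus S"
proof -
  have r: "reg_curve S" using assms by (simp add: generic_curve_def)
  have "csum (\<lambda>z. (wind (reversepath S) z)\<^sup>2) (path_image S) = csum (\<lambda>z. (wind S z)\<^sup>2) (path_image S)"
    by (rule csum_cong) (simp add: wind_reverse[OF r])
  then show ?thesis
    unfolding J_plus_eq[OF assms] J_plus_eq[OF generic_curve_reverse[OF assms]]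
    by (simp add: nodes_reverse[OF r] mean_index_reverse[OF assms])
qed

text \<open>Half of the mixed terms that arise when all squares in \<open>J_two_plus\<close> are
  expanded. The last summand belongs to the square of the encircling index, which is nonzero only
  for disjoint curves.\<close>

definition cross_term :: "(real \<Rightarrow> complex) \<Rightarrow> (real \<Rightarrow> complex) \<Rightarrow> real" where
  "cross_term S T = (\<Sum>p\<in>nodes S \<union> nodes T \<union> (path_image S \<inter> path_image T). mean_index S p * mean_index T p)
     - csum (\<lambda>z. wind S z * wind T z) (path_image S \<union> path_image T)
     + (if path_image S \<inter> path_image T = {} then wind S (T 0) * wind T (S 0) else 0)"

lemma cross_term_sym: "cross_term T S = cross_term S T"
  unfolding cross_term_def by (simp add: Un_commute Int_commute mult.commute)

text \<open>Each of the three summands is bilinear in the winding numbers of the two curves, and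
  reversal negates those of one curve.\<close>

lemma cross_term_reverse:
  assumes "generic_pair S T" shows "cross_term (reversepath S) T = - cross_term S T"
proof -
  note c = generic_pairD[OF assms]
  have "csum (\<lambda>z. wind (reversepath S) z * wind T z) (path_image S \<union> path_image T)
      = csum (\<lambda>z. - 1 * (wind S z * wind T z)) (path_image S \<union> path_image T)"
    by (rule csum_cong) (simp add: wind_reverse[OF c(3)])
  also have "\<dots> = - csum (\<lambda>z. wind S z * wind T z) (path_image S \<union> path_image T)" unfolding csum_scale by simp
  finally have e: "csum (\<lambda>z. wind (reversepath S) z * wind T z) (path_image S \<union> path_image T)
      = - csum (\<lambda>z. wind S z * wind T z) (path_image S \<union> path_image T)" .
  have S0: "reversepath S 0 = S 0" using reg_closed[OF c(3)] by (simp add: reversepath_def)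
  have T0: "T 0 \<in> path_image T" by (auto simp: path_image_def)
  have w: "wind (reversepath S) (T 0) = - wind S (T 0)" if "path_image S \<inter> path_image T = {}"
    by (rule wind_reverse[OF c(3)]) (use that T0 in blast)
  show ?thesis
    unfolding cross_term_def path_image_reversepath e S0 nodes_reverse[OF c(3)] mean_index_reverse[OF c(1)]
    using w by (simp add: sum_negf)
qed

section \<open>Decomposition and evenness of the pair invariant\<close>

lemma sum_double_points:
  fixes f :: "complex \<Rightarrow> real"
  assumes "generic_pair S T" "path_image S \<inter> path_image T = Q" "finite Q"
  shows "sum f (nodes S \<union> nodes T \<union> Q) = sum f (nodes S) + sum f (nodes T) + sum f Q"
proof -
  note c = generic_pairD[OF assms(1)]
  have "nodes S \<inter> nodes T = {}" "(nodes S \<union> nodes T) \<inter> Q = {}" using c(5-8) assms(2) by blast+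
  then show ?thesis
    using finite_nodes[OF c(1)] finite_nodes[OF c(2)] assms(3) by (simp add: sum.union_disjoint)
qed

text \<open>As \<open>\<sigma>^2 = 1\<close>, the squares before and after a crossing differ only in
  the sign of the term mean times \<open>\<sigma>\<close>. The two totals agree by
  \<open>crossing_sums\<close>, so these terms sum to zero; the identity function in place of the
  square gives the same for the signs.\<close>

lemma crossing_square_sums:
  assumes gp: "generic_pair S T" and Q: "path_image S \<inter> path_image T = Q" "Q \<noteq> {}"
  shows "(\<Sum>q\<in>Q. mean_index S q * crossing_sign S T q) = 0"
    and "(\<Sum>q\<in>Q. (mean_index S q - crossing_sign S T q / 2)\<^sup>2) = (\<Sum>q\<in>Q. (mean_index S q)\<^sup>2) + card Q / 4"
    and "(\<Sum>q\<in>Q. crossing_sign S T q) = 0"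
proof -
  let ?m = "mean_index S" and ?s = "crossing_sign S T"
  have s2: "(?s q)\<^sup>2 = 1" if q: "q \<in> Q" for q
  proof -
    have "q \<in> path_image S" "q \<in> path_image T" using q Q(1) by auto
    then obtain s t where "q = S s" "q = T t" unfolding path_image_def by blast
    then have "?s q = 1 \<or> ?s q = - 1" using crossing_sign_eq(2)[OF gp, of s q t] by simp
    then show ?thesis by auto
  qed
  have m: "(\<Sum>q\<in>Q. (?m q - ?s q / 2)\<^sup>2) = (\<Sum>q\<in>Q. (?m q)\<^sup>2) + card Q / 4 - (\<Sum>q\<in>Q. ?m q * ?s q)"
  proof -
    have "(\<Sum>q\<in>Q. (?m q - ?s q / 2)\<^sup>2) = (\<Sum>q\<in>Q. (?m q)\<^sup>2 + 1 / 4 - ?m q * ?s q)"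
    proof (rule sum.cong[OF refl])
      fix q assume "q \<in> Q"
      from s2[OF this] show "(?m q - ?s q / 2)\<^sup>2 = (?m q)\<^sup>2 + 1 / 4 - ?m q * ?s q"
        by (simp add: power2_diff power_divide)
    qed
    then show ?thesis by (simp add: sum.distrib sum_subtractf)
  qed
  have p: "(\<Sum>q\<in>Q. (?m q + ?s q / 2)\<^sup>2) = (\<Sum>q\<in>Q. (?m q)\<^sup>2) + card Q / 4 + (\<Sum>q\<in>Q. ?m q * ?s q)"
  proof -
    have "(\<Sum>q\<in>Q. (?m q + ?s q / 2)\<^sup>2) = (\<Sum>q\<in>Q. (?m q)\<^sup>2 + 1 / 4 + ?m q * ?s q)"
    proof (rule sum.cong[OF refl])
      fix q assume "q \<in> Q"
      from s2[OF this] show "(?m q + ?s q / 2)\<^sup>2 = (?m q)\<^sup>2 + 1 / 4 + ?m q * ?s q"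
        by (simp add: power2_sum power_divide)
    qed
    then show ?thesis by (simp add: sum.distrib)
  qed
  show z: "(\<Sum>q\<in>Q. ?m q * ?s q) = 0"
    using crossing_sums(2)[OF gp Q, of "\<lambda>x. x\<^sup>2"] m p by simp
  show "(\<Sum>q\<in>Q. (?m q - ?s q / 2)\<^sup>2) = (\<Sum>q\<in>Q. (?m q)\<^sup>2) + card Q / 4" using m z by simp
  show "(\<Sum>q\<in>Q. ?s q) = 0"
    using crossing_sums(2)[OF gp Q, of "\<lambda>x. x"] by (simp add: sum.distrib sum_subtractf flip: sum_divide_distrib)
qed

text \<open>With crossings, \<open>card Q\<close> from the double points loses a quarter for either
  curve, and the squared means at \<open>Q\<close> cancel. Without crossings, the nodes of
  \<open>T\<close> contribute \<open>a^2\<close> each while the new components subtract it once more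
  than there are nodes; the remainder \<open>- a^2 - b^2\<close> plus the square of the encircling
  index \<open>a + b\<close> leaves \<open>2 * a * b\<close>, which is part of the cross
  term.\<close>

theorem J_two_plus_decomp:
  assumes gp: "generic_pair S T"
  shows "J_two_plus S T = J_plus S + J_plus T + card (path_image S \<inter> path_image T) / 2 + 2 * cross_term S T"
proof -
  note c = generic_pairD[OF gp]
  note gp' = generic_pair_sym[OF gp]
  define Q where "Q = path_image S \<inter> path_image T"
  then have Q: "path_image S \<inter> path_image T = Q" by simp
  have Q': "path_image T \<inter> path_image S = Q" using Q by blast
  let ?U = "path_image S \<union> path_image T"
  let ?N = "nodes S \<union> nodes T \<union> Q"
  have U': "path_image T \<union> path_image S = ?U" by blast
  have fQ: "finite Q"
  proof (cases "Q = {}")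
    case False
    then show ?thesis by (rule crossing_sums(3)[OF gp Q])
  qed simp
  have card: "real (card ?N) = card (nodes S) + card (nodes T) + card Q"
    using sum_double_points[OF gp Q fQ, of "\<lambda>p. 1"] by simp
  have "csum (\<lambda>z. (wind S z + wind T z)\<^sup>2) ?U
      = csum (\<lambda>z. (wind S z)\<^sup>2 + (wind T z)\<^sup>2) ?U + csum (\<lambda>z. 2 * (wind S z * wind T z)) ?U"
    by (rule csum_add) (simp add: power2_sum)
  also have "csum (\<lambda>z. (wind S z)\<^sup>2 + (wind T z)\<^sup>2) ?U = csum (\<lambda>z. (wind S z)\<^sup>2) ?U + csum (\<lambda>z. (wind T z)\<^sup>2) ?U"
    by (rule csum_add) simp
  finally have w: "csum (\<lambda>z. (wind S z + wind T z)\<^sup>2) ?U = csum (\<lambda>z. (wind S z)\<^sup>2) ?U + csum (\<lambda>z. (wind T z)\<^sup>2) ?U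
      + 2 * csum (\<lambda>z. wind S z * wind T z) ?U" unfolding csum_scale .
  have "(\<Sum>p\<in>?N. (mean_index S p + mean_index T p)\<^sup>2)
      = (\<Sum>p\<in>?N. (mean_index S p)\<^sup>2 + (mean_index T p)\<^sup>2 + 2 * (mean_index S p * mean_index T p))"
    by (rule sum.cong) (simp_all add: power2_sum)
  then have m: "(\<Sum>p\<in>?N. (mean_index S p + mean_index T p)\<^sup>2)
      = (\<Sum>p\<in>?N. (mean_index S p)\<^sup>2) + (\<Sum>p\<in>?N. (mean_index T p)\<^sup>2) + 2 * (\<Sum>p\<in>?N. mean_index S p * mean_index T p)"
    by (simp only: sum.distrib sum_distrib_left)
  note mS = sum_double_points[OF gp Q fQ, of "\<lambda>p. (mean_index S p)\<^sup>2"]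
  note mT = sum_double_points[OF gp Q fQ, of "\<lambda>p. (mean_index T p)\<^sup>2"]
  show ?thesis
  proof (cases "Q = {}")
    case False
    have u: "encircling_index S T = 0" using False Q by (simp add: encircling_index_def)
    note wS = crossing_sums(1)[OF gp Q False, of "\<lambda>x. x\<^sup>2", unfolded crossing_square_sums(2)[OF gp Q False]]
    note wT = crossing_sums(1)[OF gp' Q' False, of "\<lambda>x. x\<^sup>2", unfolded crossing_square_sums(2)[OF gp' Q' False] U']
    show ?thesis
      unfolding J_two_plus_eq[OF gp] J_plus_eq[OF c(1)] J_plus_eq[OF c(2)] cross_term_def Q w m card u mS mT wS wT
      using False card by simp
  next
    case True
    note d = disjoint_sums[OF gp Q[unfolded True]]
    note e = disjoint_sums[OF gp' Q'[unfolded True]]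
    let ?a = "wind S (T 0)" and ?b = "wind T (S 0)"
    note wS = d(1)[of "\<lambda>x. x\<^sup>2"]
    note wT = e(1)[of "\<lambda>x. x\<^sup>2", unfolded U']
    have nT: "(\<Sum>p\<in>nodes T. (mean_index S p)\<^sup>2) = card (nodes T) * ?a\<^sup>2"
    proof -
      have "(\<Sum>p\<in>nodes T. (mean_index S p)\<^sup>2) = (\<Sum>p\<in>nodes T. ?a\<^sup>2)"
        by (rule sum.cong[OF refl]) (use d(2) c(8) in \<open>metis subsetD\<close>)
      then show ?thesis by simp
    qed
    have nS: "(\<Sum>p\<in>nodes S. (mean_index T p)\<^sup>2) = card (nodes S) * ?b\<^sup>2"
    proof -
      have "(\<Sum>p\<in>nodes S. (mean_index T p)\<^sup>2) = (\<Sum>p\<in>nodes S. ?b\<^sup>2)"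
        by (rule sum.cong[OF refl]) (use e(2) c(7) in \<open>metis subsetD\<close>)
      then show ?thesis by simp
    qed
    have u: "of_int (encircling_index S T) = ?a + ?b"
      unfolding encircling_index_def using Q True d(4) e(4) by simp
    show ?thesis
      unfolding J_two_plus_eq[OF gp] J_plus_eq[OF c(1)] J_plus_eq[OF c(2)] cross_term_def Q w m card u mS mT wS wT nS nT
      using True card by (simp add: power2_sum algebra_simps)
  qed
qed

text \<open>By the decomposition it suffices that \<open>card Q / 4 + cross_term S T\<close> is an
  integer. At a crossing the product of the means is not one, but replacing the means by the values
  just before the crossing gives a product of integers; since the linear terms sum to zero, the
  total changes by \<open>card Q / 4\<close>. Together this makes \<open>card Q / 2\<close>, an
  integer as the signs sum to zero.\<close>

lemma J_two_plus_even:
  assumes gp: "generic_pair S T" shows "J_two_plus S T / 2 \<in> \<int>"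
proof -
  note c = generic_pairD[OF gp]
  note gp' = generic_pair_sym[OF gp]
  define Q where "Q = path_image S \<inter> path_image T"
  then have Q: "path_image S \<inter> path_image T = Q" by simp
  have Q': "path_image T \<inter> path_image S = Q" using Q by blast
  let ?U = "path_image S \<union> path_image T"
  have fQ: "finite Q"
  proof (cases "Q = {}")
    case False
    then show ?thesis by (rule crossing_sums(3)[OF gp Q])
  qed simp
  have I: "mean_index X p \<in> \<int>" if "generic_curve X" "p \<in> nodes X \<or> p \<notin> path_image X" for X p
    using that mean_index_node_Ints[of X p] mean_index_off(2)[of X p] wind_Ints[of X p] by auto
  have nS: "(\<Sum>p\<in>nodes S. mean_index S p * mean_index T p) \<in> \<int>"
  proof (rule Ints_sum)
    fix p assume "p \<in> nodes S"
    then have "p \<in> nodes S" "p \<notin> path_image T" using c(5) by auto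
    then show "mean_index S p * mean_index T p \<in> \<int>" using I[OF c(1)] I[OF c(2)] by (intro Ints_mult) blast+
  qed
  have nT: "(\<Sum>p\<in>nodes T. mean_index S p * mean_index T p) \<in> \<int>"
  proof (rule Ints_sum)
    fix p assume "p \<in> nodes T"
    then have "p \<in> nodes T" "p \<notin> path_image S" using c(6) by auto
    then show "mean_index S p * mean_index T p \<in> \<int>" using I[OF c(1)] I[OF c(2)] by (intro Ints_mult) blast+
  qed
  have w: "csum (\<lambda>z. wind S z * wind T z) ?U \<in> \<int>"
    by (rule csum_Ints) (use wind_Ints[OF c(1)] wind_Ints[OF c(2)] in \<open>intro Ints_mult; blast\<close>)
  note m = sum_double_points[OF gp Q fQ, of "\<lambda>p. mean_index S p * mean_index T p"]
  have "card Q / 4 + cross_term S T \<in> \<int>"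
  proof (cases "Q = {}")
    case True
    have "wind S (T 0) \<in> \<int>" "wind T (S 0) \<in> \<int>"
      using disjoint_sums(3)[OF gp Q[unfolded True]] disjoint_sums(3)[OF gp' Q'[unfolded True]] by simp_all
    then have "wind S (T 0) * wind T (S 0) \<in> \<int>" by (rule Ints_mult)
    with nS nT w have "(\<Sum>p\<in>nodes S. mean_index S p * mean_index T p) + (\<Sum>p\<in>nodes T. mean_index S p * mean_index T p)
        - csum (\<lambda>z. wind S z * wind T z) ?U + wind S (T 0) * wind T (S 0) \<in> \<int>"
      by (intro Ints_add Ints_diff)
    then show ?thesis unfolding cross_term_def Q m using True by simp
  next
    case False
    let ?s = "crossing_sign S T"
    \<comment> \<open>\<open>?a\<close> is \<open>wind S\<close> just before \<open>T\<close>
      crosses, \<open>?b\<close> is \<open>wind T\<close> just before \<open>S\<close> crosses; the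
      signs differ because \<open>crossing_sign\<close> is antisymmetric in the two curves.\<close>
    let ?a = "\<lambda>q. mean_index S q - ?s q / 2" and ?b = "\<lambda>q. mean_index T q + ?s q / 2"
    have s: "?s q = 1 \<or> ?s q = - 1" if q: "q \<in> Q" for q
    proof -
      have "q \<in> path_image S" "q \<in> path_image T" using q Q by auto
      then obtain s t where "q = S s" "q = T t" unfolding path_image_def by blast
      then show ?thesis using crossing_sign_eq(2)[OF gp, of s q t] by simp
    qed
    have ab: "(\<Sum>q\<in>Q. ?a q * ?b q) \<in> \<int>"
    proof (rule Ints_sum)
      fix q assume q: "q \<in> Q"
      have "?a q \<in> \<int>" by (rule crossing_sums(4)[OF gp Q False q])
      moreover have "?b q \<in> \<int>"
        using crossing_sums(4)[OF gp' Q' False q] unfolding crossing_sign_swap[of T S] by simp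
      ultimately show "?a q * ?b q \<in> \<int>" by (rule Ints_mult)
    qed
    have "(\<Sum>q\<in>Q. ?a q * ?b q) = (\<Sum>q\<in>Q. mean_index S q * mean_index T q + (mean_index S q * ?s q) / 2
        - (mean_index T q * ?s q) / 2 - 1 / 4)"
    proof (rule sum.cong[OF refl])
      fix q assume "q \<in> Q"
      then have "?s q * ?s q = 1" using s by force
      then show "?a q * ?b q = mean_index S q * mean_index T q + (mean_index S q * ?s q) / 2
        - (mean_index T q * ?s q) / 2 - 1 / 4" by (simp add: algebra_simps)
    qed
    also have "\<dots> = (\<Sum>q\<in>Q. mean_index S q * mean_index T q) + (\<Sum>q\<in>Q. mean_index S q * ?s q) / 2
        - (\<Sum>q\<in>Q. mean_index T q * ?s q) / 2 - card Q / 4"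
      by (simp add: sum.distrib sum_subtractf sum_divide_distrib)
    also have "(\<Sum>q\<in>Q. mean_index S q * ?s q) = 0" by (rule crossing_square_sums(1)[OF gp Q False])
    also have "(\<Sum>q\<in>Q. mean_index T q * ?s q) = 0"
      using crossing_square_sums(1)[OF gp' Q' False] unfolding crossing_sign_swap[of T S] by (simp add: sum_negf)
    finally have e: "(\<Sum>q\<in>Q. mean_index S q * mean_index T q) = (\<Sum>q\<in>Q. ?a q * ?b q) + card Q / 4" by simp
    have "even (card Q)"
      by (rule sum_signs_zero_imp_even[OF fQ _ crossing_square_sums(3)[OF gp Q False]]) (rule s)
    then obtain k where k: "card Q = 2 * k" by blast
    have c4: "card Q / 4 + cross_term S T = (\<Sum>p\<in>nodes S. mean_index S p * mean_index T p)
        + (\<Sum>p\<in>nodes T. mean_index S p * mean_index T p) + (\<Sum>q\<in>Q. ?a q * ?b q) + of_nat k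
        - csum (\<lambda>z. wind S z * wind T z) ?U"
      unfolding cross_term_def Q m e k using False by simp
    show ?thesis unfolding c4 by (intro Ints_add Ints_diff Ints_of_nat nS nT ab w)
  qed
  with J_plus_even[OF c(1)] J_plus_even[OF c(2)]
  have "J_plus S / 2 + J_plus T / 2 + (card Q / 4 + cross_term S T) \<in> \<int>" using Ints_add by blast
  also have "J_plus S / 2 + J_plus T / 2 + (card Q / 4 + cross_term S T) = J_two_plus S T / 2"
    unfolding J_two_plus_decomp[OF gp] Q by simp
  finally show ?thesis .
qed

theorem theoremC:
  fixes S1 S2 T1 T2 :: "real \<Rightarrow> complex" and x y z z_bar :: real
  assumes "generic [S1, S2]"
    and "(T1, T2) = (reversepath S1, S2) \<or> (T1, T2) = (S1, reversepath S2)"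
    and "x = J_plus S1" and "y = J_plus S2"
    and "z = J_two_plus S1 S2" and "z_bar = J_two_plus T1 T2"
  shows "(\<forall>w \<in> {x, y, z, z_bar}. \<exists>k::int. even k \<and> w = of_int k) \<and>
         z + z_bar \<ge> 2 * x + 2 * y"
proof -
  note gp = generic_imp_generic_pair[OF assms(1)]
  note gp' = generic_pair_sym[OF gp]
  note c = generic_pairD[OF gp]
  \<comment> \<open>Reversing the second curve is reduced to reversing the first by the symmetry of
    \<open>generic_pair\<close> and \<open>cross_term\<close>.\<close>
  have "generic_pair T1 T2 \<and> cross_term T1 T2 = - cross_term S1 S2 \<and> J_plus T1 = x \<and> J_plus T2 = y
      \<and> path_image T1 \<inter> path_image T2 = path_image S1 \<inter> path_image S2"
    using assms(2)
  proof
    assume T: "(T1, T2) = (reversepath S1, S2)"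
    then have T: "T1 = reversepath S1" "T2 = S2" by auto
    show ?thesis
      unfolding T assms(3,4)
      using generic_pair_reverse[OF gp] cross_term_reverse[OF gp] J_plus_reverse[OF c(1)] by simp
  next
    assume "(T1, T2) = (S1, reversepath S2)"
    then have T: "T1 = S1" "T2 = reversepath S2" by auto
    show ?thesis
      unfolding T assms(3,4)
      using generic_pair_sym[OF generic_pair_reverse[OF gp']] cross_term_reverse[OF gp'] J_plus_reverse[OF c(2)]
        cross_term_sym[of S1 S2] cross_term_sym[of S1 "reversepath S2"] by simp
  qed
  then have T: "generic_pair T1 T2" "cross_term T1 T2 = - cross_term S1 S2" "J_plus T1 = x" "J_plus T2 = y"
    "path_image T1 \<inter> path_image T2 = path_image S1 \<inter> path_image S2" by auto
  \<comment> \<open>The cross terms cancel, and either decomposition contributes half the number of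
    crossings: this number is the exact gap in the inequality.\<close>
  have "z + z_bar = 2 * x + 2 * y + card (path_image S1 \<inter> path_image S2)"
    using J_two_plus_decomp[OF gp] J_two_plus_decomp[OF T(1)] unfolding assms(3-6)[symmetric] T(2-5) by simp
  moreover have "w / 2 \<in> \<int>" if "w \<in> {x, y, z, z_bar}" for w
    using that J_plus_even[OF c(1)] J_plus_even[OF c(2)] J_two_plus_even[OF gp] J_two_plus_even[OF T(1)]
    unfolding assms(3-6)[symmetric] by blast
  moreover have "\<exists>k::int. even k \<and> w = of_int k" if half: "w / 2 \<in> \<int>" for w :: real
  proof -
    obtain k :: int where "w / 2 = of_int k" using half by (auto elim: Ints_cases)
    then have "even (2 * k) \<and> w = of_int (2 * k)" by simp
    then show ?thesis by (rule exI)
  qed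
  ultimately show ?thesis by simp
qed

end
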